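(* Let $X$ be a complex manifold, $i\colon Y\hookrightarrow X$ a compact complex submanifold, and $L$ a holomorphic line bundle on $X$ whose restriction $L|_Y$ is a unitary flat line bundle on $Y$. If the generalized first Ueda obstruction class $u_1(Y,X,L)\in H^1(Y,i^*\Omega^1_X)$ is nonzero, then $L$ is not semi-positive.
   Context: A holomorphic line bundle $L$ on a complex manifold $X$ is semi-positive if it admits a $C^\infty$ Hermitian metric whose Chern curvature form is semi-positive at every point of $X$. A holomorphic line bundle is unitary flat if it can be given by locally constant transition functions with values in $\mathrm{U}(1)$. Generalized first Ueda obstruction class. Let $X$ be a complex manifold, $i\colon Y\hookrightarrow X$ a closed embedding of a reduced analytic subvariety (not necessarily smooth), and $L$ a holomorphic line bundle on $X$. Here $i^{-1}$ denotes the inverse image functor for sheaves of abelian groups, and $i^*\mathcal F:=i^{-1}\mathcal F\otimes_{i^{-1}\mathcal O_X}\mathcal O_Y$ is the inverse image of an $\mathcal O_X$-module $\mathcal F$; there is a canonical morphism $i^{-1}\mathcal F\to i^*\mathcal F$. Let $[L]\in H^1(Y,i^{-1}\mathcal O_X^* )$ be the image of the class of $L$ in $H^1(X,\mathcal O_X^* )$ under the natural map $H^1(X,\mathcal O_X^* )\to H^1(X,i_*i^{-1}\mathcal O_X^* )\simeq H^1(Y,i^{-1}\mathcal O_X^* )$. Let $d\mathcal O_X\subset\Omega^1_X$ be the subsheaf of (locally) exact holomorphic $1$-forms. Then $u_1(Y,X,L)\in H^1(Y,i^*\Omega^1_X)$ is the image of $[L]$ under $$H^1(Y,i^{-1}\mathcal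 O_X^* )\xrightarrow{d\log}H^1(Y,i^{-1}d\mathcal O_X)\to H^1(Y,i^{-1}\Omega_X^1)\to H^1(Y,i^*\Omega_X^1),$$ where $d\log$ is induced by $f\mapsto df/f$, the second map by the inclusion $d\mathcal O_X\hookrightarrow\Omega^1_X$, and the third by $i^{-1}\Omega^1_X\to i^*\Omega^1_X$. *)

theory Defs
  imports "HOL-Analysis.Analysis" "HOL-Algebra.Free_Abelian_Groups" "HOL-Algebra.Module"
begin

section \<open>Calculus on open subsets of \<open>\<complex>\<^sup>n\<close>\<close>

definition holomorphic_at_vec :: "(complex ^ 'n::finite \<Rightarrow> complex) \<Rightarrow> complex ^ 'n \<Rightarrow> bool" where
  "holomorphic_at_vec f z \<longleftrightarrow>
     (\<exists>D. (f has_derivative D) (at z) \<and> (\<forall>c v. D (c *s v) = c * D v))"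

definition holomorphic_on_vec :: "(complex ^ 'n::finite \<Rightarrow> complex) \<Rightarrow> (complex ^ 'n) set \<Rightarrow> bool" where
  "holomorphic_on_vec f W \<longleftrightarrow> open W \<and> (\<forall>z\<in>W. holomorphic_at_vec f z)"

definition holomorphic_map_on ::
    "(complex ^ 'n::finite \<Rightarrow> complex ^ 'm::finite) \<Rightarrow> (complex ^ 'n) set \<Rightarrow> bool" where
  "holomorphic_map_on f W \<longleftrightarrow> (\<forall>i. holomorphic_on_vec (\<lambda>z. f z $ i) W)"

text \<open>The Wirtinger operators \<open>\<partial>/\<partial>z\<^sub>i\<close> and \<open>\<partial>/\<partial>z\<^sub>i\<close>-bar, expressed by the real directional derivatives
  along \<open>e\<^sub>i\<close> and \<open>\<i> e\<^sub>i\<close>.\<close>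

definition d_dz :: "'n::finite \<Rightarrow> (complex ^ 'n \<Rightarrow> complex) \<Rightarrow> complex ^ 'n \<Rightarrow> complex" where
  "d_dz i f z = (frechet_derivative f (at z) (axis i 1)
                  - \<i> * frechet_derivative f (at z) (axis i \<i>)) / 2"

definition d_dzbar :: "'n::finite \<Rightarrow> (complex ^ 'n \<Rightarrow> complex) \<Rightarrow> complex ^ 'n \<Rightarrow> complex" where
  "d_dzbar i f z = (frechet_derivative f (at z) (axis i 1)
                  + \<i> * frechet_derivative f (at z) (axis i \<i>)) / 2"

primrec Ck_on :: "nat \<Rightarrow> ('v::real_normed_vector \<Rightarrow> 'w::real_normed_vector) \<Rightarrow> 'v set \<Rightarrow> bool" where
  "Ck_on 0 f W \<longleftrightarrow> continuous_on W f"
| "Ck_on (Suc k) f W \<longleftrightarrow>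
     (\<forall>z\<in>W. f differentiable (at z)) \<and> (\<forall>v. Ck_on k (\<lambda>z. frechet_derivative f (at z) v) W)"

definition C_infinity_on :: "('v::real_normed_vector \<Rightarrow> 'w::real_normed_vector) \<Rightarrow> 'v set \<Rightarrow> bool" where
  "C_infinity_on f W \<longleftrightarrow> open W \<and> (\<forall>k. Ck_on k f W)"


section \<open>Complex manifolds and submanifolds\<close>

text \<open>The points of the manifold are the elements of the type \<open>'a\<close>; in
  \<open>complex_manifold\<close> this type is Hausdorff and second countable.\<close>

type_synonym ('a, 'n) chart = "'a set \<times> ('a \<Rightarrow> complex ^ 'n)"

abbreviation chart_inv :: "('a, 'n) chart \<Rightarrow> complex ^ 'n \<Rightarrow> 'a" where
  "chart_inv c \<equiv> inv_into (fst c) (snd c)"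

definition holomorphic_transition ::
    "('a, 'n::finite) chart \<Rightarrow> ('a, 'n) chart \<Rightarrow> bool" where
  "holomorphic_transition c c' \<longleftrightarrow>
     holomorphic_map_on (snd c' \<circ> chart_inv c) (snd c ` (fst c \<inter> fst c'))"

text \<open>Membership in the maximal atlas determined by \<open>A\<close>.\<close>

definition holomorphic_chart ::
    "('a::topological_space, 'n::finite) chart set \<Rightarrow> ('a, 'n) chart \<Rightarrow> bool" where
  "holomorphic_chart A c \<longleftrightarrow>
     open (fst c) \<and> open (snd c ` fst c) \<and>
     homeomorphism (fst c) (snd c ` fst c) (snd c) (chart_inv c) \<and>
     (\<forall>c'\<in>A. holomorphic_transition c c' \<and> holomorphic_transition c' c)"

definition complex_manifold ::
    "('a::{t2_space, second_countable_topology}, 'n::finite) chart set \<Rightarrow> bool" where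
  "complex_manifold A \<longleftrightarrow> (\<Union>c\<in>A. fst c) = UNIV \<and> (\<forall>c\<in>A. holomorphic_chart A c)"

text \<open>The set \<open>J\<close> of vanishing coordinates may depend on the point, so that \<open>Y\<close> need not be
  equidimensional.\<close>

definition complex_submanifold ::
    "('a::topological_space, 'n::finite) chart set \<Rightarrow> 'a set \<Rightarrow> bool" where
  "complex_submanifold A Y \<longleftrightarrow>
     (\<forall>p\<in>Y. \<exists>c J. holomorphic_chart A c \<and> p \<in> fst c \<and>
        snd c ` (fst c \<inter> Y) = {z \<in> snd c ` fst c. \<forall>i\<in>J. z $ i = 0})"


section \<open>Sheaves of functions, stalks and inverse images\<close>

text \<open>Every sheaf below has as sections over \<open>U\<close> certain functions on \<open>U\<close> (possibly with values in
  stalks), extended by \<open>undefined\<close>; restriction of sections is \<open>restrict\<close>. A sheaf is therefore given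
  by the structures \<open>F U\<close> of its sections over the open sets \<open>U\<close>.

  The germ at \<open>p\<close> of a section \<open>s\<close> over \<open>U\<close> is the set of all pairs \<open>(V, t)\<close> such that \<open>s\<close> and \<open>t\<close>
  agree near \<open>p\<close>; here \<open>S U\<close> is the set of sections over \<open>U\<close>.\<close>

definition germ ::
    "'a topology \<Rightarrow> ('a set \<Rightarrow> ('a \<Rightarrow> 'v) set) \<Rightarrow> 'a \<Rightarrow> 'a set \<Rightarrow> ('a \<Rightarrow> 'v) \<Rightarrow> ('a set \<times> ('a \<Rightarrow> 'v)) set"
  where
  "germ T S p U s = {(V, t). openin T V \<and> p \<in> V \<and> t \<in> S V \<and>
     (\<exists>W. openin T W \<and> p \<in> W \<and> W \<subseteq> U \<inter> V \<and> restrict s W = restrict t W)}"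

definition germs ::
    "'a topology \<Rightarrow> ('a set \<Rightarrow> ('a \<Rightarrow> 'v) set) \<Rightarrow> 'a \<Rightarrow> ('a set \<times> ('a \<Rightarrow> 'v)) set set" where
  "germs T S p = {germ T S p U s | U s. openin T U \<and> p \<in> U \<and> s \<in> S U}"

text \<open>The operation on germs induced by binary operations \<open>f W\<close> on sections over \<open>W\<close>. All members of
  the union are the same germ.\<close>

definition germ_op ::
    "'a topology \<Rightarrow> ('a set \<Rightarrow> ('a \<Rightarrow> 'w) set) \<Rightarrow> 'a \<Rightarrow> ('a set \<Rightarrow> ('a \<Rightarrow> 'u) \<Rightarrow> ('a \<Rightarrow> 'v) \<Rightarrow> ('a \<Rightarrow> 'w)) \<Rightarrow>
     ('a set \<times> ('a \<Rightarrow> 'u)) set \<Rightarrow> ('a set \<times> ('a \<Rightarrow> 'v)) set \<Rightarrow> ('a set \<times> ('a \<Rightarrow> 'w)) set" where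
  "germ_op T S p f x y =
     (\<Union>(U, s)\<in>x. \<Union>(V, t)\<in>y. germ T S p (U \<inter> V) (f (U \<inter> V) (restrict s (U \<inter> V)) (restrict t (U \<inter> V))))"

definition stalk ::
    "'a topology \<Rightarrow> ('a set \<Rightarrow> ('a \<Rightarrow> 'v, 'm) monoid_scheme) \<Rightarrow> 'a \<Rightarrow> ('a set \<times> ('a \<Rightarrow> 'v)) set monoid" where
  "stalk T F p =
     \<lparr>carrier = germs T (\<lambda>U. carrier (F U)) p,
      monoid.mult = germ_op T (\<lambda>U. carrier (F U)) p (\<lambda>W s t. s \<otimes>\<^bsub>F W\<^esub> t),
      one = germ T (\<lambda>U. carrier (F U)) p (topspace T) \<one>\<^bsub>F (topspace T)\<^esub>\<rparr>"

definition stalk_ring ::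
    "'a topology \<Rightarrow> ('a set \<Rightarrow> ('a \<Rightarrow> 'v, 'm) ring_scheme) \<Rightarrow> 'a \<Rightarrow> ('a set \<times> ('a \<Rightarrow> 'v)) set ring" where
  "stalk_ring T R p =
     \<lparr>carrier = germs T (\<lambda>U. carrier (R U)) p,
      monoid.mult = germ_op T (\<lambda>U. carrier (R U)) p (\<lambda>W s t. s \<otimes>\<^bsub>R W\<^esub> t),
      one = germ T (\<lambda>U. carrier (R U)) p (topspace T) \<one>\<^bsub>R (topspace T)\<^esub>,
      zero = germ T (\<lambda>U. carrier (R U)) p (topspace T) \<zero>\<^bsub>R (topspace T)\<^esub>,
      add = germ_op T (\<lambda>U. carrier (R U)) p (\<lambda>W s t. s \<oplus>\<^bsub>R W\<^esub> t)\<rparr>"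

text \<open>The multiplicative fields of a module record play no role in the theory of modules.\<close>

definition stalk_module ::
    "'a topology \<Rightarrow> ('a set \<Rightarrow> ('a \<Rightarrow> 'r, 'a \<Rightarrow> 'v) module) \<Rightarrow> 'a \<Rightarrow>
     (('a set \<times> ('a \<Rightarrow> 'r)) set, ('a set \<times> ('a \<Rightarrow> 'v)) set) module" where
  "stalk_module T M p =
     \<lparr>carrier = germs T (\<lambda>U. carrier (M U)) p,
      monoid.mult = undefined,
      one = undefined,
      zero = germ T (\<lambda>U. carrier (M U)) p (topspace T) \<zero>\<^bsub>M (topspace T)\<^esub>,
      add = germ_op T (\<lambda>U. carrier (M U)) p (\<lambda>W s t. s \<oplus>\<^bsub>M W\<^esub> t),
      smult = germ_op T (\<lambda>U. carrier (M U)) p (\<lambda>W f s. f \<odot>\<^bsub>M W\<^esub> s)\<rparr>"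

text \<open>The inverse image \<open>i\<inverse>F\<close> for the inclusion \<open>i\<close> of a subspace \<open>Y\<close>: sections over an open set \<open>V\<close> of
  \<open>Y\<close> are the families of germs of \<open>F\<close> that are locally induced by sections of \<open>F\<close>.\<close>

definition inv_image_sheaf ::
    "('a::topological_space set \<Rightarrow> ('a \<Rightarrow> 'v, 'm) monoid_scheme) \<Rightarrow>
     'a set \<Rightarrow> ('a \<Rightarrow> ('a set \<times> ('a \<Rightarrow> 'v)) set) monoid" where
  "inv_image_sheaf F V =
     \<lparr>carrier = {s \<in> extensional V. \<forall>p\<in>V. \<exists>U \<sigma>. open U \<and> p \<in> U \<and> \<sigma> \<in> carrier (F U) \<and>
        (\<forall>q\<in>U \<inter> V. s q = germ euclidean (\<lambda>U. carrier (F U)) q U \<sigma>)},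
      monoid.mult = (\<lambda>s t. \<lambda>p\<in>V. s p \<otimes>\<^bsub>stalk euclidean F p\<^esub> t p),
      one = (\<lambda>p\<in>V. \<one>\<^bsub>stalk euclidean F p\<^esub>)\<rparr>"

text \<open>The morphism \<open>i\<inverse>F \<rightarrow> i\<inverse>G\<close> induced by a sheaf morphism \<open>\<phi>\<close> from \<open>F\<close> to \<open>G\<close>.\<close>

definition inv_image_map ::
    "('a::topological_space set \<Rightarrow> ('a \<Rightarrow> 'w, 'm) monoid_scheme) \<Rightarrow> ('a set \<Rightarrow> ('a \<Rightarrow> 'v) \<Rightarrow> ('a \<Rightarrow> 'w)) \<Rightarrow>
     'a set \<Rightarrow> ('a \<Rightarrow> ('a set \<times> ('a \<Rightarrow> 'v)) set) \<Rightarrow> ('a \<Rightarrow> ('a set \<times> ('a \<Rightarrow> 'w)) set)" where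
  "inv_image_map G \<phi> V s =
     (\<lambda>p\<in>V. \<Union>(U, \<sigma>)\<in>s p. germ euclidean (\<lambda>U. carrier (G U)) p U (\<phi> U \<sigma>))"

definition direct_image_sheaf ::
    "'a set \<Rightarrow> ('a set \<Rightarrow> ('a \<Rightarrow> 'v, 'm) monoid_scheme) \<Rightarrow> 'a set \<Rightarrow> ('a \<Rightarrow> 'v, 'm) monoid_scheme" where
  "direct_image_sheaf Y G U = G (U \<inter> Y)"

text \<open>The adjunction morphism \<open>F \<rightarrow> i\<^sub>*i\<inverse>F\<close>.\<close>

definition adjunction_unit ::
    "'a::topological_space set \<Rightarrow> ('a set \<Rightarrow> ('a \<Rightarrow> 'v, 'm) monoid_scheme) \<Rightarrow>
     'a set \<Rightarrow> ('a \<Rightarrow> 'v) \<Rightarrow> ('a \<Rightarrow> ('a set \<times> ('a \<Rightarrow> 'v)) set)" where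
  "adjunction_unit Y F U s = (\<lambda>p\<in>U \<inter> Y. germ euclidean (\<lambda>U. carrier (F U)) p U s)"


section \<open>First cohomology\<close>

text \<open>The first sheaf cohomology group, as the Cech group, i.e. the direct limit over all open
  covers (in degree one it agrees with the derived functor on every space). Covers are indexed by the
  points of the space, with \<open>p \<in> \<U> p\<close>; these are cofinal among all open covers.\<close>

definition pointed_cover :: "'a topology \<Rightarrow> ('a \<Rightarrow> 'a set) \<Rightarrow> bool" where
  "pointed_cover T \<U> \<longleftrightarrow> (\<forall>p\<in>topspace T. openin T (\<U> p) \<and> p \<in> \<U> p)"

definition cocycles1 ::
    "'a topology \<Rightarrow> ('a set \<Rightarrow> ('a \<Rightarrow> 'v, 'm) monoid_scheme) \<Rightarrow>
     (('a \<Rightarrow> 'a set) \<times> ('a \<Rightarrow> 'a \<Rightarrow> 'a \<Rightarrow> 'v)) set" where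
  "cocycles1 T F = {(\<U>, c). pointed_cover T \<U> \<and>
     (\<forall>p\<in>topspace T. \<forall>q\<in>topspace T. c p q \<in> carrier (F (\<U> p \<inter> \<U> q))) \<and>
     (\<forall>p\<in>topspace T. \<forall>q\<in>topspace T. \<forall>r\<in>topspace T. let W = \<U> p \<inter> \<U> q \<inter> \<U> r in
        restrict (c p q) W \<otimes>\<^bsub>F W\<^esub> restrict (c q r) W = restrict (c p r) W)}"

text \<open>Two cocycles are equivalent if on a common refinement \<open>\<W>\<close> (with refinement maps \<open>\<tau>\<close>, \<open>\<tau>'\<close>) they
  differ by the coboundary of a 0-cochain \<open>b\<close>.\<close>

definition cohomologous1 ::
    "'a topology \<Rightarrow> ('a set \<Rightarrow> ('a \<Rightarrow> 'v, 'm) monoid_scheme) \<Rightarrow>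
     ((('a \<Rightarrow> 'a set) \<times> ('a \<Rightarrow> 'a \<Rightarrow> 'a \<Rightarrow> 'v)) \<times> (('a \<Rightarrow> 'a set) \<times> ('a \<Rightarrow> 'a \<Rightarrow> 'a \<Rightarrow> 'v))) set" where
  "cohomologous1 T F = {((\<U>, c), (\<U>', c')).
     (\<U>, c) \<in> cocycles1 T F \<and> (\<U>', c') \<in> cocycles1 T F \<and>
     (\<exists>\<W> \<tau> \<tau>' b. pointed_cover T \<W> \<and>
        (\<forall>p\<in>topspace T. \<tau> p \<in> topspace T \<and> \<tau>' p \<in> topspace T \<and>
           \<W> p \<subseteq> \<U> (\<tau> p) \<inter> \<U>' (\<tau>' p) \<and> b p \<in> carrier (F (\<W> p))) \<and>
        (\<forall>p\<in>topspace T. \<forall>q\<in>topspace T. let W = \<W> p \<inter> \<W> q in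
           restrict (c' (\<tau>' p) (\<tau>' q)) W \<otimes>\<^bsub>F W\<^esub> restrict (b q) W =
           restrict (b p) W \<otimes>\<^bsub>F W\<^esub> restrict (c (\<tau> p) (\<tau> q)) W))}"

definition H1 ::
    "'a topology \<Rightarrow> ('a set \<Rightarrow> ('a \<Rightarrow> 'v, 'm) monoid_scheme) \<Rightarrow>
     (('a \<Rightarrow> 'a set) \<times> ('a \<Rightarrow> 'a \<Rightarrow> 'a \<Rightarrow> 'v)) set monoid" where
  "H1 T F =
     \<lparr>carrier = cocycles1 T F // cohomologous1 T F,
      monoid.mult = (\<lambda>\<xi> \<eta>. cohomologous1 T F ``
        {(\<lambda>p. \<U> p \<inter> \<V> p,
          \<lambda>p q. let W = \<U> p \<inter> \<V> p \<inter> (\<U> q \<inter> \<V> q) in restrict (c p q) W \<otimes>\<^bsub>F W\<^esub> restrict (d p q) W)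
         | \<U> c \<V> d. (\<U>, c) \<in> \<xi> \<and> (\<V>, d) \<in> \<eta>}),
      one = cohomologous1 T F `` {(\<lambda>_. topspace T, \<lambda>_ _. \<one>\<^bsub>F (topspace T)\<^esub>)}\<rparr>"

text \<open>The map \<open>H\<^sup>1(T, F) \<rightarrow> H\<^sup>1(T, G)\<close> induced by a sheaf morphism \<open>\<phi>\<close> from \<open>F\<close> to \<open>G\<close>.\<close>

definition H1_map ::
    "'a topology \<Rightarrow> ('a set \<Rightarrow> ('a \<Rightarrow> 'w, 'm) monoid_scheme) \<Rightarrow> ('a set \<Rightarrow> ('a \<Rightarrow> 'v) \<Rightarrow> ('a \<Rightarrow> 'w)) \<Rightarrow>
     (('a \<Rightarrow> 'a set) \<times> ('a \<Rightarrow> 'a \<Rightarrow> 'a \<Rightarrow> 'v)) set \<Rightarrow> (('a \<Rightarrow> 'a set) \<times> ('a \<Rightarrow> 'a \<Rightarrow> 'a \<Rightarrow> 'w)) set" where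
  "H1_map T G \<phi> \<xi> =
     cohomologous1 T G `` ((\<lambda>(\<U>, c). (\<U>, \<lambda>p q. \<phi> (\<U> p \<inter> \<U> q) (c p q))) ` \<xi>)"

text \<open>The canonical map \<open>H\<^sup>1(X, i\<^sub>*G) \<rightarrow> H\<^sup>1(Y, G)\<close> for the inclusion \<open>i\<close> of a subspace \<open>Y\<close>.\<close>

definition H1_direct_image ::
    "'a::topological_space set \<Rightarrow> ('a set \<Rightarrow> ('a \<Rightarrow> 'v, 'm) monoid_scheme) \<Rightarrow>
     (('a \<Rightarrow> 'a set) \<times> ('a \<Rightarrow> 'a \<Rightarrow> 'a \<Rightarrow> 'v)) set \<Rightarrow> (('a \<Rightarrow> 'a set) \<times> ('a \<Rightarrow> 'a \<Rightarrow> 'a \<Rightarrow> 'v)) set" where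
  "H1_direct_image Y G \<xi> =
     cohomologous1 (top_of_set Y) G `` ((\<lambda>(\<U>, c). (\<lambda>p. \<U> p \<inter> Y, c)) ` \<xi>)"


section \<open>Structure sheaves and holomorphic 1-forms\<close>

definition function_ring :: "('a \<Rightarrow> complex) set \<Rightarrow> 'a set \<Rightarrow> ('a \<Rightarrow> complex) ring" where
  "function_ring S U =
     \<lparr>carrier = S,
      monoid.mult = (\<lambda>f g. \<lambda>p\<in>U. f p * g p),
      one = (\<lambda>p\<in>U. 1),
      zero = (\<lambda>p\<in>U. 0),
      add = (\<lambda>f g. \<lambda>p\<in>U. f p + g p)\<rparr>"

definition hol_sheaf ::
    "('a, 'n::finite) chart set \<Rightarrow> 'a set \<Rightarrow> ('a \<Rightarrow> complex) ring" where
  "hol_sheaf A U = function_ring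
     {f \<in> extensional U. \<forall>c\<in>A. holomorphic_on_vec (f \<circ> chart_inv c) (snd c ` (fst c \<inter> U))} U"

text \<open>The structure sheaf of the reduced subspace \<open>Y\<close>.\<close>

definition sub_hol_sheaf ::
    "('a::topological_space, 'n::finite) chart set \<Rightarrow> 'a set \<Rightarrow> ('a \<Rightarrow> complex) ring" where
  "sub_hol_sheaf A V = function_ring
     {f \<in> extensional V. \<forall>p\<in>V. \<exists>U. open U \<and> p \<in> U \<and>
        (\<exists>g\<in>carrier (hol_sheaf A U). \<forall>q\<in>U \<inter> V. f q = g q)} V"

text \<open>A cotangent vector of type (1,0) at \<open>p\<close> is the family of its coefficient vectors with respect to
  the bases \<open>dz\<^sub>1, \<dots>, dz\<^sub>n\<close> given by the charts around \<open>p\<close>, subject to the transformation law. The value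
  \<open>0\<close> at all other charts is a normalization.\<close>

type_synonym ('a, 'n) covector = "('a, 'n) chart \<Rightarrow> complex ^ 'n"

definition covectors_at ::
    "('a, 'n::finite) chart set \<Rightarrow> 'a \<Rightarrow> ('a, 'n) covector set" where
  "covectors_at A p = {\<kappa>.
     (\<forall>c. \<not> (c \<in> A \<and> p \<in> fst c) \<longrightarrow> \<kappa> c = 0) \<and>
     (\<forall>c\<in>A. \<forall>c'\<in>A. p \<in> fst c \<inter> fst c' \<longrightarrow>
        (\<forall>i. \<kappa> c $ i = (\<Sum>j\<in>UNIV. \<kappa> c' $ j * d_dz i (\<lambda>z. snd c' (chart_inv c z) $ j) (snd c p))))}"

definition hol_forms ::
    "('a, 'n::finite) chart set \<Rightarrow> 'a set \<Rightarrow> ('a \<Rightarrow> complex, 'a \<Rightarrow> ('a, 'n) covector) module" where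
  "hol_forms A U =
     \<lparr>carrier = {\<omega> \<in> extensional U. (\<forall>p\<in>U. \<omega> p \<in> covectors_at A p) \<and>
        (\<forall>c\<in>A. holomorphic_map_on (\<lambda>z. \<omega> (chart_inv c z) c) (snd c ` (fst c \<inter> U)))},
      monoid.mult = undefined,
      one = undefined,
      zero = (\<lambda>p\<in>U. \<lambda>c. 0),
      add = (\<lambda>\<omega> \<eta>. \<lambda>p\<in>U. \<lambda>c. \<omega> p c + \<eta> p c),
      smult = (\<lambda>f \<omega>. \<lambda>p\<in>U. \<lambda>c. f p *s \<omega> p c)\<rparr>"

definition ext_deriv ::
    "('a, 'n::finite) chart set \<Rightarrow> 'a set \<Rightarrow> ('a \<Rightarrow> complex) \<Rightarrow> ('a \<Rightarrow> ('a, 'n) covector)" where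
  "ext_deriv A U f = (\<lambda>p\<in>U. \<lambda>c.
     if c \<in> A \<and> p \<in> fst c then (\<chi> i. d_dz i (f \<circ> chart_inv c) (snd c p)) else 0)"

definition exact_forms ::
    "('a::topological_space, 'n::finite) chart set \<Rightarrow> 'a set \<Rightarrow>
     ('a \<Rightarrow> complex, 'a \<Rightarrow> ('a, 'n) covector) module" where
  "exact_forms A U = (hol_forms A U)
     \<lparr>carrier := {\<omega> \<in> carrier (hol_forms A U). \<forall>p\<in>U. \<exists>V f. open V \<and> p \<in> V \<and> V \<subseteq> U \<and>
        f \<in> carrier (hol_sheaf A V) \<and> restrict \<omega> V = ext_deriv A V f}\<rparr>"

definition dlog ::
    "('a, 'n::finite) chart set \<Rightarrow> 'a set \<Rightarrow> ('a \<Rightarrow> complex) \<Rightarrow> ('a \<Rightarrow> ('a, 'n) covector)" where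
  "dlog A U f = (\<lambda>p\<in>U. \<lambda>c. (1 / f p) *s ext_deriv A U f p c)"


section \<open>Inverse images of \<open>\<O>\<^sub>X\<close>-modules\<close>

text \<open>The tensor product of modules over a commutative ring: the free abelian group on the product
  of the carriers, modulo the bilinearity relations.\<close>

definition tensor_relations ::
    "('r, 'x) ring_scheme \<Rightarrow> ('r, 'm) module \<Rightarrow> ('r, 'k) module \<Rightarrow> (('m \<times> 'k) \<Rightarrow>\<^sub>0 int) set" where
  "tensor_relations R M N =
     {frag_of (x \<oplus>\<^bsub>M\<^esub> x', y) - frag_of (x, y) - frag_of (x', y) | x x' y.
        x \<in> carrier M \<and> x' \<in> carrier M \<and> y \<in> carrier N} \<union>
     {frag_of (x, y \<oplus>\<^bsub>N\<^esub> y') - frag_of (x, y) - frag_of (x, y') | x y y'.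
        x \<in> carrier M \<and> y \<in> carrier N \<and> y' \<in> carrier N} \<union>
     {frag_of (r \<odot>\<^bsub>M\<^esub> x, y) - frag_of (x, r \<odot>\<^bsub>N\<^esub> y) | r x y.
        r \<in> carrier R \<and> x \<in> carrier M \<and> y \<in> carrier N}"

definition tensor_subgroup ::
    "('r, 'x) ring_scheme \<Rightarrow> ('r, 'm) module \<Rightarrow> ('r, 'k) module \<Rightarrow> (('m \<times> 'k) \<Rightarrow>\<^sub>0 int) set" where
  "tensor_subgroup R M N =
     generate (free_Abelian_group (carrier M \<times> carrier N)) (tensor_relations R M N)"

definition tensor_product ::
    "('r, 'x) ring_scheme \<Rightarrow> ('r, 'm) module \<Rightarrow> ('r, 'k) module \<Rightarrow> (('m \<times> 'k) \<Rightarrow>\<^sub>0 int) set monoid" where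
  "tensor_product R M N =
     free_Abelian_group (carrier M \<times> carrier N) Mod tensor_subgroup R M N"

definition tensor_class ::
    "('r, 'x) ring_scheme \<Rightarrow> ('r, 'm) module \<Rightarrow> ('r, 'k) module \<Rightarrow>
     (('m \<times> 'k) \<Rightarrow>\<^sub>0 int) \<Rightarrow> (('m \<times> 'k) \<Rightarrow>\<^sub>0 int) set" where
  "tensor_class R M N u =
     tensor_subgroup R M N #>\<^bsub>free_Abelian_group (carrier M \<times> carrier N)\<^esub> u"

text \<open>The stalk of \<open>\<O>\<^sub>Y\<close> at a point of \<open>Y\<close>, as a module over the stalk of \<open>\<O>\<^sub>X\<close>.\<close>

definition sub_stalk_module ::
    "('a::topological_space, 'n::finite) chart set \<Rightarrow> 'a set \<Rightarrow> 'a \<Rightarrow>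
     (('a set \<times> ('a \<Rightarrow> complex)) set, ('a set \<times> ('a \<Rightarrow> complex)) set) module" where
  "sub_stalk_module A Y p =
     (let R = stalk_ring (top_of_set Y) (sub_hol_sheaf A) p in
      \<lparr>carrier = carrier R, monoid.mult = monoid.mult R, one = one R, zero = zero R, add = add R,
       smult = germ_op (top_of_set Y) (\<lambda>V. carrier (sub_hol_sheaf A V)) p
                 (\<lambda>W f g. f \<otimes>\<^bsub>sub_hol_sheaf A W\<^esub> g)\<rparr>)"

text \<open>The inverse image \<open>i\<^sup>*F\<close>, i.e. the tensor product of \<open>i\<inverse>F\<close> and \<open>\<O>\<^sub>Y\<close> over \<open>i\<inverse>\<O>\<^sub>X\<close>: its stalk at
  \<open>p\<close> is the tensor product of the stalks (the stalks of \<open>i\<inverse>F\<close> and \<open>i\<inverse>\<O>\<^sub>X\<close> at \<open>p \<in> Y\<close> being those of \<open>F\<close>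
  and \<open>\<O>\<^sub>X\<close>), and its sections are the families of elements of the stalks that are locally
  induced by finite sums of tensors \<open>\<sigma>\<^sub>k \<otimes> g\<^sub>k\<close> of sections.\<close>

definition pullback_class ::
    "('a::topological_space, 'n::finite) chart set \<Rightarrow> 'a set \<Rightarrow>
     ('a set \<Rightarrow> ('a \<Rightarrow> complex, 'a \<Rightarrow> 'v) module) \<Rightarrow> 'a \<Rightarrow>
     ((('a set \<times> ('a \<Rightarrow> 'v)) set \<times> ('a set \<times> ('a \<Rightarrow> complex)) set) \<Rightarrow>\<^sub>0 int) \<Rightarrow>
     ((('a set \<times> ('a \<Rightarrow> 'v)) set \<times> ('a set \<times> ('a \<Rightarrow> complex)) set) \<Rightarrow>\<^sub>0 int) set" where
  "pullback_class A Y F p =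
     tensor_class (stalk_ring euclidean (hol_sheaf A) p) (stalk_module euclidean F p)
       (sub_stalk_module A Y p)"

definition pullback_stalk ::
    "('a::topological_space, 'n::finite) chart set \<Rightarrow> 'a set \<Rightarrow>
     ('a set \<Rightarrow> ('a \<Rightarrow> complex, 'a \<Rightarrow> 'v) module) \<Rightarrow> 'a \<Rightarrow>
     ((('a set \<times> ('a \<Rightarrow> 'v)) set \<times> ('a set \<times> ('a \<Rightarrow> complex)) set) \<Rightarrow>\<^sub>0 int) set monoid" where
  "pullback_stalk A Y F p =
     tensor_product (stalk_ring euclidean (hol_sheaf A) p) (stalk_module euclidean F p)
       (sub_stalk_module A Y p)"

definition pullback_sheaf ::
    "('a::topological_space, 'n::finite) chart set \<Rightarrow> 'a set \<Rightarrow>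
     ('a set \<Rightarrow> ('a \<Rightarrow> complex, 'a \<Rightarrow> 'v) module) \<Rightarrow> 'a set \<Rightarrow>
     ('a \<Rightarrow> ((('a set \<times> ('a \<Rightarrow> 'v)) set \<times> ('a set \<times> ('a \<Rightarrow> complex)) set) \<Rightarrow>\<^sub>0 int) set) monoid" where
  "pullback_sheaf A Y F V =
     \<lparr>carrier = {s \<in> extensional V. \<forall>p\<in>V. \<exists>U (m::nat) \<sigma> g. open U \<and> p \<in> U \<and>
        (\<forall>k<m. \<sigma> k \<in> carrier (F U) \<and> g k \<in> carrier (sub_hol_sheaf A (U \<inter> Y))) \<and>
        (\<forall>q\<in>U \<inter> V. s q = pullback_class A Y F q
           (\<Sum>k<m. frag_of (germ euclidean (\<lambda>U. carrier (F U)) q U (\<sigma> k),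
                            germ (top_of_set Y) (\<lambda>V. carrier (sub_hol_sheaf A V)) q (U \<inter> Y) (g k))))},
      monoid.mult = (\<lambda>s t. \<lambda>p\<in>V. s p \<otimes>\<^bsub>pullback_stalk A Y F p\<^esub> t p),
      one = (\<lambda>p\<in>V. \<one>\<^bsub>pullback_stalk A Y F p\<^esub>)\<rparr>"

text \<open>The canonical morphism \<open>i\<inverse>F \<rightarrow> i\<^sup>*F\<close>, \<open>s \<mapsto> s \<otimes> 1\<close>.\<close>

definition to_pullback ::
    "('a::topological_space, 'n::finite) chart set \<Rightarrow> 'a set \<Rightarrow>
     ('a set \<Rightarrow> ('a \<Rightarrow> complex, 'a \<Rightarrow> 'v) module) \<Rightarrow> 'a set \<Rightarrow>
     ('a \<Rightarrow> ('a set \<times> ('a \<Rightarrow> 'v)) set) \<Rightarrow>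
     ('a \<Rightarrow> ((('a set \<times> ('a \<Rightarrow> 'v)) set \<times> ('a set \<times> ('a \<Rightarrow> complex)) set) \<Rightarrow>\<^sub>0 int) set)" where
  "to_pullback A Y F V s =
     (\<lambda>p\<in>V. pullback_class A Y F p (frag_of (s p, \<one>\<^bsub>stalk_ring (top_of_set Y) (sub_hol_sheaf A) p\<^esub>)))"


section \<open>Holomorphic line bundles\<close>

text \<open>A line bundle over a space \<open>T\<close> with structure sheaf \<open>R\<close> is given by the projection \<open>\<pi>\<close> of its total
  space (the elements of \<open>'e\<close> lying over \<open>topspace T\<close>) and a set \<open>L\<close> of local trivializations
  \<open>(U, \<tau>)\<close>, where \<open>e \<mapsto> (\<pi> e, \<tau> e)\<close> identifies the part over \<open>U\<close> with \<open>U \<times> \<complex>\<close>; the transition functions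
  are invertible elements of \<open>R\<close>. The topology and complex structure of the total space and the vector
  space structure of the fibres are those induced by the trivializations.\<close>

definition frame :: "('e \<Rightarrow> 'a) \<Rightarrow> ('e \<Rightarrow> complex) \<Rightarrow> 'a \<Rightarrow> 'e" where
  "frame \<pi> \<tau> p = (THE e. \<pi> e = p \<and> \<tau> e = 1)"

definition transition ::
    "('e \<Rightarrow> 'a) \<Rightarrow> ('e \<Rightarrow> complex) \<Rightarrow> ('e \<Rightarrow> complex) \<Rightarrow> 'a set \<Rightarrow> 'a \<Rightarrow> complex" where
  "transition \<pi> \<tau> \<tau>' W = (\<lambda>p\<in>W. \<tau> (frame \<pi> \<tau>' p))"

definition line_bundle ::
    "'a topology \<Rightarrow> ('a set \<Rightarrow> ('a \<Rightarrow> complex) ring) \<Rightarrow>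
     ('e \<Rightarrow> 'a) \<Rightarrow> ('a set \<times> ('e \<Rightarrow> complex)) set \<Rightarrow> bool" where
  "line_bundle T R \<pi> L \<longleftrightarrow>
     (\<Union>(U, \<tau>)\<in>L. U) = topspace T \<and>
     (\<forall>(U, \<tau>)\<in>L. openin T U \<and> (\<forall>p\<in>U. bij_betw \<tau> {e. \<pi> e = p} UNIV)) \<and>
     (\<forall>(U, \<tau>)\<in>L. \<forall>(U', \<tau>')\<in>L.
        transition \<pi> \<tau> \<tau>' (U \<inter> U') \<in> Units (R (U \<inter> U')) \<and>
        (\<forall>e. \<pi> e \<in> U \<inter> U' \<longrightarrow> \<tau> e = transition \<pi> \<tau> \<tau>' (U \<inter> U') (\<pi> e) * \<tau>' e))"

definition restrict_bundle ::
    "'a set \<Rightarrow> ('a set \<times> ('e \<Rightarrow> complex)) set \<Rightarrow> ('a set \<times> ('e \<Rightarrow> complex)) set" where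
  "restrict_bundle Y L = (\<lambda>(U, \<tau>). (U \<inter> Y, \<tau>)) ` L"

definition locally_constant_on :: "'a topology \<Rightarrow> 'a set \<Rightarrow> ('a \<Rightarrow> 'b) \<Rightarrow> bool" where
  "locally_constant_on T W f \<longleftrightarrow>
     (\<forall>p\<in>W. \<exists>V. openin T V \<and> p \<in> V \<and> V \<subseteq> W \<and> (\<forall>q\<in>V. f q = f p))"

definition unitary_flat ::
    "'a topology \<Rightarrow> ('a set \<Rightarrow> ('a \<Rightarrow> complex) ring) \<Rightarrow>
     ('e \<Rightarrow> 'a) \<Rightarrow> ('a set \<times> ('e \<Rightarrow> complex)) set \<Rightarrow> bool" where
  "unitary_flat T R \<pi> L \<longleftrightarrow>
     (\<exists>S. line_bundle T R \<pi> (L \<union> S) \<and> (\<Union>(U, \<tau>)\<in>S. U) = topspace T \<and>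
        (\<forall>(U, \<tau>)\<in>S. \<forall>(U', \<tau>')\<in>S.
           locally_constant_on T (U \<inter> U') (transition \<pi> \<tau> \<tau>' (U \<inter> U')) \<and>
           (\<forall>p\<in>U \<inter> U'. cmod (transition \<pi> \<tau> \<tau>' (U \<inter> U') p) = 1)))"

text \<open>A Hermitian metric is given by the squared norm \<open>h\<close> of the elements of the total space. Its local
  weight is the squared norm of the local frame.\<close>

definition hermitian_metric ::
    "('a, 'n::finite) chart set \<Rightarrow> ('e \<Rightarrow> 'a) \<Rightarrow> ('a set \<times> ('e \<Rightarrow> complex)) set \<Rightarrow> ('e \<Rightarrow> real) \<Rightarrow> bool"
  where
  "hermitian_metric A \<pi> L h \<longleftrightarrow>
     (\<forall>(U, \<tau>)\<in>L.
        (\<forall>p\<in>U. h (frame \<pi> \<tau> p) > 0) \<and>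
        (\<forall>e. \<pi> e \<in> U \<longrightarrow> h e = (cmod (\<tau> e))\<^sup>2 * h (frame \<pi> \<tau> (\<pi> e))) \<and>
        (\<forall>c\<in>A. C_infinity_on (\<lambda>z. h (frame \<pi> \<tau> (chart_inv c z))) (snd c ` (fst c \<inter> U))))"

text \<open>The coefficients \<open>\<Theta>\<^sub>j\<^sub>k\<close> of the Chern curvature form \<open>\<Theta> = - \<partial>\<partial>\<close>-bar \<open>log h = \<Sum> \<Theta>\<^sub>j\<^sub>k dz\<^sub>j \<and> dz\<^sub>k\<close>-bar in
  the chart \<open>c\<close> and the trivialization \<open>\<tau>\<close>. Semi-positivity of \<open>\<i>\<Theta>\<close> means that the matrix
  \<open>(\<Theta>\<^sub>j\<^sub>k)\<close> is positive semi-definite.\<close>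

definition chern_curvature ::
    "('a, 'n::finite) chart \<Rightarrow> ('e \<Rightarrow> 'a) \<Rightarrow> ('e \<Rightarrow> complex) \<Rightarrow> ('e \<Rightarrow> real) \<Rightarrow> 'a \<Rightarrow> 'n \<Rightarrow> 'n \<Rightarrow> complex" where
  "chern_curvature c \<pi> \<tau> h p j k =
     - d_dz j (d_dzbar k (\<lambda>z. complex_of_real (ln (h (frame \<pi> \<tau> (chart_inv c z)))))) (snd c p)"

definition semi_positive ::
    "('a, 'n::finite) chart set \<Rightarrow> ('e \<Rightarrow> 'a) \<Rightarrow> ('a set \<times> ('e \<Rightarrow> complex)) set \<Rightarrow> bool" where
  "semi_positive A \<pi> L \<longleftrightarrow>
     (\<exists>h. hermitian_metric A \<pi> L h \<and>
        (\<forall>(U, \<tau>)\<in>L. \<forall>c\<in>A. \<forall>p\<in>U \<inter> fst c. \<forall>\<xi> :: complex ^ 'n.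
           (\<Sum>j\<in>UNIV. \<Sum>k\<in>UNIV. chern_curvature c \<pi> \<tau> h p j k * \<xi> $ j * cnj (\<xi> $ k)) \<in> \<real>\<^sub>\<ge>\<^sub>0))"

text \<open>The class of a line bundle in \<open>H\<^sup>1(T, R\<^sup>*)\<close>; it does not depend on the chosen trivializations.\<close>

definition line_bundle_class ::
    "'a topology \<Rightarrow> ('a set \<Rightarrow> ('a \<Rightarrow> complex) ring) \<Rightarrow> ('e \<Rightarrow> 'a) \<Rightarrow> ('a set \<times> ('e \<Rightarrow> complex)) set \<Rightarrow>
     (('a \<Rightarrow> 'a set) \<times> ('a \<Rightarrow> 'a \<Rightarrow> 'a \<Rightarrow> complex)) set" where
  "line_bundle_class T R \<pi> L =
     (let t = (\<lambda>p. SOME t. t \<in> L \<and> p \<in> fst t) in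
      cohomologous1 T (\<lambda>U. units_of (R U)) ``
        {(\<lambda>p. fst (t p), \<lambda>p q. transition \<pi> (snd (t p)) (snd (t q)) (fst (t p) \<inter> fst (t q)))})"


section \<open>The generalized first Ueda obstruction class\<close>

abbreviation hol_units :: "('a, 'n::finite) chart set \<Rightarrow> 'a set \<Rightarrow> ('a \<Rightarrow> complex) monoid" where
  "hol_units A \<equiv> \<lambda>U. units_of (hol_sheaf A U)"

definition restricted_class ::
    "('a::topological_space, 'n::finite) chart set \<Rightarrow> 'a set \<Rightarrow>
     ('e \<Rightarrow> 'a) \<Rightarrow> ('a set \<times> ('e \<Rightarrow> complex)) set \<Rightarrow>
     (('a \<Rightarrow> 'a set) \<times> ('a \<Rightarrow> 'a \<Rightarrow> 'a \<Rightarrow> ('a set \<times> ('a \<Rightarrow> complex)) set)) set" where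
  "restricted_class A Y \<pi> L =
     H1_direct_image Y (inv_image_sheaf (hol_units A))
       (H1_map euclidean (direct_image_sheaf Y (inv_image_sheaf (hol_units A)))
          (adjunction_unit Y (hol_units A))
          (line_bundle_class euclidean (hol_sheaf A) \<pi> L))"

definition ueda_class ::
    "('a::topological_space, 'n::finite) chart set \<Rightarrow> 'a set \<Rightarrow>
     ('e \<Rightarrow> 'a) \<Rightarrow> ('a set \<times> ('e \<Rightarrow> complex)) set \<Rightarrow>
     (('a \<Rightarrow> 'a set) \<times> ('a \<Rightarrow> 'a \<Rightarrow> 'a \<Rightarrow>
       ((('a set \<times> ('a \<Rightarrow> ('a, 'n) covector)) set \<times> ('a set \<times> ('a \<Rightarrow> complex)) set) \<Rightarrow>\<^sub>0 int) set)) set"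
  where
  "ueda_class A Y \<pi> L =
     H1_map (top_of_set Y) (pullback_sheaf A Y (hol_forms A)) (to_pullback A Y (hol_forms A))
       (H1_map (top_of_set Y) (inv_image_sheaf (\<lambda>U. add_monoid (hol_forms A U)))
          (inv_image_map (\<lambda>U. add_monoid (hol_forms A U)) (\<lambda>U \<omega>. \<omega>))
          (H1_map (top_of_set Y) (inv_image_sheaf (\<lambda>U. add_monoid (exact_forms A U)))
             (inv_image_map (\<lambda>U. add_monoid (exact_forms A U)) (dlog A))
             (restricted_class A Y \<pi> L)))"

end

theory Submission
  imports Defs "HOL-Complex_Analysis.Cauchy_Integral_Formula"
begin

text \<open>Let \<open>h\<close> be a semi-positive metric. Relative to the unitary flat frames of \<open>L|\<^sub>Y\<close>, the function \<open>log h\<close> is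
  a well-defined superharmonic function along the compact manifold \<open>Y\<close>, hence locally constant. So
  the curvature \<open>\<Theta>\<close> of \<open>h\<close> satisfies \<open>\<Theta>(v, v) = 0\<close> for \<open>v\<close> tangent to \<open>Y\<close>, and by semi-positivity
  \<open>\<Theta>(v, \<cdot>) = 0\<close>. This says that the coefficients of the (1,0)-forms \<open>\<partial> log h\<^sub>p\<close>, for the local weights
  \<open>h\<^sub>p\<close> of \<open>h\<close>, are holomorphic along \<open>Y\<close>. Restricted to \<open>Y\<close> these forms are therefore sections of
  \<open>i\<^sup>*\<Omega>\<^sup>1\<close>, and since \<open>h\<^sub>q = \<bar>g\<^sub>p\<^sub>q\<bar>\<^sup>2 h\<^sub>p\<close>, their coboundary is the cocycle \<open>dg\<^sub>p\<^sub>q / g\<^sub>p\<^sub>q\<close> representing \<open>u\<^sub>1\<close>.\<close>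


section \<open>Presheaves of groups and first cohomology\<close>

text \<open>The class lives in the cohomology of the whole cotangent sheaf of X along Y, so the
  coefficients in directions normal to Y must be holomorphic as well. Local constancy of log h
  controls the curvature on pairs of tangent vectors only; positivity of the full matrix on X turns
  a null vector into a kernel vector and so reaches the mixed entries. Compactness enters through
  the minimum on each connected component of Y, which the strong maximum principle spreads along
  complex lines in submanifold charts. Two encodings shape the rest. Maps on cohomology are defined
  on whole classes of cocycles over arbitrary pointed covers, so each must be shown to be computable
  on one representative. And i^* Omega^1 is literally a sheaf of families in tensor products of
  stalks, so an identity of forms along Y becomes an identity there only after all tensors are
  expanded in the dz_i of a chart. The coefficients of \<partial> log h are merely smooth on X; the
  local extensions that a section of O_Y requires come from a projection onto the slice.\<close>

locale group_presheaf =
  fixes T :: "'a topology" and F :: "'a set \<Rightarrow> ('a \<Rightarrow> 'v, 'm) monoid_scheme"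
  assumes group: "openin T U \<Longrightarrow> group (F U)"
    and extensional: "openin T U \<Longrightarrow> s \<in> carrier (F U) \<Longrightarrow> s \<in> extensional U"
    and restrict_closed:
      "openin T U \<Longrightarrow> openin T V \<Longrightarrow> V \<subseteq> U \<Longrightarrow> s \<in> carrier (F U) \<Longrightarrow> restrict s V \<in> carrier (F V)"
    and restrict_mult:
      "openin T U \<Longrightarrow> openin T V \<Longrightarrow> V \<subseteq> U \<Longrightarrow> s \<in> carrier (F U) \<Longrightarrow> t \<in> carrier (F U) \<Longrightarrow>
        restrict (s \<otimes>\<^bsub>F U\<^esub> t) V = restrict s V \<otimes>\<^bsub>F V\<^esub> restrict t V"
begin

text \<open>The restricted unit is idempotent, and a group has only one idempotent.\<close>

lemma restrict_one:
  assumes "openin T U" "openin T V" "V \<subseteq> U"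
  shows "restrict \<one>\<^bsub>F U\<^esub> V = \<one>\<^bsub>F V\<^esub>"
proof -
  interpret U: group "F U" using group assms by blast
  interpret V: group "F V" using group assms by blast
  have c: "restrict \<one>\<^bsub>F U\<^esub> V \<in> carrier (F V)"
    using restrict_closed assms by blast
  have "restrict \<one>\<^bsub>F U\<^esub> V \<otimes>\<^bsub>F V\<^esub> restrict \<one>\<^bsub>F U\<^esub> V = restrict \<one>\<^bsub>F U\<^esub> V"
    using restrict_mult[OF assms, of "\<one>\<^bsub>F U\<^esub>" "\<one>\<^bsub>F U\<^esub>"] by simp
  then show ?thesis using c V.r_cancel_one' by metis
qed

lemma cocycle_carrier:
  assumes "(\<U>, c) \<in> cocycles1 T F" "p \<in> topspace T" "q \<in> topspace T"
    "openin T W" "W \<subseteq> \<U> p \<inter> \<U> q"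
  shows "restrict (c p q) W \<in> carrier (F W)"
  using assms unfolding cocycles1_def pointed_cover_def
  by (auto intro!: restrict_closed[of "\<U> p \<inter> \<U> q"])

text \<open>The definition states the cocycle identity on full triple overlaps; refinements use it
  on smaller open sets.\<close>

lemma cocycle_mult:
  assumes c: "(\<U>, c) \<in> cocycles1 T F" and pqr: "p \<in> topspace T" "q \<in> topspace T" "r \<in> topspace T"
    and W: "openin T W" "W \<subseteq> \<U> p \<inter> \<U> q \<inter> \<U> r"
  shows "restrict (c p q) W \<otimes>\<^bsub>F W\<^esub> restrict (c q r) W = restrict (c p r) W"
proof -
  let ?V = "\<U> p \<inter> \<U> q \<inter> \<U> r"
  have V: "openin T ?V" using c pqr unfolding cocycles1_def pointed_cover_def by auto
  have eq: "restrict (c p q) ?V \<otimes>\<^bsub>F ?V\<^esub> restrict (c q r) ?V = restrict (c p r) ?V"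
    using c pqr unfolding cocycles1_def Let_def by auto
  have "restrict (restrict (c p q) ?V \<otimes>\<^bsub>F ?V\<^esub> restrict (c q r) ?V) W
     = restrict (restrict (c p q) ?V) W \<otimes>\<^bsub>F W\<^esub> restrict (restrict (c q r) ?V) W"
    by (rule restrict_mult[OF V W]) (use cocycle_carrier[OF c _ _ V] pqr in auto)
  moreover have "?V \<inter> W = W" using W by auto
  ultimately show ?thesis using eq by (simp add: restrict_restrict)
qed

text \<open>Covers are indexed by the points themselves, so two covers can be compared at the same
  index. The refinement maps are absorbed by the usual argument that two refinements of a cocycle
  differ by a coboundary, which leaves a 0-cochain with identity maps.\<close>

lemma cohomologous1_iff:
  "((\<U>, c), (\<U>', c')) \<in> cohomologous1 T F \<longleftrightarrow>
     (\<U>, c) \<in> cocycles1 T F \<and> (\<U>', c') \<in> cocycles1 T F \<and>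
     (\<exists>\<W> b. pointed_cover T \<W> \<and>
        (\<forall>p\<in>topspace T. \<W> p \<subseteq> \<U> p \<inter> \<U>' p \<and> b p \<in> carrier (F (\<W> p))) \<and>
        (\<forall>p\<in>topspace T. \<forall>q\<in>topspace T.
           restrict (c' p q) (\<W> p \<inter> \<W> q) \<otimes>\<^bsub>F (\<W> p \<inter> \<W> q)\<^esub> restrict (b q) (\<W> p \<inter> \<W> q) =
           restrict (b p) (\<W> p \<inter> \<W> q) \<otimes>\<^bsub>F (\<W> p \<inter> \<W> q)\<^esub> restrict (c p q) (\<W> p \<inter> \<W> q)))"
    (is "?L \<longleftrightarrow> ?R")
proof
  assume ?R
  then show ?L unfolding cohomologous1_def Let_def
    apply clarsimp
    subgoal for \<W> b
      apply (rule exI[of _ \<W>], intro conjI, assumption)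
      apply (rule exI[of _ "\<lambda>p. p"], rule exI[of _ "\<lambda>p. p"], rule exI[of _ b])
      by auto
    done
next
  assume ?L
  then obtain \<W> \<tau> \<tau>' b where c: "(\<U>, c) \<in> cocycles1 T F" and c': "(\<U>', c') \<in> cocycles1 T F"
    and W: "pointed_cover T \<W>"
    and \<tau>: "\<forall>p\<in>topspace T. \<tau> p \<in> topspace T \<and> \<tau>' p \<in> topspace T \<and>
           \<W> p \<subseteq> \<U> (\<tau> p) \<inter> \<U>' (\<tau>' p) \<and> b p \<in> carrier (F (\<W> p))"
    and eq: "\<forall>p\<in>topspace T. \<forall>q\<in>topspace T.
           restrict (c' (\<tau>' p) (\<tau>' q)) (\<W> p \<inter> \<W> q) \<otimes>\<^bsub>F (\<W> p \<inter> \<W> q)\<^esub> restrict (b q) (\<W> p \<inter> \<W> q) =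
           restrict (b p) (\<W> p \<inter> \<W> q) \<otimes>\<^bsub>F (\<W> p \<inter> \<W> q)\<^esub> restrict (c (\<tau> p) (\<tau> q)) (\<W> p \<inter> \<W> q)"
    unfolding cohomologous1_def Let_def by clarify (erule (4) that)
  note \<tau> = \<tau>[rule_format] and eq = eq[rule_format]
  define V where "V p = \<W> p \<inter> \<U> p \<inter> \<U>' p" for p
  have pc: "pointed_cover T \<U>" "pointed_cover T \<U>'" using c c' unfolding cocycles1_def by auto
  have V: "pointed_cover T V" using W pc unfolding pointed_cover_def V_def by auto
  have oW: "openin T (\<W> p)" "openin T (V p)" if "p \<in> topspace T" for p
    using W V that unfolding pointed_cover_def by auto
  \<comment> \<open>\<open>c (\<tau> p) p\<close> and \<open>c' p (\<tau>' p)\<close> carry the old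
    cochain from the indices \<open>\<tau> p\<close> and \<open>\<tau>' p\<close> to the index
    \<open>p\<close>. The order of the three factors makes the products below telescope without
    commutativity.\<close>
  define d where "d p = restrict (c' p (\<tau>' p)) (V p) \<otimes>\<^bsub>F (V p)\<^esub> (restrict (b p) (V p) \<otimes>\<^bsub>F (V p)\<^esub>
      restrict (c (\<tau> p) p) (V p))" for p
  have parts: "restrict (c' p (\<tau>' p)) Z \<in> carrier (F Z)" "restrict (b p) Z \<in> carrier (F Z)"
    "restrict (c (\<tau> p) p) Z \<in> carrier (F Z)"
    if "p \<in> topspace T" "openin T Z" "Z \<subseteq> V p" for p Z
    subgoal using that \<tau>[of p] by (intro cocycle_carrier[OF c']) (auto simp: V_def)
    subgoal using that \<tau>[of p] oW[of p] by (intro restrict_closed[of "\<W> p"]) (auto simp: V_def)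
    subgoal using that \<tau>[of p] by (intro cocycle_carrier[OF c]) (auto simp: V_def)
    done
  have d_in: "d p \<in> carrier (F (V p))" if p: "p \<in> topspace T" for p
  proof -
    interpret group "F (V p)" using group oW p by blast
    show ?thesis unfolding d_def using parts[OF p oW(2)[OF p]] by auto
  qed
  have d_res: "restrict (d p) Z = restrict (c' p (\<tau>' p)) Z \<otimes>\<^bsub>F Z\<^esub> (restrict (b p) Z \<otimes>\<^bsub>F Z\<^esub>
      restrict (c (\<tau> p) p) Z)" if p: "p \<in> topspace T" and Z: "openin T Z" "Z \<subseteq> V p" for p Z
  proof -
    interpret group "F (V p)" using group oW p by blast
    have [simp]: "V p \<inter> Z = Z" using Z by auto
    show ?thesis
      unfolding d_def using parts[OF p oW(2)[OF p]] restrict_mult[OF oW(2)[OF p] Z]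
      by (simp add: restrict_restrict)
  qed
  have "restrict (c' p q) Z \<otimes>\<^bsub>F Z\<^esub> restrict (d q) Z = restrict (d p) Z \<otimes>\<^bsub>F Z\<^esub> restrict (c p q) Z"
    if p: "p \<in> topspace T" and q: "q \<in> topspace T" and Z: "Z = V p \<inter> V q" for p q Z
  proof -
    have oZ: "openin T Z" "Z \<subseteq> V p" "Z \<subseteq> V q" using Z oW p q by auto
    interpret group "F Z" using group oZ by blast
    note P = parts[OF p oZ(1,2)] note Q = parts[OF q oZ(1,3)]
    have C: "restrict (c' p q) Z \<in> carrier (F Z)" "restrict (c p q) Z \<in> carrier (F Z)"
      "restrict (c' (\<tau>' p) (\<tau>' q)) Z \<in> carrier (F Z)" "restrict (c (\<tau> p) (\<tau> q)) Z \<in> carrier (F Z)"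
      using p q \<tau>[OF p] \<tau>[OF q] oZ
      by (auto intro!: cocycle_carrier[OF c] cocycle_carrier[OF c'] simp: V_def)
    have sub: "\<W> p \<inter> \<W> q \<inter> Z = Z" "Z \<subseteq> \<W> p \<inter> \<W> q" using oZ by (auto simp: V_def)
    have oWW: "openin T (\<W> p \<inter> \<W> q)" using oW p q by auto
    have CW: "restrict (c' (\<tau>' p) (\<tau>' q)) (\<W> p \<inter> \<W> q) \<in> carrier (F (\<W> p \<inter> \<W> q))"
      "restrict (c (\<tau> p) (\<tau> q)) (\<W> p \<inter> \<W> q) \<in> carrier (F (\<W> p \<inter> \<W> q))"
      "restrict (b p) (\<W> p \<inter> \<W> q) \<in> carrier (F (\<W> p \<inter> \<W> q))"
      "restrict (b q) (\<W> p \<inter> \<W> q) \<in> carrier (F (\<W> p \<inter> \<W> q))"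
      subgoal using p q \<tau>[OF p] \<tau>[OF q] oWW by (intro cocycle_carrier[OF c']) auto
      subgoal using p q \<tau>[OF p] \<tau>[OF q] oWW by (intro cocycle_carrier[OF c]) auto
      subgoal using \<tau>[OF p] oW[OF p] oWW by (intro restrict_closed[of "\<W> p"]) auto
      subgoal using \<tau>[OF q] oW[OF q] oWW by (intro restrict_closed[of "\<W> q"]) auto
      done
    have e: "restrict (c' (\<tau>' p) (\<tau>' q)) Z \<otimes>\<^bsub>F Z\<^esub> restrict (b q) Z =
        restrict (b p) Z \<otimes>\<^bsub>F Z\<^esub> restrict (c (\<tau> p) (\<tau> q)) Z"
      using arg_cong[OF eq[OF p q], of "\<lambda>s. restrict s Z"] restrict_mult[OF oWW oZ(1) sub(2)] CW
      by (simp add: restrict_restrict sub(1))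
    have m: "restrict (c' p q) Z \<otimes>\<^bsub>F Z\<^esub> restrict (c' q (\<tau>' q)) Z = restrict (c' p (\<tau>' q)) Z"
      "restrict (c' p (\<tau>' p)) Z \<otimes>\<^bsub>F Z\<^esub> restrict (c' (\<tau>' p) (\<tau>' q)) Z = restrict (c' p (\<tau>' q)) Z"
      "restrict (c (\<tau> p) (\<tau> q)) Z \<otimes>\<^bsub>F Z\<^esub> restrict (c (\<tau> q) q) Z = restrict (c (\<tau> p) q) Z"
      "restrict (c (\<tau> p) p) Z \<otimes>\<^bsub>F Z\<^esub> restrict (c p q) Z = restrict (c (\<tau> p) q) Z"
      using p q \<tau>[OF p] \<tau>[OF q] oZ
      by (auto intro!: cocycle_mult[OF c] cocycle_mult[OF c'] simp: V_def)
    have "restrict (c' p q) Z \<otimes>\<^bsub>F Z\<^esub> restrict (d q) Z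
       = restrict (c' p (\<tau>' q)) Z \<otimes>\<^bsub>F Z\<^esub> (restrict (b q) Z \<otimes>\<^bsub>F Z\<^esub> restrict (c (\<tau> q) q) Z)"
      using d_res[OF q oZ(1,3)] P Q C by (simp add: m_assoc flip: m(1))
    also have "\<dots> = restrict (c' p (\<tau>' p)) Z \<otimes>\<^bsub>F Z\<^esub> (restrict (c' (\<tau>' p) (\<tau>' q)) Z \<otimes>\<^bsub>F Z\<^esub> restrict (b q) Z)
         \<otimes>\<^bsub>F Z\<^esub> restrict (c (\<tau> q) q) Z"
      using P Q C by (simp add: m_assoc flip: m(2))
    also have "\<dots> = restrict (c' p (\<tau>' p)) Z \<otimes>\<^bsub>F Z\<^esub> (restrict (b p) Z \<otimes>\<^bsub>F Z\<^esub> restrict (c (\<tau> p) q) Z)"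
      unfolding e using P Q C by (simp add: m_assoc flip: m(3))
    also have "\<dots> = restrict (d p) Z \<otimes>\<^bsub>F Z\<^esub> restrict (c p q) Z"
      using d_res[OF p oZ(1,2)] P Q C by (simp add: m_assoc flip: m(4))
    finally show ?thesis .
  qed
  then show ?R using c c' V d_in
    by (intro conjI exI[of _ V] exI[of _ d]) (auto simp: V_def)
qed

lemma cohomologous1_refl:
  assumes c: "(\<U>, c) \<in> cocycles1 T F"
  shows "((\<U>, c), (\<U>, c)) \<in> cohomologous1 T F"
proof -
  have U: "openin T (\<U> p)" if "p \<in> topspace T" for p
    using c that unfolding cocycles1_def pointed_cover_def by auto
  have "restrict (c p q) W \<otimes>\<^bsub>F W\<^esub> restrict \<one>\<^bsub>F (\<U> q)\<^esub> W = restrict \<one>\<^bsub>F (\<U> p)\<^esub> W \<otimes>\<^bsub>F W\<^esub> restrict (c p q) W"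
    if p: "p \<in> topspace T" and q: "q \<in> topspace T" and W: "W = \<U> p \<inter> \<U> q" for p q W
  proof -
    have oW: "openin T W" "W \<subseteq> \<U> p" "W \<subseteq> \<U> q" using U p q W by auto
    interpret group "F W" using group oW by blast
    show ?thesis using restrict_one[OF U oW(1)] oW p q cocycle_carrier[OF c p q oW(1)] by auto
  qed
  then show ?thesis unfolding cohomologous1_iff using c group[THEN group.is_monoid, THEN monoid.one_closed] U
    by (intro conjI exI[of _ \<U>] exI[of _ "\<lambda>p. \<one>\<^bsub>F (\<U> p)\<^esub>"]) (auto simp: cocycles1_def)
qed

text \<open>Inverting the 0-cochain reverses the relation.\<close>

lemma cohomologous1_sym:
  assumes "((\<U>, c), (\<U>', c')) \<in> cohomologous1 T F"
  shows "((\<U>', c'), (\<U>, c)) \<in> cohomologous1 T F"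
proof -
  obtain \<W> b where c: "(\<U>, c) \<in> cocycles1 T F" and c': "(\<U>', c') \<in> cocycles1 T F"
    and W: "pointed_cover T \<W>"
    and b: "\<forall>p\<in>topspace T. \<W> p \<subseteq> \<U> p \<inter> \<U>' p \<and> b p \<in> carrier (F (\<W> p))"
    and eq: "\<forall>p\<in>topspace T. \<forall>q\<in>topspace T.
           restrict (c' p q) (\<W> p \<inter> \<W> q) \<otimes>\<^bsub>F (\<W> p \<inter> \<W> q)\<^esub> restrict (b q) (\<W> p \<inter> \<W> q) =
           restrict (b p) (\<W> p \<inter> \<W> q) \<otimes>\<^bsub>F (\<W> p \<inter> \<W> q)\<^esub> restrict (c p q) (\<W> p \<inter> \<W> q)"
    using assms unfolding cohomologous1_iff by blast
  note b = b[rule_format] and eq = eq[rule_format]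
  have oW: "openin T (\<W> p)" if "p \<in> topspace T" for p
    using W that unfolding pointed_cover_def by auto
  let ?i = "\<lambda>p. inv\<^bsub>F (\<W> p)\<^esub> b p"
  have i: "?i p \<in> carrier (F (\<W> p))" if "p \<in> topspace T" for p
    using group[OF oW] b that by (simp add: group.inv_closed)
  have "restrict (c p q) Z \<otimes>\<^bsub>F Z\<^esub> restrict (?i q) Z = restrict (?i p) Z \<otimes>\<^bsub>F Z\<^esub> restrict (c' p q) Z"
    if p: "p \<in> topspace T" and q: "q \<in> topspace T" and Z: "Z = \<W> p \<inter> \<W> q" for p q Z
  proof -
    have oZ: "openin T Z" "Z \<subseteq> \<W> p" "Z \<subseteq> \<W> q" using Z oW p q by auto
    interpret group "F Z" using group oZ by blast
    have *: "restrict (?i r) Z \<otimes>\<^bsub>F Z\<^esub> restrict (b r) Z = \<one>\<^bsub>F Z\<^esub>" "restrict (b r) Z \<otimes>\<^bsub>F Z\<^esub> restrict (?i r) Z = \<one>\<^bsub>F Z\<^esub>"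
      "restrict (b r) Z \<in> carrier (F Z)" "restrict (?i r) Z \<in> carrier (F Z)"
      if r: "r \<in> topspace T" "Z \<subseteq> \<W> r" for r
      using restrict_mult[OF oW oZ(1)] r i[of r] b[of r] restrict_one[OF oW oZ(1)]
        group.l_inv[OF group[OF oW]] group.r_inv[OF group[OF oW]] restrict_closed[OF oW oZ(1)]
      by (metis (no_types, lifting))+
    have C: "restrict (c' p q) Z \<in> carrier (F Z)" "restrict (c p q) Z \<in> carrier (F Z)"
      using p q b[OF p] b[OF q] oZ
      by (auto intro!: cocycle_carrier[OF c] cocycle_carrier[OF c'])
    note P = *[OF p oZ(2)] note Q = *[OF q oZ(3)]
    have e: "restrict (c' p q) Z \<otimes>\<^bsub>F Z\<^esub> restrict (b q) Z = restrict (b p) Z \<otimes>\<^bsub>F Z\<^esub> restrict (c p q) Z"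
      using eq[OF p q] Z by simp
    have "restrict (c p q) Z \<otimes>\<^bsub>F Z\<^esub> restrict (?i q) Z =
       (restrict (?i p) Z \<otimes>\<^bsub>F Z\<^esub> restrict (b p) Z) \<otimes>\<^bsub>F Z\<^esub> restrict (c p q) Z \<otimes>\<^bsub>F Z\<^esub> restrict (?i q) Z"
      using P Q C by simp
    also have "\<dots> = restrict (?i p) Z \<otimes>\<^bsub>F Z\<^esub> (restrict (c' p q) Z \<otimes>\<^bsub>F Z\<^esub> restrict (b q) Z) \<otimes>\<^bsub>F Z\<^esub> restrict (?i q) Z"
      unfolding e using P(3,4) Q(3,4) C by (simp add: m_assoc)
    also have "\<dots> = restrict (?i p) Z \<otimes>\<^bsub>F Z\<^esub> restrict (c' p q) Z \<otimes>\<^bsub>F Z\<^esub> (restrict (b q) Z \<otimes>\<^bsub>F Z\<^esub> restrict (?i q) Z)"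
      using P(3,4) Q(3,4) C by (simp add: m_assoc)
    also have "\<dots> = restrict (?i p) Z \<otimes>\<^bsub>F Z\<^esub> restrict (c' p q) Z" using P Q C by simp
    finally show ?thesis .
  qed
  then show ?thesis unfolding cohomologous1_iff using c c' W b i
    by (intro conjI exI[of _ \<W>] exI[of _ ?i]) auto
qed

text \<open>On the common refinement the product of the two 0-cochains, with \<open>b'\<close> on
  the left, relates the outer cocycles.\<close>

lemma cohomologous1_trans:
  assumes "((\<U>, c), (\<U>', c')) \<in> cohomologous1 T F" "((\<U>', c'), (\<U>'', c'')) \<in> cohomologous1 T F"
  shows "((\<U>, c), (\<U>'', c'')) \<in> cohomologous1 T F"
proof -
  obtain \<W> b where c: "(\<U>, c) \<in> cocycles1 T F" and c': "(\<U>', c') \<in> cocycles1 T F"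
    and W: "pointed_cover T \<W>"
    and b: "\<forall>p\<in>topspace T. \<W> p \<subseteq> \<U> p \<inter> \<U>' p \<and> b p \<in> carrier (F (\<W> p))"
    and eq: "\<forall>p\<in>topspace T. \<forall>q\<in>topspace T.
           restrict (c' p q) (\<W> p \<inter> \<W> q) \<otimes>\<^bsub>F (\<W> p \<inter> \<W> q)\<^esub> restrict (b q) (\<W> p \<inter> \<W> q) =
           restrict (b p) (\<W> p \<inter> \<W> q) \<otimes>\<^bsub>F (\<W> p \<inter> \<W> q)\<^esub> restrict (c p q) (\<W> p \<inter> \<W> q)"
    using assms(1) unfolding cohomologous1_iff by blast
  note b = b[rule_format] and eq = eq[rule_format]
  obtain \<W>' b' where c'': "(\<U>'', c'') \<in> cocycles1 T F"
    and W': "pointed_cover T \<W>'"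
    and b': "\<forall>p\<in>topspace T. \<W>' p \<subseteq> \<U>' p \<inter> \<U>'' p \<and> b' p \<in> carrier (F (\<W>' p))"
    and eq': "\<forall>p\<in>topspace T. \<forall>q\<in>topspace T.
           restrict (c'' p q) (\<W>' p \<inter> \<W>' q) \<otimes>\<^bsub>F (\<W>' p \<inter> \<W>' q)\<^esub> restrict (b' q) (\<W>' p \<inter> \<W>' q) =
           restrict (b' p) (\<W>' p \<inter> \<W>' q) \<otimes>\<^bsub>F (\<W>' p \<inter> \<W>' q)\<^esub> restrict (c' p q) (\<W>' p \<inter> \<W>' q)"
    using assms(2) unfolding cohomologous1_iff by blast
  note b' = b'[rule_format] and eq' = eq'[rule_format]
  define V where "V p = \<W> p \<inter> \<W>' p" for p
  define d where "d p = restrict (b' p) (V p) \<otimes>\<^bsub>F (V p)\<^esub> restrict (b p) (V p)" for p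
  have V: "pointed_cover T V" using W W' unfolding pointed_cover_def V_def by auto
  have oW: "openin T (\<W> p)" "openin T (\<W>' p)" "openin T (V p)" if "p \<in> topspace T" for p
    using W W' V that unfolding pointed_cover_def by auto
  have bV: "restrict (b p) Z \<in> carrier (F Z)" "restrict (b' p) Z \<in> carrier (F Z)"
    if "p \<in> topspace T" "openin T Z" "Z \<subseteq> V p" for p Z
    subgoal using b[OF that(1)] oW[OF that(1)] that by (intro restrict_closed[of "\<W> p"]) (auto simp: V_def)
    subgoal using b'[OF that(1)] oW[OF that(1)] that by (intro restrict_closed[of "\<W>' p"]) (auto simp: V_def)
    done
  have d: "d p \<in> carrier (F (V p))" if p: "p \<in> topspace T" for p
    unfolding d_def using bV[OF p oW(3)[OF p]] group[OF oW(3)[OF p]]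
    by (simp add: group.is_monoid monoid.m_closed)
  have "restrict (c'' p q) Z \<otimes>\<^bsub>F Z\<^esub> restrict (d q) Z = restrict (d p) Z \<otimes>\<^bsub>F Z\<^esub> restrict (c p q) Z"
    if p: "p \<in> topspace T" and q: "q \<in> topspace T" and Z: "Z = V p \<inter> V q" for p q Z
  proof -
    have oZ: "openin T Z" "Z \<subseteq> V p" "Z \<subseteq> V q" using Z oW p q by auto
    have s: "V p \<inter> Z = Z" "V q \<inter> Z = Z" "\<W> p \<inter> \<W> q \<inter> Z = Z" "\<W>' p \<inter> \<W>' q \<inter> Z = Z"
      "Z \<subseteq> \<W> p \<inter> \<W> q" "Z \<subseteq> \<W>' p \<inter> \<W>' q"
      using oZ by (auto simp: V_def)
    interpret group "F Z" using group oZ by blast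
    have dr: "restrict (d r) Z = restrict (b' r) Z \<otimes>\<^bsub>F Z\<^esub> restrict (b r) Z"
      if "r \<in> topspace T" "V r \<inter> Z = Z" "Z \<subseteq> V r" for r
      unfolding d_def using restrict_mult[OF oW(3)[OF that(1)] oZ(1) that(3)] bV[OF that(1) oW(3)[OF that(1)]]
      by (simp add: restrict_restrict that)
    have C: "restrict (c p q) Z \<in> carrier (F Z)" "restrict (c' p q) Z \<in> carrier (F Z)" "restrict (c'' p q) Z \<in> carrier (F Z)"
      using p q b[OF p] b[OF q] b'[OF p] b'[OF q] oZ
      by (auto intro!: cocycle_carrier[OF c] cocycle_carrier[OF c'] cocycle_carrier[OF c''] simp: V_def)
    have oWW: "openin T (\<W> p \<inter> \<W> q)" "openin T (\<W>' p \<inter> \<W>' q)" using oW p q by auto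
    have CW: "restrict (c' p q) (\<W> p \<inter> \<W> q) \<in> carrier (F (\<W> p \<inter> \<W> q))"
      "restrict (c p q) (\<W> p \<inter> \<W> q) \<in> carrier (F (\<W> p \<inter> \<W> q))"
      "restrict (b p) (\<W> p \<inter> \<W> q) \<in> carrier (F (\<W> p \<inter> \<W> q))"
      "restrict (b q) (\<W> p \<inter> \<W> q) \<in> carrier (F (\<W> p \<inter> \<W> q))"
      subgoal using p q b[OF p] b[OF q] oWW by (intro cocycle_carrier[OF c']) auto
      subgoal using p q b[OF p] b[OF q] oWW by (intro cocycle_carrier[OF c]) auto
      subgoal using b[OF p] oW[OF p] oWW by (intro restrict_closed[of "\<W> p"]) auto
      subgoal using b[OF q] oW[OF q] oWW by (intro restrict_closed[of "\<W> q"]) auto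
      done
    have CW': "restrict (c'' p q) (\<W>' p \<inter> \<W>' q) \<in> carrier (F (\<W>' p \<inter> \<W>' q))"
      "restrict (c' p q) (\<W>' p \<inter> \<W>' q) \<in> carrier (F (\<W>' p \<inter> \<W>' q))"
      "restrict (b' p) (\<W>' p \<inter> \<W>' q) \<in> carrier (F (\<W>' p \<inter> \<W>' q))"
      "restrict (b' q) (\<W>' p \<inter> \<W>' q) \<in> carrier (F (\<W>' p \<inter> \<W>' q))"
      subgoal using p q b'[OF p] b'[OF q] oWW by (intro cocycle_carrier[OF c'']) auto
      subgoal using p q b'[OF p] b'[OF q] oWW by (intro cocycle_carrier[OF c']) auto
      subgoal using b'[OF p] oW[OF p] oWW by (intro restrict_closed[of "\<W>' p"]) auto
      subgoal using b'[OF q] oW[OF q] oWW by (intro restrict_closed[of "\<W>' q"]) auto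
      done
    have e: "restrict (c' p q) Z \<otimes>\<^bsub>F Z\<^esub> restrict (b q) Z = restrict (b p) Z \<otimes>\<^bsub>F Z\<^esub> restrict (c p q) Z"
      using arg_cong[OF eq[OF p q], of "\<lambda>s. restrict s Z"] restrict_mult[OF oWW(1) oZ(1) s(5)] CW
      by (simp add: restrict_restrict s)
    have e': "restrict (c'' p q) Z \<otimes>\<^bsub>F Z\<^esub> restrict (b' q) Z = restrict (b' p) Z \<otimes>\<^bsub>F Z\<^esub> restrict (c' p q) Z"
      using arg_cong[OF eq'[OF p q], of "\<lambda>s. restrict s Z"] restrict_mult[OF oWW(2) oZ(1) s(6)] CW'
      by (simp add: restrict_restrict s)
    have "restrict (c'' p q) Z \<otimes>\<^bsub>F Z\<^esub> restrict (d q) Z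
      = restrict (b' p) Z \<otimes>\<^bsub>F Z\<^esub> restrict (c' p q) Z \<otimes>\<^bsub>F Z\<^esub> restrict (b q) Z"
      using dr[OF q s(2) oZ(3)] C bV[OF q oZ(1,3)] bV[OF p oZ(1,2)] by (simp flip: m_assoc e')
    also have "\<dots> = restrict (b' p) Z \<otimes>\<^bsub>F Z\<^esub> (restrict (b p) Z \<otimes>\<^bsub>F Z\<^esub> restrict (c p q) Z)"
      using C bV[OF q oZ(1,3)] bV[OF p oZ(1,2)] by (simp add: m_assoc flip: e)
    also have "\<dots> = restrict (d p) Z \<otimes>\<^bsub>F Z\<^esub> restrict (c p q) Z"
      using dr[OF p s(1) oZ(2)] C bV[OF q oZ(1,3)] bV[OF p oZ(1,2)] by (simp add: m_assoc)
    finally show ?thesis .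
  qed
  moreover have "V p \<subseteq> \<U> p \<inter> \<U>'' p" if "p \<in> topspace T" for p
    using b[OF that] b'[OF that] by (auto simp: V_def)
  ultimately show ?thesis unfolding cohomologous1_iff using c c'' V d
    by (intro conjI exI[of _ V] exI[of _ d]) auto
qed

text \<open>Maps on cohomology take the image of a whole class, so their value is a priori a union
  of classes. If all members of the image are cohomologous to one of them, the union is a single
  class.\<close>

lemma cohomologous1_Image:
  assumes "y \<in> Z" and "\<And>z. z \<in> Z \<Longrightarrow> (y, z) \<in> cohomologous1 T F"
  shows "cohomologous1 T F `` Z = cohomologous1 T F `` {y}"
proof -
  have t: "(u, w) \<in> cohomologous1 T F" if "(u, v) \<in> cohomologous1 T F" "(v, w) \<in> cohomologous1 T F" for u v w
    using that cohomologous1_trans by (cases u; cases v; cases w) blast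
  have "(y, w) \<in> cohomologous1 T F" if "z \<in> Z" "(z, w) \<in> cohomologous1 T F" for z w
    using t assms(2) that by blast
  then show ?thesis using assms(1) by (auto simp: Image_def)
qed

end

locale presheaf_hom = F: group_presheaf T F + G: group_presheaf T G
  for T :: "'a topology" and F :: "'a set \<Rightarrow> ('a \<Rightarrow> 'v, 'm) monoid_scheme"
    and G :: "'a set \<Rightarrow> ('a \<Rightarrow> 'w, 'k) monoid_scheme" +
  fixes \<phi> :: "'a set \<Rightarrow> ('a \<Rightarrow> 'v) \<Rightarrow> ('a \<Rightarrow> 'w)"
  assumes closed: "openin T U \<Longrightarrow> s \<in> carrier (F U) \<Longrightarrow> \<phi> U s \<in> carrier (G U)"
    and mult: "openin T U \<Longrightarrow> s \<in> carrier (F U) \<Longrightarrow> t \<in> carrier (F U) \<Longrightarrow>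
       \<phi> U (s \<otimes>\<^bsub>F U\<^esub> t) = \<phi> U s \<otimes>\<^bsub>G U\<^esub> \<phi> U t"
    and natural: "openin T U \<Longrightarrow> openin T V \<Longrightarrow> V \<subseteq> U \<Longrightarrow> s \<in> carrier (F U) \<Longrightarrow>
       restrict (\<phi> U s) V = \<phi> V (restrict s V)"
begin

lemma cocycle_image:
  assumes c: "(\<U>, c) \<in> cocycles1 T F"
  shows "(\<U>, \<lambda>p q. \<phi> (\<U> p \<inter> \<U> q) (c p q)) \<in> cocycles1 T G"
proof -
  have U: "openin T (\<U> p)" if "p \<in> topspace T" for p
    using c that unfolding cocycles1_def pointed_cover_def by auto
  have cc: "c p q \<in> carrier (F (\<U> p \<inter> \<U> q))" if "p \<in> topspace T" "q \<in> topspace T" for p q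
    using c that unfolding cocycles1_def by auto
  have "restrict (\<phi> (\<U> p \<inter> \<U> q) (c p q)) W \<otimes>\<^bsub>G W\<^esub> restrict (\<phi> (\<U> q \<inter> \<U> r) (c q r)) W =
      restrict (\<phi> (\<U> p \<inter> \<U> r) (c p r)) W"
    if p: "p \<in> topspace T" "q \<in> topspace T" "r \<in> topspace T" and W: "W = \<U> p \<inter> \<U> q \<inter> \<U> r" for p q r W
  proof -
    have oW: "openin T W" "W \<subseteq> \<U> p \<inter> \<U> q" "W \<subseteq> \<U> q \<inter> \<U> r" "W \<subseteq> \<U> p \<inter> \<U> r" using U p W by auto
    have n: "restrict (\<phi> (\<U> p \<inter> \<U> q) (c p q)) W = \<phi> W (restrict (c p q) W)"
      "restrict (\<phi> (\<U> q \<inter> \<U> r) (c q r)) W = \<phi> W (restrict (c q r) W)"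
      "restrict (\<phi> (\<U> p \<inter> \<U> r) (c p r)) W = \<phi> W (restrict (c p r) W)"
      using U oW cc p by (auto intro!: natural)
    have "restrict (c p q) W \<otimes>\<^bsub>F W\<^esub> restrict (c q r) W = restrict (c p r) W"
      using F.cocycle_mult[OF c p oW(1)] W by simp
    then show ?thesis unfolding n
      using mult[OF oW(1) F.cocycle_carrier[OF c p(1,2) oW(1,2)] F.cocycle_carrier[OF c p(2,3) oW(1,3)]]
      by simp
  qed
  then show ?thesis using c closed[OF openin_Int[OF U U]] unfolding cocycles1_def Let_def by auto
qed

lemma cohomologous_image:
  assumes "((\<U>, c), (\<U>', c')) \<in> cohomologous1 T F"
  shows "((\<U>, \<lambda>p q. \<phi> (\<U> p \<inter> \<U> q) (c p q)), (\<U>', \<lambda>p q. \<phi> (\<U>' p \<inter> \<U>' q) (c' p q))) \<in> cohomologous1 T G"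
proof -
  obtain \<W> b where c: "(\<U>, c) \<in> cocycles1 T F" and c': "(\<U>', c') \<in> cocycles1 T F"
    and W: "pointed_cover T \<W>"
    and b: "\<forall>p\<in>topspace T. \<W> p \<subseteq> \<U> p \<inter> \<U>' p \<and> b p \<in> carrier (F (\<W> p))"
    and eq: "\<forall>p\<in>topspace T. \<forall>q\<in>topspace T.
           restrict (c' p q) (\<W> p \<inter> \<W> q) \<otimes>\<^bsub>F (\<W> p \<inter> \<W> q)\<^esub> restrict (b q) (\<W> p \<inter> \<W> q) =
           restrict (b p) (\<W> p \<inter> \<W> q) \<otimes>\<^bsub>F (\<W> p \<inter> \<W> q)\<^esub> restrict (c p q) (\<W> p \<inter> \<W> q)"
    using assms(1) unfolding F.cohomologous1_iff by blast
  note b = b[rule_format] and eq = eq[rule_format]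
  have oW: "openin T (\<W> p)" "openin T (\<U> p)" "openin T (\<U>' p)" if "p \<in> topspace T" for p
    using W c c' that unfolding pointed_cover_def cocycles1_def by auto
  have "restrict (\<phi> (\<U>' p \<inter> \<U>' q) (c' p q)) Z \<otimes>\<^bsub>G Z\<^esub> restrict (\<phi> (\<W> q) (b q)) Z =
     restrict (\<phi> (\<W> p) (b p)) Z \<otimes>\<^bsub>G Z\<^esub> restrict (\<phi> (\<U> p \<inter> \<U> q) (c p q)) Z"
    if p: "p \<in> topspace T" "q \<in> topspace T" and Z: "Z = \<W> p \<inter> \<W> q" for p q Z
  proof -
    have oZ: "openin T Z" "Z \<subseteq> \<W> p" "Z \<subseteq> \<W> q" using oW p Z by auto
    have sub: "Z \<subseteq> \<U> p \<inter> \<U> q" "Z \<subseteq> \<U>' p \<inter> \<U>' q" using b[OF p(1)] b[OF p(2)] oZ by auto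
    have n: "restrict (\<phi> (\<U>' p \<inter> \<U>' q) (c' p q)) Z = \<phi> Z (restrict (c' p q) Z)"
      "restrict (\<phi> (\<U> p \<inter> \<U> q) (c p q)) Z = \<phi> Z (restrict (c p q) Z)"
      "restrict (\<phi> (\<W> p) (b p)) Z = \<phi> Z (restrict (b p) Z)"
      "restrict (\<phi> (\<W> q) (b q)) Z = \<phi> Z (restrict (b q) Z)"
      using oW oZ sub p b[OF p(1)] b[OF p(2)] c c' by (auto intro!: natural simp: cocycles1_def)
    have C: "restrict (c p q) Z \<in> carrier (F Z)" "restrict (c' p q) Z \<in> carrier (F Z)"
      "restrict (b p) Z \<in> carrier (F Z)" "restrict (b q) Z \<in> carrier (F Z)"
      using F.cocycle_carrier[OF c p oZ(1) sub(1)] F.cocycle_carrier[OF c' p oZ(1) sub(2)]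
        F.restrict_closed[OF oW(1) oZ(1)] p b[OF p(1)] b[OF p(2)] oZ by auto
    show ?thesis unfolding n using eq[OF p] C by (simp flip: mult[OF oZ(1)] Z)
  qed
  then show ?thesis unfolding G.cohomologous1_iff using cocycle_image[OF c] cocycle_image[OF c'] W b
      closed[OF oW(1)]
    by (intro conjI exI[of _ \<W>] exI[of _ "\<lambda>p. \<phi> (\<W> p) (b p)"]) auto
qed

text \<open>Induced maps can thus be followed on one representing cocycle.\<close>

lemma H1_map_class:
  assumes c: "(\<U>, c) \<in> cocycles1 T F"
  shows "H1_map T G \<phi> (cohomologous1 T F `` {(\<U>, c)}) =
     cohomologous1 T G `` {(\<U>, \<lambda>p q. \<phi> (\<U> p \<inter> \<U> q) (c p q))}"
  unfolding H1_map_def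
proof (rule G.cohomologous1_Image)
  show "(\<U>, \<lambda>p q. \<phi> (\<U> p \<inter> \<U> q) (c p q)) \<in>
     (\<lambda>(\<U>, c). (\<U>, \<lambda>p q. \<phi> (\<U> p \<inter> \<U> q) (c p q))) ` cohomologous1 T F `` {(\<U>, c)}"
    using F.cohomologous1_refl[OF c] by (intro image_eqI[of _ _ "(\<U>, c)"]) auto
qed (auto intro: cohomologous_image)

end

lemma group_presheaf_direct_image:
  fixes G :: "'a::topological_space set \<Rightarrow> ('a \<Rightarrow> 'v, 'm) monoid_scheme"
  assumes "group_presheaf (top_of_set Y) G"
  shows "group_presheaf euclidean (direct_image_sheaf Y G)"
proof -
  interpret group_presheaf "top_of_set Y" G by fact
  have o: "openin (top_of_set Y) (U \<inter> Y)" if "open U" for U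
    using that openin_open_Int[of U Y] by (simp add: inf_commute)
  \<comment> \<open>A section over \<open>U \<inter> Y\<close> is \<open>undefined\<close> off that
    set, so restricting it to \<open>V\<close> or to \<open>V \<inter> Y\<close> gives the same
    function.\<close>
  have e: "restrict s V = restrict s (V \<inter> Y)" if "open U" "s \<in> carrier (G (U \<inter> Y))" for s U V
    using extensional[OF o that(2)] that(1) by (auto simp: restrict_def extensional_def fun_eq_iff)
  show ?thesis
  proof (rule group_presheaf.intro)
    fix U V s t assume *: "openin euclidean U" "openin euclidean V" "V \<subseteq> U" "s \<in> carrier (direct_image_sheaf Y G U)"
    then have oo: "openin (top_of_set Y) (U \<inter> Y)" "openin (top_of_set Y) (V \<inter> Y)" "V \<inter> Y \<subseteq> U \<inter> Y"
      using o by auto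
    show "restrict s V \<in> carrier (direct_image_sheaf Y G V)"
      using * restrict_closed[OF oo] e[of U s V] by (auto simp: direct_image_sheaf_def)
    assume t: "t \<in> carrier (direct_image_sheaf Y G U)"
    interpret U: group "G (U \<inter> Y)" using group oo by auto
    show "restrict (s \<otimes>\<^bsub>direct_image_sheaf Y G U\<^esub> t) V = restrict s V \<otimes>\<^bsub>direct_image_sheaf Y G V\<^esub> restrict t V"
      using * t restrict_mult[OF oo] e[of U s V] e[of U t V] e[of U "s \<otimes>\<^bsub>G (U \<inter> Y)\<^esub> t" V]
      by (auto simp: direct_image_sheaf_def)
  next
    fix U :: "'a set" and s assume U: "openin euclidean U"
    show "group (direct_image_sheaf Y G U)"
      using group[OF o] U by (simp add: direct_image_sheaf_def)
    assume "s \<in> carrier (direct_image_sheaf Y G U)"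
    then show "s \<in> extensional U"
      using extensional[OF o, of U s] U by (simp add: direct_image_sheaf_def extensional_def)
  qed
qed

text \<open>A cocycle with values in the direct image already consists of sections of
  \<open>G\<close> over the traces on \<open>Y\<close>. The canonical map intersects the cover with
  \<open>Y\<close> and looks at the indices in \<open>Y\<close> only.\<close>

lemma H1_direct_image_class:
  fixes G :: "'a::topological_space set \<Rightarrow> ('a \<Rightarrow> 'v, 'm) monoid_scheme"
  assumes G: "group_presheaf (top_of_set Y) G"
    and c: "(\<U>, c) \<in> cocycles1 euclidean (direct_image_sheaf Y G)"
  shows "H1_direct_image Y G (cohomologous1 euclidean (direct_image_sheaf Y G) `` {(\<U>, c)}) =
     cohomologous1 (top_of_set Y) G `` {(\<lambda>p. \<U> p \<inter> Y, c)}"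
    and "(\<lambda>p. \<U> p \<inter> Y, c) \<in> cocycles1 (top_of_set Y) G"
proof -
  interpret G: group_presheaf "top_of_set Y" G by fact
  interpret D: group_presheaf euclidean "direct_image_sheaf Y G" by (rule group_presheaf_direct_image) fact
  have o: "openin (top_of_set Y) (U \<inter> Y)" if "open U" for U
    using that openin_open_Int[of U Y] by (simp add: inf_commute)
  have e: "restrict s V = restrict s (V \<inter> Y)" if "open U" "s \<in> carrier (G (U \<inter> Y))" for s U V
    using G.extensional[OF o that(2)] that(1) by (auto simp: restrict_def extensional_def fun_eq_iff)
  have YY: "U \<inter> Y \<inter> (V \<inter> Y) = U \<inter> V \<inter> Y" for U V by auto
  have coc: "(\<lambda>p. \<U> p \<inter> Y, c) \<in> cocycles1 (top_of_set Y) G"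
    if c: "(\<U>, c) \<in> cocycles1 euclidean (direct_image_sheaf Y G)" for \<U> c
  proof -
    have U: "open (\<U> p)" "p \<in> \<U> p" for p using c by (auto simp: cocycles1_def pointed_cover_def)
    have cc: "c p q \<in> carrier (G (\<U> p \<inter> \<U> q \<inter> Y))" for p q
      using c by (auto simp: cocycles1_def direct_image_sheaf_def)
    have "restrict (c p q) W \<otimes>\<^bsub>G W\<^esub> restrict (c q r) W = restrict (c p r) W"
      if W: "W = \<U> p \<inter> \<U> q \<inter> \<U> r \<inter> Y" for p q r W
    proof -
      let ?W = "\<U> p \<inter> \<U> q \<inter> \<U> r"
      have "restrict (c p q) ?W \<otimes>\<^bsub>direct_image_sheaf Y G ?W\<^esub> restrict (c q r) ?W = restrict (c p r) ?W"
        by (rule D.cocycle_mult[OF c]) (use U in auto)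
      then show ?thesis
        using e[OF _ cc[of p q], of ?W] e[OF _ cc[of q r], of ?W] e[OF _ cc[of p r], of ?W] U(1)
        by (simp add: W direct_image_sheaf_def open_Int)
    qed
    moreover have "pointed_cover (top_of_set Y) (\<lambda>p. \<U> p \<inter> Y)"
      using U o by (auto simp: pointed_cover_def)
    ultimately show ?thesis using cc
      by (auto simp: cocycles1_def YY)
  qed
  show "(\<lambda>p. \<U> p \<inter> Y, c) \<in> cocycles1 (top_of_set Y) G" using c by (rule coc)
  have rel: "((\<lambda>p. \<U> p \<inter> Y, c), (\<lambda>p. \<U>' p \<inter> Y, c')) \<in> cohomologous1 (top_of_set Y) G"
    if *: "((\<U>, c), (\<U>', c')) \<in> cohomologous1 euclidean (direct_image_sheaf Y G)" for \<U>' c'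
  proof -
    obtain \<W> b where c: "(\<U>, c) \<in> cocycles1 euclidean (direct_image_sheaf Y G)"
      and c': "(\<U>', c') \<in> cocycles1 euclidean (direct_image_sheaf Y G)"
      and W: "pointed_cover euclidean \<W>"
      and b: "\<forall>p. \<W> p \<subseteq> \<U> p \<inter> \<U>' p \<and> b p \<in> carrier (direct_image_sheaf Y G (\<W> p))"
      and eq: "\<forall>p q. restrict (c' p q) (\<W> p \<inter> \<W> q) \<otimes>\<^bsub>direct_image_sheaf Y G (\<W> p \<inter> \<W> q)\<^esub> restrict (b q) (\<W> p \<inter> \<W> q) =
           restrict (b p) (\<W> p \<inter> \<W> q) \<otimes>\<^bsub>direct_image_sheaf Y G (\<W> p \<inter> \<W> q)\<^esub> restrict (c p q) (\<W> p \<inter> \<W> q)"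
      using * unfolding D.cohomologous1_iff topspace_euclidean ball_UNIV by blast
    note b = b[rule_format] and eq = eq[rule_format]
    have oW: "open (\<W> p)" "p \<in> \<W> p" "open (\<U> p)" "open (\<U>' p)" for p
      using W c c' by (auto simp: pointed_cover_def cocycles1_def)
    have cc: "c p q \<in> carrier (G (\<U> p \<inter> \<U> q \<inter> Y))" "c' p q \<in> carrier (G (\<U>' p \<inter> \<U>' q \<inter> Y))"
      "b p \<in> carrier (G (\<W> p \<inter> Y))" for p q
      using c c' b by (auto simp: cocycles1_def direct_image_sheaf_def)
    have "restrict (c' p q) Z \<otimes>\<^bsub>G Z\<^esub> restrict (b q) Z = restrict (b p) Z \<otimes>\<^bsub>G Z\<^esub> restrict (c p q) Z"
      if Z: "Z = \<W> p \<inter> \<W> q \<inter> Y" for p q Z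
      using eq[of p q] e[OF _ cc(1)[of p q], of "\<W> p \<inter> \<W> q"] e[OF _ cc(2)[of p q], of "\<W> p \<inter> \<W> q"]
        e[OF _ cc(3)[of p], of "\<W> p \<inter> \<W> q"] e[OF _ cc(3)[of q], of "\<W> p \<inter> \<W> q"] oW(1,3,4)
      by (simp add: Z direct_image_sheaf_def open_Int)
    moreover have "pointed_cover (top_of_set Y) (\<lambda>p. \<W> p \<inter> Y)"
      using oW o by (auto simp: pointed_cover_def)
    moreover have "\<W> p \<inter> Y \<subseteq> \<U> p \<inter> Y \<inter> (\<U>' p \<inter> Y)" for p using b[of p] by auto
    ultimately show ?thesis unfolding G.cohomologous1_iff using coc[OF c] coc[OF c'] cc(3)
      by (intro conjI exI[of _ "\<lambda>p. \<W> p \<inter> Y"] exI[of _ b]) (auto simp: YY)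
  qed
  show "H1_direct_image Y G (cohomologous1 euclidean (direct_image_sheaf Y G) `` {(\<U>, c)}) =
     cohomologous1 (top_of_set Y) G `` {(\<lambda>p. \<U> p \<inter> Y, c)}"
    unfolding H1_direct_image_def
  proof (rule G.cohomologous1_Image)
    show "(\<lambda>p. \<U> p \<inter> Y, c) \<in> (\<lambda>(\<U>, c). (\<lambda>p. \<U> p \<inter> Y, c)) `
        cohomologous1 euclidean (direct_image_sheaf Y G) `` {(\<U>, c)}"
      using D.cohomologous1_refl[OF c] by (intro image_eqI[of _ _ "(\<U>, c)"]) auto
  qed (auto intro: rel)
qed


section \<open>Germs and inverse images\<close>

lemma germ_mem: "openin T U \<Longrightarrow> p \<in> U \<Longrightarrow> s \<in> S U \<Longrightarrow> (U, s) \<in> germ T S p U s"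
  unfolding germ_def by auto

text \<open>Agreement near the point passes to every representative of the germ. The situation is
  symmetric, so one inclusion, proved for arbitrary data, gives both.\<close>

lemma germ_eqI:
  assumes W: "openin T W" "p \<in> W" "W \<subseteq> U \<inter> V" and eq: "\<And>q. q \<in> W \<Longrightarrow> s q = t q"
  shows "germ T S p U s = germ T S p V t"
proof -
  have "x \<in> germ T S p V t"
    if x0: "x \<in> germ T S p U s" and "W \<subseteq> U \<inter> V" "\<And>q. q \<in> W \<Longrightarrow> s q = t q" for x U V s t
  proof -
    obtain V' t' W' where x: "x = (V', t')" "openin T V'" "p \<in> V'" "t' \<in> S V'"
      "openin T W'" "p \<in> W'" "W' \<subseteq> U \<inter> V'" "restrict s W' = restrict t' W'"
      using x0 unfolding germ_def by auto
    have "s q = t' q" if "q \<in> W'" for q using x(8) that by (metis restrict_apply')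
    then have "restrict t (W \<inter> W') = restrict t' (W \<inter> W')" using that(3) by (force simp: restrict_def fun_eq_iff)
    moreover have "W \<inter> W' \<subseteq> V \<inter> V'" "openin T (W \<inter> W')" using x W that(2) by auto
    ultimately show ?thesis using x W unfolding germ_def by blast
  qed
  from this[of _ U s V t] this[of _ V t U s] show ?thesis using W eq by auto
qed

lemma germ_restrict:
  assumes "openin T W" "p \<in> W" "W \<subseteq> U"
  shows "germ T S p W (restrict s W) = germ T S p U s"
  by (rule germ_eqI[of _ W]) (use assms in auto)

lemma germ_memE:
  assumes "(V, t) \<in> germ T S p U s"
  obtains W where "openin T V" "p \<in> V" "t \<in> S V" "openin T W" "p \<in> W" "W \<subseteq> U \<inter> V"
    "\<And>Z. Z \<subseteq> W \<Longrightarrow> restrict s Z = restrict t Z"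
proof -
  obtain W where W: "openin T V" "p \<in> V" "t \<in> S V" "openin T W" "p \<in> W" "W \<subseteq> U \<inter> V" "restrict s W = restrict t W"
    using assms unfolding germ_def by auto
  have "restrict s Z = restrict t Z" if "Z \<subseteq> W" for Z
    using arg_cong[OF W(7), of "\<lambda>u. restrict u Z"] that by (simp add: restrict_restrict inf.absorb2)
  then show ?thesis using that W by blast
qed

lemma germs_E:
  assumes "x \<in> germs T S p"
  obtains U s where "openin T U" "p \<in> U" "s \<in> S U" "x = germ T S p U s"
  using assms unfolding germs_def by auto

lemma germs_I: "openin T U \<Longrightarrow> p \<in> U \<Longrightarrow> s \<in> S U \<Longrightarrow> germ T S p U s \<in> germs T S p"
  unfolding germs_def by auto

text \<open>\<open>germ_op\<close> is a union over all pairs of representatives. Compatibility of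
  \<open>f\<close> with restriction makes all members equal, so any one pair computes it. Three
  topologies occur because the stalk of O_X, taken on X, acts on the stalk of O_Y, taken on
  Y.\<close>

lemma germ_op_germ:
  assumes T: "\<And>W1 W2. openin T1 W1 \<Longrightarrow> openin T2 W2 \<Longrightarrow> openin T (W1 \<inter> W2)"
    and s: "openin T1 U" "p \<in> U" "s \<in> S1 U" and t: "openin T2 V" "p \<in> V" "t \<in> S2 V"
    and f: "\<And>U V W s t. openin T1 U \<Longrightarrow> openin T2 V \<Longrightarrow> openin T W \<Longrightarrow> W \<subseteq> U \<inter> V \<Longrightarrow>
      s \<in> S1 U \<Longrightarrow> t \<in> S2 V \<Longrightarrow>
      restrict (f (U \<inter> V) (restrict s (U \<inter> V)) (restrict t (U \<inter> V))) W = f W (restrict s W) (restrict t W)"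
  shows "germ_op T S p f (germ T1 S1 p U s) (germ T2 S2 p V t) =
     germ T S p (U \<inter> V) (f (U \<inter> V) (restrict s (U \<inter> V)) (restrict t (U \<inter> V)))"
proof -
  let ?g = "\<lambda>U V s t. germ T S p (U \<inter> V) (f (U \<inter> V) (restrict s (U \<inter> V)) (restrict t (U \<inter> V)))"
  have "?g U' V' s' t' = ?g U V s t"
    if U': "(U', s') \<in> germ T1 S1 p U s" and V': "(V', t') \<in> germ T2 S2 p V t" for U' s' V' t'
  proof -
    obtain W1 where 1: "openin T1 U'" "p \<in> U'" "s' \<in> S1 U'" "openin T1 W1" "p \<in> W1" "W1 \<subseteq> U \<inter> U'"
      "\<And>Z. Z \<subseteq> W1 \<Longrightarrow> restrict s Z = restrict s' Z" using germ_memE[OF U'] by metis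
    obtain W2 where 2: "openin T2 V'" "p \<in> V'" "t' \<in> S2 V'" "openin T2 W2" "p \<in> W2" "W2 \<subseteq> V \<inter> V'"
      "\<And>Z. Z \<subseteq> W2 \<Longrightarrow> restrict t Z = restrict t' Z" using germ_memE[OF V'] by metis
    let ?W = "W1 \<inter> W2"
    have W: "openin T ?W" using T 1 2 by auto
    have "restrict (f (U' \<inter> V') (restrict s' (U' \<inter> V')) (restrict t' (U' \<inter> V'))) ?W
       = restrict (f (U \<inter> V) (restrict s (U \<inter> V)) (restrict t (U \<inter> V))) ?W"
      using f[OF 1(1) 2(1) W _ 1(3) 2(3)] f[OF s(1) t(1) W _ s(3) t(3)] 1(6) 2(6) 1(7)[of ?W] 2(7)[of ?W]
      by (simp add: le_infI1 le_infI2)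
    then show ?thesis
      by (intro germ_eqI[of _ ?W]) (use W 1 2 in \<open>auto dest: fun_cong simp: restrict_def fun_eq_iff split: if_splits\<close>)
  qed
  moreover have "(U, s) \<in> germ T1 S1 p U s" "(V, t) \<in> germ T2 S2 p V t"
    using s t by (simp_all add: germ_mem)
  ultimately have "(\<Union>(U', s')\<in>germ T1 S1 p U s. \<Union>(V', t')\<in>germ T2 S2 p V t. ?g U' V' s' t') = ?g U V s t"
    by fast
  then show ?thesis unfolding germ_op_def .
qed

section \<open>Stalks of a presheaf of groups\<close>

context group_presheaf
begin

abbreviation "gm \<equiv> germ T (\<lambda>U. carrier (F U))"

lemma stalk_mult:
  assumes "openin T U" "p \<in> U" "s \<in> carrier (F U)" "t \<in> carrier (F U)"
  shows "gm p U s \<otimes>\<^bsub>stalk T F p\<^esub> gm p U t = gm p U (s \<otimes>\<^bsub>F U\<^esub> t)"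
proof -
  have "germ_op T (\<lambda>U. carrier (F U)) p (\<lambda>W s t. s \<otimes>\<^bsub>F W\<^esub> t) (gm p U s) (gm p U t) =
    gm p (U \<inter> U) (restrict s (U \<inter> U) \<otimes>\<^bsub>F (U \<inter> U)\<^esub> restrict t (U \<inter> U))"
  proof (rule germ_op_germ)
    fix U V W s t assume *: "openin T U" "openin T V" "openin T W" "W \<subseteq> U \<inter> V" "s \<in> carrier (F U)" "t \<in> carrier (F V)"
    then have "restrict s (U \<inter> V) \<in> carrier (F (U \<inter> V))" "restrict t (U \<inter> V) \<in> carrier (F (U \<inter> V))"
      using restrict_closed[of U "U \<inter> V"] restrict_closed[of V "U \<inter> V"] by auto
    moreover have "U \<inter> V \<inter> W = W" using * by auto
    ultimately show "restrict (restrict s (U \<inter> V) \<otimes>\<^bsub>F (U \<inter> V)\<^esub> restrict t (U \<inter> V)) W = restrict s W \<otimes>\<^bsub>F W\<^esub> restrict t W"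
      using restrict_mult[of "U \<inter> V" W] * by (simp add: restrict_restrict openin_Int)
  qed (use assms in auto)
  then show ?thesis using assms extensional by (simp add: stalk_def extensional_restrict)
qed

lemma stalk_carrierI: "openin T U \<Longrightarrow> p \<in> U \<Longrightarrow> s \<in> carrier (F U) \<Longrightarrow> gm p U s \<in> carrier (stalk T F p)"
  by (simp add: stalk_def germs_I)

lemma stalk_one: "openin T U \<Longrightarrow> p \<in> U \<Longrightarrow> \<one>\<^bsub>stalk T F p\<^esub> = gm p U \<one>\<^bsub>F U\<^esub>"
  using restrict_one[of "topspace T" U] germ_restrict[of T U p "topspace T" "\<lambda>U. carrier (F U)" "\<one>\<^bsub>F (topspace T)\<^esub>"]
  by (simp add: stalk_def openin_subset)

text \<open>Germs have representatives on one common neighbourhood, where the group laws of the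
  stalk become those of the sections.\<close>

lemma stalk_common2:
  assumes "x \<in> carrier (stalk T F p)" "y \<in> carrier (stalk T F p)"
  obtains U s t where "openin T U" "p \<in> U" "s \<in> carrier (F U)" "t \<in> carrier (F U)" "x = gm p U s" "y = gm p U t"
proof -
  obtain U s where s: "openin T U" "p \<in> U" "s \<in> carrier (F U)" "x = gm p U s"
    using assms(1) by (auto simp: stalk_def elim: germs_E)
  obtain V t where t: "openin T V" "p \<in> V" "t \<in> carrier (F V)" "y = gm p V t"
    using assms(2) by (auto simp: stalk_def elim: germs_E)
  show ?thesis
    using s t restrict_closed[of U "U \<inter> V" s] restrict_closed[of V "U \<inter> V" t]
      germ_restrict[of T "U \<inter> V" p U "\<lambda>U. carrier (F U)" s] germ_restrict[of T "U \<inter> V" p V "\<lambda>U. carrier (F U)" t]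
    by (intro that[of "U \<inter> V" "restrict s (U \<inter> V)" "restrict t (U \<inter> V)"]) auto
qed

lemma stalk_common3:
  assumes "x \<in> carrier (stalk T F p)" "y \<in> carrier (stalk T F p)" "z \<in> carrier (stalk T F p)"
  obtains U s t u where "openin T U" "p \<in> U" "s \<in> carrier (F U)" "t \<in> carrier (F U)" "u \<in> carrier (F U)"
    "x = gm p U s" "y = gm p U t" "z = gm p U u"
proof -
  obtain U s t where s: "openin T U" "p \<in> U" "s \<in> carrier (F U)" "t \<in> carrier (F U)" "x = gm p U s" "y = gm p U t"
    using stalk_common2[OF assms(1,2)] .
  obtain V u where t: "openin T V" "p \<in> V" "u \<in> carrier (F V)" "z = gm p V u"
    using assms(3) by (auto simp: stalk_def elim: germs_E)
  show ?thesis
    using s t restrict_closed[of U "U \<inter> V"] restrict_closed[of V "U \<inter> V" u]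
      germ_restrict[of T "U \<inter> V" p U "\<lambda>U. carrier (F U)"] germ_restrict[of T "U \<inter> V" p V "\<lambda>U. carrier (F U)" u]
    by (intro that[of "U \<inter> V" "restrict s (U \<inter> V)" "restrict t (U \<inter> V)" "restrict u (U \<inter> V)"]) auto
qed

lemma stalk_group: assumes "p \<in> topspace T" shows "group (stalk T F p)"
proof (rule groupI)
  interpret X: group "F (topspace T)" using group by auto
  show "\<one>\<^bsub>stalk T F p\<^esub> \<in> carrier (stalk T F p)"
    using assms by (simp add: stalk_one[of "topspace T"] stalk_carrierI)
  fix x y assume xy: "x \<in> carrier (stalk T F p)" "y \<in> carrier (stalk T F p)"
  then obtain U s t where U: "openin T U" "p \<in> U" "s \<in> carrier (F U)" "t \<in> carrier (F U)" "x = gm p U s" "y = gm p U t"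
    by (rule stalk_common2)
  interpret U: group "F U" using group U by auto
  show "x \<otimes>\<^bsub>stalk T F p\<^esub> y \<in> carrier (stalk T F p)"
    using U by (simp add: stalk_mult stalk_carrierI)
  show "\<one>\<^bsub>stalk T F p\<^esub> \<otimes>\<^bsub>stalk T F p\<^esub> x = x"
    using U by (simp add: stalk_mult stalk_one[OF U(1,2)])
  have "inv\<^bsub>F U\<^esub> s \<in> carrier (F U)" using U by auto
  then show "\<exists>y\<in>carrier (stalk T F p). y \<otimes>\<^bsub>stalk T F p\<^esub> x = \<one>\<^bsub>stalk T F p\<^esub>"
    using U by (intro bexI[of _ "gm p U (inv\<^bsub>F U\<^esub> s)"]) (simp_all add: stalk_mult stalk_one[OF U(1,2)] stalk_carrierI)
next
  fix x y z assume xy: "x \<in> carrier (stalk T F p)" "y \<in> carrier (stalk T F p)" "z \<in> carrier (stalk T F p)"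
  then obtain U s t u where U: "openin T U" "p \<in> U" "s \<in> carrier (F U)" "t \<in> carrier (F U)" "u \<in> carrier (F U)"
    "x = gm p U s" "y = gm p U t" "z = gm p U u" by (rule stalk_common3)
  interpret U: group "F U" using group U by auto
  show "x \<otimes>\<^bsub>stalk T F p\<^esub> y \<otimes>\<^bsub>stalk T F p\<^esub> z = x \<otimes>\<^bsub>stalk T F p\<^esub> (y \<otimes>\<^bsub>stalk T F p\<^esub> z)"
    using U by (simp add: stalk_mult U.m_assoc)
qed

lemma stalk_inv:
  assumes "openin T U" "p \<in> U" "s \<in> carrier (F U)"
  shows "inv\<^bsub>stalk T F p\<^esub> gm p U s = gm p U (inv\<^bsub>F U\<^esub> s)"
proof -
  interpret U: group "F U" using group assms by auto
  interpret P: group "stalk T F p" using stalk_group assms openin_subset by blast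
  show ?thesis
    using assms by (intro P.inv_equality) (simp_all add: stalk_mult stalk_one[OF assms(1,2)] stalk_carrierI)
qed

end

section \<open>Inverse images of presheaves of groups and of their morphisms\<close>

lemma inv_image_sheaf_simps:
  "s \<in> carrier (inv_image_sheaf F V) \<longleftrightarrow> s \<in> extensional V \<and> (\<forall>p\<in>V. \<exists>U \<sigma>. open U \<and> p \<in> U \<and> \<sigma> \<in> carrier (F U) \<and>
        (\<forall>q\<in>U \<inter> V. s q = germ euclidean (\<lambda>U. carrier (F U)) q U \<sigma>))"
  "s \<otimes>\<^bsub>inv_image_sheaf F V\<^esub> t = (\<lambda>p\<in>V. s p \<otimes>\<^bsub>stalk euclidean F p\<^esub> t p)"
  "\<one>\<^bsub>inv_image_sheaf F V\<^esub> = (\<lambda>p\<in>V. \<one>\<^bsub>stalk euclidean F p\<^esub>)"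
  unfolding inv_image_sheaf_def by auto

text \<open>The operations are taken stalk by stalk, so the group laws come from the stalks. Closure
  is the local question: near each point, the product or inverse of representing sections represents
  the result.\<close>

lemma group_presheaf_inv_image:
  fixes F :: "'a::topological_space set \<Rightarrow> ('a \<Rightarrow> 'v, 'm) monoid_scheme"
  assumes "group_presheaf euclidean F"
  shows "group_presheaf (top_of_set Y) (inv_image_sheaf F)"
proof -
  interpret F: group_presheaf euclidean F by fact
  have st: "group (stalk euclidean F p)" for p using F.stalk_group by simp
  have sc: "s p \<in> carrier (stalk euclidean F p)" if "s \<in> carrier (inv_image_sheaf F V)" "p \<in> V" for s p V
    using that F.stalk_carrierI unfolding inv_image_sheaf_simps
    by (metis Int_iff open_openin)
  have grp: "group (inv_image_sheaf F V)" for V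
  proof (rule groupI)
    show "\<one>\<^bsub>inv_image_sheaf F V\<^esub> \<in> carrier (inv_image_sheaf F V)"
      using F.group[of UNIV, THEN group.is_monoid] F.stalk_one[of UNIV] unfolding inv_image_sheaf_simps
      by (intro conjI ballI exI[of _ UNIV] exI[of _ "\<one>\<^bsub>F UNIV\<^esub>"]) (auto intro: monoid.one_closed)
    fix x y assume x: "x \<in> carrier (inv_image_sheaf F V)" and y: "y \<in> carrier (inv_image_sheaf F V)"
    show "x \<otimes>\<^bsub>inv_image_sheaf F V\<^esub> y \<in> carrier (inv_image_sheaf F V)"
      unfolding inv_image_sheaf_simps
    proof (intro conjI ballI)
      fix p assume p: "p \<in> V"
      obtain U \<sigma> where U: "open U" "p \<in> U" "\<sigma> \<in> carrier (F U)" "\<And>q. q\<in>U \<inter> V \<Longrightarrow> x q = F.gm q U \<sigma>"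
        using x p unfolding inv_image_sheaf_simps by meson
      obtain U' \<sigma>' where U': "open U'" "p \<in> U'" "\<sigma>' \<in> carrier (F U')" "\<And>q. q\<in>U' \<inter> V \<Longrightarrow> y q = F.gm q U' \<sigma>'"
        using y p unfolding inv_image_sheaf_simps by meson
      let ?W = "U \<inter> U'"
      interpret W: group "F ?W" using F.group U U' by auto
      have c: "restrict \<sigma> ?W \<in> carrier (F ?W)" "restrict \<sigma>' ?W \<in> carrier (F ?W)"
        using U(1,3) U'(1,3) F.restrict_closed[of U ?W \<sigma>] F.restrict_closed[of U' ?W \<sigma>'] by (simp_all add: open_Int)
      have "x q \<otimes>\<^bsub>stalk euclidean F q\<^esub> y q = F.gm q ?W (restrict \<sigma> ?W \<otimes>\<^bsub>F ?W\<^esub> restrict \<sigma>' ?W)" if "q \<in> ?W \<inter> V" for q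
      proof -
        have "x q = F.gm q ?W (restrict \<sigma> ?W)" "y q = F.gm q ?W (restrict \<sigma>' ?W)"
          using that U(1,4) U'(1,4) germ_restrict[of euclidean ?W q U _ \<sigma>] germ_restrict[of euclidean ?W q U' _ \<sigma>']
          by (simp_all add: open_Int)
        then show ?thesis using F.stalk_mult[of ?W q] c that U(1) U'(1) by (simp add: open_Int)
      qed
      then show "\<exists>U \<sigma>. open U \<and> p \<in> U \<and> \<sigma> \<in> carrier (F U) \<and> (\<forall>q\<in>U \<inter> V.
          (\<lambda>p\<in>V. x p \<otimes>\<^bsub>stalk euclidean F p\<^esub> y p) q = F.gm q U \<sigma>)"
        using U U' c by (intro exI[of _ ?W] exI[of _ "restrict \<sigma> ?W \<otimes>\<^bsub>F ?W\<^esub> restrict \<sigma>' ?W"]) auto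
    qed simp
    show "\<one>\<^bsub>inv_image_sheaf F V\<^esub> \<otimes>\<^bsub>inv_image_sheaf F V\<^esub> x = x"
    proof
      fix p show "(\<one>\<^bsub>inv_image_sheaf F V\<^esub> \<otimes>\<^bsub>inv_image_sheaf F V\<^esub> x) p = x p"
      proof (cases "p \<in> V")
        case True
        then show ?thesis using sc[OF x True] st[of p, THEN group.is_monoid]
          by (simp add: inv_image_sheaf_simps monoid.l_one)
      next
        case False
        then show ?thesis using x by (simp add: inv_image_sheaf_simps extensional_def)
      qed
    qed
    show "\<exists>y\<in>carrier (inv_image_sheaf F V). y \<otimes>\<^bsub>inv_image_sheaf F V\<^esub> x = \<one>\<^bsub>inv_image_sheaf F V\<^esub>"
    proof
      let ?y = "\<lambda>p\<in>V. inv\<^bsub>stalk euclidean F p\<^esub> x p"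
      show "?y \<otimes>\<^bsub>inv_image_sheaf F V\<^esub> x = \<one>\<^bsub>inv_image_sheaf F V\<^esub>"
        using sc[OF x] st by (auto simp: inv_image_sheaf_simps restrict_def fun_eq_iff group.l_inv)
      show "?y \<in> carrier (inv_image_sheaf F V)" unfolding inv_image_sheaf_simps
      proof (intro conjI ballI)
        fix p assume p: "p \<in> V"
        obtain U \<sigma> where U: "open U" "p \<in> U" "\<sigma> \<in> carrier (F U)" "\<And>q. q\<in>U \<inter> V \<Longrightarrow> x q = F.gm q U \<sigma>"
          using x p unfolding inv_image_sheaf_simps by meson
        interpret U: group "F U" using F.group U by auto
        show "\<exists>U \<sigma>. open U \<and> p \<in> U \<and> \<sigma> \<in> carrier (F U) \<and> (\<forall>q\<in>U \<inter> V. ?y q = F.gm q U \<sigma>)"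
          using U F.stalk_inv[of U] by (intro exI[of _ U] exI[of _ "inv\<^bsub>F U\<^esub> \<sigma>"]) auto
      qed simp
    qed
  next
    fix x y z assume x: "x \<in> carrier (inv_image_sheaf F V)" and y: "y \<in> carrier (inv_image_sheaf F V)"
      and z: "z \<in> carrier (inv_image_sheaf F V)"
    show "x \<otimes>\<^bsub>inv_image_sheaf F V\<^esub> y \<otimes>\<^bsub>inv_image_sheaf F V\<^esub> z = x \<otimes>\<^bsub>inv_image_sheaf F V\<^esub> (y \<otimes>\<^bsub>inv_image_sheaf F V\<^esub> z)"
      using sc[OF x] sc[OF y] sc[OF z] st[THEN group.is_monoid]
      by (auto simp: inv_image_sheaf_simps restrict_def fun_eq_iff monoid.m_assoc)
  qed
  show ?thesis
  proof (rule group_presheaf.intro)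
    fix U V s t assume *: "V \<subseteq> U" "s \<in> carrier (inv_image_sheaf F U)"
    show "restrict s V \<in> carrier (inv_image_sheaf F V)"
      unfolding inv_image_sheaf_simps
    proof (intro conjI ballI)
      fix p assume p: "p \<in> V"
      then obtain Z \<sigma> where U: "open Z" "p \<in> Z" "\<sigma> \<in> carrier (F Z)" "\<And>q. q\<in>Z \<inter> U \<Longrightarrow> s q = F.gm q Z \<sigma>"
        using * unfolding inv_image_sheaf_simps by (meson subsetD)
      show "\<exists>U \<sigma>. open U \<and> p \<in> U \<and> \<sigma> \<in> carrier (F U) \<and> (\<forall>q\<in>U \<inter> V. restrict s V q = F.gm q U \<sigma>)"
        using U * by (intro exI[of _ Z] exI[of _ \<sigma>]) auto
    qed simp
    assume "t \<in> carrier (inv_image_sheaf F U)"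
    show "restrict (s \<otimes>\<^bsub>inv_image_sheaf F U\<^esub> t) V = restrict s V \<otimes>\<^bsub>inv_image_sheaf F V\<^esub> restrict t V"
      using * by (auto simp: inv_image_sheaf_simps restrict_def fun_eq_iff)
  qed (use grp in \<open>auto simp: inv_image_sheaf_simps\<close>)
qed

text \<open>The union in \<open>inv_image_map\<close> runs over all representatives of the germ;
  naturality of \<open>\<phi>\<close> makes them all contribute the same germ.\<close>

lemma inv_image_map_germ:
  fixes F :: "'a::topological_space set \<Rightarrow> ('a \<Rightarrow> 'v, 'm) monoid_scheme"
  assumes hom: "presheaf_hom euclidean F G \<phi>" and "open U" "p \<in> U" "\<sigma> \<in> carrier (F U)" "p \<in> V"
    "s p = germ euclidean (\<lambda>U. carrier (F U)) p U \<sigma>"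
  shows "inv_image_map G \<phi> V s p = germ euclidean (\<lambda>U. carrier (G U)) p U (\<phi> U \<sigma>)"
proof -
  interpret presheaf_hom euclidean F G \<phi> by (rule hom)
  have "G.gm p U' (\<phi> U' \<sigma>') = G.gm p U (\<phi> U \<sigma>)" if "(U', \<sigma>') \<in> F.gm p U \<sigma>" for U' \<sigma>'
  proof -
    obtain W where W: "openin euclidean U'" "p \<in> U'" "\<sigma>' \<in> carrier (F U')" "openin euclidean W" "p \<in> W" "W \<subseteq> U \<inter> U'"
      "restrict \<sigma> W = restrict \<sigma>' W" using germ_memE[OF \<open>(U', \<sigma>') \<in> F.gm p U \<sigma>\<close>] by (metis order_refl)
    then have "restrict (\<phi> U' \<sigma>') W = restrict (\<phi> U \<sigma>) W"
      using natural[of U' W \<sigma>'] natural[of U W \<sigma>] assms by auto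
    then show ?thesis
      by (intro germ_eqI[of _ W]) (use W in \<open>auto dest: fun_cong simp: restrict_def fun_eq_iff split: if_splits\<close>)
  qed
  moreover have "(U, \<sigma>) \<in> F.gm p U \<sigma>" using assms by (intro germ_mem) auto
  ultimately have "(\<Union>(U', \<sigma>')\<in>F.gm p U \<sigma>. G.gm p U' (\<phi> U' \<sigma>')) = G.gm p U (\<phi> U \<sigma>)" by fast
  then show ?thesis using assms by (simp add: inv_image_map_def)
qed

lemma presheaf_hom_inv_image:
  fixes F :: "'a::topological_space set \<Rightarrow> ('a \<Rightarrow> 'v, 'm) monoid_scheme"
  assumes "presheaf_hom euclidean F G \<phi>"
  shows "presheaf_hom (top_of_set Y) (inv_image_sheaf F) (inv_image_sheaf G) (inv_image_map G \<phi>)"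
proof -
  interpret presheaf_hom euclidean F G \<phi> by fact
  interpret IF: group_presheaf "top_of_set Y" "inv_image_sheaf F" by (rule group_presheaf_inv_image) unfold_locales
  interpret IG: group_presheaf "top_of_set Y" "inv_image_sheaf G" by (rule group_presheaf_inv_image) unfold_locales
  have ex: "\<exists>U \<sigma>. open U \<and> p \<in> U \<and> \<sigma> \<in> carrier (F U) \<and> s p = F.gm p U \<sigma>"
    if "s \<in> carrier (inv_image_sheaf F V)" "p \<in> V" for s p V
    using that unfolding inv_image_sheaf_simps by blast
  show ?thesis
  proof
    fix U s t assume s: "s \<in> carrier (inv_image_sheaf F U)"
    show "inv_image_map G \<phi> U s \<in> carrier (inv_image_sheaf G U)"
      unfolding inv_image_sheaf_simps
    proof (intro conjI ballI)
      fix p assume p: "p \<in> U"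
      then obtain Z \<sigma> where Z: "open Z" "p \<in> Z" "\<sigma> \<in> carrier (F Z)" "\<And>q. q\<in>Z \<inter> U \<Longrightarrow> s q = F.gm q Z \<sigma>"
        using s unfolding inv_image_sheaf_simps by (meson subsetD)
      show "\<exists>V \<sigma>. open V \<and> p \<in> V \<and> \<sigma> \<in> carrier (G V) \<and> (\<forall>q\<in>V \<inter> U. inv_image_map G \<phi> U s q = G.gm q V \<sigma>)"
        using Z closed[of Z \<sigma>] inv_image_map_germ[OF assms, of Z _ \<sigma>]
        by (intro exI[of _ Z] exI[of _ "\<phi> Z \<sigma>"]) auto
    qed (simp add: inv_image_map_def)
    assume t: "t \<in> carrier (inv_image_sheaf F U)"
    have "inv_image_map G \<phi> U (s \<otimes>\<^bsub>inv_image_sheaf F U\<^esub> t) p =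
        (inv_image_map G \<phi> U s \<otimes>\<^bsub>inv_image_sheaf G U\<^esub> inv_image_map G \<phi> U t) p" if p: "p \<in> U" for p
    proof -
      have "s p \<in> carrier (stalk euclidean F p)" "t p \<in> carrier (stalk euclidean F p)"
        using ex[OF s p] ex[OF t p] F.stalk_carrierI by (auto simp flip: open_openin)
      then obtain V \<sigma> \<theta> where V: "openin euclidean V" "p \<in> V" "\<sigma> \<in> carrier (F V)" "\<theta> \<in> carrier (F V)"
         "s p = F.gm p V \<sigma>" "t p = F.gm p V \<theta>" by (rule F.stalk_common2)
      interpret V: group "F V" using F.group V by auto
      have "inv_image_map G \<phi> U s p = G.gm p V (\<phi> V \<sigma>)" "inv_image_map G \<phi> U t p = G.gm p V (\<phi> V \<theta>)"
        using V p inv_image_map_germ[OF assms] by auto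
      moreover have "inv_image_map G \<phi> U (s \<otimes>\<^bsub>inv_image_sheaf F U\<^esub> t) p = G.gm p V (\<phi> V (\<sigma> \<otimes>\<^bsub>F V\<^esub> \<theta>))"
        using V p by (intro inv_image_map_germ[OF assms]) (auto simp: inv_image_sheaf_simps F.stalk_mult)
      ultimately show ?thesis using V p mult[of V] closed[of V]
        by (simp add: inv_image_sheaf_simps G.stalk_mult)
    qed
    then show "inv_image_map G \<phi> U (s \<otimes>\<^bsub>inv_image_sheaf F U\<^esub> t) =
        inv_image_map G \<phi> U s \<otimes>\<^bsub>inv_image_sheaf G U\<^esub> inv_image_map G \<phi> U t"
      by (auto simp: inv_image_map_def inv_image_sheaf_simps(2) restrict_def fun_eq_iff)
  qed (auto simp: inv_image_map_def restrict_def fun_eq_iff)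
qed

lemma presheaf_hom_adjunction_unit:
  fixes F :: "'a::topological_space set \<Rightarrow> ('a \<Rightarrow> 'v, 'm) monoid_scheme"
  assumes "group_presheaf euclidean F"
  shows "presheaf_hom euclidean F (direct_image_sheaf Y (inv_image_sheaf F)) (adjunction_unit Y F)"
proof -
  interpret F: group_presheaf euclidean F by fact
  interpret D: group_presheaf euclidean "direct_image_sheaf Y (inv_image_sheaf F)"
    by (intro group_presheaf_direct_image group_presheaf_inv_image assms)
  show ?thesis
  proof
    fix U s t assume *: "openin euclidean U" "s \<in> carrier (F U)"
    then show "adjunction_unit Y F U s \<in> carrier (direct_image_sheaf Y (inv_image_sheaf F) U)"
      by (auto simp: adjunction_unit_def direct_image_sheaf_def inv_image_sheaf_simps)
    assume "t \<in> carrier (F U)"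
    then show "adjunction_unit Y F U (s \<otimes>\<^bsub>F U\<^esub> t) =
        adjunction_unit Y F U s \<otimes>\<^bsub>direct_image_sheaf Y (inv_image_sheaf F) U\<^esub> adjunction_unit Y F U t"
      using * by (auto simp: adjunction_unit_def direct_image_sheaf_def inv_image_sheaf_simps F.stalk_mult
         restrict_def fun_eq_iff)
  next
    fix U V s assume *: "openin euclidean U" "openin euclidean V" "V \<subseteq> U" "s \<in> carrier (F U)"
    then show "restrict (adjunction_unit Y F U s) V = adjunction_unit Y F V (restrict s V)"
      using germ_restrict[of euclidean V _ U "\<lambda>U. carrier (F U)" s] by (auto simp: adjunction_unit_def restrict_def fun_eq_iff)
  qed
qed


section \<open>Holomorphic functions of several variables\<close>

lemma bounded_linear_axis: "bounded_linear (axis i :: 'a::euclidean_space \<Rightarrow> 'a ^ 'n::finite)"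
  by (auto intro!: linearI simp: linear_conv_bounded_linear[symmetric] axis_def vec_eq_iff)

lemma has_derivative_vecI:
  fixes f :: "'v::real_normed_vector \<Rightarrow> 'a::euclidean_space ^ 'n::finite"
  assumes "\<And>i. ((\<lambda>x. f x $ i) has_derivative (\<lambda>v. f' v $ i)) F"
  shows "(f has_derivative f') F"
proof -
  have *: "(\<Sum>i\<in>UNIV. axis i (x $ i)) = x" for x :: "'a ^ 'n"
    by (simp add: vec_eq_iff axis_def if_distrib[of "\<lambda>a. a $ _"] sum.delta)
  have "((\<lambda>x. \<Sum>i\<in>UNIV. axis i (f x $ i)) has_derivative (\<lambda>v. \<Sum>i\<in>UNIV. axis i (f' v $ i))) F"
    by (intro has_derivative_sum bounded_linear.has_derivative[OF bounded_linear_axis] assms)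
  then show ?thesis by (simp add: *)
qed

lemma norm_axis: "norm (axis i c :: complex ^ 'n::finite) = norm c"
proof -
  have "(\<Sum>j\<in>UNIV. (norm ((axis i c :: complex ^ 'n) $ j))\<^sup>2) = (\<Sum>j\<in>UNIV. if j = i then (norm c)\<^sup>2 else 0)"
    by (intro sum.cong) (auto simp: axis_def)
  then show ?thesis by (simp add: norm_vec_def L2_set_def)
qed

lemma scaled_axis: "c *s axis i 1 = (axis i c :: complex ^ 'n::finite)"
  by (auto simp: axis_def vec_eq_iff)

lemma axis_expansion: "(\<Sum>i\<in>UNIV. axis i (x $ i)) = (x :: complex ^ 'n::finite)"
  using basis_expansion[of x] by (simp add: scaled_axis)

text \<open>Most Wirtinger derivatives below are found by exhibiting the real derivative as a
  combination of \<open>v $ j\<close> and \<open>cnj (v $ j)\<close> and reading off the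
  coefficients.\<close>

lemma wirtinger_unique:
  assumes "(f has_derivative (\<lambda>v. \<Sum>j\<in>UNIV. a j * v $ j + b j * cnj (v $ j))) (at z)"
  shows "d_dz i f z = a i" "d_dzbar i f z = b i"
proof -
  have "frechet_derivative f (at z) = (\<lambda>v. \<Sum>j\<in>UNIV. a j * v $ j + b j * cnj (v $ j))"
    using frechet_derivative_at[OF assms] by simp
  then have "frechet_derivative f (at z) (axis i c) = a i * c + b i * cnj c" for c
    by (simp add: axis_def if_distrib[of "\<lambda>c. _ * c"] if_distrib[of cnj] sum.distrib sum.delta cong: if_cong)
  then show "d_dz i f z = a i" "d_dzbar i f z = b i"
    by (simp_all add: d_dz_def d_dzbar_def algebra_simps)
qed

text \<open>A real-linear map on the j-th complex axis is determined by its values at 1 and \<i>,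
  which are what the two operators combine.\<close>

lemma has_derivative_wirtinger:
  assumes "f differentiable (at z)"
  shows "(f has_derivative (\<lambda>v. \<Sum>j\<in>UNIV. d_dz j f z * v $ j + d_dzbar j f z * cnj (v $ j))) (at z)"
proof -
  let ?D = "frechet_derivative f (at z)"
  have D: "(f has_derivative ?D) (at z)" using assms by (simp add: frechet_derivative_works)
  interpret D: bounded_linear ?D using D by (rule has_derivative_bounded_linear)
  have "?D (axis j c) = d_dz j f z * c + d_dzbar j f z * cnj c" for j c
  proof -
    have "axis j c = Re c *\<^sub>R axis j 1 + Im c *\<^sub>R axis j \<i>"
      by (auto simp: axis_def vec_eq_iff complex_eq_iff)
    then have "?D (axis j c) = Re c *\<^sub>R ?D (axis j 1) + Im c *\<^sub>R ?D (axis j \<i>)"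
      by (simp add: D.add D.scaleR)
    then show ?thesis unfolding d_dz_def d_dzbar_def
      by (simp add: complex_eq_iff field_simps)
  qed
  then have "?D v = (\<Sum>j\<in>UNIV. d_dz j f z * v $ j + d_dzbar j f z * cnj (v $ j))" for v
    using D.sum[of "\<lambda>j. axis j (v $ j)" UNIV] by (simp add: axis_expansion)
  then have "?D = (\<lambda>v. \<Sum>j\<in>UNIV. d_dz j f z * v $ j + d_dzbar j f z * cnj (v $ j))" by auto
  then show ?thesis using D by metis
qed

lemma holomorphic_at_vecI:
  assumes "(f has_derivative (\<lambda>v. \<Sum>j\<in>UNIV. a j * v $ j)) (at z)"
  shows "holomorphic_at_vec f z" "d_dz i f z = a i"
proof -
  have "(\<Sum>j\<in>UNIV. a j * (c *s v) $ j) = c * (\<Sum>j\<in>UNIV. a j * v $ j)" for c and v :: "complex ^ 'a"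
    by (simp add: sum_distrib_left algebra_simps)
  then show "holomorphic_at_vec f z" using assms unfolding holomorphic_at_vec_def by blast
  show "d_dz i f z = a i" using assms wirtinger_unique(1)[of f a "\<lambda>_. 0" z] by simp
qed

text \<open>Complex linearity removes the conjugate part of the derivative.\<close>

lemma holomorphic_at_vecD:
  assumes "holomorphic_at_vec f z"
  shows "(f has_derivative (\<lambda>v. \<Sum>j\<in>UNIV. d_dz j f z * v $ j)) (at z)"
proof -
  obtain D where D: "(f has_derivative D) (at z)" "\<And>c v. D (c *s v) = c * D v"
    using assms unfolding holomorphic_at_vec_def by blast
  interpret D: bounded_linear D using D(1) by (rule has_derivative_bounded_linear)
  define a where "a j = D (axis j 1)" for j
  have ax: "D (axis j c) = a j * c" for j c
    unfolding a_def using D(2)[of c "axis j 1"] by (simp add: scaled_axis)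
  have "D = (\<lambda>v. \<Sum>j\<in>UNIV. a j * v $ j)"
    using D.sum[of "\<lambda>j. axis j (_ $ j)" UNIV] by (auto simp: axis_expansion ax)
  then have "(f has_derivative (\<lambda>v. \<Sum>j\<in>UNIV. a j * v $ j)) (at z)" using D(1) by metis
  from holomorphic_at_vecI(2)[OF this] this show ?thesis by simp
qed

lemma holomorphic_at_vec_differentiable: "holomorphic_at_vec f z \<Longrightarrow> f differentiable (at z)"
  using holomorphic_at_vecD differentiableI by blast

lemma holomorphic_at_vec_cong:
  assumes "open S" "z \<in> S" "\<And>w. w \<in> S \<Longrightarrow> f w = g w" "holomorphic_at_vec f z"
  shows "holomorphic_at_vec g z"
  using has_derivative_transform_within_open[OF _ assms(1,2), of f _ UNIV g] assms(3,4)
  unfolding holomorphic_at_vec_def by blast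

lemma wirtinger_cong:
  assumes "open S" "z \<in> S" "\<And>w. w \<in> S \<Longrightarrow> f w = g w"
  shows "d_dz i f z = d_dz i g z" "d_dzbar i f z = d_dzbar i g z"
proof -
  have "(f has_derivative D) (at z) = (g has_derivative D) (at z)" for D
    using has_derivative_transform_within_open[OF _ assms(1,2)] assms(3) by metis
  then have "frechet_derivative f (at z) = frechet_derivative g (at z)"
    unfolding frechet_derivative_def by simp
  then show "d_dz i f z = d_dz i g z" "d_dzbar i f z = d_dzbar i g z"
    by (simp_all add: d_dz_def d_dzbar_def)
qed

lemma has_derivative_holomorphic_map:
  fixes g :: "complex ^ 'n::finite \<Rightarrow> complex ^ 'm::finite"
  assumes "\<And>k. holomorphic_at_vec (\<lambda>w. g w $ k) z"
  shows "(g has_derivative (\<lambda>v. \<chi> k. \<Sum>j\<in>UNIV. d_dz j (\<lambda>w. g w $ k) z * v $ j)) (at z)"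
  by (rule has_derivative_vecI) (simp add: holomorphic_at_vecD[OF assms])

text \<open>\<open>f\<close> is only real differentiable, since it will be the logarithm of a
  weight. Holomorphy of \<open>g\<close> keeps the conjugate part of the derivative of
  \<open>f\<close> out of the (1,0) part of the composite.\<close>

lemma d_dz_compose:
  fixes g :: "complex ^ 'n::finite \<Rightarrow> complex ^ 'm::finite"
  assumes f: "f differentiable (at (g z))" and g: "\<And>k. holomorphic_at_vec (\<lambda>w. g w $ k) z"
  shows "d_dz i (\<lambda>w. f (g w)) z = (\<Sum>k\<in>UNIV. d_dz k f (g z) * d_dz i (\<lambda>w. g w $ k) z)"
proof -
  let ?G = "\<lambda>k j. d_dz j (\<lambda>w. g w $ k) z"
  have "((\<lambda>w. f (g w)) has_derivative (\<lambda>v. \<Sum>k\<in>UNIV. d_dz k f (g z) * (\<Sum>j\<in>UNIV. ?G k j * v $ j)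
      + d_dzbar k f (g z) * cnj (\<Sum>j\<in>UNIV. ?G k j * v $ j))) (at z)"
    using has_derivative_compose[OF has_derivative_holomorphic_map[OF g] has_derivative_wirtinger[OF f]]
    by simp
  moreover have "(\<Sum>k\<in>UNIV. d_dz k f (g z) * (\<Sum>j\<in>UNIV. ?G k j * v $ j)
      + d_dzbar k f (g z) * cnj (\<Sum>j\<in>UNIV. ?G k j * v $ j)) =
     (\<Sum>j\<in>UNIV. (\<Sum>k\<in>UNIV. d_dz k f (g z) * ?G k j) * v $ j
        + (\<Sum>k\<in>UNIV. d_dzbar k f (g z) * cnj (?G k j)) * cnj (v $ j))" for v
    unfolding sum.distrib sum_distrib_left sum_distrib_right cnj_sum complex_cnj_mult mult.assoc
    by (intro arg_cong2[of _ _ _ _ "(+)"] sum.swap)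
  ultimately show ?thesis
    using wirtinger_unique(1)[of "\<lambda>w. f (g w)" "\<lambda>j. \<Sum>k\<in>UNIV. d_dz k f (g z) * ?G k j"
        "\<lambda>j. \<Sum>k\<in>UNIV. d_dzbar k f (g z) * cnj (?G k j)" z] by simp
qed

lemma holomorphic_at_vec_compose:
  fixes g :: "complex ^ 'n::finite \<Rightarrow> complex ^ 'm::finite"
  assumes f: "holomorphic_at_vec f (g z)" and g: "\<And>k. holomorphic_at_vec (\<lambda>w. g w $ k) z"
  shows "holomorphic_at_vec (\<lambda>w. f (g w)) z"
proof -
  let ?G = "\<lambda>k j. d_dz j (\<lambda>w. g w $ k) z"
  have "((\<lambda>w. f (g w)) has_derivative (\<lambda>v. \<Sum>k\<in>UNIV. d_dz k f (g z) * (\<Sum>j\<in>UNIV. ?G k j * v $ j))) (at z)"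
    using has_derivative_compose[OF has_derivative_holomorphic_map[OF g] holomorphic_at_vecD[OF f]]
    by simp
  moreover have "(\<Sum>k\<in>UNIV. d_dz k f (g z) * (\<Sum>j\<in>UNIV. ?G k j * v $ j)) =
     (\<Sum>j\<in>UNIV. (\<Sum>k\<in>UNIV. d_dz k f (g z) * ?G k j) * v $ j)" for v
    unfolding sum_distrib_left sum_distrib_right mult.assoc by (rule sum.swap)
  ultimately show ?thesis
    using holomorphic_at_vecI(1)[of "\<lambda>w. f (g w)" "\<lambda>j. \<Sum>k\<in>UNIV. d_dz k f (g z) * ?G k j"] by simp
qed

lemma holomorphic_at_vec_field_compose:
  assumes f: "holomorphic_at_vec f z" and g: "(g has_field_derivative g') (at (f z))"
  shows "holomorphic_at_vec (\<lambda>w. g (f w)) z" "d_dz i (\<lambda>w. g (f w)) z = g' * d_dz i f z"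
proof -
  have "((\<lambda>w. g (f w)) has_derivative (\<lambda>v. g' * (\<Sum>j\<in>UNIV. d_dz j f z * v $ j))) (at z)"
    using has_derivative_compose[OF holomorphic_at_vecD[OF f] g[unfolded has_field_derivative_def]] by simp
  then have *: "((\<lambda>w. g (f w)) has_derivative (\<lambda>v. (\<Sum>j\<in>UNIV. (g' * d_dz j f z) * v $ j))) (at z)"
    by (simp add: sum_distrib_left mult.assoc)
  show "holomorphic_at_vec (\<lambda>w. g (f w)) z" "d_dz i (\<lambda>w. g (f w)) z = g' * d_dz i f z"
    using holomorphic_at_vecI[OF *] by auto
qed

lemma holomorphic_at_vec_const: "holomorphic_at_vec (\<lambda>_. c) z" "d_dz i (\<lambda>_. c) z = 0"
  using holomorphic_at_vecI[of "\<lambda>_. c" "\<lambda>_. 0" z] by simp_all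

lemma holomorphic_at_vec_nth:
  "holomorphic_at_vec (\<lambda>w. w $ k) z" "d_dz i (\<lambda>w. w $ k) z = (if i = k then 1 else 0)"
proof -
  have "((\<lambda>w. w $ k) has_derivative (\<lambda>v. \<Sum>j\<in>UNIV. (if j = k then 1 else 0) * v $ j)) (at z)" for z :: "complex ^ 'a"
    using bounded_linear.has_derivative[OF bounded_linear_vec_nth has_derivative_ident]
    by (simp add: if_distrib[of "\<lambda>c. c * _"] sum.delta cong: if_cong)
  from holomorphic_at_vecI[OF this]
  show "holomorphic_at_vec (\<lambda>w. w $ k) z" "d_dz i (\<lambda>w. w $ k) z = (if i = k then 1 else 0)" by auto
qed

lemma holomorphic_at_vec_add:
  assumes "holomorphic_at_vec f z" "holomorphic_at_vec g z"
  shows "holomorphic_at_vec (\<lambda>w. f w + g w) z" "d_dz i (\<lambda>w. f w + g w) z = d_dz i f z + d_dz i g z"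
proof -
  have "((\<lambda>w. f w + g w) has_derivative (\<lambda>v. \<Sum>j\<in>UNIV. (d_dz j f z + d_dz j g z) * v $ j)) (at z)"
    using has_derivative_add[OF assms[THEN holomorphic_at_vecD]] by (simp add: ring_distribs sum.distrib)
  from holomorphic_at_vecI[OF this]
  show "holomorphic_at_vec (\<lambda>w. f w + g w) z" "d_dz i (\<lambda>w. f w + g w) z = d_dz i f z + d_dz i g z" by auto
qed

lemma holomorphic_at_vec_mult:
  assumes "holomorphic_at_vec f z" "holomorphic_at_vec g z"
  shows "holomorphic_at_vec (\<lambda>w. f w * g w) z" "d_dz i (\<lambda>w. f w * g w) z = d_dz i f z * g z + f z * d_dz i g z"
proof -
  have "((\<lambda>w. f w * g w) has_derivative (\<lambda>v. \<Sum>j\<in>UNIV. (d_dz j f z * g z + f z * d_dz j g z) * v $ j)) (at z)"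
    using has_derivative_mult[OF assms[THEN holomorphic_at_vecD]]
    by (simp add: ring_distribs sum.distrib sum_distrib_left sum_distrib_right algebra_simps)
  from holomorphic_at_vecI[OF this]
  show "holomorphic_at_vec (\<lambda>w. f w * g w) z" "d_dz i (\<lambda>w. f w * g w) z = d_dz i f z * g z + f z * d_dz i g z" by auto
qed

lemma holomorphic_at_vec_uminus:
  assumes "holomorphic_at_vec f z" shows "holomorphic_at_vec (\<lambda>w. - f w) z" "d_dz i (\<lambda>w. - f w) z = - d_dz i f z"
proof -
  have "((\<lambda>x. - x) has_field_derivative -1) (at (f z))" by (auto intro!: derivative_eq_intros)
  from holomorphic_at_vec_field_compose[OF assms this]
  show "holomorphic_at_vec (\<lambda>w. - f w) z" "d_dz i (\<lambda>w. - f w) z = - d_dz i f z" by simp_all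
qed

lemma holomorphic_at_vec_inverse:
  assumes "holomorphic_at_vec f z" "f z \<noteq> 0" shows "holomorphic_at_vec (\<lambda>w. inverse (f w)) z"
  using holomorphic_at_vec_field_compose(1)[OF assms(1), of inverse] DERIV_inverse[OF assms(2)] by blast

lemma has_field_derivative_along_curve:
  fixes \<gamma> :: "complex \<Rightarrow> complex ^ 'n::finite"
  assumes f: "holomorphic_at_vec f (\<gamma> \<zeta>)" and g: "\<And>k. ((\<lambda>\<zeta>. \<gamma> \<zeta> $ k) has_field_derivative v $ k) (at \<zeta>)"
  shows "((\<lambda>\<zeta>. f (\<gamma> \<zeta>)) has_field_derivative (\<Sum>j\<in>UNIV. d_dz j f (\<gamma> \<zeta>) * v $ j)) (at \<zeta>)"
proof -
  have "(\<gamma> has_derivative (\<lambda>c. c *s v)) (at \<zeta>)"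
    using g by (intro has_derivative_vecI) (simp add: has_field_derivative_def mult_commute_abs)
  from has_derivative_compose[OF this holomorphic_at_vecD[OF f]] show ?thesis
    unfolding has_field_derivative_def
    by (rule has_derivative_eq_rhs) (auto simp: fun_eq_iff sum_distrib_left sum_distrib_right mult_ac)
qed

text \<open>The one-variable Cauchy formula for the derivative, on the disc in the
  \<open>i\<close>-th coordinate direction. The velocity of \<open>circlepath\<close> is 2 pi \<i>
  times its position, which cancels the prefactor and one power of the denominator. The integrand
  involves values of \<open>f\<close> only, so regularity of \<open>f\<close> passes to its partial
  derivatives.\<close>

lemma d_dz_cauchy_integral:
  assumes hol: "holomorphic_on_vec f W" and sub: "cball z r \<subseteq> W" and r: "r > 0"
  shows "d_dz i f z = integral (cbox 0 1) (\<lambda>t. f (z + axis i (circlepath 0 r t)) / circlepath 0 r t)"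
proof -
  let ?F = "\<lambda>\<zeta>. f (z + axis i \<zeta>)"
  have W: "open W" and hol: "\<And>w. w \<in> W \<Longrightarrow> holomorphic_at_vec f w"
    using hol unfolding holomorphic_on_vec_def by auto
  have inW: "z + axis i \<zeta> \<in> W" if "\<zeta> \<in> cball 0 r" for \<zeta>
    using that sub by (auto simp: dist_norm norm_axis)
  have der: "(?F has_field_derivative d_dz i f (z + axis i \<zeta>)) (at \<zeta>)" if "\<zeta> \<in> cball 0 r" for \<zeta>
  proof -
    have "((\<lambda>\<zeta>. (z + axis i \<zeta>) $ k) has_field_derivative (axis i 1 :: complex ^ 'a) $ k) (at \<zeta>)" for k
      by (cases "k = i") (auto simp: axis_def intro!: derivative_eq_intros)
    from has_field_derivative_along_curve[OF hol[OF inW[OF that]] this] show ?thesis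
      by (simp add: axis_def if_distrib[of "\<lambda>c. _ * c"] sum.delta cong: if_cong)
  qed
  have cont: "continuous_on (cball 0 r) ?F"
    using der by (meson DERIV_isCont continuous_at_imp_continuous_on)
  have holF: "?F holomorphic_on ball 0 r"
    using der by (intro holomorphic_onI) (meson ball_subset_cball field_differentiable_at_within field_differentiable_def subsetD)
  have c0: "circlepath 0 r t \<noteq> 0" for t using r by (simp add: circlepath)
  note C = Cauchy_derivative_integral_circlepath[OF cont holF, of 0]
  have "((\<lambda>u. ?F u / (u - 0)^2) has_contour_integral contour_integral (circlepath 0 r) (\<lambda>u. ?F u / (u - 0)^2)) (circlepath 0 r)"
    using C(1) r by (intro has_contour_integral_integral) auto
  then have "((\<lambda>t. 2 * of_real pi * \<i> * (?F (circlepath 0 r t) / circlepath 0 r t)) has_integral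
     contour_integral (circlepath 0 r) (\<lambda>u. ?F u / (u - 0)^2)) {0..1}"
    unfolding has_contour_integral
  proof (rule has_integral_eq_rhs[OF has_integral_eq[rotated], OF _ _ refl])
    fix t :: real
    have "vector_derivative (circlepath 0 r) (at t) = 2 * of_real pi * \<i> * circlepath 0 r t"
      unfolding vector_derivative_circlepath by (simp add: circlepath)
    then show "?F (circlepath 0 r t) / (circlepath 0 r t - 0)\<^sup>2 * vector_derivative (circlepath 0 r) (at t) =
      2 * of_real pi * \<i> * (?F (circlepath 0 r t) / circlepath 0 r t)"
      using c0[of t] by (simp add: power2_eq_square)
  qed
  from integral_unique[OF this]
  have I: "contour_integral (circlepath 0 r) (\<lambda>u. ?F u / (u - 0)^2) =
     2 * of_real pi * \<i> * integral {0..1} (\<lambda>t. ?F (circlepath 0 r t) / circlepath 0 r t)"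
    by (simp only: integral_mult_right)
  have "(?F has_field_derivative integral {0..1} (\<lambda>t. ?F (circlepath 0 r t) / circlepath 0 r t)) (at 0)"
    using C(2) r unfolding I by simp
  moreover have "(?F has_field_derivative d_dz i f z) (at 0)"
    using der[of 0] r by (simp add: axis_def flip: zero_vec_def) 
  ultimately show ?thesis using DERIV_unique by force
qed

lemma holomorphic_at_vec_isCont: "holomorphic_at_vec f z \<Longrightarrow> isCont f z"
  using holomorphic_at_vecD has_derivative_continuous by blast

text \<open>The formula above shows that \<open>f\<close> is \<open>C\<^sup>1\<close>, so that it can then be differentiated under the integral.\<close>

lemma holomorphic_d_dz:
  assumes hol: "holomorphic_on_vec f W"
  shows "holomorphic_on_vec (d_dz i f) W"
proof -
  have W: "open W" and holW: "\<And>w. w \<in> W \<Longrightarrow> holomorphic_at_vec f w"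
    using hol unfolding holomorphic_on_vec_def by auto
  have contf: "continuous_on W f"
    using holW holomorphic_at_vec_isCont continuous_at_imp_continuous_on by blast
  have cc: "continuous_on S (\<lambda>x. circlepath 0 r (g x))" if "continuous_on S g"
    for r and S :: "'s::topological_space set" and g
    unfolding circlepath by (intro continuous_intros that)
  have ca: "continuous_on S (\<lambda>x. axis k (g x) :: complex ^ 'a)" if "continuous_on S g"
    for k and S :: "'s::topological_space set" and g
    using bounded_linear.continuous_on[OF bounded_linear_axis that] .
  \<comment> \<open>The factor 2 leaves room for circles of radius \<open>r\<close> around every
    base point in \<open>ball z r\<close>.\<close>
  have loc: "\<exists>r>0. cball z (2 * r) \<subseteq> W" if "z \<in> W" for z
  proof -
    obtain e where "e > 0" "cball z e \<subseteq> W" using open_contains_cball[of W] W \<open>z \<in> W\<close> by blast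
    then show ?thesis by (intro exI[of _ "e / 2"]) auto
  qed
  have in1: "w + axis k (circlepath 0 r t) \<in> W" if "cball z (2 * r) \<subseteq> W" "w \<in> ball z r" "r > 0" for w k t z r
  proof -
    have "dist z (w + axis k (circlepath 0 r t)) \<le> dist z w + dist w (w + axis k (circlepath 0 r t))"
      by (rule dist_triangle)
    also have "\<dots> \<le> r + r" using that
      by (intro add_mono) (auto simp: dist_norm norm_axis circlepath norm_mult)
    finally show ?thesis using that(1) by auto
  qed
  have cb: "cball w r \<subseteq> W" if "cball z (2 * r) \<subseteq> W" "w \<in> ball z r" for w z r
  proof -
    have "cball w r \<subseteq> cball z (2 * r)" using that(2) by (simp add: cball_subset_cball_iff dist_commute)
    then show ?thesis using that by auto
  qed
  have sub: "continuous_on (ball z r \<times> S) (\<lambda>(w, t). g (w + axis k (circlepath 0 r t)))"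
    if "cball z (2 * r) \<subseteq> W" "r > 0" "continuous_on W g" for z r k S and g :: "complex ^ 'a \<Rightarrow> complex"
    unfolding split_beta
    by (rule continuous_on_compose2[OF that(3)])
       (auto intro!: continuous_on_add ca cc continuous_on_fst continuous_on_snd continuous_on_id in1[OF that(1) _ that(2)])
  have c0: "circlepath 0 r t \<noteq> 0" if "r > 0" for r t using that by (simp add: circlepath)
  have contd: "continuous_on W (d_dz k f)" for k
    unfolding continuous_on_eq_continuous_at[OF W]
  proof
    fix z assume "z \<in> W"
    then obtain r where r: "r > 0" "cball z (2 * r) \<subseteq> W" using loc by blast
    have "continuous_on (ball z r) (\<lambda>w. integral (cbox 0 1) (\<lambda>t. f (w + axis k (circlepath 0 r t)) / circlepath 0 r t))"
      using sub[OF r(2,1) contf, of "cbox 0 1" k] c0[OF r(1)]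
      by (intro integral_continuous_on_param)
        (auto simp: split_beta intro!: continuous_on_divide cc continuous_on_snd continuous_on_id)
    then have "continuous_on (ball z r) (d_dz k f)"
      using d_dz_cauchy_integral[OF hol cb[OF r(2)] r(1)] by (subst continuous_on_cong[OF refl]) auto
    then show "isCont (d_dz k f) z" using r by (simp add: continuous_on_eq_continuous_at)
  qed
  show ?thesis unfolding holomorphic_on_vec_def
  proof (intro conjI ballI W)
    fix z assume "z \<in> W"
    then obtain r where r: "r > 0" "cball z (2 * r) \<subseteq> W" using loc by blast
    let ?c = "circlepath 0 r"
    define P :: "'a \<Rightarrow> (complex ^ 'a) \<Rightarrow>\<^sub>L complex" where "P j = Blinfun (\<lambda>v. v $ j)" for j
    have P: "blinfun_apply (P j) v = v $ j" for j v
      by (simp add: P_def bounded_linear_Blinfun_apply bounded_linear_vec_nth)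
    \<comment> \<open>The derivative of the integrand in \<open>w\<close>, as a bounded linear map.
      \<open>leibniz_rule\<close> asks for its joint continuity, which follows from the continuity
      of the partial derivatives shown above.\<close>
    define D where "D w t = (\<Sum>j\<in>UNIV. blinfun_mult_right (d_dz j f (w + axis i (?c t)) / ?c t) o\<^sub>L P j)" for w t
    have D: "blinfun_apply (D w t) v = (\<Sum>j\<in>UNIV. d_dz j f (w + axis i (?c t)) / ?c t * v $ j)" for w t v
      by (simp add: D_def P blinfun.sum_left)
    have cD: "continuous_on (ball z r \<times> cbox 0 1) (\<lambda>(w, t). D w t)"
      unfolding D_def split_beta
    proof (rule continuous_on_sum)
      fix j
      have "continuous_on (ball z r \<times> cbox 0 1) (\<lambda>p. d_dz j f (fst p + axis i (?c (snd p))) / ?c (snd p))"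
        using sub[OF r(2,1) contd[of j], of "cbox 0 1" i] c0[OF r(1)] unfolding split_beta
        by (intro continuous_on_divide cc continuous_on_snd continuous_on_id) auto
      then show "continuous_on (ball z r \<times> cbox 0 1)
          (\<lambda>p. blinfun_mult_right (d_dz j f (fst p + axis i (?c (snd p))) / ?c (snd p)) o\<^sub>L P j)"
        by (intro bounded_bilinear.continuous_on[OF bounded_bilinear_blinfun_compose _ continuous_on_const]
          bounded_linear.continuous_on[OF bounded_linear_blinfun_mult_right])
    qed
    have "((\<lambda>w. integral (cbox 0 1) (\<lambda>t. f (w + axis i (?c t)) / ?c t)) has_derivative integral (cbox 0 1) (D z)) (at z within ball z r)"
    proof (rule leibniz_rule[OF _ _ cD])
      fix w and t :: real assume w: "w \<in> ball z r"
      have "((\<lambda>w. f (w + axis i (?c t))) has_derivative (\<lambda>v. \<Sum>j\<in>UNIV. d_dz j f (w + axis i (?c t)) * v $ j)) (at w)"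
      proof (rule has_derivative_compose[of "\<lambda>w. w + axis i (?c t)" "\<lambda>v. v" w UNIV f])
        show "((\<lambda>w. w + axis i (?c t)) has_derivative (\<lambda>v. v)) (at w)"
          by (rule has_derivative_eq_rhs[OF has_derivative_add[OF has_derivative_ident has_derivative_const]]) simp
        show "(f has_derivative (\<lambda>v. \<Sum>j\<in>UNIV. d_dz j f (w + axis i (?c t)) * v $ j)) (at (w + axis i (?c t)))"
          by (rule holomorphic_at_vecD[OF holW[OF in1[OF r(2) w r(1)]]])
      qed
      then have "((\<lambda>w. f (w + axis i (?c t)) / ?c t) has_derivative (\<lambda>v. (\<Sum>j\<in>UNIV. d_dz j f (w + axis i (?c t)) * v $ j) / ?c t)) (at w)"
        by (rule bounded_linear.has_derivative[OF bounded_linear_divide])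
      moreover have "(\<lambda>v. (\<Sum>j\<in>UNIV. d_dz j f (w + axis i (?c t)) * v $ j) / ?c t) = blinfun_apply (D w t)"
        by (simp add: fun_eq_iff D sum_divide_distrib)
      ultimately show "((\<lambda>w. f (w + axis i (?c t)) / ?c t) has_derivative blinfun_apply (D w t)) (at w within ball z r)"
        by (simp add: has_derivative_at_withinI)
    next
      fix w assume w: "w \<in> ball z r"
      have "continuous_on (cbox 0 1) (\<lambda>t. f (w + axis i (?c t)) / ?c t)"
        using c0[OF r(1)] in1[OF r(2) w r(1)]
        by (auto intro!: continuous_on_divide continuous_on_compose2[OF contf] continuous_on_add
            continuous_on_const continuous_on_id ca cc)
      then show "(\<lambda>t. f (w + axis i (?c t)) / ?c t) integrable_on cbox 0 1"
        by (rule integrable_continuous)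
    qed (use r in auto)
    then have 1: "((\<lambda>w. integral (cbox 0 1) (\<lambda>t. f (w + axis i (?c t)) / ?c t)) has_derivative integral (cbox 0 1) (D z)) (at z)"
      using r by (simp add: at_within_open[of z "ball z r"])
    have "(d_dz i f has_derivative blinfun_apply (integral (cbox 0 1) (D z))) (at z)"
      by (rule has_derivative_transform_within_open[OF 1, of "ball z r"])
         (use r d_dz_cauchy_integral[OF hol cb[OF r(2)] r(1)] in auto)
    \<comment> \<open>Evaluation at a vector commutes with the integral, so the complex linearity of
      each \<open>D z t\<close> passes to the derivative.\<close>
    moreover have "blinfun_apply (integral (cbox 0 1) (D z)) (c *s v) = c * blinfun_apply (integral (cbox 0 1) (D z)) v" for c v
    proof -
      have int: "D z integrable_on cbox 0 1"
      proof (rule integrable_continuous)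
        have "continuous_on (cbox 0 1) (\<lambda>t::real. (z, t))" by (intro continuous_intros)
        moreover have "(\<lambda>t. (z, t)) ` cbox 0 1 \<subseteq> ball z r \<times> cbox 0 (1::real)" using r by auto
        ultimately show "continuous_on (cbox 0 1) (D z)" using continuous_on_compose2[OF cD] by fastforce
      qed
      have ap: "blinfun_apply (integral (cbox 0 1) (D z)) u = integral (cbox 0 1) (\<lambda>t. blinfun_apply (D z t) u)" for u
        using integral_linear[OF int blinfun.bounded_linear_left[of u]] unfolding o_def by (rule sym)
      have "blinfun_apply (D z t) (c *s v) = c * blinfun_apply (D z t) v" for t
        unfolding D by (simp add: sum_distrib_left algebra_simps)
      then show ?thesis unfolding ap by simp
    qed
    ultimately show "holomorphic_at_vec (d_dz i f) z" unfolding holomorphic_at_vec_def by blast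
  qed
qed


section \<open>Subharmonic functions\<close>

text \<open>The sum of the second derivatives along the horizontal and the vertical line through
  \<open>z\<close>. Only the restrictions of \<open>u\<close> to these two lines enter: this
  suffices for the test at a maximum, and it is what composition with a curve provides.\<close>

definition has_laplacian :: "(complex \<Rightarrow> real) \<Rightarrow> real \<Rightarrow> complex \<Rightarrow> bool" where
  "has_laplacian u l z \<longleftrightarrow> (\<exists>p q P Q.
     (\<forall>\<^sub>F t in nhds (0::real). ((\<lambda>t. u (z + of_real t)) has_real_derivative p t) (at t)) \<and>
     (p has_real_derivative P) (at 0) \<and>
     (\<forall>\<^sub>F t in nhds (0::real). ((\<lambda>t. u (z + \<i> * of_real t)) has_real_derivative q t) (at t)) \<and>
     (q has_real_derivative Q) (at 0) \<and> l = P + Q)"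

lemma has_laplacian_add:
  assumes "has_laplacian u k z" "has_laplacian v l z"
  shows "has_laplacian (\<lambda>w. u w + v w) (k + l) z"
proof -
  obtain p q P Q where u: "\<forall>\<^sub>F t in nhds (0::real). ((\<lambda>t. u (z + of_real t)) has_real_derivative p t) (at t)"
     "(p has_real_derivative P) (at 0)"
     "\<forall>\<^sub>F t in nhds (0::real). ((\<lambda>t. u (z + \<i> * of_real t)) has_real_derivative q t) (at t)"
     "(q has_real_derivative Q) (at 0)" "k = P + Q"
    using assms(1) unfolding has_laplacian_def by blast
  obtain p' q' P' Q' where v: "\<forall>\<^sub>F t in nhds (0::real). ((\<lambda>t. v (z + of_real t)) has_real_derivative p' t) (at t)"
     "(p' has_real_derivative P') (at 0)"
     "\<forall>\<^sub>F t in nhds (0::real). ((\<lambda>t. v (z + \<i> * of_real t)) has_real_derivative q' t) (at t)"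
     "(q' has_real_derivative Q') (at 0)" "l = P' + Q'"
    using assms(2) unfolding has_laplacian_def by blast
  show ?thesis unfolding has_laplacian_def
  proof (intro exI conjI)
    show "\<forall>\<^sub>F t in nhds 0. ((\<lambda>t. u (z + of_real t) + v (z + of_real t)) has_real_derivative p t + p' t) (at t)"
      using u(1) v(1) by eventually_elim (rule DERIV_add)
    show "\<forall>\<^sub>F t in nhds 0. ((\<lambda>t. u (z + \<i> * of_real t) + v (z + \<i> * of_real t)) has_real_derivative q t + q' t) (at t)"
      using u(3) v(3) by eventually_elim (rule DERIV_add)
    show "((\<lambda>t. p t + p' t) has_real_derivative P + P') (at 0)" "((\<lambda>t. q t + q' t) has_real_derivative Q + Q') (at 0)"
      using u v by (auto intro: DERIV_add)
    show "k + l = P + P' + (Q + Q')" using u v by simp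
  qed
qed

lemma has_laplacian_cmult:
  assumes "has_laplacian u k z" shows "has_laplacian (\<lambda>w. c * u w) (c * k) z"
proof -
  obtain p q P Q where u: "\<forall>\<^sub>F t in nhds (0::real). ((\<lambda>t. u (z + of_real t)) has_real_derivative p t) (at t)"
     "(p has_real_derivative P) (at 0)"
     "\<forall>\<^sub>F t in nhds (0::real). ((\<lambda>t. u (z + \<i> * of_real t)) has_real_derivative q t) (at t)"
     "(q has_real_derivative Q) (at 0)" "k = P + Q"
    using assms(1) unfolding has_laplacian_def by blast
  show ?thesis unfolding has_laplacian_def
  proof (intro exI conjI)
    show "\<forall>\<^sub>F t in nhds 0. ((\<lambda>t. c * u (z + of_real t)) has_real_derivative c * p t) (at t)"
      using u(1) by eventually_elim (rule DERIV_cmult)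
    show "\<forall>\<^sub>F t in nhds 0. ((\<lambda>t. c * u (z + \<i> * of_real t)) has_real_derivative c * q t) (at t)"
      using u(3) by eventually_elim (rule DERIV_cmult)
    show "((\<lambda>t. c * p t) has_real_derivative c * P) (at 0)" "((\<lambda>t. c * q t) has_real_derivative c * Q) (at 0)"
      using u by (auto intro: DERIV_cmult)
    show "c * k = c * P + c * Q" using u by (simp add: ring_distribs)
  qed
qed

lemma has_laplacian_const: "has_laplacian (\<lambda>_. c) 0 z"
  unfolding has_laplacian_def
  by (rule exI[of _ "\<lambda>_. 0"], rule exI[of _ "\<lambda>_. 0"], rule exI[of _ 0], rule exI[of _ 0]) auto

lemma eventually_along_line:
  assumes "open S" "(z::complex) \<in> S"
  shows "\<forall>\<^sub>F t in nhds (0::real). z + d * of_real t \<in> S"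
proof -
  have "((\<lambda>t. z + d * of_real t) \<longlongrightarrow> z + d * of_real 0) (nhds 0)"
    by (intro tendsto_add tendsto_mult tendsto_const tendsto_of_real filterlim_ident)
  from topological_tendstoD[OF this assms(1)] assms(2) show ?thesis by simp
qed

lemma has_laplacian_cong:
  assumes S: "open S" "z \<in> S" "\<And>w. w \<in> S \<Longrightarrow> u w = v w" and u: "has_laplacian u l z"
  shows "has_laplacian v l z"
proof -
  have *: "\<forall>\<^sub>F t in nhds (0::real). ((\<lambda>t. v (z + d * of_real t)) has_real_derivative p t) (at t)"
    if "\<forall>\<^sub>F t in nhds (0::real). ((\<lambda>t. u (z + d * of_real t)) has_real_derivative p t) (at t)" for d p
  proof -
    \<comment> \<open>Derivatives at \<open>t\<close> call for agreement of \<open>u\<close> and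
      \<open>v\<close> near \<open>t\<close>, hence the nested neighbourhood filters.\<close>
    have "\<forall>\<^sub>F t in nhds (0::real). \<forall>\<^sub>F s in nhds t. z + d * of_real s \<in> S"
      using eventually_along_line[OF S(1,2)] by (subst eventually_eventually)
    with that show ?thesis
    proof eventually_elim
      case (elim t)
      have "\<forall>\<^sub>F s in nhds t. u (z + d * of_real s) = v (z + d * of_real s)"
        using elim(2) by eventually_elim (rule S(3))
      from DERIV_cong_ev[OF refl this refl] elim(1) show ?case by blast
    qed
  qed
  show ?thesis using u *[of 1] *[of \<i>] unfolding has_laplacian_def by simp blast
qed

text \<open>The second derivative in direction \<open>d\<close> is the real part of d^2 times the
  second complex derivative, and 1 + \<i>^2 = 0.\<close>

lemma has_laplacian_Re:
  assumes f: "f holomorphic_on S" "open S" "z \<in> S"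
  shows "has_laplacian (\<lambda>w. Re (f w)) 0 z"
proof -
  have 1: "((\<lambda>t. Re (f (z + d * of_real t))) has_real_derivative Re (d * deriv f (z + d * of_real t))) (at t)"
    if "f holomorphic_on S" "z + d * of_real t \<in> S" for d t f
  proof -
    have "(f has_field_derivative deriv f (z + d * of_real t)) (at (z + d * of_real t))"
      using that f(2) by (simp add: holomorphic_derivI)
    then have "((\<lambda>w. f (z + d * w)) has_field_derivative deriv f (z + d * of_real t) * d) (at (of_real t))"
      by (rule DERIV_chain2) (auto intro!: derivative_eq_intros)
    from has_field_derivative_Re[OF has_vector_derivative_real_field[OF this]] show ?thesis
      by (subst mult.commute)
  qed
  have 2: "((\<lambda>t. Re (d * deriv f (z + d * of_real t))) has_real_derivative Re (d * (d * deriv (deriv f) z))) (at 0)" for d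
  proof -
    have "(\<lambda>w. d * deriv f w) holomorphic_on S" using f by (intro holomorphic_intros)
    from 1[OF this, of d 0] f show ?thesis
      by (simp add: deriv_cmult holomorphic_on_imp_differentiable_at[OF holomorphic_deriv[OF f(1,2)] f(2)])
  qed
  show ?thesis unfolding has_laplacian_def
  proof (intro exI conjI)
    show "\<forall>\<^sub>F t in nhds 0. ((\<lambda>t. Re (f (z + of_real t))) has_real_derivative Re (1 * deriv f (z + 1 * of_real t))) (at t)"
      using eventually_along_line[OF f(2,3), of 1] by eventually_elim (use 1[OF f(1), of 1] in simp)
    show "\<forall>\<^sub>F t in nhds 0. ((\<lambda>t. Re (f (z + \<i> * of_real t))) has_real_derivative Re (\<i> * deriv f (z + \<i> * of_real t))) (at t)"
      using eventually_along_line[OF f(2,3), of \<i>] by eventually_elim (rule 1[OF f(1)])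
    show "0 = Re (1 * (1 * deriv (deriv f) z)) + Re (\<i> * (\<i> * deriv (deriv f) z))" by simp
  qed (rule 2)+
qed

text \<open>Near \<open>z\<close> the function is the real part of a branch of log f plus a
  constant. Dividing by \<open>f z\<close> puts the values into the right half plane, away from the
  cut of \<open>Ln\<close>.\<close>

lemma has_laplacian_ln_cmod:
  assumes f: "f holomorphic_on S" "open S" "z \<in> S" and nz: "\<And>w. w \<in> S \<Longrightarrow> f w \<noteq> 0"
  shows "has_laplacian (\<lambda>w. ln (cmod (f w))) 0 z"
proof -
  define T where "T = S \<inter> (\<lambda>w. f w / f z) -` {w. Re w > 0}"
  have cont: "continuous_on S (\<lambda>w. f w / f z)"
    using holomorphic_on_imp_continuous_on[OF f(1)] nz[OF f(3)] by (intro continuous_intros) auto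
  have "open T" unfolding T_def
    by (rule continuous_open_preimage[OF cont f(2) open_halfspace_Re_gt])
  moreover have "z \<in> T" using f nz by (simp add: T_def)
  moreover have "(\<lambda>w. Ln (f w / f z)) holomorphic_on T"
    using nz[OF f(3)] holomorphic_on_subset[OF f(1), of T]
    by (intro holomorphic_intros) (auto simp: T_def complex_nonpos_Reals_iff)
  ultimately have "has_laplacian (\<lambda>w. Re (Ln (f w / f z))) 0 z" by (intro has_laplacian_Re)
  from has_laplacian_add[OF this has_laplacian_const[of "ln (cmod (f z))"]]
  have "has_laplacian (\<lambda>w. Re (Ln (f w / f z)) + ln (cmod (f z))) 0 z" by simp
  then show ?thesis
    by (rule has_laplacian_cong[OF \<open>open T\<close> \<open>z \<in> T\<close>, rotated])
       (use nz f in \<open>auto simp: T_def norm_divide ln_div\<close>)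
qed

text \<open>The Laplacian is strictly positive, so adding a small multiple turns a weak inequality
  for a Laplacian into a strict one.\<close>

lemma has_laplacian_norm_square: "has_laplacian (\<lambda>w. (cmod (w - a))\<^sup>2) 4 z"
proof -
  have 1: "(cmod (z + of_real t - a))\<^sup>2 = (Re z + t - Re a)\<^sup>2 + (Im z - Im a)\<^sup>2" for t
    by (simp add: cmod_def)
  have 2: "(cmod (z + \<i> * of_real t - a))\<^sup>2 = (Re z - Re a)\<^sup>2 + (Im z + t - Im a)\<^sup>2" for t
    by (simp add: cmod_def)
  show ?thesis unfolding has_laplacian_def 1 2
    by (rule exI[of _ "\<lambda>t. 2 * (Re z + t - Re a)"], rule exI[of _ "\<lambda>t. 2 * (Im z + t - Im a)"],
        rule exI[of _ 2], rule exI[of _ 2]) (auto intro!: derivative_eq_intros always_eventually)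
qed

section \<open>Maximum principles\<close>

lemma second_derivative_local_max:
  fixes f :: "real \<Rightarrow> real"
  assumes p: "\<forall>\<^sub>F t in nhds 0. (f has_real_derivative p t) (at t)" and P: "(p has_real_derivative P) (at 0)"
    and max: "\<forall>\<^sub>F t in nhds 0. f t \<le> f 0"
  shows "P \<le> 0"
proof (rule ccontr)
  assume "\<not> P \<le> 0"
  then obtain d where d: "d > 0" "\<And>h. 0 < h \<Longrightarrow> h < d \<Longrightarrow> p 0 < p (0 + h)"
    using DERIV_pos_inc_right[OF P] by auto
  obtain e where e: "e > 0" "\<And>t. \<bar>t\<bar> < e \<Longrightarrow> (f has_real_derivative p t) (at t) \<and> f t \<le> f 0"
    using eventually_conj[OF p max] unfolding eventually_nhds_metric by (auto simp: dist_real_def)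
  have p0: "p 0 = 0"
    using e(2)[of 0] e by (intro DERIV_local_max[of f "p 0" 0 e]) auto
  define h where "h = min d e / 2"
  have h: "0 < h" "h < d" "h < e" using d e by (auto simp: h_def)
  obtain \<xi> where \<xi>: "0 < \<xi>" "\<xi> < h" "f h - f 0 = (h - 0) * p \<xi>"
    using MVT2[of 0 h f p] e(2) h by (auto simp: abs_if)
  \<comment> \<open>\<open>p\<close> vanishes at the maximum and has positive derivative there, so
    it is positive to the right of 0, and the mean value theorem makes \<open>f h\<close> exceed
    \<open>f 0\<close>.\<close>
  have "p \<xi> > 0" using d(2)[of \<xi>] \<xi> h p0 by simp
  then have "f h - f 0 > 0" using \<xi> h by simp
  moreover have "f h \<le> f 0" using e(2)[of h] h by simp
  ultimately show False by simp
qed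

lemma has_laplacian_local_max:
  assumes u: "has_laplacian u l z" and S: "open S" "z \<in> S" "\<And>w. w \<in> S \<Longrightarrow> u w \<le> u z"
  shows "l \<le> 0"
proof -
  obtain p q P Q where u: "\<forall>\<^sub>F t in nhds (0::real). ((\<lambda>t. u (z + of_real t)) has_real_derivative p t) (at t)"
     "(p has_real_derivative P) (at 0)"
     "\<forall>\<^sub>F t in nhds (0::real). ((\<lambda>t. u (z + \<i> * of_real t)) has_real_derivative q t) (at t)"
     "(q has_real_derivative Q) (at 0)" "l = P + Q"
    using u unfolding has_laplacian_def by blast
  have "P \<le> 0"
    using second_derivative_local_max[OF u(1,2)] eventually_mono[OF eventually_along_line[OF S(1,2), of 1]] S(3) by simp
  moreover have "Q \<le> 0"
    using second_derivative_local_max[OF u(3,4)] eventually_mono[OF eventually_along_line[OF S(1,2), of \<i>]] S(3) by simp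
  ultimately show ?thesis using u by simp
qed

text \<open>At an interior maximum the Laplacian would be at most 0, so the maximum of
  \<open>w\<close> over \<open>K\<close> is attained in \<open>K - I\<close>.\<close>

lemma weak_maximum_principle:
  assumes K: "compact K" "continuous_on K w" and I: "open I" "I \<subseteq> K"
    and lap: "\<And>z. z \<in> I \<Longrightarrow> \<exists>l>0. has_laplacian w l z"
    and bd: "\<And>z. z \<in> K - I \<Longrightarrow> w z \<le> M" and z: "z \<in> K"
  shows "w z \<le> M"
proof -
  obtain m where m: "m \<in> K" "\<And>z. z \<in> K \<Longrightarrow> w z \<le> w m"
    using continuous_attains_sup[OF K(1) _ K(2)] z by blast
  have "m \<notin> I"
  proof
    assume "m \<in> I"
    then obtain l where "l > 0" "has_laplacian w l m" using lap by blast
    with has_laplacian_local_max[OF this(2) I(1) \<open>m \<in> I\<close>] m I show False by fastforce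
  qed
  then show ?thesis using bd[of m] m z by force
qed

text \<open>Hopf's argument with the barrier \<open>ln (R / \<bar>z - y\<bar>)\<close> on an annulus whose outer circle touches the
  set where the maximum is attained.\<close>

lemma hopf_lemma:
  assumes D: "open D" "cball y R \<subseteq> D" and R: "R > 0"
    and diff: "\<And>z. z \<in> D \<Longrightarrow> u differentiable (at z)"
    and lap: "\<And>z. z \<in> D \<Longrightarrow> \<exists>l\<ge>0. has_laplacian u l z"
    and le: "\<And>z. z \<in> D \<Longrightarrow> u z \<le> M" and less: "\<And>z. z \<in> ball y R \<Longrightarrow> u z < M"
    and x0: "dist y x0 = R"
  shows "u x0 < M"
proof (rule ccontr)
  assume "\<not> u x0 < M"
  have x0D: "x0 \<in> D" using D x0 by auto
  with le \<open>\<not> u x0 < M\<close> have ux0: "u x0 = M" by fastforce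
  have contu: "continuous_on D u"
    using diff by (meson continuous_at_imp_continuous_on differentiable_imp_continuous_within)
  have "compact (sphere y (R/2))" "sphere y (R/2) \<noteq> {}" "continuous_on (sphere y (R/2)) u"
    using R D by (auto intro!: continuous_on_subset[OF contu])
  then obtain m where m: "m \<in> sphere y (R/2)" "\<And>z. z \<in> sphere y (R/2) \<Longrightarrow> u z \<le> u m"
    using continuous_attains_sup[of "sphere y (R/2)" u] by metis
  \<comment> \<open>The gap between \<open>u\<close> and \<open>M\<close> on the inner circle. The
    barrier equals ln 2 < 1 there, so \<open>\<epsilon>\<close> times the barrier fits into the
    gap.\<close>
  define \<epsilon> where "\<epsilon> = M - u m"
  have eps: "\<epsilon> > 0" using m(1) less[of m] R by (simp add: \<epsilon>_def)
  define K where "K = cball y R - ball y (R/2)"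
  define I where "I = ball y R - cball y (R/2)"
  have K: "compact K" "open I" "I \<subseteq> K" "K \<subseteq> D"
    using D R by (auto simp: K_def I_def compact_diff)
  have pos: "0 < cmod (z - y)" if "z \<in> K" for z using that R by (auto simp: K_def)
  have main: "u z + \<epsilon> * (ln R - ln (cmod (z - y))) \<le> M" if z: "z \<in> K" for z
  proof (rule field_le_epsilon)
    fix e :: real assume "e > 0"
    \<comment> \<open>The sum of \<open>u\<close> and the barrier is only known to have a
      nonnegative Laplacian. The quadratic term makes it positive and adds at most
      \<open>\<eta> * R\<^sup>2 = e\<close> on \<open>K\<close>.\<close>
    define \<eta> where "\<eta> = e / R\<^sup>2"
    have \<eta>: "\<eta> > 0" using \<open>e > 0\<close> R by (simp add: \<eta>_def)
    let ?w = "\<lambda>z. u z + (\<epsilon> * (ln R - ln (cmod (z - y))) + \<eta> * (cmod (z - y))\<^sup>2)"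
    have "?w z \<le> M + e"
    proof (rule weak_maximum_principle[OF K(1) _ K(2,3) _ _ z])
      show "continuous_on K ?w"
        using pos K by (intro continuous_intros continuous_on_subset[OF contu]) auto
      fix x assume x: "x \<in> I"
      obtain l where l: "l \<ge> 0" "has_laplacian u l x" using lap K x by blast
      have "has_laplacian (\<lambda>z. ln (cmod (z - y))) 0 x"
        using pos x K by (intro has_laplacian_ln_cmod[OF _ K(2)] holomorphic_intros) auto
      from has_laplacian_add[OF has_laplacian_const[of "ln R"] has_laplacian_cmult[OF this, of "-1"]]
      have "has_laplacian (\<lambda>z. ln R - ln (cmod (z - y))) 0 x" by simp
      from has_laplacian_add[OF l(2) has_laplacian_add[OF has_laplacian_cmult[OF this, of \<epsilon>]
            has_laplacian_cmult[OF has_laplacian_norm_square[of y], of \<eta>]]]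
      have "has_laplacian ?w (l + 4 * \<eta>) x" by (simp add: mult.commute)
      then show "\<exists>l>0. has_laplacian ?w l x" using l \<eta> by (intro exI[of _ "l + 4 * \<eta>"]) auto
    next
      fix x assume x: "x \<in> K - I"
      then have nx: "cmod (x - y) \<le> R" by (auto simp: K_def dist_norm norm_minus_commute)
      have "\<eta> * (cmod (x - y))\<^sup>2 \<le> \<eta> * R\<^sup>2"
        using \<eta> nx by (intro mult_left_mono power_mono) auto
      also have "\<dots> = e" using R by (simp add: \<eta>_def)
      finally have 1: "\<eta> * (cmod (x - y))\<^sup>2 \<le> e" .
      have "cmod (x - y) = R \<or> cmod (x - y) = R / 2"
        using x by (auto simp: K_def I_def dist_norm norm_minus_commute)
      then have "u x + \<epsilon> * (ln R - ln (cmod (x - y))) \<le> M"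
      proof
        assume "cmod (x - y) = R"
        then show ?thesis using le[of x] x K by auto
      next
        assume *: "cmod (x - y) = R / 2"
        then have "u x \<le> M - \<epsilon>" using m(2)[of x] by (simp add: \<epsilon>_def dist_norm norm_minus_commute)
        moreover have "ln R - ln (cmod (x - y)) = ln 2" using R unfolding * by (simp add: ln_div)
        moreover have "\<epsilon> * ln 2 \<le> \<epsilon> * 1" using eps ln_2_less_1 by (intro mult_left_mono) auto
        ultimately show ?thesis by simp
      qed
      with 1 show "?w x \<le> M + e" by simp
    qed
    moreover have "\<eta> * (cmod (z - y))\<^sup>2 \<ge> 0" using \<eta> by simp
    ultimately show "u z + \<epsilon> * (ln R - ln (cmod (z - y))) \<le> M + e" by linarith
  qed
  \<comment> \<open>The inward unit normal of the outer circle at \<open>x0\<close>.\<close>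
  define n where "n = (y - x0) /\<^sub>R R"
  have nn: "x0 - y = - (R *\<^sub>R n)" using R by (simp add: n_def)
  have norm_n: "cmod n = 1" using x0 R by (simp add: n_def dist_norm)
  obtain d where d: "((\<lambda>t. u (x0 + t *\<^sub>R n)) has_real_derivative d) (at 0)"
  proof -
    obtain D' where D': "(u has_derivative D') (at x0)" using diff[OF x0D] differentiable_def by blast
    have "((\<lambda>t. x0 + t *\<^sub>R n) has_derivative (\<lambda>t. t *\<^sub>R n)) (at 0)"
      by (auto intro!: derivative_eq_intros)
    from has_derivative_compose[OF this, of u D'] D'
    have "((\<lambda>t. u (x0 + t *\<^sub>R n)) has_derivative (\<lambda>t. D' (t *\<^sub>R n))) (at 0)" by simp
    moreover have "(\<lambda>t. D' (t *\<^sub>R n)) = (*) (D' n)"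
      using linear_cmul[OF has_derivative_linear[OF D']] by auto
    ultimately show ?thesis using that unfolding has_field_derivative_def by auto
  qed
  \<comment> \<open>\<open>x0\<close> is an interior point of \<open>D\<close> at which
    \<open>u\<close> is maximal.\<close>
  have "d = 0"
  proof -
    obtain r where r: "r > 0" "ball x0 r \<subseteq> D" using D(1) x0D openE by blast
    show ?thesis
    proof (rule DERIV_local_max[OF d r(1)], intro allI impI)
      fix t :: real assume "\<bar>0 - t\<bar> < r"
      then have "x0 + t *\<^sub>R n \<in> D" using r norm_n by (auto simp: dist_norm)
      then show "u (x0 + t *\<^sub>R n) \<le> u (x0 + 0 *\<^sub>R n)" using le ux0 by simp
    qed
  qed
  \<comment> \<open>Since d = 0, this function exceeds its value M just to the right of 0. The
    barrier bound at the same points keeps it below M, because ln R - ln (R - h) \<ge> h / R: a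
    contradiction.\<close>
  have "((\<lambda>t. u (x0 + t *\<^sub>R n) + \<epsilon> * t / R) has_real_derivative \<epsilon> / R) (at 0)"
    using d unfolding \<open>d = 0\<close> using R by (auto intro!: derivative_eq_intros)
  from DERIV_pos_inc_right[OF this] eps R
  obtain e where e: "e > 0" "\<And>h. 0 < h \<Longrightarrow> h < e \<Longrightarrow> u x0 < u (x0 + h *\<^sub>R n) + \<epsilon> * h / R"
    by auto
  define h where "h = min e (R/2) / 2"
  have h: "0 < h" "h < e" "h < R / 2" using e R by (auto simp: h_def)
  have nz: "cmod (x0 + h *\<^sub>R n - y) = R - h"
  proof -
    have "x0 + h *\<^sub>R n - y = (h - R) *\<^sub>R n" using nn by (simp add: algebra_simps)
    then show ?thesis using norm_n h R by simp
  qed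
  then have "x0 + h *\<^sub>R n \<in> K" using h by (auto simp: K_def dist_norm norm_minus_commute)
  from main[OF this] have "u (x0 + h *\<^sub>R n) + \<epsilon> * (ln R - ln (R - h)) \<le> M" by (simp add: nz)
  moreover have "ln R - ln (R - h) \<ge> h / R"
  proof -
    have "ln ((R - h) / R) \<le> (R - h) / R - 1" using h R by (intro ln_le_minus_one) auto
    then show ?thesis using h R by (simp add: ln_div field_simps)
  qed
  then have "\<epsilon> * (ln R - ln (R - h)) \<ge> \<epsilon> * (h / R)" using eps by (intro mult_left_mono) auto
  ultimately show False using e(2)[OF h(1,2)] ux0 by simp
qed

text \<open>The set where the maximum is attained is closed. If it were not open, there would be a
  point \<open>y\<close> outside it but close to one of its members; the largest disc around
  \<open>y\<close> free of maximum points has one on its boundary, against Hopf's lemma.\<close>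

lemma strong_maximum_principle:
  assumes D: "open D" "connected D"
    and diff: "\<And>z. z \<in> D \<Longrightarrow> u differentiable (at z)"
    and lap: "\<And>z. z \<in> D \<Longrightarrow> \<exists>l\<ge>0. has_laplacian u l z"
    and le: "\<And>z. z \<in> D \<Longrightarrow> u z \<le> u a" and a: "a \<in> D" and z: "z \<in> D"
  shows "u z = u a"
proof -
  let ?M = "u a"
  have contu: "continuous_on D u"
    using diff by (meson continuous_at_imp_continuous_on differentiable_imp_continuous_within)
  define Z where "Z = {z \<in> D. u z = ?M}"
  have clos: "closedin (top_of_set D) Z"
    unfolding Z_def by (rule continuous_closedin_preimage_constant[OF contu])
  have "open Z" unfolding open_contains_ball
  proof
    fix x assume "x \<in> Z"
    then have xD: "x \<in> D" by (simp add: Z_def)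
    then obtain e where e: "e > 0" "ball x e \<subseteq> D" using D openE by blast
    \<comment> \<open>Half the radius keeps \<open>cball y s\<close> inside \<open>D\<close> for
      every \<open>y\<close> in \<open>ball x s\<close>. This closed disc contains \<open>x\<close>,
      so a maximum point nearest to \<open>y\<close> can be sought in it.\<close>
    define s where "s = e / 2"
    have s: "s > 0" "2 * s = e" using e by (auto simp: s_def)
    have "ball x s \<subseteq> Z"
    proof
      fix y assume y: "y \<in> ball x s"
      have yb: "cball y s \<subseteq> D"
      proof -
        have "cball y s \<subseteq> ball x e" using y s by (simp add: cball_subset_ball_iff dist_commute)
        then show ?thesis using e by blast
      qed
      show "y \<in> Z"
      proof (rule ccontr)
        assume "y \<notin> Z"
        obtain C where C: "closed C" "Z = D \<inter> C" using clos by (auto simp: closedin_closed)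
        have "compact (cball y s \<inter> C)" by (simp add: C compact_Int_closed)
        moreover have "x \<in> cball y s \<inter> C" using y \<open>x \<in> Z\<close> C by (auto simp: dist_commute)
        ultimately obtain x0 where x0: "x0 \<in> cball y s \<inter> C" "\<And>w. w \<in> cball y s \<inter> C \<Longrightarrow> dist y x0 \<le> dist y w"
          using continuous_attains_inf[of "cball y s \<inter> C" "dist y"]
            continuous_on_dist[OF continuous_on_const continuous_on_id, of "cball y s \<inter> C" y]
          by (metis empty_iff)
        have x0Z: "x0 \<in> Z" using x0 C yb by auto
        have R: "dist y x0 > 0" using x0Z \<open>y \<notin> Z\<close> by auto
        have sub: "cball y (dist y x0) \<subseteq> D" using x0 yb by auto
        have "u x0 < ?M"
        proof (rule hopf_lemma[OF D(1) sub R diff lap le _ refl])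
          fix w assume w: "w \<in> ball y (dist y x0)"
          then have "w \<notin> C" using x0(2)[of w] x0(1) by force
          moreover have "w \<in> D" using w sub by auto
          ultimately have "w \<notin> Z" using C by auto
          then show "u w < ?M" using le[OF \<open>w \<in> D\<close>] \<open>w \<in> D\<close> unfolding Z_def by force
        qed
        then show False using x0Z by (simp add: Z_def)
      qed
    qed
    then show "\<exists>e>0. ball x e \<subseteq> Z" using s by blast
  qed
  then have "openin (top_of_set D) Z" by (auto simp: openin_open Z_def)
  with clos have "Z = {} \<or> Z = D" using D(2) by (simp add: connected_clopen)
  then show ?thesis using a z by (auto simp: Z_def)
qed


section \<open>The complex Hessian of a real function\<close>

text \<open>The derivative takes real values, which makes the two Wirtinger coefficients conjugate
  to each other.\<close>

lemma wirtinger_of_real: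
  assumes "(\<lambda>z. complex_of_real (f z)) differentiable (at z)"
  shows "d_dz k (\<lambda>z. complex_of_real (f z)) z = cnj (d_dzbar k (\<lambda>z. complex_of_real (f z)) z)"
    and "(f has_derivative (\<lambda>v. 2 * Re (\<Sum>k\<in>UNIV. d_dzbar k (\<lambda>z. complex_of_real (f z)) z * cnj (v $ k)))) (at z)"
proof -
  let ?F = "\<lambda>z. complex_of_real (f z)"
  let ?D = "frechet_derivative ?F (at z)"
  have D: "(?F has_derivative ?D) (at z)" using assms by (simp add: frechet_derivative_works)
  have f: "(f has_derivative (\<lambda>v. Re (?D v))) (at z)"
    using bounded_linear.has_derivative[OF bounded_linear_Re D] by simp
  have "?D = (\<lambda>v. complex_of_real (Re (?D v)))"
    using has_derivative_unique[OF D bounded_linear.has_derivative[OF bounded_linear_of_real f]] by simp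
  then have im: "Im (?D v) = 0" for v by (metis Im_complex_of_real)
  show *: "d_dz k ?F z = cnj (d_dzbar k ?F z)" for k
    using im unfolding d_dz_def d_dzbar_def by (simp add: complex_eq_iff)
  have "(f has_derivative (\<lambda>v. Re (\<Sum>j\<in>UNIV. d_dz j ?F z * v $ j + d_dzbar j ?F z * cnj (v $ j)))) (at z)"
    using bounded_linear.has_derivative[OF bounded_linear_Re has_derivative_wirtinger[OF assms]] by simp
  moreover have "Re (\<Sum>j\<in>UNIV. d_dz j ?F z * v $ j + d_dzbar j ?F z * cnj (v $ j)) =
      2 * Re (\<Sum>k\<in>UNIV. d_dzbar k ?F z * cnj (v $ k))" for v
    unfolding * Re_sum sum_distrib_left by (intro sum.cong) auto
  ultimately show "(f has_derivative (\<lambda>v. 2 * Re (\<Sum>k\<in>UNIV. d_dzbar k ?F z * cnj (v $ k)))) (at z)" by simp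
qed

lemma d_dzbar_cnj:
  assumes "A differentiable (at z)"
  shows "d_dzbar k (\<lambda>z. cnj (A z)) z = cnj (d_dz k A z)"
proof -
  have "((\<lambda>z. cnj (A z)) has_derivative (\<lambda>v. cnj (\<Sum>j\<in>UNIV. d_dz j A z * v $ j + d_dzbar j A z * cnj (v $ j)))) (at z)"
    using bounded_linear.has_derivative[OF bounded_linear_cnj has_derivative_wirtinger[OF assms]] by simp
  then have "((\<lambda>z. cnj (A z)) has_derivative
      (\<lambda>v. \<Sum>j\<in>UNIV. cnj (d_dzbar j A z) * v $ j + cnj (d_dz j A z) * cnj (v $ j))) (at z)"
    by (simp add: add.commute)
  from wirtinger_unique(2)[OF this] show ?thesis .
qed

lemma has_vector_derivative_along:
  assumes "(F has_derivative D) (at (L t))" "(L has_vector_derivative w) (at t)"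
  shows "((\<lambda>t. F (L t)) has_vector_derivative D w) (at t)"
proof -
  have "((\<lambda>t. F (L t)) has_derivative (\<lambda>s. D (s *\<^sub>R w))) (at t)"
    using has_derivative_compose[OF assms(2)[unfolded has_vector_derivative_def] assms(1)] .
  then show ?thesis unfolding has_vector_derivative_def
    using linear_cmul[OF has_derivative_linear[OF assms(1)]] by simp
qed

text \<open>The terms with the second derivative of the curve cancel since \<open>1\<^sup>2 + \<i>\<^sup>2 = 0\<close>.\<close>

lemma has_laplacian_along_holomorphic_curve:
  fixes f :: "complex ^ 'n::finite \<Rightarrow> real" and \<gamma> :: "complex \<Rightarrow> complex ^ 'n"
  defines "F \<equiv> \<lambda>z. complex_of_real (f z)"
  assumes S: "open S" "\<zeta> \<in> S" "\<And>k. (\<lambda>w. \<gamma> w $ k) holomorphic_on S" "\<And>w. w \<in> S \<Longrightarrow> \<gamma> w \<in> W"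
    and d1: "\<And>z. z \<in> W \<Longrightarrow> F differentiable (at z)"
    and d2: "\<And>z k. z \<in> W \<Longrightarrow> d_dzbar k F differentiable (at z)"
    and v: "\<And>k. v $ k = deriv (\<lambda>w. \<gamma> w $ k) \<zeta>"
  shows "has_laplacian (\<lambda>w. f (\<gamma> w))
    (4 * Re (\<Sum>j\<in>UNIV. \<Sum>k\<in>UNIV. d_dz j (d_dzbar k F) (\<gamma> \<zeta>) * v $ j * cnj (v $ k))) \<zeta>"
proof -
  define \<gamma>' where "\<gamma>' k = deriv (\<lambda>w. \<gamma> w $ k)" for k
  define \<gamma>'' where "\<gamma>'' k = deriv (\<gamma>' k) \<zeta>" for k
  define A where "A k = d_dzbar k F" for k
  have line: "((\<lambda>t. g (\<zeta> + d * complex_of_real t)) has_vector_derivative d * deriv g (\<zeta> + d * of_real t)) (at t)"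
    if "g holomorphic_on S" "\<zeta> + d * of_real t \<in> S" for g d t
  proof -
    have "(g has_field_derivative deriv g (\<zeta> + d * of_real t)) (at (\<zeta> + d * of_real t))"
      using that S(1) by (simp add: holomorphic_derivI)
    then have "((\<lambda>w. g (\<zeta> + d * w)) has_field_derivative deriv g (\<zeta> + d * of_real t) * d) (at (of_real t))"
      by (rule DERIV_chain2) (auto intro!: derivative_eq_intros)
    from has_vector_derivative_real_field[OF this] show ?thesis by (simp add: mult.commute)
  qed
  have L: "((\<lambda>t. \<gamma> (\<zeta> + d * complex_of_real t)) has_vector_derivative (\<chi> k. d * \<gamma>' k (\<zeta> + d * of_real t))) (at t)"
    if "\<zeta> + d * of_real t \<in> S" for d t
    unfolding has_vector_derivative_def
    using line[OF S(3) that] by (intro has_derivative_vecI) (simp add: \<gamma>'_def has_vector_derivative_def)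
  \<comment> \<open>\<open>p d\<close> is the derivative of f along the image of the line in
    direction \<open>d\<close>, and \<open>P d\<close> is the derivative of \<open>p d\<close> at 0;
    they are used for d = 1 and d = \<i>.\<close>
  define p where "p d t = 2 * Re (\<Sum>k\<in>UNIV. A k (\<gamma> (\<zeta> + d * of_real t)) * cnj (d * \<gamma>' k (\<zeta> + d * of_real t)))" for d t
  define P where "P d = 2 * Re (\<Sum>k\<in>UNIV. A k (\<gamma> \<zeta>) * cnj (d * (d * \<gamma>'' k)) +
      (\<Sum>j\<in>UNIV. d_dz j (A k) (\<gamma> \<zeta>) * (d * v $ j) + d_dzbar j (A k) (\<gamma> \<zeta>) * cnj (d * v $ j)) * cnj (d * v $ k))" for d
  have p: "\<forall>\<^sub>F t in nhds 0. ((\<lambda>t. f (\<gamma> (\<zeta> + d * of_real t))) has_real_derivative p d t) (at t)" for d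
    using eventually_along_line[OF S(1,2), of d]
  proof eventually_elim
    case (elim t)
    show ?case
      using has_vector_derivative_along[OF wirtinger_of_real(2)[OF d1[OF S(4)[OF elim], unfolded F_def]] L[OF elim]]
      by (simp add: has_real_derivative_iff_has_vector_derivative p_def A_def F_def)
  qed
  have P: "(p d has_real_derivative P d) (at 0)" for d
  proof -
    have h: "\<gamma>' k holomorphic_on S" for k
      unfolding \<gamma>'_def by (rule holomorphic_deriv[OF S(3,1)])
    have v': "\<gamma>' k \<zeta> = v $ k" for k by (simp add: v \<gamma>'_def)
    have 1: "((\<lambda>t. A k (\<gamma> (\<zeta> + d * of_real t))) has_vector_derivative
       (\<Sum>j\<in>UNIV. d_dz j (A k) (\<gamma> \<zeta>) * (d * v $ j) + d_dzbar j (A k) (\<gamma> \<zeta>) * cnj (d * v $ j))) (at 0)" for k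
    proof -
      have "(A k has_derivative (\<lambda>w. \<Sum>j\<in>UNIV. d_dz j (A k) (\<gamma> \<zeta>) * w $ j + d_dzbar j (A k) (\<gamma> \<zeta>) * cnj (w $ j)))
          (at (\<gamma> (\<zeta> + d * of_real 0)))"
        using has_derivative_wirtinger[OF d2[OF S(4)[OF S(2)], of k]] by (simp add: A_def)
      from has_vector_derivative_along[OF this L[of d 0]] S(2) show ?thesis by (simp add: v')
    qed
    have "((\<lambda>t. d * \<gamma>' k (\<zeta> + d * of_real t)) has_vector_derivative d * (d * \<gamma>'' k)) (at 0)" for k
      using has_vector_derivative_mult_right[OF line[OF h[of k], of d 0]] S(2) by (simp add: \<gamma>''_def)
    then have 2: "((\<lambda>t. cnj (d * \<gamma>' k (\<zeta> + d * of_real t))) has_vector_derivative cnj (d * (d * \<gamma>'' k))) (at 0)" for k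
      by (rule has_vector_derivative_cnj)
    have "((\<lambda>t. \<Sum>k\<in>UNIV. A k (\<gamma> (\<zeta> + d * of_real t)) * cnj (d * \<gamma>' k (\<zeta> + d * of_real t))) has_vector_derivative
       (\<Sum>k\<in>UNIV. A k (\<gamma> \<zeta>) * cnj (d * (d * \<gamma>'' k)) +
      (\<Sum>j\<in>UNIV. d_dz j (A k) (\<gamma> \<zeta>) * (d * v $ j) + d_dzbar j (A k) (\<gamma> \<zeta>) * cnj (d * v $ j)) * cnj (d * v $ k))) (at 0)"
    proof (rule has_vector_derivative_sum)
      fix k show "((\<lambda>t. A k (\<gamma> (\<zeta> + d * of_real t)) * cnj (d * \<gamma>' k (\<zeta> + d * of_real t))) has_vector_derivative
        A k (\<gamma> \<zeta>) * cnj (d * (d * \<gamma>'' k)) +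
        (\<Sum>j\<in>UNIV. d_dz j (A k) (\<gamma> \<zeta>) * (d * v $ j) + d_dzbar j (A k) (\<gamma> \<zeta>) * cnj (d * v $ j)) * cnj (d * v $ k)) (at 0)"
        using has_vector_derivative_mult[OF 1[of k] 2[of k]] by (simp add: v')
    qed
    from has_field_derivative_Re[OF this] show ?thesis
      unfolding p_def P_def by (intro DERIV_cmult)
  qed
  \<comment> \<open>The terms with \<open>d_dzbar j (A k)\<close> carry the square of
    \<open>cnj d\<close> and cancel like those with \<open>\<gamma>''\<close>. The mixed terms carry
    |d|^2 = 1 and double, which with the 2 in \<open>P\<close> gives the factor 4.\<close>
  have "P 1 + P \<i> = 4 * Re (\<Sum>k\<in>UNIV. \<Sum>j\<in>UNIV. d_dz j (A k) (\<gamma> \<zeta>) * v $ j * cnj (v $ k))"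
  proof -
    have "(\<Sum>k\<in>UNIV. A k (\<gamma> \<zeta>) * cnj (1 * (1 * \<gamma>'' k)) +
      (\<Sum>j\<in>UNIV. d_dz j (A k) (\<gamma> \<zeta>) * (1 * v $ j) + d_dzbar j (A k) (\<gamma> \<zeta>) * cnj (1 * v $ j)) * cnj (1 * v $ k)) +
      (\<Sum>k\<in>UNIV. A k (\<gamma> \<zeta>) * cnj (\<i> * (\<i> * \<gamma>'' k)) +
      (\<Sum>j\<in>UNIV. d_dz j (A k) (\<gamma> \<zeta>) * (\<i> * v $ j) + d_dzbar j (A k) (\<gamma> \<zeta>) * cnj (\<i> * v $ j)) * cnj (\<i> * v $ k))
      = (\<Sum>k\<in>UNIV. \<Sum>j\<in>UNIV. 2 * (d_dz j (A k) (\<gamma> \<zeta>) * v $ j * cnj (v $ k)))"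
      unfolding sum.distrib[symmetric] sum_distrib_right
      by (intro sum.cong refl) (simp add: algebra_simps flip: sum.distrib sum_distrib_left)
    then show ?thesis unfolding P_def
      by (simp only: distrib_left[symmetric] plus_complex.sel(1)[symmetric] sum_distrib_left[symmetric]) simp
  qed
  also have "\<dots> = 4 * Re (\<Sum>j\<in>UNIV. \<Sum>k\<in>UNIV. d_dz j (A k) (\<gamma> \<zeta>) * v $ j * cnj (v $ k))"
    by (subst sum.swap) simp
  finally show ?thesis unfolding has_laplacian_def A_def
    using p[of 1] p[of \<i>] P[of 1] P[of \<i>] by (intro exI[of _ "p 1"] exI[of _ "p \<i>"] exI[of _ "P 1"] exI[of _ "P \<i>"]) simp
qed

text \<open>For small \<open>t\<close> the linear term dominates the quadratic one, and it changes
  sign with \<open>t\<close>.\<close>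

lemma nonneg_quadratic_linear_term:
  assumes "\<And>t::real. of_real t * c + of_real (t\<^sup>2 * q) \<in> \<real>\<^sub>\<ge>\<^sub>0"
  shows "c = (0::complex)"
proof -
  have re: "t * Re c + t\<^sup>2 * q \<ge> 0" for t using assms[of t] by (simp add: complex_nonneg_Reals_iff)
  have "Im c = 0" using assms[of 1] by (simp add: complex_nonneg_Reals_iff)
  moreover have "Re c = 0"
  proof (rule ccontr)
    assume nz: "Re c \<noteq> 0"
    \<comment> \<open>A positive number above \<open>q\<close>: at t = - Re c / s the expression is
      (Re c)^2 / s times q / s - 1, which is negative.\<close>
    define s where "s = \<bar>q\<bar> + 1"
    have s: "s > 0" "q < s" by (auto simp: s_def)
    have "(- Re c / s) * Re c + (- Re c / s)\<^sup>2 * q = (Re c)\<^sup>2 / s * (q / s - 1)"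
      using s by (simp add: field_simps power2_eq_square)
    moreover have "(Re c)\<^sup>2 / s * (q / s - 1) < 0" using s nz by (intro mult_pos_neg) (auto simp: field_simps)
    ultimately show False using re[of "- Re c / s"] by linarith
  qed
  ultimately show ?thesis by (simp add: complex_eq_iff)
qed

text \<open>The equality case of Cauchy-Schwarz, for a form not assumed to be Hermitian symmetric.
  Perturbing \<open>v\<close> by t w and by \<i> t w with real t gives H v w + H w v = 0 and H w v -
  H v w = 0.\<close>

lemma semidefinite_form_kernel:
  fixes \<Theta> :: "'n::finite \<Rightarrow> 'n \<Rightarrow> complex"
  defines "H \<equiv> \<lambda>\<xi> \<eta>. \<Sum>j\<in>UNIV. \<Sum>k\<in>UNIV. \<Theta> j k * \<xi> $ j * cnj (\<eta> $ k)"
  assumes psd: "\<And>\<xi> :: complex ^ 'n. H \<xi> \<xi> \<in> \<real>\<^sub>\<ge>\<^sub>0" and v: "H v v = 0"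
  shows "(\<Sum>j\<in>UNIV. \<Theta> j i * v $ j) = 0"
proof -
  have exp: "H (v + s *s w) (v + s *s w) = H v v + cnj s * H v w + s * H w v + s * cnj s * H w w" for s w
    unfolding H_def sum_distrib_left sum.distrib[symmetric]
    by (intro sum.cong refl) (simp add: algebra_simps)
  have *: "H v w = 0" for w
  proof -
    have real: "of_real (Re (H w w)) = H w w" using psd[of w] by (simp add: complex_nonneg_Reals_iff complex_eq_iff)
    have "H v w + H w v = 0"
    proof (rule nonneg_quadratic_linear_term[of _ "Re (H w w)"])
      fix t :: real
      have "H (v + of_real t *s w) (v + of_real t *s w) = of_real t * (H v w + H w v) + of_real (t\<^sup>2) * H w w"
        unfolding exp v by (simp add: algebra_simps power2_eq_square)
      then show "of_real t * (H v w + H w v) + of_real (t\<^sup>2 * Re (H w w)) \<in> \<real>\<^sub>\<ge>\<^sub>0"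
        using psd[of "v + of_real t *s w"] real by simp
    qed
    moreover have "\<i> * (H w v - H v w) = 0"
    proof (rule nonneg_quadratic_linear_term[of _ "Re (H w w)"])
      fix t :: real
      have "H (v + (\<i> * of_real t) *s w) (v + (\<i> * of_real t) *s w) =
         of_real t * (\<i> * (H w v - H v w)) + of_real (t\<^sup>2) * H w w"
        unfolding exp v by (simp add: algebra_simps power2_eq_square)
      then show "of_real t * (\<i> * (H w v - H v w)) + of_real (t\<^sup>2 * Re (H w w)) \<in> \<real>\<^sub>\<ge>\<^sub>0"
        using psd[of "v + (\<i> * of_real t) *s w"] real by simp
    qed
    ultimately show ?thesis by (simp add: algebra_simps)
  qed
  have "H v (axis i 1) = (\<Sum>j\<in>UNIV. \<Theta> j i * v $ j)"
    unfolding H_def by (intro sum.cong refl) (simp add: axis_def if_distrib[of cnj] if_distrib[of "\<lambda>c. _ * c"] cong: if_cong)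
  then show ?thesis using * by simp
qed

text \<open>The derivative of ln H is that of H divided by H, so the second derivatives come from
  those of H. The formula holds on all of \<open>W\<close>, which is what allows it to be
  differentiated once more.\<close>

lemma differentiable_d_dz_ln:
  fixes H :: "complex ^ 'n::finite \<Rightarrow> real"
  assumes H: "C_infinity_on H W" "\<And>z. z \<in> W \<Longrightarrow> H z > 0" and z: "z \<in> W"
  defines "F \<equiv> \<lambda>z. complex_of_real (ln (H z))"
  shows "F differentiable (at z)" "d_dz k F differentiable (at z)" "d_dzbar k F differentiable (at z)"
proof -
  have W: "open W" and C2: "Ck_on (Suc (Suc 0)) H W" using H(1) unfolding C_infinity_on_def by auto
  have d1: "H differentiable (at z)" if "z \<in> W" for z using C2 that by simp
  define h where "h z = frechet_derivative H (at z)" for z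
  have d2: "(\<lambda>z. h z v) differentiable (at z)" if "z \<in> W" for z v using C2 that by (simp add: h_def)
  have F: "(F has_derivative (\<lambda>v. complex_of_real (h z v / H z))) (at z)" if "z \<in> W" for z
  proof -
    have "((\<lambda>z. ln (H z)) has_derivative (\<lambda>v. h z v / H z)) (at z)"
      using d1[OF that] H(2)[OF that] unfolding h_def frechet_derivative_works
      by (auto intro!: derivative_eq_intros simp: field_simps)
    then show ?thesis unfolding F_def by (rule has_derivative_of_real)
  qed
  show "F differentiable (at z)" using F[OF z] by (rule differentiableI)
  have fd: "frechet_derivative F (at z) v = complex_of_real (h z v / H z)" if "z \<in> W" for z v
    using frechet_derivative_at[OF F[OF that]] by metis
  let ?r = "\<lambda>v z. complex_of_real (h z v / H z)"
  have r: "?r v differentiable (at z)" for v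
  proof -
    have "(\<lambda>z. h z v / H z) differentiable (at z)" using d2[OF z] d1[OF z] H(2)[OF z] by (intro derivative_intros) auto
    then show ?thesis unfolding differentiable_def using has_derivative_of_real by blast
  qed
  have "(\<lambda>z. (?r (axis k 1) z - \<i> * ?r (axis k \<i>) z) / 2) differentiable (at z)"
    "(\<lambda>z. (?r (axis k 1) z + \<i> * ?r (axis k \<i>) z) / 2) differentiable (at z)"
    by (intro derivative_intros r; simp)+
  moreover have "d_dz k F w = (?r (axis k 1) w - \<i> * ?r (axis k \<i>) w) / 2"
    "d_dzbar k F w = (?r (axis k 1) w + \<i> * ?r (axis k \<i>) w) / 2" if "w \<in> W" for w
    unfolding d_dz_def d_dzbar_def fd[OF that] by auto
  moreover have "b differentiable (at z)" if "a differentiable (at z)" "\<And>w. w \<in> W \<Longrightarrow> b w = a w"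
    for a b :: "complex ^ 'n \<Rightarrow> complex"
    using that(1) has_derivative_transform_within_open[OF _ W z, of a _ UNIV b] that(2)
    unfolding differentiable_def by auto
  ultimately show "d_dz k F differentiable (at z)" "d_dzbar k F differentiable (at z)" by blast+
qed

text \<open>The conjugate derivative of \<open>f\<close> kills the image of the derivative of
  \<open>G\<close>, so the composite has no conjugate part. Later \<open>f\<close> is a coefficient
  of \<partial> log h and \<open>G\<close> a holomorphic map into \<open>Y\<close>, in
  coordinates.\<close>

lemma holomorphic_at_vec_along_kernel:
  fixes G :: "complex ^ 'm::finite \<Rightarrow> complex ^ 'n::finite"
  assumes f: "f differentiable (at (G y))" and G: "\<And>k. holomorphic_at_vec (\<lambda>w. G w $ k) y"
    and ker: "\<And>v. (\<Sum>k\<in>UNIV. d_dzbar k f (G y) * cnj (\<Sum>j\<in>UNIV. d_dz j (\<lambda>w. G w $ k) y * v $ j)) = 0"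
  shows "holomorphic_at_vec (\<lambda>w. f (G w)) y"
proof -
  let ?G = "\<lambda>k j. d_dz j (\<lambda>w. G w $ k) y"
  have "((\<lambda>w. f (G w)) has_derivative (\<lambda>v. \<Sum>k\<in>UNIV. d_dz k f (G y) * (\<Sum>j\<in>UNIV. ?G k j * v $ j)
      + d_dzbar k f (G y) * cnj (\<Sum>j\<in>UNIV. ?G k j * v $ j))) (at y)"
    using has_derivative_compose[OF has_derivative_holomorphic_map[OF G] has_derivative_wirtinger[OF f]]
    by simp
  moreover have "(\<Sum>k\<in>UNIV. d_dz k f (G y) * (\<Sum>j\<in>UNIV. ?G k j * v $ j)
      + d_dzbar k f (G y) * cnj (\<Sum>j\<in>UNIV. ?G k j * v $ j)) =
     (\<Sum>j\<in>UNIV. (\<Sum>k\<in>UNIV. d_dz k f (G y) * ?G k j) * v $ j)" for v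
    unfolding sum.distrib ker sum_distrib_left sum_distrib_right mult.assoc add_0_right by (rule sum.swap)
  ultimately show ?thesis
    using holomorphic_at_vecI(1)[of "\<lambda>w. f (G w)" "\<lambda>j. \<Sum>k\<in>UNIV. d_dz k f (G y) * ?G k j"] by simp
qed


section \<open>Holomorphic functions and forms on a complex manifold\<close>

lemma holomorphic_chartD:
  assumes "holomorphic_chart A c"
  shows "open (fst c)" "continuous_on (fst c) (snd c)" "continuous_on (snd c ` fst c) (chart_inv c)"
    "p \<in> fst c \<Longrightarrow> chart_inv c (snd c p) = p"
    "z \<in> snd c ` fst c \<Longrightarrow> snd c (chart_inv c z) = z"
    "z \<in> snd c ` fst c \<Longrightarrow> chart_inv c z \<in> fst c"
    "c' \<in> A \<Longrightarrow> holomorphic_transition c c'" "c' \<in> A \<Longrightarrow> holomorphic_transition c' c"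
  using assms unfolding holomorphic_chart_def homeomorphism_def by (auto intro: inv_into_into)

lemma holomorphic_chart_open_image:
  assumes c: "holomorphic_chart A c" and U: "open U"
  shows "open (snd c ` (fst c \<inter> U))"
proof -
  have "snd c ` (fst c \<inter> U) = snd c ` fst c \<inter> chart_inv c -` U"
    using holomorphic_chartD(4,5,6)[OF c] by (auto simp: image_iff)
  then show ?thesis
    using continuous_open_preimage[OF holomorphic_chartD(3)[OF c] _ U] c by (simp add: holomorphic_chart_def)
qed

lemma holomorphic_transition_at:
  assumes "holomorphic_transition c c'" "p \<in> fst c" "p \<in> fst c'"
  shows "holomorphic_at_vec (\<lambda>z. snd c' (chart_inv c z) $ k) (snd c p)"
  using assms unfolding holomorphic_transition_def holomorphic_map_on_def holomorphic_on_vec_def by auto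

text \<open>Submanifold charts may lie outside the atlas, and the maximal atlas is defined by
  compatibility with members of \<open>A\<close>; so the transition from \<open>c\<close> to
  \<open>c'\<close> appears as a separate hypothesis.\<close>

lemma chart_change:
  assumes c: "holomorphic_chart A c" and c': "holomorphic_chart A c'" and t: "holomorphic_transition c c'"
    and p: "p \<in> fst c" "p \<in> fst c'"
  shows "holomorphic_at_vec (f \<circ> chart_inv c') (snd c' p) \<Longrightarrow> holomorphic_at_vec (f \<circ> chart_inv c) (snd c p)"
    and "(f \<circ> chart_inv c') differentiable (at (snd c' p)) \<Longrightarrow> d_dz i (f \<circ> chart_inv c) (snd c p) =
      (\<Sum>k\<in>UNIV. d_dz k (f \<circ> chart_inv c') (snd c' p) * d_dz i (\<lambda>z. snd c' (chart_inv c z) $ k) (snd c p))"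
proof -
  let ?S = "snd c ` (fst c \<inter> fst c')"
  have S: "open ?S" "snd c p \<in> ?S"
    using holomorphic_chart_open_image[OF c] holomorphic_chartD(1)[OF c'] p by auto
  have eq: "(f \<circ> chart_inv c') (snd c' (chart_inv c z)) = (f \<circ> chart_inv c) z" if "z \<in> ?S" for z
    using that holomorphic_chartD(4)[OF c] holomorphic_chartD(4)[OF c'] by auto
  have p': "snd c' (chart_inv c (snd c p)) = snd c' p" using holomorphic_chartD(4)[OF c] p by simp
  note ta = holomorphic_transition_at[OF t p]
  show "holomorphic_at_vec (f \<circ> chart_inv c) (snd c p)" if "holomorphic_at_vec (f \<circ> chart_inv c') (snd c' p)"
    by (rule holomorphic_at_vec_cong[OF S eq])
       (use holomorphic_at_vec_compose[OF _ ta, of "f \<circ> chart_inv c'"] that p' in auto)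
  show "d_dz i (f \<circ> chart_inv c) (snd c p) =
      (\<Sum>k\<in>UNIV. d_dz k (f \<circ> chart_inv c') (snd c' p) * d_dz i (\<lambda>z. snd c' (chart_inv c z) $ k) (snd c p))"
    if "(f \<circ> chart_inv c') differentiable (at (snd c' p))"
    using wirtinger_cong(1)[OF S, of "\<lambda>z. (f \<circ> chart_inv c') (snd c' (chart_inv c z))" "f \<circ> chart_inv c" i, OF eq]
      d_dz_compose[OF _ ta, of "f \<circ> chart_inv c'" i] that p' by simp
qed

lemma covectors_at_closed:
  "\<kappa> \<in> covectors_at A p \<Longrightarrow> \<kappa>' \<in> covectors_at A p \<Longrightarrow> (\<lambda>c. \<kappa> c + \<kappa>' c) \<in> covectors_at A p"
  "\<kappa> \<in> covectors_at A p \<Longrightarrow> (\<lambda>c. a *s \<kappa> c) \<in> covectors_at A p"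
  "\<kappa> \<in> covectors_at A p \<Longrightarrow> (\<lambda>c. - \<kappa> c) \<in> covectors_at A p"
  "(\<lambda>c. 0) \<in> covectors_at A p"
proof -
  let ?T = "\<lambda>c c' i j. d_dz i (\<lambda>z. snd c' (chart_inv c z) $ j) (snd c p)"
  have D: "\<kappa> c $ i = (\<Sum>j\<in>UNIV. \<kappa> c' $ j * ?T c c' i j)"
    if "\<kappa> \<in> covectors_at A p" "c \<in> A" "c' \<in> A" "p \<in> fst c \<inter> fst c'" for \<kappa> c c' i
    using that unfolding covectors_at_def by blast
  have Z: "\<kappa> c = 0" if "\<kappa> \<in> covectors_at A p" "\<not> (c \<in> A \<and> p \<in> fst c)" for \<kappa> c
    using that unfolding covectors_at_def by blast
  have I: "\<kappa> \<in> covectors_at A p"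
    if "\<And>c. \<not> (c \<in> A \<and> p \<in> fst c) \<Longrightarrow> \<kappa> c = 0"
      "\<And>c c' i. c \<in> A \<Longrightarrow> c' \<in> A \<Longrightarrow> p \<in> fst c \<inter> fst c' \<Longrightarrow> \<kappa> c $ i = (\<Sum>j\<in>UNIV. \<kappa> c' $ j * ?T c c' i j)" for \<kappa>
    using that unfolding covectors_at_def by blast
  show "(\<lambda>c. 0) \<in> covectors_at A p" by (rule I) auto
  assume k: "\<kappa> \<in> covectors_at A p"
  show "(\<lambda>c. a *s \<kappa> c) \<in> covectors_at A p"
  proof (rule I)
    fix c c' i assume c: "c \<in> A" "c' \<in> A" "p \<in> fst c \<inter> fst c'"
    show "(a *s \<kappa> c) $ i = (\<Sum>j\<in>UNIV. (a *s \<kappa> c') $ j * ?T c c' i j)"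
      unfolding vector_smult_component D[OF k c, of i] sum_distrib_left by (simp add: mult.assoc)
  qed (use Z[OF k] in auto)
  show "(\<lambda>c. - \<kappa> c) \<in> covectors_at A p"
  proof (rule I)
    fix c c' i assume c: "c \<in> A" "c' \<in> A" "p \<in> fst c \<inter> fst c'"
    show "(- \<kappa> c) $ i = (\<Sum>j\<in>UNIV. (- \<kappa> c') $ j * ?T c c' i j)"
      unfolding vector_uminus_component D[OF k c, of i] by (simp add: sum_negf)
  qed (use Z[OF k] in auto)
  assume k': "\<kappa>' \<in> covectors_at A p"
  show "(\<lambda>c. \<kappa> c + \<kappa>' c) \<in> covectors_at A p"
  proof (rule I)
    fix c c' i assume c: "c \<in> A" "c' \<in> A" "p \<in> fst c \<inter> fst c'"
    show "(\<kappa> c + \<kappa>' c) $ i = (\<Sum>j\<in>UNIV. (\<kappa> c' + \<kappa>' c') $ j * ?T c c' i j)"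
      unfolding vector_add_component D[OF k c, of i] D[OF k' c, of i] by (simp add: ring_distribs sum.distrib)
  qed (use Z[OF k] Z[OF k'] in auto)
qed

section \<open>The structure sheaf and its units\<close>

locale complex_mfd =
  fixes A :: "('a::{t2_space, second_countable_topology}, 'n::finite) chart set"
  assumes mfd: "complex_manifold A"
begin

lemma atlas_chart: "c \<in> A \<Longrightarrow> holomorphic_chart A c"
  using mfd by (simp add: complex_manifold_def)

lemma atlas_cover: obtains c where "c \<in> A" "p \<in> fst c"
  using mfd unfolding complex_manifold_def by blast

lemmas atlasD = holomorphic_chartD[OF atlas_chart]

lemma atlas_transition: "c \<in> A \<Longrightarrow> c' \<in> A \<Longrightarrow> holomorphic_transition c c'"
  using atlas_chart holomorphic_chartD(7) by blast

lemma hol_sheaf_carrier: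
  assumes "open U"
  shows "f \<in> carrier (hol_sheaf A U) \<longleftrightarrow> f \<in> extensional U \<and>
    (\<forall>c\<in>A. \<forall>p\<in>fst c \<inter> U. holomorphic_at_vec (f \<circ> chart_inv c) (snd c p))"
  using holomorphic_chart_open_image[OF atlas_chart assms]
  unfolding hol_sheaf_def function_ring_def holomorphic_on_vec_def by auto

lemma hol_sheaf_ops:
  "f \<otimes>\<^bsub>hol_sheaf A U\<^esub> g = (\<lambda>p\<in>U. f p * g p)" "\<one>\<^bsub>hol_sheaf A U\<^esub> = (\<lambda>p\<in>U. 1)"
  "f \<oplus>\<^bsub>hol_sheaf A U\<^esub> g = (\<lambda>p\<in>U. f p + g p)" "\<zero>\<^bsub>hol_sheaf A U\<^esub> = (\<lambda>p\<in>U. 0)"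
  by (simp_all add: hol_sheaf_def function_ring_def)

lemma at_chart_cong:
  assumes c: "holomorphic_chart A c" and U: "open U" "p \<in> U" "p \<in> fst c" and eq: "\<And>q. q \<in> U \<Longrightarrow> f q = g q"
  shows "holomorphic_at_vec (f \<circ> chart_inv c) (snd c p) \<Longrightarrow> holomorphic_at_vec (g \<circ> chart_inv c) (snd c p)"
    "d_dz i (f \<circ> chart_inv c) (snd c p) = d_dz i (g \<circ> chart_inv c) (snd c p)"
proof -
  let ?S = "snd c ` (fst c \<inter> U)"
  have S: "open ?S" "snd c p \<in> ?S" using holomorphic_chart_open_image[OF c U(1)] U by auto
  have e: "(f \<circ> chart_inv c) z = (g \<circ> chart_inv c) z" if "z \<in> ?S" for z
    using that eq holomorphic_chartD(4)[OF c] by auto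
  show "holomorphic_at_vec (f \<circ> chart_inv c) (snd c p) \<Longrightarrow> holomorphic_at_vec (g \<circ> chart_inv c) (snd c p)"
    by (rule holomorphic_at_vec_cong[OF S e])
  show "d_dz i (f \<circ> chart_inv c) (snd c p) = d_dz i (g \<circ> chart_inv c) (snd c p)"
    by (rule wirtinger_cong(1)[OF S e])
qed

lemma hol_sheaf_restrict:
  assumes "open U" "open V" "V \<subseteq> U" "f \<in> carrier (hol_sheaf A U)" "\<And>q. q \<in> V \<Longrightarrow> g q = f q" "g \<in> extensional V"
  shows "g \<in> carrier (hol_sheaf A V)"
  unfolding hol_sheaf_carrier[OF assms(2)]
proof (intro conjI ballI)
  fix c p assume c: "c \<in> A" "p \<in> fst c \<inter> V"
  show "holomorphic_at_vec (g \<circ> chart_inv c) (snd c p)"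
    by (rule at_chart_cong(1)[OF atlas_chart assms(2), of c p f])
       (use c assms in \<open>auto simp: hol_sheaf_carrier\<close>)
qed fact

lemma hol_sheafD:
  assumes "open U" "f \<in> carrier (hol_sheaf A U)" "c \<in> A" "p \<in> fst c" "p \<in> U"
  shows "holomorphic_at_vec (f \<circ> chart_inv c) (snd c p)"
  using assms by (simp add: hol_sheaf_carrier)

lemma hol_sheafI:
  assumes U: "open U"
    and hol: "\<And>c p. c \<in> A \<Longrightarrow> p \<in> fst c \<Longrightarrow> p \<in> U \<Longrightarrow> holomorphic_at_vec (f \<circ> chart_inv c) (snd c p)"
  shows "restrict f U \<in> carrier (hol_sheaf A U)"
  unfolding hol_sheaf_carrier[OF U]
proof (intro conjI ballI)
  fix c p assume c: "c \<in> A" "p \<in> fst c \<inter> U"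
  show "holomorphic_at_vec (restrict f U \<circ> chart_inv c) (snd c p)"
    by (rule at_chart_cong(1)[OF atlas_chart U, of c p f]) (use c hol in auto)
qed simp

lemma hol_sheaf_mult:
  assumes "open U" "f \<in> carrier (hol_sheaf A U)" "g \<in> carrier (hol_sheaf A U)"
  shows "(\<lambda>p\<in>U. f p * g p) \<in> carrier (hol_sheaf A U)"
proof (rule hol_sheafI[OF assms(1)])
  fix c p assume "c \<in> A" "p \<in> fst c" "p \<in> U"
  from holomorphic_at_vec_mult(1)[OF hol_sheafD[OF assms(1,2) this] hol_sheafD[OF assms(1,3) this]]
  show "holomorphic_at_vec ((\<lambda>p. f p * g p) \<circ> chart_inv c) (snd c p)" by (simp add: o_def)
qed

lemma hol_sheaf_add:
  assumes "open U" "f \<in> carrier (hol_sheaf A U)" "g \<in> carrier (hol_sheaf A U)"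
  shows "(\<lambda>p\<in>U. f p + g p) \<in> carrier (hol_sheaf A U)"
proof (rule hol_sheafI[OF assms(1)])
  fix c p assume "c \<in> A" "p \<in> fst c" "p \<in> U"
  from holomorphic_at_vec_add(1)[OF hol_sheafD[OF assms(1,2) this] hol_sheafD[OF assms(1,3) this]]
  show "holomorphic_at_vec ((\<lambda>p. f p + g p) \<circ> chart_inv c) (snd c p)" by (simp add: o_def)
qed

lemma hol_sheaf_const: "open U \<Longrightarrow> (\<lambda>p\<in>U. a) \<in> carrier (hol_sheaf A U)"
  by (rule hol_sheafI) (simp_all add: o_def holomorphic_at_vec_const)

lemma hol_sheaf_uminus:
  assumes "open U" "f \<in> carrier (hol_sheaf A U)"
  shows "(\<lambda>p\<in>U. - f p) \<in> carrier (hol_sheaf A U)"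
proof (rule hol_sheafI[OF assms(1)])
  fix c p assume "c \<in> A" "p \<in> fst c" "p \<in> U"
  from holomorphic_at_vec_uminus(1)[OF hol_sheafD[OF assms(1,2) this]]
  show "holomorphic_at_vec ((\<lambda>p. - f p) \<circ> chart_inv c) (snd c p)" by (simp add: o_def)
qed

lemma hol_sheaf_inverse:
  assumes "open U" "f \<in> carrier (hol_sheaf A U)" "\<And>p. p \<in> U \<Longrightarrow> f p \<noteq> 0"
  shows "(\<lambda>p\<in>U. inverse (f p)) \<in> carrier (hol_sheaf A U)"
proof (rule hol_sheafI[OF assms(1)])
  fix c p assume c: "c \<in> A" "p \<in> fst c" "p \<in> U"
  from holomorphic_at_vec_inverse[OF hol_sheafD[OF assms(1,2) this]] assms(3)[OF c(3)] atlasD(4)[OF c(1,2)]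
  show "holomorphic_at_vec ((\<lambda>p. inverse (f p)) \<circ> chart_inv c) (snd c p)" by (simp add: o_def)
qed

lemma hol_sheaf_monoid:
  assumes U: "open U" shows "monoid (hol_sheaf A U)"
proof (rule monoidI)
  fix x y z assume x: "x \<in> carrier (hol_sheaf A U)"
  then have "x \<in> extensional U" by (simp add: hol_sheaf_carrier[OF U])
  then show "\<one>\<^bsub>hol_sheaf A U\<^esub> \<otimes>\<^bsub>hol_sheaf A U\<^esub> x = x" "x \<otimes>\<^bsub>hol_sheaf A U\<^esub> \<one>\<^bsub>hol_sheaf A U\<^esub> = x"
    by (auto simp: hol_sheaf_ops restrict_def fun_eq_iff extensional_def)
  show "x \<otimes>\<^bsub>hol_sheaf A U\<^esub> y \<in> carrier (hol_sheaf A U)" if "y \<in> carrier (hol_sheaf A U)"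
    using hol_sheaf_mult[OF U x that] by (simp add: hol_sheaf_ops)
  show "x \<otimes>\<^bsub>hol_sheaf A U\<^esub> y \<otimes>\<^bsub>hol_sheaf A U\<^esub> z = x \<otimes>\<^bsub>hol_sheaf A U\<^esub> (y \<otimes>\<^bsub>hol_sheaf A U\<^esub> z)"
    by (auto simp: hol_sheaf_ops restrict_def fun_eq_iff mult.assoc)
qed (use hol_sheaf_const[OF U] in \<open>simp add: hol_sheaf_ops\<close>)

lemma hol_sheaf_Units:
  assumes "open U"
  shows "f \<in> Units (hol_sheaf A U) \<longleftrightarrow> f \<in> carrier (hol_sheaf A U) \<and> (\<forall>p\<in>U. f p \<noteq> 0)"
proof
  assume "f \<in> Units (hol_sheaf A U)"
  then obtain g where "f \<in> carrier (hol_sheaf A U)" "(\<lambda>p\<in>U. g p * f p) = (\<lambda>p\<in>U. 1)"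
    unfolding Units_def hol_sheaf_ops by blast
  moreover have "g p * f p = 1" if "p \<in> U" for p using fun_cong[OF calculation(2), of p] that by simp
  ultimately show "f \<in> carrier (hol_sheaf A U) \<and> (\<forall>p\<in>U. f p \<noteq> 0)" by fastforce
next
  assume *: "f \<in> carrier (hol_sheaf A U) \<and> (\<forall>p\<in>U. f p \<noteq> 0)"
  then show "f \<in> Units (hol_sheaf A U)"
    using hol_sheaf_inverse[OF assms, of f] unfolding Units_def hol_sheaf_ops
    by (auto intro!: bexI[of _ "\<lambda>p\<in>U. inverse (f p)"] simp: restrict_def fun_eq_iff)
qed

lemma group_presheaf_hol_units: "group_presheaf euclidean (hol_units A)"
proof (rule group_presheaf.intro)
  fix U :: "'a set" assume U: "openin euclidean U"
  then have oU: "open U" by simp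
  interpret monoid "hol_sheaf A U" by (rule hol_sheaf_monoid[OF oU])
  show "group (hol_units A U)" by (rule units_group)
  show "s \<in> extensional U" if "s \<in> carrier (hol_units A U)" for s
    using that oU by (simp add: units_of_def hol_sheaf_Units hol_sheaf_carrier)
  fix V s t assume V: "openin euclidean V" "V \<subseteq> U" and s: "s \<in> carrier (hol_units A U)"
  then show "restrict s V \<in> carrier (hol_units A V)"
    using hol_sheaf_restrict[of U V s "restrict s V"] oU by (auto simp: units_of_def hol_sheaf_Units)
  show "restrict (s \<otimes>\<^bsub>hol_units A U\<^esub> t) V = restrict s V \<otimes>\<^bsub>hol_units A V\<^esub> restrict t V"
    using V by (auto simp: units_of_def hol_sheaf_ops restrict_def fun_eq_iff)
qed

section \<open>Holomorphic forms, exact forms and the logarithmic derivative\<close>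

lemma hol_forms_carrier:
  assumes "open U"
  shows "\<omega> \<in> carrier (hol_forms A U) \<longleftrightarrow> \<omega> \<in> extensional U \<and> (\<forall>p\<in>U. \<omega> p \<in> covectors_at A p) \<and>
     (\<forall>c\<in>A. \<forall>p\<in>fst c \<inter> U. \<forall>i. holomorphic_at_vec ((\<lambda>q. \<omega> q c $ i) \<circ> chart_inv c) (snd c p))"
  using holomorphic_chart_open_image[OF atlas_chart assms]
  unfolding hol_forms_def holomorphic_map_on_def holomorphic_on_vec_def o_def by auto

lemma hol_forms_ops:
  "\<omega> \<oplus>\<^bsub>hol_forms A U\<^esub> \<eta> = (\<lambda>p\<in>U. \<lambda>c. \<omega> p c + \<eta> p c)" "\<zero>\<^bsub>hol_forms A U\<^esub> = (\<lambda>p\<in>U. \<lambda>c. 0)"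
  "f \<odot>\<^bsub>hol_forms A U\<^esub> \<omega> = (\<lambda>p\<in>U. \<lambda>c. f p *s \<omega> p c)"
  by (simp_all add: hol_forms_def)

lemma hol_forms_restrict:
  assumes "open U" "open V" "V \<subseteq> U" "\<omega> \<in> carrier (hol_forms A U)"
  shows "restrict \<omega> V \<in> carrier (hol_forms A V)"
  unfolding hol_forms_carrier[OF assms(2)]
proof (intro conjI ballI allI)
  fix c p i assume c: "c \<in> A" "p \<in> fst c \<inter> V"
  show "holomorphic_at_vec ((\<lambda>q. restrict \<omega> V q c $ i) \<circ> chart_inv c) (snd c p)"
    by (rule at_chart_cong(1)[OF atlas_chart assms(2), of c p "\<lambda>q. \<omega> q c $ i"])
       (use c assms in \<open>auto simp: hol_forms_carrier\<close>)
qed (use assms in \<open>auto simp: hol_forms_carrier\<close>)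

lemma hol_formsI:
  assumes U: "open U" and cov: "\<And>p. p \<in> U \<Longrightarrow> \<omega> p \<in> covectors_at A p"
    and hol: "\<And>c p i. c \<in> A \<Longrightarrow> p \<in> fst c \<Longrightarrow> p \<in> U \<Longrightarrow> holomorphic_at_vec ((\<lambda>q. \<omega> q c $ i) \<circ> chart_inv c) (snd c p)"
  shows "restrict \<omega> U \<in> carrier (hol_forms A U)"
  unfolding hol_forms_carrier[OF U]
proof (intro conjI ballI allI)
  fix c p i assume c: "c \<in> A" "p \<in> fst c \<inter> U"
  show "holomorphic_at_vec ((\<lambda>q. restrict \<omega> U q c $ i) \<circ> chart_inv c) (snd c p)"
    by (rule at_chart_cong(1)[OF atlas_chart U, of c p "\<lambda>q. \<omega> q c $ i"]) (use c hol in auto)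
qed (use cov in auto)

lemma hol_forms_add:
  assumes "open U" "\<omega> \<in> carrier (hol_forms A U)" "\<eta> \<in> carrier (hol_forms A U)"
  shows "(\<lambda>p\<in>U. \<lambda>c. \<omega> p c + \<eta> p c) \<in> carrier (hol_forms A U)"
proof (rule hol_formsI[OF assms(1)])
  fix c p i assume "c \<in> A" "p \<in> fst c" "p \<in> U"
  then show "holomorphic_at_vec ((\<lambda>q. (\<omega> q c + \<eta> q c) $ i) \<circ> chart_inv c) (snd c p)"
    using assms holomorphic_at_vec_add(1)[of "(\<lambda>q. \<omega> q c $ i) \<circ> chart_inv c" _ "(\<lambda>q. \<eta> q c $ i) \<circ> chart_inv c"]
    by (auto simp: hol_forms_carrier o_def)
qed (use assms in \<open>auto simp: hol_forms_carrier covectors_at_closed\<close>)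

lemma hol_forms_uminus:
  assumes "open U" "\<omega> \<in> carrier (hol_forms A U)"
  shows "(\<lambda>p\<in>U. \<lambda>c. - \<omega> p c) \<in> carrier (hol_forms A U)"
proof (rule hol_formsI[OF assms(1)])
  fix c p i assume "c \<in> A" "p \<in> fst c" "p \<in> U"
  then show "holomorphic_at_vec ((\<lambda>q. (- \<omega> q c) $ i) \<circ> chart_inv c) (snd c p)"
    using assms holomorphic_at_vec_uminus(1)[of "(\<lambda>q. \<omega> q c $ i) \<circ> chart_inv c"]
    by (auto simp: hol_forms_carrier o_def)
qed (use assms in \<open>auto simp: hol_forms_carrier covectors_at_closed\<close>)

lemma hol_forms_zero:
  assumes "open U" shows "(\<lambda>p\<in>U. \<lambda>c. 0) \<in> carrier (hol_forms A U)"
  by (rule hol_formsI[OF assms]) (auto simp: o_def covectors_at_closed holomorphic_at_vec_const)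

lemma hol_forms_smult:
  assumes "open U" "f \<in> carrier (hol_sheaf A U)" "\<omega> \<in> carrier (hol_forms A U)"
  shows "(\<lambda>p\<in>U. \<lambda>c. f p *s \<omega> p c) \<in> carrier (hol_forms A U)"
proof (rule hol_formsI[OF assms(1)])
  fix c p i assume "c \<in> A" "p \<in> fst c" "p \<in> U"
  then show "holomorphic_at_vec ((\<lambda>q. (f q *s \<omega> q c) $ i) \<circ> chart_inv c) (snd c p)"
    using assms holomorphic_at_vec_mult(1)[of "f \<circ> chart_inv c" _ "(\<lambda>q. \<omega> q c $ i) \<circ> chart_inv c"]
    by (auto simp: hol_forms_carrier hol_sheaf_carrier o_def)
qed (use assms in \<open>auto simp: hol_forms_carrier covectors_at_closed\<close>)

lemma group_presheaf_hol_forms: "group_presheaf euclidean (\<lambda>U. add_monoid (hol_forms A U))"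
proof (rule group_presheaf.intro)
  fix U :: "'a set" assume "openin euclidean U"
  then have U: "open U" by simp
  show "group (add_monoid (hol_forms A U))"
  proof (rule groupI)
    fix x assume x: "x \<in> carrier (add_monoid (hol_forms A U))"
    show "\<exists>y\<in>carrier (add_monoid (hol_forms A U)). y \<otimes>\<^bsub>add_monoid (hol_forms A U)\<^esub> x = \<one>\<^bsub>add_monoid (hol_forms A U)\<^esub>"
      using hol_forms_uminus[OF U, of x] x
      by (intro bexI[of _ "\<lambda>p\<in>U. \<lambda>c. - x p c"]) (auto simp: hol_forms_ops restrict_def fun_eq_iff)
    show "\<one>\<^bsub>add_monoid (hol_forms A U)\<^esub> \<otimes>\<^bsub>add_monoid (hol_forms A U)\<^esub> x = x"
      using x U by (auto simp: hol_forms_ops hol_forms_carrier restrict_def fun_eq_iff extensional_def)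
    show "x \<otimes>\<^bsub>add_monoid (hol_forms A U)\<^esub> y \<in> carrier (add_monoid (hol_forms A U))"
      if "y \<in> carrier (add_monoid (hol_forms A U))" for y
      using x that hol_forms_add[OF U, of x y] by (simp add: hol_forms_ops)
  next
    show "\<one>\<^bsub>add_monoid (hol_forms A U)\<^esub> \<in> carrier (add_monoid (hol_forms A U))"
      using hol_forms_zero[OF U] by (simp add: hol_forms_ops)
  qed (auto simp: hol_forms_ops restrict_def fun_eq_iff add.assoc)
  show "s \<in> extensional U" if "s \<in> carrier (add_monoid (hol_forms A U))" for s
    using that U by (simp add: hol_forms_carrier)
  fix V s t assume V: "openin euclidean V" "V \<subseteq> U" and s: "s \<in> carrier (add_monoid (hol_forms A U))"
  then show "restrict s V \<in> carrier (add_monoid (hol_forms A V))"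
    using hol_forms_restrict[of U V s] U by auto
  show "restrict (s \<otimes>\<^bsub>add_monoid (hol_forms A U)\<^esub> t) V = restrict s V \<otimes>\<^bsub>add_monoid (hol_forms A V)\<^esub> restrict t V"
    using V by (auto simp: hol_forms_ops restrict_def fun_eq_iff)
qed

lemma ext_deriv_restrict:
  assumes "open V" "V \<subseteq> U" "\<And>q. q \<in> V \<Longrightarrow> f q = g q"
  shows "restrict (ext_deriv A U f) V = ext_deriv A V g"
  using at_chart_cong(2)[OF atlas_chart assms(1) _ _ assms(3), of _ _ ] assms(2)
  by (auto simp: ext_deriv_def restrict_def fun_eq_iff vec_eq_iff subset_iff)

text \<open>The transformation law is the chain rule. Holomorphy of the coefficients is the point at
  which partial derivatives of holomorphic functions have to be holomorphic again.\<close>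

lemma ext_deriv_hol_forms:
  assumes U: "open U" and f: "f \<in> carrier (hol_sheaf A U)"
  shows "ext_deriv A U f \<in> carrier (hol_forms A U)"
  unfolding ext_deriv_def
proof (rule hol_formsI[OF U])
  fix p assume p: "p \<in> U"
  have hol: "holomorphic_at_vec (f \<circ> chart_inv c) (snd c p)" if "c \<in> A" "p \<in> fst c" for c
    using f that p U by (auto simp: hol_sheaf_carrier)
  show "(\<lambda>c. if c \<in> A \<and> p \<in> fst c then \<chi> i. d_dz i (f \<circ> chart_inv c) (snd c p) else 0) \<in> covectors_at A p"
    unfolding covectors_at_def
  proof (intro CollectI conjI ballI impI allI)
    fix c c' i assume c: "c \<in> A" "c' \<in> A" "p \<in> fst c \<inter> fst c'"
    from chart_change(2)[OF atlas_chart atlas_chart atlas_transition, of c c' p f i] c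
      holomorphic_at_vec_differentiable[OF hol, of c']
    show "(if c \<in> A \<and> p \<in> fst c then \<chi> i. d_dz i (f \<circ> chart_inv c) (snd c p) else 0) $ i =
        (\<Sum>j\<in>UNIV. (if c' \<in> A \<and> p \<in> fst c' then \<chi> i. d_dz i (f \<circ> chart_inv c') (snd c' p) else 0) $ j *
           d_dz i (\<lambda>z. snd c' (chart_inv c z) $ j) (snd c p))"
      by simp
  qed auto
next
  fix c p i assume c: "c \<in> A" "p \<in> fst c" "p \<in> U"
  let ?S = "snd c ` (fst c \<inter> U)"
  have S: "open ?S" "snd c p \<in> ?S" using holomorphic_chart_open_image[OF atlas_chart U] c by auto
  have "holomorphic_on_vec (f \<circ> chart_inv c) ?S"
    using f c S by (auto simp: hol_sheaf_carrier[OF U] holomorphic_on_vec_def)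
  then have "holomorphic_at_vec (d_dz i (f \<circ> chart_inv c)) (snd c p)"
    using holomorphic_d_dz S unfolding holomorphic_on_vec_def by blast
  then show "holomorphic_at_vec ((\<lambda>q. (if c \<in> A \<and> q \<in> fst c then \<chi> i. d_dz i (f \<circ> chart_inv c) (snd c q) else 0) $ i) \<circ> chart_inv c) (snd c p)"
    by (rule holomorphic_at_vec_cong[OF S, rotated]) (use c atlasD(4) in auto)
qed

lemma hol_sheaf_continuous:
  assumes "open U" "f \<in> carrier (hol_sheaf A U)" "c \<in> A"
  shows "continuous_on (fst c \<inter> U) f"
proof -
  have "continuous_on (snd c ` (fst c \<inter> U)) (f \<circ> chart_inv c)"
    using holomorphic_at_vec_isCont[OF hol_sheafD[OF assms]] by (intro continuous_at_imp_continuous_on) blast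
  moreover have "continuous_on (fst c \<inter> U) (snd c)"
    using atlasD(2)[OF assms(3)] continuous_on_subset by blast
  ultimately have "continuous_on (fst c \<inter> U) (\<lambda>q. (f \<circ> chart_inv c) (snd c q))"
    by (rule continuous_on_compose2) auto
  then show ?thesis
    by (rule continuous_on_eq) (use atlasD(4)[OF assms(3)] in auto)
qed

lemma exact_forms_carrier:
  "\<omega> \<in> carrier (exact_forms A U) \<longleftrightarrow> \<omega> \<in> carrier (hol_forms A U) \<and> (\<forall>p\<in>U. \<exists>V f. open V \<and> p \<in> V \<and> V \<subseteq> U \<and>
        f \<in> carrier (hol_sheaf A V) \<and> restrict \<omega> V = ext_deriv A V f)"
  unfolding exact_forms_def by simp

lemma exact_forms_ops:
  "\<omega> \<oplus>\<^bsub>exact_forms A U\<^esub> \<eta> = (\<lambda>p\<in>U. \<lambda>c. \<omega> p c + \<eta> p c)" "\<zero>\<^bsub>exact_forms A U\<^esub> = (\<lambda>p\<in>U. \<lambda>c. 0)"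
  by (simp_all add: hol_forms_def exact_forms_def)

lemma ext_deriv_add:
  assumes "open U" "f \<in> carrier (hol_sheaf A U)" "g \<in> carrier (hol_sheaf A U)"
  shows "ext_deriv A U (\<lambda>p\<in>U. f p + g p) = (\<lambda>p\<in>U. \<lambda>c. ext_deriv A U f p c + ext_deriv A U g p c)"
proof -
  have "d_dz i ((\<lambda>p\<in>U. f p + g p) \<circ> chart_inv c) (snd c p) =
      d_dz i (f \<circ> chart_inv c) (snd c p) + d_dz i (g \<circ> chart_inv c) (snd c p)"
    if "c \<in> A" "p \<in> fst c" "p \<in> U" for c p i
    using at_chart_cong(2)[OF atlas_chart assms(1), of c p "\<lambda>p. f p + g p" "\<lambda>p\<in>U. f p + g p"]
      holomorphic_at_vec_add(2)[of "f \<circ> chart_inv c" "snd c p" "g \<circ> chart_inv c"] assms that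
    by (auto simp: hol_sheaf_carrier o_def)
  then show ?thesis by (auto simp: ext_deriv_def restrict_def fun_eq_iff vec_eq_iff)
qed

lemma ext_deriv_uminus:
  assumes "open U" "f \<in> carrier (hol_sheaf A U)"
  shows "ext_deriv A U (\<lambda>p\<in>U. - f p) = (\<lambda>p\<in>U. \<lambda>c. - ext_deriv A U f p c)"
proof -
  have "d_dz i ((\<lambda>p\<in>U. - f p) \<circ> chart_inv c) (snd c p) = - d_dz i (f \<circ> chart_inv c) (snd c p)"
    if "c \<in> A" "p \<in> fst c" "p \<in> U" for c p i
    using at_chart_cong(2)[OF atlas_chart assms(1), of c p "\<lambda>p. - f p" "\<lambda>p\<in>U. - f p"]
      holomorphic_at_vec_uminus(2)[of "f \<circ> chart_inv c" "snd c p"] assms that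
    by (auto simp: hol_sheaf_carrier o_def)
  then show ?thesis by (auto simp: ext_deriv_def restrict_def fun_eq_iff vec_eq_iff)
qed

lemma ext_deriv_const:
  assumes "open U" shows "ext_deriv A U (\<lambda>p\<in>U. a) = (\<lambda>p\<in>U. \<lambda>c. 0)"
proof -
  have "d_dz i ((\<lambda>p\<in>U. a) \<circ> chart_inv c) (snd c p) = 0" if "c \<in> A" "p \<in> fst c" "p \<in> U" for c p i
    using at_chart_cong(2)[OF atlas_chart assms(1), of c p "\<lambda>p. a" "\<lambda>p\<in>U. a" i, symmetric] that
    by (simp add: o_def holomorphic_at_vec_const)
  then show ?thesis by (auto simp: ext_deriv_def restrict_def fun_eq_iff vec_eq_iff)
qed

text \<open>Local primitives can be negated, restricted, and added on the intersection of their
  domains.\<close>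

lemma group_presheaf_exact_forms: "group_presheaf euclidean (\<lambda>U. add_monoid (exact_forms A U))"
proof (rule group_presheaf.intro)
  fix U :: "'a set" assume "openin euclidean U"
  then have U: "open U" by simp
  show "group (add_monoid (exact_forms A U))"
  proof (rule groupI)
    fix x assume x: "x \<in> carrier (add_monoid (exact_forms A U))"
    then have xh: "x \<in> carrier (hol_forms A U)" by (simp add: exact_forms_carrier)
    show "\<exists>y\<in>carrier (add_monoid (exact_forms A U)). y \<otimes>\<^bsub>add_monoid (exact_forms A U)\<^esub> x = \<one>\<^bsub>add_monoid (exact_forms A U)\<^esub>"
    proof
      have "\<exists>V f. open V \<and> p \<in> V \<and> V \<subseteq> U \<and> f \<in> carrier (hol_sheaf A V) \<and>
          restrict (\<lambda>p\<in>U. \<lambda>c. - x p c) V = ext_deriv A V f" if p: "p \<in> U" for p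
      proof -
        obtain V f where V: "open V" "p \<in> V" "V \<subseteq> U" "f \<in> carrier (hol_sheaf A V)" "restrict x V = ext_deriv A V f"
          using x p by (auto simp: exact_forms_carrier)
        have "restrict (\<lambda>p\<in>U. \<lambda>c. - x p c) V = ext_deriv A V (\<lambda>p\<in>V. - f p)"
          unfolding ext_deriv_uminus[OF V(1,4)] V(5)[symmetric] using V(3) by (auto simp: restrict_def fun_eq_iff)
        then show ?thesis using V hol_sheaf_uminus[OF V(1,4)] by blast
      qed
      then show "(\<lambda>p\<in>U. \<lambda>c. - x p c) \<in> carrier (add_monoid (exact_forms A U))"
        using hol_forms_uminus[OF U xh] by (simp add: exact_forms_carrier)
    qed (auto simp: exact_forms_ops restrict_def fun_eq_iff)
    show "\<one>\<^bsub>add_monoid (exact_forms A U)\<^esub> \<otimes>\<^bsub>add_monoid (exact_forms A U)\<^esub> x = x"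
      using xh U by (auto simp: exact_forms_ops hol_forms_carrier restrict_def fun_eq_iff extensional_def)
    fix y assume y: "y \<in> carrier (add_monoid (exact_forms A U))"
    then have yh: "y \<in> carrier (hol_forms A U)" by (simp add: exact_forms_carrier)
    have "\<exists>V f. open V \<and> p \<in> V \<and> V \<subseteq> U \<and> f \<in> carrier (hol_sheaf A V) \<and>
          restrict (\<lambda>p\<in>U. \<lambda>c. x p c + y p c) V = ext_deriv A V f" if p: "p \<in> U" for p
    proof -
      obtain V f where V: "open V" "p \<in> V" "V \<subseteq> U" "f \<in> carrier (hol_sheaf A V)" "restrict x V = ext_deriv A V f"
        using x p by (auto simp: exact_forms_carrier)
      obtain V' f' where V': "open V'" "p \<in> V'" "V' \<subseteq> U" "f' \<in> carrier (hol_sheaf A V')" "restrict y V' = ext_deriv A V' f'"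
        using y p by (auto simp: exact_forms_carrier)
      let ?V = "V \<inter> V'"
      have oV: "open ?V" using V V' by auto
      have f: "restrict f ?V \<in> carrier (hol_sheaf A ?V)" "restrict f' ?V \<in> carrier (hol_sheaf A ?V)"
        using hol_sheaf_restrict[OF V(1) oV _ V(4)] hol_sheaf_restrict[OF V'(1) oV _ V'(4)] by auto
      have x: "restrict x ?V = ext_deriv A ?V (restrict f ?V)"
      proof -
        have "restrict x ?V = restrict (restrict x V) ?V" by (simp add: restrict_restrict inf.absorb2)
        then show ?thesis unfolding V(5) using ext_deriv_restrict[OF oV, of V f "restrict f ?V"] by simp
      qed
      have y: "restrict y ?V = ext_deriv A ?V (restrict f' ?V)"
      proof -
        have "restrict y ?V = restrict (restrict y V') ?V" by (simp add: restrict_restrict inf.absorb2)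
        then show ?thesis unfolding V'(5) using ext_deriv_restrict[OF oV, of V' f' "restrict f' ?V"] by simp
      qed
      have "restrict (\<lambda>p\<in>U. \<lambda>c. x p c + y p c) ?V = (\<lambda>p\<in>?V. \<lambda>c. restrict x ?V p c + restrict y ?V p c)"
        using V by (auto simp: fun_eq_iff)
      then show ?thesis using oV V V' ext_deriv_add[OF oV f] hol_sheaf_add[OF oV f] unfolding x y by (intro exI[of _ ?V]) auto
    qed
    then show "x \<otimes>\<^bsub>add_monoid (exact_forms A U)\<^esub> y \<in> carrier (add_monoid (exact_forms A U))"
      using hol_forms_add[OF U xh yh] by (simp add: exact_forms_carrier exact_forms_ops)
  next
    have "\<exists>V f. open V \<and> p \<in> V \<and> V \<subseteq> U \<and> f \<in> carrier (hol_sheaf A V) \<and>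
        restrict (\<lambda>p\<in>U. \<lambda>c. 0) V = ext_deriv A V f" if "p \<in> U" for p
      using U that hol_sheaf_const[OF U, of 0] ext_deriv_const[OF U, of 0] by (intro exI[of _ U] exI[of _ "\<lambda>p\<in>U. 0"]) auto
    then show "\<one>\<^bsub>add_monoid (exact_forms A U)\<^esub> \<in> carrier (add_monoid (exact_forms A U))"
      using hol_forms_zero[OF U] by (simp add: exact_forms_carrier exact_forms_ops)
  qed (auto simp: exact_forms_ops restrict_def fun_eq_iff add.assoc)
  show "s \<in> extensional U" if "s \<in> carrier (add_monoid (exact_forms A U))" for s
    using that U by (simp add: exact_forms_carrier hol_forms_carrier)
  fix V s t assume V: "openin euclidean V" "V \<subseteq> U" and s: "s \<in> carrier (add_monoid (exact_forms A U))"
  have "\<exists>V' f. open V' \<and> p \<in> V' \<and> V' \<subseteq> V \<and> f \<in> carrier (hol_sheaf A V') \<and>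
          restrict (restrict s V) V' = ext_deriv A V' f" if p: "p \<in> V" for p
  proof -
    obtain Z f where Z: "open Z" "p \<in> Z" "Z \<subseteq> U" "f \<in> carrier (hol_sheaf A Z)" "restrict s Z = ext_deriv A Z f"
      using s subsetD[OF V(2) p] by (auto simp: exact_forms_carrier)
    let ?V = "V \<inter> Z"
    have oV: "open ?V" using V Z by auto
    have "restrict (restrict s V) ?V = restrict (restrict s Z) ?V" by (simp add: restrict_restrict inf.absorb2)
    then show ?thesis unfolding Z(5)
      using ext_deriv_restrict[OF oV, of Z f "restrict f ?V"] hol_sheaf_restrict[OF Z(1) oV _ Z(4), of "restrict f ?V"] p Z oV
      by (intro exI[of _ ?V] exI[of _ "restrict f ?V"]) auto
  qed
  then show "restrict s V \<in> carrier (add_monoid (exact_forms A V))"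
    using hol_forms_restrict[of U V s] U V s by (auto simp: exact_forms_carrier)
  show "restrict (s \<otimes>\<^bsub>add_monoid (exact_forms A U)\<^esub> t) V = restrict s V \<otimes>\<^bsub>add_monoid (exact_forms A V)\<^esub> restrict t V"
    using V by (auto simp: exact_forms_ops restrict_def fun_eq_iff)
qed

lemma presheaf_hom_exact_inclusion:
  "presheaf_hom euclidean (\<lambda>U. add_monoid (exact_forms A U)) (\<lambda>U. add_monoid (hol_forms A U)) (\<lambda>U \<omega>. \<omega>)"
proof -
  interpret E: group_presheaf euclidean "\<lambda>U. add_monoid (exact_forms A U)" by (rule group_presheaf_exact_forms)
  interpret H: group_presheaf euclidean "\<lambda>U. add_monoid (hol_forms A U)" by (rule group_presheaf_hol_forms)
  show ?thesis by unfold_locales (auto simp: exact_forms_carrier exact_forms_ops hol_forms_ops)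
qed

text \<open>The local primitive is a branch of log f.\<close>

lemma dlog_exact:
  assumes U: "open U" and f: "f \<in> carrier (hol_sheaf A U)" and nz: "\<And>p. p \<in> U \<Longrightarrow> f p \<noteq> 0"
  shows "dlog A U f \<in> carrier (exact_forms A U)"
  unfolding exact_forms_carrier
proof (intro conjI ballI)
  have i: "(\<lambda>p\<in>U. inverse (f p)) \<in> carrier (hol_sheaf A U)" using hol_sheaf_inverse[OF U f nz] .
  have "dlog A U f = (\<lambda>p\<in>U. \<lambda>c. (\<lambda>p\<in>U. inverse (f p)) p *s ext_deriv A U f p c)"
    by (auto simp: dlog_def inverse_eq_divide)
  then show "dlog A U f \<in> carrier (hol_forms A U)"
    using hol_forms_smult[OF U i ext_deriv_hol_forms[OF U f]] by simp
  fix p assume p: "p \<in> U"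
  obtain c0 where c0: "c0 \<in> A" "p \<in> fst c0" by (rule atlas_cover)
  \<comment> \<open>Here f / f p stays in the right half plane, where \<open>Ln\<close> is
    holomorphic; the constant divisor does not change the logarithmic differential. The chart
    \<open>c0\<close> provides an open set on which \<open>f\<close> is known to be
    continuous.\<close>
  define V where "V = fst c0 \<inter> U \<inter> (\<lambda>q. f q / f p) -` {w. Re w > 0}"
  have "continuous_on (fst c0 \<inter> U) (\<lambda>q. f q / f p)"
    using hol_sheaf_continuous[OF U f c0(1)] nz[OF p] by (intro continuous_on_divide) auto
  then have V: "open V" unfolding V_def
    using atlasD(1)[OF c0(1)] U by (intro continuous_open_preimage open_halfspace_Re_gt) auto
  have pV: "p \<in> V" "V \<subseteq> U" using p c0 nz[OF p] by (auto simp: V_def)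
  define g where "g = (\<lambda>q\<in>V. Ln (f q / f p))"
  have der: "((\<lambda>w. Ln (w / f p)) has_field_derivative 1 / f q) (at (f q))" if "q \<in> V" for q
  proof -
    have "f q / f p \<notin> \<real>\<^sub>\<le>\<^sub>0" using that by (auto simp: V_def complex_nonpos_Reals_iff)
    then show ?thesis using nz[OF p] nz[of q] that pV
      by (auto intro!: derivative_eq_intros simp: field_simps)
  qed
  have hol: "holomorphic_at_vec (g \<circ> chart_inv c) (snd c q)"
    "d_dz i (g \<circ> chart_inv c) (snd c q) = 1 / f q * d_dz i (f \<circ> chart_inv c) (snd c q)"
    if "c \<in> A" "q \<in> fst c" "q \<in> V" for c q i
  proof -
    have e: "(f \<circ> chart_inv c) (snd c q) = f q" using atlasD(4)[of c q] that by simp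
    have h: "holomorphic_at_vec (f \<circ> chart_inv c) (snd c q)"
      using f that pV by (auto simp: hol_sheaf_carrier[OF U])
    note X = holomorphic_at_vec_field_compose[OF h, unfolded e, OF der[OF that(3)]]
    show "holomorphic_at_vec (g \<circ> chart_inv c) (snd c q)"
      by (rule at_chart_cong(1)[OF atlas_chart V, of c q "\<lambda>q. Ln (f q / f p)"])
         (use X(1) that in \<open>auto simp: g_def o_def\<close>)
    show "d_dz i (g \<circ> chart_inv c) (snd c q) = 1 / f q * d_dz i (f \<circ> chart_inv c) (snd c q)"
      using X(2)[of i] at_chart_cong(2)[OF atlas_chart V, of c q "\<lambda>q. Ln (f q / f p)" g i] that
      by (simp add: g_def o_def)
  qed
  have "g \<in> carrier (hol_sheaf A V)" using hol(1) by (simp add: hol_sheaf_carrier[OF V] g_def)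
  moreover have "restrict (dlog A U f) V = ext_deriv A V g"
    using hol(2) pV by (auto simp: dlog_def ext_deriv_def restrict_def fun_eq_iff vec_eq_iff subset_iff)
  ultimately show "\<exists>V g. open V \<and> p \<in> V \<and> V \<subseteq> U \<and> g \<in> carrier (hol_sheaf A V) \<and> restrict (dlog A U f) V = ext_deriv A V g"
    using V pV by blast
qed

lemma presheaf_hom_dlog: "presheaf_hom euclidean (hol_units A) (\<lambda>U. add_monoid (exact_forms A U)) (dlog A)"
proof -
  interpret E: group_presheaf euclidean "\<lambda>U. add_monoid (exact_forms A U)" by (rule group_presheaf_exact_forms)
  interpret H: group_presheaf euclidean "hol_units A" by (rule group_presheaf_hol_units)
  have un: "s \<in> carrier (hol_units A U) \<longleftrightarrow> s \<in> carrier (hol_sheaf A U) \<and> (\<forall>p\<in>U. s p \<noteq> 0)" if "open U" for s U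
    using that by (simp add: units_of_def hol_sheaf_Units)
  show ?thesis
  proof
    fix U :: "'a set" and s t assume "openin euclidean U" and s: "s \<in> carrier (hol_units A U)"
    then have U: "open U" by simp
    show "dlog A U s \<in> carrier (add_monoid (exact_forms A U))"
      using dlog_exact[OF U] s un[OF U] by simp
    assume t: "t \<in> carrier (hol_units A U)"
    have "d_dz i ((\<lambda>p\<in>U. s p * t p) \<circ> chart_inv c) (snd c p) =
        d_dz i (s \<circ> chart_inv c) (snd c p) * t p + s p * d_dz i (t \<circ> chart_inv c) (snd c p)"
      if "c \<in> A" "p \<in> fst c" "p \<in> U" for c p i
      using at_chart_cong(2)[OF atlas_chart U, of c p "\<lambda>p. s p * t p" "\<lambda>p\<in>U. s p * t p"]
        holomorphic_at_vec_mult(2)[of "s \<circ> chart_inv c" "snd c p" "t \<circ> chart_inv c"] s t that atlasD(4)[of c p]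
      by (auto simp: un[OF U] hol_sheaf_carrier[OF U] o_def)
    moreover have "s p \<noteq> 0" "t p \<noteq> 0" if "p \<in> U" for p using s t that by (auto simp: un[OF U])
    ultimately show "dlog A U (s \<otimes>\<^bsub>hol_units A U\<^esub> t) = dlog A U s \<otimes>\<^bsub>add_monoid (exact_forms A U)\<^esub> dlog A U t"
      by (auto simp: units_of_def hol_sheaf_ops exact_forms_ops dlog_def ext_deriv_def restrict_def fun_eq_iff
         vec_eq_iff field_simps)
  next
    fix U V :: "'a set" and s assume *: "openin euclidean U" "openin euclidean V" "V \<subseteq> U"
    then show "restrict (dlog A U s) V = dlog A V (restrict s V)"
      using ext_deriv_restrict[of V U s "restrict s V"]
      by (auto simp: dlog_def restrict_def fun_eq_iff subset_iff split: if_splits)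
  qed
qed

end


section \<open>Tensor products and inverse images of modules\<close>

text \<open>Closure under the additions and the scalar actions is what puts the bilinearity
  relations into the free Abelian group.\<close>

locale tensor_pair =
  fixes R :: "('r, 'x) ring_scheme" and M :: "('r, 'm) module" and N :: "('r, 'k) module"
  assumes M_add: "x \<in> carrier M \<Longrightarrow> x' \<in> carrier M \<Longrightarrow> x \<oplus>\<^bsub>M\<^esub> x' \<in> carrier M"
    and N_add: "y \<in> carrier N \<Longrightarrow> y' \<in> carrier N \<Longrightarrow> y \<oplus>\<^bsub>N\<^esub> y' \<in> carrier N"
    and M_smult: "r \<in> carrier R \<Longrightarrow> x \<in> carrier M \<Longrightarrow> r \<odot>\<^bsub>M\<^esub> x \<in> carrier M"
    and N_smult: "r \<in> carrier R \<Longrightarrow> y \<in> carrier N \<Longrightarrow> r \<odot>\<^bsub>N\<^esub> y \<in> carrier N"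
begin

abbreviation "FAG \<equiv> free_Abelian_group (carrier M \<times> carrier N)"
abbreviation "sub \<equiv> tensor_subgroup R M N"
abbreviation "cls \<equiv> tensor_class R M N"

lemma frag_carrier: "x \<in> carrier M \<Longrightarrow> y \<in> carrier N \<Longrightarrow> frag_of (x, y) \<in> carrier FAG"
  by simp

lemma FAG_closed: "u \<in> carrier FAG \<Longrightarrow> v \<in> carrier FAG \<Longrightarrow> u + v \<in> carrier FAG"
  "u \<in> carrier FAG \<Longrightarrow> v \<in> carrier FAG \<Longrightarrow> u - v \<in> carrier FAG" "0 \<in> carrier FAG"
  using keys_add[of u v] keys_diff[of u v] by auto

lemma sub_group: "subgroup sub FAG"
  unfolding tensor_subgroup_def
proof (rule group.generate_is_subgroup)
  show "tensor_relations R M N \<subseteq> carrier FAG"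
    unfolding tensor_relations_def using M_add N_add M_smult N_smult
    by (auto intro!: FAG_closed frag_carrier)
qed simp

lemma sub_closed: "0 \<in> sub" "u \<in> sub \<Longrightarrow> v \<in> sub \<Longrightarrow> u + v \<in> sub" "u \<in> sub \<Longrightarrow> - u \<in> sub"
proof -
  interpret subgroup sub FAG by (rule sub_group)
  show "0 \<in> sub" using one_closed by simp
  show "u \<in> sub \<Longrightarrow> v \<in> sub \<Longrightarrow> u + v \<in> sub" using m_closed[of u v] by simp
  assume u: "u \<in> sub"
  have "inv\<^bsub>FAG\<^esub> u = - u" using mem_carrier[OF u] by (simp add: inv_free_Abelian_group)
  then show "- u \<in> sub" using m_inv_closed[OF u] by simp
qed

text \<open>Equality of tensors, expressed on representatives in the free Abelian group so that sums
  can be manipulated without cosets.\<close>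

definition teq (infix "\<doteq>" 50) where "u \<doteq> v \<longleftrightarrow> u - v \<in> sub"

lemma teq_refl: "u \<doteq> u" by (simp add: teq_def sub_closed)

lemma teq_sym: "u \<doteq> v \<Longrightarrow> v \<doteq> u" using sub_closed(3)[of "u - v"] by (simp add: teq_def)

lemma teq_trans [trans]: "u \<doteq> v \<Longrightarrow> v \<doteq> w \<Longrightarrow> u \<doteq> w"
  using sub_closed(2)[of "u - v" "v - w"] by (simp add: teq_def)

lemma teq_add: "u \<doteq> v \<Longrightarrow> u' \<doteq> v' \<Longrightarrow> u + u' \<doteq> v + v'"
  using sub_closed(2)[of "u - v" "u' - v'"] by (simp add: teq_def algebra_simps)

lemma teq_sum: "finite I \<Longrightarrow> (\<And>i. i \<in> I \<Longrightarrow> f i \<doteq> g i) \<Longrightarrow> sum f I \<doteq> sum g I"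
  by (induction I rule: finite_induct) (auto intro: teq_add teq_refl)

lemma cls_eq: "cls u = {t + u | t. t \<in> sub}"
  unfolding tensor_class_def r_coset_def by auto

lemma cls_eqI: assumes "u \<doteq> v" shows "cls u = cls v"
proof -
  have "cls u \<subseteq> cls v" if "u \<doteq> v" for u v
  proof
    fix w assume "w \<in> cls u"
    then obtain t where t: "t \<in> sub" "w = t + u" by (auto simp: cls_eq)
    then have "w = (t + (u - v)) + v" by simp
    moreover have "t + (u - v) \<in> sub" using that t sub_closed(2) by (simp add: teq_def)
    ultimately show "w \<in> cls v" unfolding cls_eq by blast
  qed
  then show ?thesis using assms teq_sym by blast
qed

lemma sub_normal: "sub \<lhd> FAG"
  using comm_group.normal_iff_subgroup[OF abelian_free_Abelian_group] sub_group by blast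

lemma tensor_group: "group (tensor_product R M N)"
  unfolding tensor_product_def by (rule normal.factorgroup_is_group[OF sub_normal])

lemma cls_carrier: "u \<in> carrier FAG \<Longrightarrow> cls u \<in> carrier (tensor_product R M N)"
  unfolding tensor_product_def tensor_class_def FactGroup_def RCOSETS_def by auto

lemma cls_mult: "cls u \<otimes>\<^bsub>tensor_product R M N\<^esub> cls v = cls (u + v)"
proof -
  have "cls u \<otimes>\<^bsub>tensor_product R M N\<^esub> cls v = {x + y | x y. x \<in> cls u \<and> y \<in> cls v}"
    by (auto simp: tensor_product_def FactGroup_def set_mult_def)
  also have "\<dots> = cls (u + v)"
  proof (intro equalityI subsetI)
    fix w assume "w \<in> {x + y | x y. x \<in> cls u \<and> y \<in> cls v}"
    then obtain t t' where "t \<in> sub" "t' \<in> sub" "w = (t + t') + (u + v)" by (auto simp: cls_eq algebra_simps)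
    then show "w \<in> cls (u + v)" unfolding cls_eq using sub_closed(2) by blast
  next
    fix w assume "w \<in> cls (u + v)"
    then obtain t where t: "t \<in> sub" "w = t + (u + v)" by (auto simp: cls_eq)
    then have "w = (t + u) + (0 + v)" by simp
    moreover have "t + u \<in> cls u" "0 + v \<in> cls v" unfolding cls_eq using t sub_closed(1) by blast+
    ultimately show "w \<in> {x + y | x y. x \<in> cls u \<and> y \<in> cls v}" by blast
  qed
  finally show ?thesis .
qed

lemma cls_one: "\<one>\<^bsub>tensor_product R M N\<^esub> = cls 0"
  by (auto simp: tensor_product_def FactGroup_def cls_eq)

lemma teq_relations:
  "x \<in> carrier M \<Longrightarrow> x' \<in> carrier M \<Longrightarrow> y \<in> carrier N \<Longrightarrow> frag_of (x \<oplus>\<^bsub>M\<^esub> x', y) \<doteq> frag_of (x, y) + frag_of (x', y)"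
  "x \<in> carrier M \<Longrightarrow> y \<in> carrier N \<Longrightarrow> y' \<in> carrier N \<Longrightarrow> frag_of (x, y \<oplus>\<^bsub>N\<^esub> y') \<doteq> frag_of (x, y) + frag_of (x, y')"
  "r \<in> carrier R \<Longrightarrow> x \<in> carrier M \<Longrightarrow> y \<in> carrier N \<Longrightarrow> frag_of (r \<odot>\<^bsub>M\<^esub> x, y) \<doteq> frag_of (x, r \<odot>\<^bsub>N\<^esub> y)"
  unfolding teq_def tensor_subgroup_def
  by (rule generate.incl; force simp: tensor_relations_def diff_diff_eq)+

text \<open>An element with x + x = x stands for zero: additivity gives t = t + t for the tensor t
  it forms, modulo the relations.\<close>

lemma teq_zero:
  "x \<in> carrier M \<Longrightarrow> x \<oplus>\<^bsub>M\<^esub> x = x \<Longrightarrow> y \<in> carrier N \<Longrightarrow> frag_of (x, y) \<doteq> 0"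
  "x \<in> carrier M \<Longrightarrow> y \<oplus>\<^bsub>N\<^esub> y = y \<Longrightarrow> y \<in> carrier N \<Longrightarrow> frag_of (x, y) \<doteq> 0"
  using teq_relations(1)[of x x y] teq_relations(2)[of x y y] sub_closed(3)[of "- frag_of (x, y)"]
  by (auto simp: teq_def)

end

section \<open>The structure sheaf of Y, coordinate functions and coordinate differentials\<close>

context complex_mfd
begin

lemma sub_hol_carrier:
  "f \<in> carrier (sub_hol_sheaf A V) \<longleftrightarrow> f \<in> extensional V \<and> (\<forall>p\<in>V. \<exists>U. open U \<and> p \<in> U \<and>
        (\<exists>g\<in>carrier (hol_sheaf A U). \<forall>q\<in>U \<inter> V. f q = g q))"
  by (simp add: sub_hol_sheaf_def function_ring_def)

lemma sub_hol_ops: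
  "f \<otimes>\<^bsub>sub_hol_sheaf A U\<^esub> g = (\<lambda>p\<in>U. f p * g p)" "\<one>\<^bsub>sub_hol_sheaf A U\<^esub> = (\<lambda>p\<in>U. 1)"
  "f \<oplus>\<^bsub>sub_hol_sheaf A U\<^esub> g = (\<lambda>p\<in>U. f p + g p)" "\<zero>\<^bsub>sub_hol_sheaf A U\<^esub> = (\<lambda>p\<in>U. 0)"
  by (simp_all add: sub_hol_sheaf_def function_ring_def)

lemma sub_holI:
  assumes "\<And>p. p \<in> V \<Longrightarrow> \<exists>U g. open U \<and> p \<in> U \<and> g \<in> carrier (hol_sheaf A U) \<and> (\<forall>q\<in>U \<inter> V. f q = g q)"
  shows "restrict f V \<in> carrier (sub_hol_sheaf A V)"
  unfolding sub_hol_carrier using assms by (fastforce)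

lemma sub_hol_ext:
  assumes "f \<in> carrier (sub_hol_sheaf A V)" "p \<in> V"
  obtains U g where "open U" "p \<in> U" "g \<in> carrier (hol_sheaf A U)" "\<And>q. q \<in> U \<inter> V \<Longrightarrow> f q = g q"
  using assms unfolding sub_hol_carrier by blast

text \<open>Local extensions to the ambient manifold are combined on the intersection of their
  domains.\<close>

lemma sub_hol_binary:
  assumes f: "f \<in> carrier (sub_hol_sheaf A V)" "g \<in> carrier (sub_hol_sheaf A W)" and Z: "Z \<subseteq> V \<inter> W"
    and op: "\<And>U a b. open U \<Longrightarrow> a \<in> carrier (hol_sheaf A U) \<Longrightarrow> b \<in> carrier (hol_sheaf A U) \<Longrightarrow>
      (\<lambda>p\<in>U. h (a p) (b p)) \<in> carrier (hol_sheaf A U)"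
  shows "(\<lambda>p\<in>Z. h (f p) (g p)) \<in> carrier (sub_hol_sheaf A Z)"
proof (rule sub_holI)
  fix p assume p: "p \<in> Z"
  obtain U a where U: "open U" "p \<in> U" "a \<in> carrier (hol_sheaf A U)" "\<And>q. q \<in> U \<inter> V \<Longrightarrow> f q = a q"
    using sub_hol_ext[OF f(1), of p] p Z by blast
  obtain U' b where U': "open U'" "p \<in> U'" "b \<in> carrier (hol_sheaf A U')" "\<And>q. q \<in> U' \<inter> W \<Longrightarrow> g q = b q"
    using sub_hol_ext[OF f(2), of p] p Z by blast
  let ?U = "U \<inter> U'"
  have o: "open ?U" using U U' by auto
  have "restrict a ?U \<in> carrier (hol_sheaf A ?U)" "restrict b ?U \<in> carrier (hol_sheaf A ?U)"
    using hol_sheaf_restrict[OF U(1) o _ U(3)] hol_sheaf_restrict[OF U'(1) o _ U'(3)] by auto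
  from op[OF o this] show "\<exists>U k. open U \<and> p \<in> U \<and> k \<in> carrier (hol_sheaf A U) \<and> (\<forall>q\<in>U \<inter> Z. h (f q) (g q) = k q)"
    using o U(2) U'(2) U(4) U'(4) Z by (intro exI[of _ ?U] exI) (auto simp: subset_iff)
qed

lemma hol_sub_hol:
  assumes "open U" "f \<in> carrier (hol_sheaf A U)" "V \<subseteq> U"
  shows "restrict f V \<in> carrier (sub_hol_sheaf A V)"
  by (rule sub_holI) (use assms in blast)

lemma sub_hol_const: "(\<lambda>p\<in>V. a) \<in> carrier (sub_hol_sheaf A V)"
  using hol_sub_hol[OF open_UNIV hol_sheaf_const[OF open_UNIV, of a], of V] by simp

lemmas sub_hol_add = sub_hol_binary[where h = "(+)", OF _ _ _ hol_sheaf_add]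
  and sub_hol_mult = sub_hol_binary[where h = "(*)", OF _ _ _ hol_sheaf_mult]

text \<open>Holomorphy can be tested in a single holomorphic chart around each point, in particular
  in a submanifold chart that does not belong to \<open>A\<close>.\<close>

lemma hol_sheafI_charts:
  assumes U: "open U"
    and ex: "\<And>p. p \<in> U \<Longrightarrow> \<exists>c. holomorphic_chart A c \<and> p \<in> fst c \<and> holomorphic_at_vec (f \<circ> chart_inv c) (snd c p)"
  shows "restrict f U \<in> carrier (hol_sheaf A U)"
proof (rule hol_sheafI[OF U])
  fix c p assume c: "c \<in> A" "p \<in> fst c" "p \<in> U"
  obtain c' where c': "holomorphic_chart A c'" "p \<in> fst c'" "holomorphic_at_vec (f \<circ> chart_inv c') (snd c' p)"
    using ex c by blast
  show "holomorphic_at_vec (f \<circ> chart_inv c) (snd c p)"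
    by (rule chart_change(1)[OF atlas_chart[OF c(1)] c'(1) holomorphic_chartD(8)[OF c'(1) c(1)] c(2) c'(2,3)])
qed

lemma form_coefficient_hol:
  assumes U: "open U" "U \<subseteq> fst c" "c \<in> A" and \<omega>: "\<omega> \<in> carrier (hol_forms A U)"
  shows "(\<lambda>q\<in>U. \<omega> q c $ i) \<in> carrier (hol_sheaf A U)"
  by (rule hol_sheafI_charts[OF U(1)])
     (use U \<omega> atlas_chart[OF U(3)] in \<open>intro exI[of _ c], auto simp: hol_forms_carrier\<close>)

lemma coordinate_hol:
  assumes U: "open U" "U \<subseteq> fst c" "c \<in> A"
  shows "(\<lambda>q\<in>U. snd c q $ i) \<in> carrier (hol_sheaf A U)"
proof (rule hol_sheafI_charts[OF U(1)])
  fix p assume p: "p \<in> U"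
  have S: "open (snd c ` (fst c \<inter> U))" "snd c p \<in> snd c ` (fst c \<inter> U)"
    using holomorphic_chart_open_image[OF atlas_chart[OF U(3)] U(1)] p U by auto
  have "holomorphic_at_vec ((\<lambda>q. snd c q $ i) \<circ> chart_inv c) (snd c p)"
    by (rule holomorphic_at_vec_cong[OF S _ holomorphic_at_vec_nth(1)[of i]]) (use atlasD(4)[OF U(3)] in auto)
  then show "\<exists>c'. holomorphic_chart A c' \<and> p \<in> fst c' \<and> holomorphic_at_vec ((\<lambda>q. snd c q $ i) \<circ> chart_inv c') (snd c' p)"
    using atlas_chart[OF U(3)] U p by blast
qed

text \<open>The form dz_i of the chart \<open>c\<close>, together with its components in all other
  charts.\<close>

definition dcoord :: "('a, 'n) chart \<Rightarrow> 'a set \<Rightarrow> 'n \<Rightarrow> 'a \<Rightarrow> ('a, 'n) covector" where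
  "dcoord c U i = ext_deriv A U (\<lambda>q\<in>U. snd c q $ i)"

lemma dcoord_forms: "open U \<Longrightarrow> U \<subseteq> fst c \<Longrightarrow> c \<in> A \<Longrightarrow> dcoord c U i \<in> carrier (hol_forms A U)"
  unfolding dcoord_def by (intro ext_deriv_hol_forms coordinate_hol)

lemma dcoord_apply:
  assumes U: "open U" "c \<in> A" "p \<in> U" and c': "c' \<in> A" "p \<in> fst c'"
  shows "dcoord c U i p c' $ j = d_dz j (\<lambda>z. snd c (chart_inv c' z) $ i) (snd c' p)"
  using at_chart_cong(2)[OF atlas_chart[OF c'(1)] U(1,3) c'(2), of "\<lambda>q. snd c q $ i" "\<lambda>q\<in>U. snd c q $ i" j] assms
  unfolding dcoord_def ext_deriv_def by (simp add: o_def)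

lemma dcoord_same:
  assumes U: "open U" "U \<subseteq> fst c" "c \<in> A" "p \<in> U"
  shows "dcoord c U i p c $ j = (if j = i then 1 else 0)"
proof -
  have S: "open (snd c ` (fst c \<inter> U))" "snd c p \<in> snd c ` (fst c \<inter> U)"
    using holomorphic_chart_open_image[OF atlas_chart[OF U(3)] U(1)] U by auto
  have "d_dz j (\<lambda>z. snd c (chart_inv c z) $ i) (snd c p) = d_dz j (\<lambda>z. z $ i) (snd c p)"
    by (rule wirtinger_cong(1)[OF S]) (use atlasD(4)[OF U(3)] in auto)
  then show ?thesis using dcoord_apply[OF U(1,3,4) U(3)] U by (auto simp: holomorphic_at_vec_nth)
qed

text \<open>The transformation law recovers all components from those in one chart.\<close>

lemma covectors_eqI:
  assumes "\<kappa> \<in> covectors_at A p" "\<kappa>' \<in> covectors_at A p" "c \<in> A" "p \<in> fst c" "\<kappa> c = \<kappa>' c"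
  shows "\<kappa> = \<kappa>'"
proof
  fix c' show "\<kappa> c' = \<kappa>' c'"
  proof (cases "c' \<in> A \<and> p \<in> fst c'")
    case True
    have "\<mu> c' $ i = (\<Sum>j\<in>UNIV. \<mu> c $ j * d_dz i (\<lambda>z. snd c (chart_inv c' z) $ j) (snd c' p))"
      if "\<mu> \<in> covectors_at A p" for \<mu> i
      using that True assms(3,4) unfolding covectors_at_def by blast
    from this[OF assms(1)] this[OF assms(2)] have "\<kappa> c' $ i = \<kappa>' c' $ i" for i
      using assms(5) by simp
    then show ?thesis by (simp add: vec_eq_iff)
  next
    case False
    then have "\<kappa> c' = 0" "\<kappa>' c' = 0" using assms(1,2) unfolding covectors_at_def by blast+
    then show ?thesis by simp
  qed
qed

end

section \<open>Stalks of the sheaves entering the tensor product\<close>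

locale complex_mfd_sub = complex_mfd A for A :: "('a::{t2_space, second_countable_topology}, 'n::finite) chart set" +
  fixes Y :: "'a set"
begin

abbreviation "gX \<equiv> germ euclidean (\<lambda>U. carrier (hol_sheaf A U))"
abbreviation "gM \<equiv> germ euclidean (\<lambda>U. carrier (hol_forms A U))"
abbreviation "gY \<equiv> germ (top_of_set Y) (\<lambda>V. carrier (sub_hol_sheaf A V))"
abbreviation "RX \<equiv> stalk_ring euclidean (hol_sheaf A)"
abbreviation "MX \<equiv> stalk_module euclidean (hol_forms A)"
abbreviation "NY \<equiv> sub_stalk_module A Y"

lemma open_Int_Y: "open U \<Longrightarrow> openin (top_of_set Y) (U \<inter> Y)"
  using openin_open_Int[of U Y] by (simp add: inf_commute)

lemma open_Int_openin_Y:
  assumes "open U" "openin (top_of_set Y) V" shows "openin (top_of_set Y) (U \<inter> V)"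
proof -
  have eq: "U \<inter> V = (U \<inter> Y) \<inter> V" using openin_subset[OF assms(2)] by auto
  show ?thesis by (subst eq) (rule openin_Int[OF open_Int_Y[OF assms(1)] assms(2)])
qed

lemma carrier_MX: "carrier (MX x) = germs euclidean (\<lambda>U. carrier (hol_forms A U)) x"
  and carrier_RX: "carrier (RX x) = germs euclidean (\<lambda>U. carrier (hol_sheaf A U)) x"
  and carrier_NY: "carrier (NY x) = germs (top_of_set Y) (\<lambda>V. carrier (sub_hol_sheaf A V)) x"
  by (simp_all add: stalk_module_def stalk_ring_def sub_stalk_module_def)

lemma MX_add:
  assumes "open U" "x \<in> U" "\<omega> \<in> carrier (hol_forms A U)" "open V" "x \<in> V" "\<eta> \<in> carrier (hol_forms A V)"
  shows "gM x U \<omega> \<oplus>\<^bsub>MX x\<^esub> gM x V \<eta> = gM x (U \<inter> V) (\<lambda>p\<in>U \<inter> V. \<lambda>c. \<omega> p c + \<eta> p c)"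
proof -
  have "gM x U \<omega> \<oplus>\<^bsub>MX x\<^esub> gM x V \<eta> = gM x (U \<inter> V) (restrict \<omega> (U \<inter> V) \<oplus>\<^bsub>hol_forms A (U \<inter> V)\<^esub> restrict \<eta> (U \<inter> V))"
    unfolding stalk_module_def
    using assms by (simp, subst germ_op_germ[of euclidean euclidean euclidean]) (auto simp: hol_forms_ops restrict_def fun_eq_iff)
  also have "\<dots> = gM x (U \<inter> V) (\<lambda>p\<in>U \<inter> V. \<lambda>c. \<omega> p c + \<eta> p c)"
    by (rule germ_eqI[of _ "U \<inter> V"]) (use assms in \<open>auto simp: hol_forms_ops\<close>)
  finally show ?thesis .
qed

lemma MX_smult:
  assumes "open U" "x \<in> U" "f \<in> carrier (hol_sheaf A U)" "open V" "x \<in> V" "\<eta> \<in> carrier (hol_forms A V)"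
  shows "gX x U f \<odot>\<^bsub>MX x\<^esub> gM x V \<eta> = gM x (U \<inter> V) (\<lambda>p\<in>U \<inter> V. \<lambda>c. f p *s \<eta> p c)"
proof -
  have "gX x U f \<odot>\<^bsub>MX x\<^esub> gM x V \<eta> = gM x (U \<inter> V) (restrict f (U \<inter> V) \<odot>\<^bsub>hol_forms A (U \<inter> V)\<^esub> restrict \<eta> (U \<inter> V))"
    unfolding stalk_module_def
    using assms by (simp, subst germ_op_germ[of euclidean euclidean euclidean]) (auto simp: hol_forms_ops restrict_def fun_eq_iff)
  also have "\<dots> = gM x (U \<inter> V) (\<lambda>p\<in>U \<inter> V. \<lambda>c. f p *s \<eta> p c)"
    by (rule germ_eqI[of _ "U \<inter> V"]) (use assms in \<open>auto simp: hol_forms_ops\<close>)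
  finally show ?thesis .
qed

lemma NY_add:
  assumes "openin (top_of_set Y) U" "x \<in> U" "f \<in> carrier (sub_hol_sheaf A U)"
    "openin (top_of_set Y) V" "x \<in> V" "g \<in> carrier (sub_hol_sheaf A V)"
  shows "gY x U f \<oplus>\<^bsub>NY x\<^esub> gY x V g = gY x (U \<inter> V) (\<lambda>p\<in>U \<inter> V. f p + g p)"
proof -
  have "gY x U f \<oplus>\<^bsub>NY x\<^esub> gY x V g = gY x (U \<inter> V) (restrict f (U \<inter> V) \<oplus>\<^bsub>sub_hol_sheaf A (U \<inter> V)\<^esub> restrict g (U \<inter> V))"
    unfolding sub_stalk_module_def stalk_ring_def Let_def
    using assms by (simp, subst germ_op_germ[of "top_of_set Y" "top_of_set Y" "top_of_set Y"]) (auto simp: sub_hol_ops restrict_def fun_eq_iff)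
  also have "\<dots> = gY x (U \<inter> V) (\<lambda>p\<in>U \<inter> V. f p + g p)"
    by (rule germ_eqI[of _ "U \<inter> V"]) (use assms in \<open>auto simp: sub_hol_ops\<close>)
  finally show ?thesis .
qed

text \<open>A germ on the ambient manifold acts on a germ on \<open>Y\<close>: the representatives
  live on open sets of different spaces, and their product lives on an open set of
  \<open>Y\<close>.\<close>

lemma NY_smult:
  assumes "open U" "x \<in> U" "f \<in> carrier (hol_sheaf A U)"
    "openin (top_of_set Y) V" "x \<in> V" "g \<in> carrier (sub_hol_sheaf A V)"
  shows "gX x U f \<odot>\<^bsub>NY x\<^esub> gY x V g = gY x (U \<inter> V) (\<lambda>p\<in>U \<inter> V. f p * g p)"
proof -
  have o: "openin (top_of_set Y) (W1 \<inter> W2)" if "openin euclidean W1" "openin (top_of_set Y) W2" for W1 W2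
    using that open_Int_openin_Y by simp
  have "gX x U f \<odot>\<^bsub>NY x\<^esub> gY x V g = gY x (U \<inter> V) (restrict f (U \<inter> V) \<otimes>\<^bsub>sub_hol_sheaf A (U \<inter> V)\<^esub> restrict g (U \<inter> V))"
    unfolding sub_stalk_module_def Let_def
    using assms o by (simp, subst germ_op_germ[of euclidean "top_of_set Y" "top_of_set Y"]) (auto simp: sub_hol_ops restrict_def fun_eq_iff)
  also have "\<dots> = gY x (U \<inter> V) (\<lambda>p\<in>U \<inter> V. f p * g p)"
    by (rule germ_eqI[of _ "U \<inter> V"]) (use assms o in \<open>auto simp: sub_hol_ops\<close>)
  finally show ?thesis .
qed

lemma gM_carrier: "open U \<Longrightarrow> x \<in> U \<Longrightarrow> \<omega> \<in> carrier (hol_forms A U) \<Longrightarrow> gM x U \<omega> \<in> carrier (MX x)"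
  and gX_carrier: "open U \<Longrightarrow> x \<in> U \<Longrightarrow> f \<in> carrier (hol_sheaf A U) \<Longrightarrow> gX x U f \<in> carrier (RX x)"
  and gY_carrier: "openin (top_of_set Y) V \<Longrightarrow> x \<in> V \<Longrightarrow> g \<in> carrier (sub_hol_sheaf A V) \<Longrightarrow> gY x V g \<in> carrier (NY x)"
  unfolding carrier_MX carrier_RX carrier_NY by (auto intro: germs_I)

sublocale T: tensor_pair "RX x" "MX x" "NY x" for x
proof
  have fr: "restrict \<omega> (U \<inter> V) \<in> carrier (hol_forms A (U \<inter> V))" "restrict \<omega> (V \<inter> U) \<in> carrier (hol_forms A (V \<inter> U))"
    if "open U" "open V" "\<omega> \<in> carrier (hol_forms A U)" for U V \<omega>
    using that hol_forms_restrict[of U] by (auto simp: open_Int)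

  fix y y' assume y: "y \<in> carrier (MX x)" "y' \<in> carrier (MX x)"
  obtain U \<omega> V \<eta> where U: "open U" "x \<in> U" "\<omega> \<in> carrier (hol_forms A U)" "y = gM x U \<omega>"
    and V: "open V" "x \<in> V" "\<eta> \<in> carrier (hol_forms A V)" "y' = gM x V \<eta>"
    using y unfolding carrier_MX by (auto elim!: germs_E)
  have "(\<lambda>p\<in>U \<inter> V. \<lambda>c. restrict \<omega> (U \<inter> V) p c + restrict \<eta> (U \<inter> V) p c) \<in> carrier (hol_forms A (U \<inter> V))"
    by (rule hol_forms_add[OF open_Int[OF U(1) V(1)] fr(1)[OF U(1) V(1) U(3)] fr(2)[OF V(1) U(1) V(3)]])
  then have "(\<lambda>p\<in>U \<inter> V. \<lambda>c. \<omega> p c + \<eta> p c) \<in> carrier (hol_forms A (U \<inter> V))" by (simp cong: restrict_cong)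
  then show "y \<oplus>\<^bsub>MX x\<^esub> y' \<in> carrier (MX x)"
    unfolding U(4) V(4) MX_add[OF U(1-3) V(1-3)] by (intro gM_carrier) (use U V in auto)
next
  fix y y' assume y: "y \<in> carrier (NY x)" "y' \<in> carrier (NY x)"
  obtain U f V g where U: "openin (top_of_set Y) U" "x \<in> U" "f \<in> carrier (sub_hol_sheaf A U)" "y = gY x U f"
    and V: "openin (top_of_set Y) V" "x \<in> V" "g \<in> carrier (sub_hol_sheaf A V)" "y' = gY x V g"
    using y unfolding carrier_NY by (auto elim!: germs_E)
  show "y \<oplus>\<^bsub>NY x\<^esub> y' \<in> carrier (NY x)"
    unfolding U(4) V(4) NY_add[OF U(1-3) V(1-3)] by (intro gY_carrier sub_hol_add[OF U(3) V(3)]) (use U V in auto)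
next
  fix r y assume y: "r \<in> carrier (RX x)" "y \<in> carrier (MX x)"
  obtain U f V \<eta> where U: "open U" "x \<in> U" "f \<in> carrier (hol_sheaf A U)" "r = gX x U f"
    and V: "open V" "x \<in> V" "\<eta> \<in> carrier (hol_forms A V)" "y = gM x V \<eta>"
    using y unfolding carrier_MX carrier_RX by (auto elim!: germs_E)
  have "restrict f (U \<inter> V) \<in> carrier (hol_sheaf A (U \<inter> V))" "restrict \<eta> (U \<inter> V) \<in> carrier (hol_forms A (U \<inter> V))"
    using U V hol_forms_restrict[of V "U \<inter> V" \<eta>] hol_sheaf_restrict[of U "U \<inter> V" f "restrict f (U \<inter> V)"] by (auto simp: open_Int)
  from hol_forms_smult[OF open_Int[OF U(1) V(1)] this]
  have "(\<lambda>p\<in>U \<inter> V. \<lambda>c. restrict f (U \<inter> V) p *s restrict \<eta> (U \<inter> V) p c) \<in> carrier (hol_forms A (U \<inter> V))" .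
  then have "(\<lambda>p\<in>U \<inter> V. \<lambda>c. f p *s \<eta> p c) \<in> carrier (hol_forms A (U \<inter> V))" by (simp cong: restrict_cong)
  then show "r \<odot>\<^bsub>MX x\<^esub> y \<in> carrier (MX x)"
    unfolding U(4) V(4) MX_smult[OF U(1-3) V(1-3)] by (intro gM_carrier) (use U V in auto)
next
  fix r y assume y: "r \<in> carrier (RX x)" "y \<in> carrier (NY x)"
  obtain U f V g where U: "open U" "x \<in> U" "f \<in> carrier (hol_sheaf A U)" "r = gX x U f"
    and V: "openin (top_of_set Y) V" "x \<in> V" "g \<in> carrier (sub_hol_sheaf A V)" "y = gY x V g"
    using y unfolding carrier_NY carrier_RX by (auto elim!: germs_E)
  have o: "openin (top_of_set Y) (U \<inter> V)" by (rule open_Int_openin_Y[OF U(1) V(1)])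
  have "restrict f (U \<inter> V) \<in> carrier (sub_hol_sheaf A (U \<inter> V))" by (rule hol_sub_hol[OF U(1,3)]) auto
  from sub_hol_mult[OF this V(3), of "U \<inter> V"]
  have "(\<lambda>p\<in>U \<inter> V. restrict f (U \<inter> V) p * g p) \<in> carrier (sub_hol_sheaf A (U \<inter> V))" by blast
  moreover have "(\<lambda>p\<in>U \<inter> V. restrict f (U \<inter> V) p * g p) = (\<lambda>p\<in>U \<inter> V. f p * g p)" by (auto simp: fun_eq_iff)
  ultimately have "(\<lambda>p\<in>U \<inter> V. f p * g p) \<in> carrier (sub_hol_sheaf A (U \<inter> V))" by metis
  then show "r \<odot>\<^bsub>NY x\<^esub> y \<in> carrier (NY x)"
    unfolding U(4) V(4) NY_smult[OF U(1-3) V(1-3)] by (intro gY_carrier o) (use U V in auto)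
qed

end


section \<open>The pulled back cotangent sheaf in coordinates\<close>

context complex_mfd_sub
begin

abbreviation "pcls \<equiv> pullback_class A Y (hol_forms A)"

lemma pcls_def: "pcls x = tensor_class (RX x) (MX x) (NY x)"
  by (simp add: pullback_class_def fun_eq_iff)

lemma pullback_stalk_eq: "pullback_stalk A Y (hol_forms A) x = tensor_product (RX x) (MX x) (NY x)"
  by (simp add: pullback_stalk_def)

abbreviation pure :: "'a \<Rightarrow> 'a set \<Rightarrow> ('a \<Rightarrow> ('a, 'n) covector) \<Rightarrow> ('a \<Rightarrow> complex) \<Rightarrow> _" where
  "pure x U \<omega> g \<equiv> frag_of (gM x U \<omega>, gY x (U \<inter> Y) g)"

lemma sub_hol_restrict:
  assumes "g \<in> carrier (sub_hol_sheaf A V)" "W \<subseteq> V"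
  shows "restrict g W \<in> carrier (sub_hol_sheaf A W)"
proof (rule sub_holI)
  fix p assume "p \<in> W"
  with assms(2) have "p \<in> V" by auto
  with assms(1) obtain U h where "open U" "p \<in> U" "h \<in> carrier (hol_sheaf A U)" "\<forall>q\<in>U \<inter> V. g q = h q"
    unfolding sub_hol_carrier by blast
  then show "\<exists>U h. open U \<and> p \<in> U \<and> h \<in> carrier (hol_sheaf A U) \<and> (\<forall>q\<in>U \<inter> W. g q = h q)"
    using assms(2) by (intro exI[of _ U] exI[of _ h]) auto
qed

lemma pure_restrict:
  assumes "open W" "x \<in> W" "x \<in> Y" "W \<subseteq> U"
  shows "pure x W (restrict \<omega> W) (restrict g (W \<inter> Y)) = pure x U \<omega> g"
proof -
  have "gY x (W \<inter> Y) (restrict g (W \<inter> Y)) = gY x (U \<inter> Y) g"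
    by (rule germ_restrict) (use assms open_Int_Y in auto)
  moreover have "gM x W (restrict \<omega> W) = gM x U \<omega>"
    by (rule germ_restrict) (use assms in auto)
  ultimately show ?thesis by simp
qed

text \<open>When \<open>\<omega>\<close> is written as the sum of a_i dz_i, the coefficients a_i are
  scalars from the stalk of O_X and can be moved across the tensor sign, where they act as functions
  on \<open>Y\<close>.\<close>

lemma pure_normal_form:
  assumes U: "open U" "U \<subseteq> fst c" "c \<in> A" and x: "x \<in> U" "x \<in> Y"
    and \<omega>: "\<omega> \<in> carrier (hol_forms A U)" and g: "g \<in> carrier (sub_hol_sheaf A (U \<inter> Y))"
  shows "T.teq x (pure x U \<omega> g) (\<Sum>i\<in>UNIV. pure x U (dcoord c U i) (\<lambda>p\<in>U \<inter> Y. \<omega> p c $ i * g p))"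
proof -
  define a where "a i = (\<lambda>q\<in>U. \<omega> q c $ i)" for i
  \<comment> \<open>Sums over subsets of the coordinates, so that additivity in the first factor can
    be applied one coordinate at a time.\<close>
  define S where "S I = (\<lambda>p\<in>U. \<lambda>c'. \<Sum>i\<in>I. a i p *s dcoord c U i p c')" for I
  have a: "a i \<in> carrier (hol_sheaf A U)" for i unfolding a_def by (rule form_coefficient_hol[OF U \<omega>])
  have ad: "(\<lambda>p\<in>U. \<lambda>c'. a i p *s dcoord c U i p c') \<in> carrier (hol_forms A U)" for i
    by (rule hol_forms_smult[OF U(1) a dcoord_forms[OF U]])
  have UY: "openin (top_of_set Y) (U \<inter> Y)" "x \<in> U \<inter> Y" using open_Int_Y[OF U(1)] x by auto
  have gc: "gY x (U \<inter> Y) g \<in> carrier (NY x)" using gY_carrier[OF UY g] .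
  have S: "S I \<in> carrier (hol_forms A U) \<and> T.teq x (pure x U (S I) g)
      (\<Sum>i\<in>I. pure x U (\<lambda>p\<in>U. \<lambda>c'. a i p *s dcoord c U i p c') g)" if "finite I" for I
    using that
  proof (induction I rule: finite_induct)
    case empty
    have z: "S {} \<in> carrier (hol_forms A U)" using hol_forms_zero[OF U(1)] by (simp add: S_def)
    have "gM x U (S {}) \<oplus>\<^bsub>MX x\<^esub> gM x U (S {}) = gM x U (S {})"
      unfolding MX_add[OF U(1) x(1) z U(1) x(1) z] by (rule germ_eqI[of _ U]) (use U x in \<open>auto simp: S_def\<close>)
    from T.teq_zero(1)[OF gM_carrier[OF U(1) x(1) z] this gc] z show ?case by simp
  next
    case (insert i I)
    let ?t = "\<lambda>p\<in>U. \<lambda>c'. a i p *s dcoord c U i p c'"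
    have SI: "S I \<in> carrier (hol_forms A U)" using insert by blast
    have eq: "S (insert i I) = (\<lambda>p\<in>U. \<lambda>c'. ?t p c' + S I p c')"
      unfolding S_def using insert by (auto simp: fun_eq_iff)
    then have "S (insert i I) \<in> carrier (hol_forms A U)" using hol_forms_add[OF U(1) ad SI] by simp
    moreover have "gM x U (S (insert i I)) = gM x U ?t \<oplus>\<^bsub>MX x\<^esub> gM x U (S I)"
      unfolding MX_add[OF U(1) x(1) ad U(1) x(1) SI] eq by simp
    then have "T.teq x (pure x U (S (insert i I)) g) (pure x U ?t g + pure x U (S I) g)"
      using T.teq_relations(1)[OF gM_carrier[OF U(1) x(1) ad] gM_carrier[OF U(1) x(1) SI] gc] by simp
    then have "T.teq x (pure x U (S (insert i I)) g) (pure x U ?t g + (\<Sum>i\<in>I. pure x U (\<lambda>p\<in>U. \<lambda>c'. a i p *s dcoord c U i p c') g))"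
      using insert(3) T.teq_add[OF T.teq_refl] T.teq_trans by blast
    ultimately show ?case unfolding sum.insert[OF insert(1,2)] by blast
  qed
  \<comment> \<open>In the chart \<open>c\<close> the dz_i have the unit vectors as components, and
    the components in one chart determine a covector.\<close>
  have "\<omega> p = S UNIV p" if p: "p \<in> U" for p
  proof (rule covectors_eqI[OF _ _ U(3)])
    show "\<omega> p \<in> covectors_at A p" using \<omega> p by (simp add: hol_forms_carrier[OF U(1)])
    show "S UNIV p \<in> covectors_at A p" using S[of UNIV] p by (simp add: hol_forms_carrier[OF U(1)])
    show "p \<in> fst c" using p U by auto
    have "(\<Sum>i\<in>UNIV. a i p *s dcoord c U i p c) $ j = \<omega> p c $ j" for j
      using p by (simp add: dcoord_same[OF U p] a_def if_distrib[of "\<lambda>t. _ * t"] cong: if_cong)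
    then show "\<omega> p c = S UNIV p c" using p by (simp add: S_def vec_eq_iff)
  qed
  moreover have "\<omega> \<in> extensional U" "S UNIV \<in> extensional U" using \<omega> by (auto simp: hol_forms_carrier[OF U(1)] S_def)
  ultimately have "\<omega> = S UNIV" by (metis extensionalityI)
  then have "T.teq x (pure x U \<omega> g) (\<Sum>i\<in>UNIV. pure x U (\<lambda>p\<in>U. \<lambda>c'. a i p *s dcoord c U i p c') g)"
    using S[of UNIV] by simp
  also have "T.teq x (\<Sum>i\<in>UNIV. pure x U (\<lambda>p\<in>U. \<lambda>c'. a i p *s dcoord c U i p c') g)
      (\<Sum>i\<in>UNIV. pure x U (dcoord c U i) (\<lambda>p\<in>U \<inter> Y. \<omega> p c $ i * g p))"
  proof (rule T.teq_sum)
    fix i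
    have d: "dcoord c U i \<in> carrier (hol_forms A U)" by (rule dcoord_forms[OF U])
    have e1: "gX x U (a i) \<odot>\<^bsub>MX x\<^esub> gM x U (dcoord c U i) = gM x U (\<lambda>p\<in>U. \<lambda>c'. a i p *s dcoord c U i p c')"
      unfolding MX_smult[OF U(1) x(1) a U(1) x(1) d] by simp
    have e2: "gX x U (a i) \<odot>\<^bsub>NY x\<^esub> gY x (U \<inter> Y) g = gY x (U \<inter> Y) (\<lambda>p\<in>U \<inter> Y. \<omega> p c $ i * g p)"
      unfolding NY_smult[OF U(1) x(1) a UY g] by (rule germ_eqI[of _ "U \<inter> Y"]) (use UY in \<open>auto simp: a_def\<close>)
    show "T.teq x (pure x U (\<lambda>p\<in>U. \<lambda>c'. a i p *s dcoord c U i p c') g)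
        (pure x U (dcoord c U i) (\<lambda>p\<in>U \<inter> Y. \<omega> p c $ i * g p))"
      using T.teq_relations(3)[OF gX_carrier[OF U(1) x(1) a[of i]] gM_carrier[OF U(1) x(1) d] gc] unfolding e1 e2 .
  qed simp
  finally show ?thesis .
qed

lemma pure_sum_right:
  assumes U: "open U" and x: "x \<in> U" "x \<in> Y" and \<omega>: "\<omega> \<in> carrier (hol_forms A U)"
    and K: "finite K" "\<And>k. k \<in> K \<Longrightarrow> h k \<in> carrier (sub_hol_sheaf A (U \<inter> Y))"
  shows "(\<lambda>p\<in>U \<inter> Y. \<Sum>k\<in>K. h k p) \<in> carrier (sub_hol_sheaf A (U \<inter> Y)) \<and>
    T.teq x (\<Sum>k\<in>K. pure x U \<omega> (h k)) (pure x U \<omega> (\<lambda>p\<in>U \<inter> Y. \<Sum>k\<in>K. h k p))"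
  using K
proof (induction K rule: finite_induct)
  case empty
  have UY: "openin (top_of_set Y) (U \<inter> Y)" "x \<in> U \<inter> Y" using open_Int_Y[OF U] x by auto
  have z: "(\<lambda>p\<in>U \<inter> Y. 0) \<in> carrier (sub_hol_sheaf A (U \<inter> Y))" by (rule sub_hol_const)
  have "gY x (U \<inter> Y) (\<lambda>p\<in>U \<inter> Y. 0) \<oplus>\<^bsub>NY x\<^esub> gY x (U \<inter> Y) (\<lambda>p\<in>U \<inter> Y. 0) = gY x (U \<inter> Y) (\<lambda>p\<in>U \<inter> Y. 0)"
    unfolding NY_add[OF UY z UY z] by (rule germ_eqI[of _ "U \<inter> Y"]) (use UY in auto)
  from T.teq_sym[OF T.teq_zero(2)[OF gM_carrier[OF U x(1) \<omega>] this gY_carrier[OF UY z]]] z show ?case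
    unfolding sum.empty by blast
next
  case (insert k K)
  have UY: "openin (top_of_set Y) (U \<inter> Y)" "x \<in> U \<inter> Y" using open_Int_Y[OF U] x by auto
  let ?s = "\<lambda>p\<in>U \<inter> Y. \<Sum>k\<in>K. h k p"
  have s: "?s \<in> carrier (sub_hol_sheaf A (U \<inter> Y))" and k: "h k \<in> carrier (sub_hol_sheaf A (U \<inter> Y))"
    and IH: "T.teq x (\<Sum>k\<in>K. pure x U \<omega> (h k)) (pure x U \<omega> ?s)" using insert by blast+
  have eq: "(\<lambda>p\<in>U \<inter> Y. \<Sum>k\<in>insert k K. h k p) = (\<lambda>p\<in>U \<inter> Y. h k p + ?s p)"
    using insert by (auto simp: fun_eq_iff)
  have "(\<lambda>p\<in>U \<inter> Y. h k p + ?s p) \<in> carrier (sub_hol_sheaf A (U \<inter> Y))"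
    by (rule sub_hol_add[OF k s]) auto
  moreover have e: "gY x (U \<inter> Y) (h k) \<oplus>\<^bsub>NY x\<^esub> gY x (U \<inter> Y) ?s = gY x (U \<inter> Y) (\<lambda>p\<in>U \<inter> Y. h k p + ?s p)"
    unfolding NY_add[OF UY k UY s] by simp
  have "T.teq x (pure x U \<omega> (\<lambda>p\<in>U \<inter> Y. h k p + ?s p)) (pure x U \<omega> (h k) + pure x U \<omega> ?s)"
    using T.teq_relations(2)[OF gM_carrier[OF U x(1) \<omega>] gY_carrier[OF UY k] gY_carrier[OF UY s]] unfolding e .
  then have "T.teq x (\<Sum>k\<in>insert k K. pure x U \<omega> (h k)) (pure x U \<omega> (\<lambda>p\<in>U \<inter> Y. h k p + ?s p))"
    using T.teq_trans[OF T.teq_add[OF T.teq_refl IH] T.teq_sym] insert by simp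
  ultimately show ?case unfolding eq by blast
qed

text \<open>In a chart, \<open>i\<^sup>*\<Omega>\<^sup>1\<close> is free on the \<open>dz\<^sub>i\<close>; hence equalities in it can be checked on the values of
  the coefficients.\<close>

lemma pullback_class_eqI:
  assumes x: "x \<in> Y" "x \<in> fst c" "c \<in> A" and U: "open U" "x \<in> U" and U': "open U'" "x \<in> U'"
    and K: "finite K" "\<And>k. k \<in> K \<Longrightarrow> \<omega> k \<in> carrier (hol_forms A U)" "\<And>k. k \<in> K \<Longrightarrow> g k \<in> carrier (sub_hol_sheaf A (U \<inter> Y))"
    and K': "finite K'" "\<And>k. k \<in> K' \<Longrightarrow> \<omega>' k \<in> carrier (hol_forms A U')" "\<And>k. k \<in> K' \<Longrightarrow> g' k \<in> carrier (sub_hol_sheaf A (U' \<inter> Y))"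
    and eq: "\<And>p i. p \<in> U \<Longrightarrow> p \<in> U' \<Longrightarrow> p \<in> Y \<Longrightarrow> p \<in> fst c \<Longrightarrow>
       (\<Sum>k\<in>K. \<omega> k p c $ i * g k p) = (\<Sum>k\<in>K'. \<omega>' k p c $ i * g' k p)"
  shows "pcls x (\<Sum>k\<in>K. pure x U (\<omega> k) (g k)) = pcls x (\<Sum>k\<in>K'. pure x U' (\<omega>' k) (g' k))"
proof -
  define W where "W = U \<inter> U' \<inter> fst c"
  have W: "open W" "W \<subseteq> fst c" "x \<in> W" "W \<subseteq> U" "W \<subseteq> U'"
    using U U' x atlasD(1)[OF x(3)] by (auto simp: W_def)
  \<comment> \<open>Each side reduces to a sum of tensors of dz_i with one function per coordinate:
    the pure tensors are expanded, the double sum is interchanged, and the right factors are added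
    up. These functions depend only on values along \<open>W \<inter> Y\<close>, where
    \<open>eq\<close> identifies them.\<close>
  have nf: "T.teq x (\<Sum>k\<in>K. pure x U (\<omega> k) (g k))
      (\<Sum>i\<in>UNIV. pure x W (dcoord c W i) (\<lambda>p\<in>W \<inter> Y. \<Sum>k\<in>K. \<omega> k p c $ i * g k p))"
    if K: "finite K" "\<And>k. k \<in> K \<Longrightarrow> \<omega> k \<in> carrier (hol_forms A U)" "\<And>k. k \<in> K \<Longrightarrow> g k \<in> carrier (sub_hol_sheaf A (U \<inter> Y))"
      and U: "open U" "W \<subseteq> U" for U and K :: "'z set" and \<omega> g
  proof -
    have \<omega>W: "restrict (\<omega> k) W \<in> carrier (hol_forms A W)" if "k \<in> K" for k
      by (rule hol_forms_restrict[OF U(1) W(1) U(2) K(2)[OF that]])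
    have gW: "restrict (g k) (W \<inter> Y) \<in> carrier (sub_hol_sheaf A (W \<inter> Y))" if "k \<in> K" for k
      by (rule sub_hol_restrict[OF K(3)[OF that]]) (use U(2) in auto)
    define h where "h k i = (\<lambda>p\<in>W \<inter> Y. restrict (\<omega> k) W p c $ i * restrict (g k) (W \<inter> Y) p)" for k i
    have 1: "(\<Sum>k\<in>K. pure x U (\<omega> k) (g k)) = (\<Sum>k\<in>K. pure x W (restrict (\<omega> k) W) (restrict (g k) (W \<inter> Y)))"
      using pure_restrict[OF W(1,3) x(1) U(2)] by simp
    have 2: "T.teq x (\<Sum>k\<in>K. pure x W (restrict (\<omega> k) W) (restrict (g k) (W \<inter> Y)))
        (\<Sum>k\<in>K. \<Sum>i\<in>UNIV. pure x W (dcoord c W i) (h k i))"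
      unfolding h_def by (rule T.teq_sum[OF K(1) pure_normal_form[OF W(1,2) x(3) W(3) x(1) \<omega>W gW]])
    have 3: "(\<Sum>k\<in>K. \<Sum>i\<in>UNIV. pure x W (dcoord c W i) (h k i)) = (\<Sum>i\<in>UNIV. \<Sum>k\<in>K. pure x W (dcoord c W i) (h k i))"
      by (rule sum.swap)
    have 4: "T.teq x (\<Sum>i\<in>UNIV. \<Sum>k\<in>K. pure x W (dcoord c W i) (h k i))
        (\<Sum>i\<in>UNIV. pure x W (dcoord c W i) (\<lambda>p\<in>W \<inter> Y. \<Sum>k\<in>K. h k i p))"
    proof (rule T.teq_sum)
      fix i
      have "h k i \<in> carrier (sub_hol_sheaf A (W \<inter> Y))" if "k \<in> K" for k
      proof -
        have "restrict (\<lambda>q\<in>W. restrict (\<omega> k) W q c $ i) (W \<inter> Y) \<in> carrier (sub_hol_sheaf A (W \<inter> Y))"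
          by (rule hol_sub_hol[OF W(1) form_coefficient_hol[OF W(1,2) x(3) \<omega>W[OF that]]]) auto
        from sub_hol_mult[OF this gW[OF that], of "W \<inter> Y"]
        have "(\<lambda>p\<in>W \<inter> Y. restrict (\<lambda>q\<in>W. restrict (\<omega> k) W q c $ i) (W \<inter> Y) p * restrict (g k) (W \<inter> Y) p)
           \<in> carrier (sub_hol_sheaf A (W \<inter> Y))" by blast
        moreover have "(\<lambda>p\<in>W \<inter> Y. restrict (\<lambda>q\<in>W. restrict (\<omega> k) W q c $ i) (W \<inter> Y) p * restrict (g k) (W \<inter> Y) p) = h k i"
          by (auto simp: fun_eq_iff h_def)
        ultimately show ?thesis by metis
      qed
      then show "T.teq x (\<Sum>k\<in>K. pure x W (dcoord c W i) (h k i)) (pure x W (dcoord c W i) (\<lambda>p\<in>W \<inter> Y. \<Sum>k\<in>K. h k i p))"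
        using pure_sum_right[OF W(1,3) x(1) dcoord_forms[OF W(1,2) x(3)] K(1), where h = "\<lambda>k. h k i"] by blast
    qed simp
    have 5: "(\<lambda>p\<in>W \<inter> Y. \<Sum>k\<in>K. h k i p) = (\<lambda>p\<in>W \<inter> Y. \<Sum>k\<in>K. \<omega> k p c $ i * g k p)" for i
      by (auto simp: fun_eq_iff h_def)
    show ?thesis using T.teq_trans[OF 2[unfolded 3] 4] unfolding 1 5 .
  qed
  have e: "(\<lambda>p\<in>W \<inter> Y. \<Sum>k\<in>K. \<omega> k p c $ i * g k p) = (\<lambda>p\<in>W \<inter> Y. \<Sum>k\<in>K'. \<omega>' k p c $ i * g' k p)" for i
    using eq by (auto simp: fun_eq_iff W_def)
  have "T.teq x (\<Sum>k\<in>K. pure x U (\<omega> k) (g k))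
      (\<Sum>i\<in>UNIV. pure x W (dcoord c W i) (\<lambda>p\<in>W \<inter> Y. \<Sum>k\<in>K. \<omega> k p c $ i * g k p))"
    by (rule nf) (use K U W in auto)
  moreover have "T.teq x (\<Sum>k\<in>K'. pure x U' (\<omega>' k) (g' k))
      (\<Sum>i\<in>UNIV. pure x W (dcoord c W i) (\<lambda>p\<in>W \<inter> Y. \<Sum>k\<in>K. \<omega> k p c $ i * g k p))"
    unfolding e by (rule nf) (use K' U' W in auto)
  ultimately have "T.teq x (\<Sum>k\<in>K. pure x U (\<omega> k) (g k)) (\<Sum>k\<in>K'. pure x U' (\<omega>' k) (g' k))"
    using T.teq_trans[OF _ T.teq_sym] by blast
  then show ?thesis unfolding pcls_def by (rule T.cls_eqI)
qed

lemma pullback_sheaf_carrier: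
  "s \<in> carrier (pullback_sheaf A Y (hol_forms A) V) \<longleftrightarrow> s \<in> extensional V \<and> (\<forall>p\<in>V. \<exists>U (m::nat) \<sigma> g. open U \<and> p \<in> U \<and>
        (\<forall>k<m. \<sigma> k \<in> carrier (hol_forms A U) \<and> g k \<in> carrier (sub_hol_sheaf A (U \<inter> Y))) \<and>
        (\<forall>q\<in>U \<inter> V. s q = pcls q (\<Sum>k<m. pure q U (\<sigma> k) (g k))))"
  unfolding pullback_sheaf_def by simp

lemma pullback_sheaf_ops:
  "s \<otimes>\<^bsub>pullback_sheaf A Y (hol_forms A) V\<^esub> t = (\<lambda>p\<in>V. s p \<otimes>\<^bsub>pullback_stalk A Y (hol_forms A) p\<^esub> t p)"
  "\<one>\<^bsub>pullback_sheaf A Y (hol_forms A) V\<^esub> = (\<lambda>p\<in>V. \<one>\<^bsub>pullback_stalk A Y (hol_forms A) p\<^esub>)"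
  unfolding pullback_sheaf_def by auto

lemma sum_lessThan_add: "(\<Sum>k<m + n. f k) = (\<Sum>k<m. f k) + (\<Sum>k<n. f (m + k))" for f :: "nat \<Rightarrow> 'z::comm_monoid_add"
  by (induction n) (auto simp: add.assoc)

text \<open>A section is locally a finite list of pairs of a form and a function. Products
  concatenate such lists, and inverses negate the forms.\<close>

lemma group_presheaf_pullback: "group_presheaf (top_of_set Y) (pullback_sheaf A Y (hol_forms A))"
proof -
  let ?P = "pullback_sheaf A Y (hol_forms A)"
  let ?S = "pullback_stalk A Y (hol_forms A)"
  have st: "group (?S p)" for p unfolding pullback_stalk_eq by (rule T.tensor_group)
  have pc: "pure q U \<omega> g \<in> carrier (T.FAG q)"
    if "open U" "q \<in> U" "q \<in> Y" "\<omega> \<in> carrier (hol_forms A U)" "g \<in> carrier (sub_hol_sheaf A (U \<inter> Y))" for q U \<omega> g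
    using that gM_carrier gY_carrier[OF open_Int_Y] by (intro T.frag_carrier) auto
  have pcs: "(\<Sum>k<m. pure q U (\<omega> k) (g k)) \<in> carrier (T.FAG q)"
    if "open U" "q \<in> U" "q \<in> Y" "\<And>k. k < m \<Longrightarrow> \<omega> k \<in> carrier (hol_forms A U)"
      "\<And>k. k < m \<Longrightarrow> g k \<in> carrier (sub_hol_sheaf A (U \<inter> Y))" for q U \<omega> g and m :: nat
    using that(4,5)
  proof (induction m)
    case 0 then show ?case using T.FAG_closed(3) by simp
  next
    case (Suc m)
    have "(\<Sum>k<m. pure q U (\<omega> k) (g k)) \<in> carrier (T.FAG q)" using Suc by simp
    from T.FAG_closed(1)[OF this pc[OF that(1-3)], of "\<omega> m" "g m"] Suc(2,3) show ?case by simp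
  qed
  have sc: "s p \<in> carrier (?S p)" if "s \<in> carrier (?P V)" "p \<in> V" "V \<subseteq> Y" for s p V
  proof -
    obtain U and m :: nat and \<sigma> g where U: "open U" "p \<in> U"
      "\<forall>k<m. \<sigma> k \<in> carrier (hol_forms A U) \<and> g k \<in> carrier (sub_hol_sheaf A (U \<inter> Y))"
      "\<forall>q\<in>U \<inter> V. s q = pcls q (\<Sum>k<m. pure q U (\<sigma> k) (g k))"
      using \<open>s \<in> carrier (?P V)\<close> \<open>p \<in> V\<close> unfolding pullback_sheaf_carrier by blast
    have sp: "s p = pcls p (\<Sum>k<m. pure p U (\<sigma> k) (g k))" using U that by blast
    show ?thesis unfolding sp pullback_stalk_eq pcls_def
      by (intro T.cls_carrier pcs) (use U that in auto)
  qed
  have one: "\<one>\<^bsub>?S p\<^esub> = pcls p 0" for p unfolding pullback_stalk_eq pcls_def by (rule T.cls_one)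
  have mult: "pcls p u \<otimes>\<^bsub>?S p\<^esub> pcls p v = pcls p (u + v)" for p u v
    unfolding pullback_stalk_eq pcls_def by (rule T.cls_mult)
  have grp: "group (?P V)" if VY: "V \<subseteq> Y" for V
  proof (rule groupI)
    show "\<one>\<^bsub>?P V\<^esub> \<in> carrier (?P V)"
      unfolding pullback_sheaf_carrier pullback_sheaf_ops
      by (auto intro!: exI[of _ UNIV] exI[of _ "0::nat"] simp: one)
    fix x y assume x: "x \<in> carrier (?P V)" and y: "y \<in> carrier (?P V)"
    show "x \<otimes>\<^bsub>?P V\<^esub> y \<in> carrier (?P V)"
      unfolding pullback_sheaf_carrier
    proof (intro conjI ballI)
      fix p assume p: "p \<in> V"
      obtain U and m :: nat and \<sigma> g where U: "open U" "p \<in> U"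
        "\<forall>k<m. \<sigma> k \<in> carrier (hol_forms A U) \<and> g k \<in> carrier (sub_hol_sheaf A (U \<inter> Y))"
        "\<forall>q\<in>U \<inter> V. x q = pcls q (\<Sum>k<m. pure q U (\<sigma> k) (g k))"
        using x p unfolding pullback_sheaf_carrier by blast
      obtain U' and m' :: nat and \<sigma>' g' where U': "open U'" "p \<in> U'"
        "\<forall>k<m'. \<sigma>' k \<in> carrier (hol_forms A U') \<and> g' k \<in> carrier (sub_hol_sheaf A (U' \<inter> Y))"
        "\<forall>q\<in>U' \<inter> V. y q = pcls q (\<Sum>k<m'. pure q U' (\<sigma>' k) (g' k))"
        using y p unfolding pullback_sheaf_carrier by blast
      let ?W = "U \<inter> U'"
      have W: "open ?W" "?W \<subseteq> U" "?W \<subseteq> U'" using U U' by auto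
      \<comment> \<open>The second list is appended after the \<open>m\<close> entries of the first,
        hence the shift \<open>k - m\<close>.\<close>
      define \<tau> where "\<tau> k = restrict (if k < m then \<sigma> k else \<sigma>' (k - m)) ?W" for k
      define h where "h k = restrict (if k < m then g k else g' (k - m)) (?W \<inter> Y)" for k
      have th: "\<tau> k \<in> carrier (hol_forms A ?W) \<and> h k \<in> carrier (sub_hol_sheaf A (?W \<inter> Y))" if "k < m + m'" for k
      proof (cases "k < m")
        case True
        then show ?thesis unfolding \<tau>_def h_def
          using U(3) hol_forms_restrict[OF U(1) W(1,2)] sub_hol_restrict[of _ "U \<inter> Y" "?W \<inter> Y"] by auto
      next
        case False
        then have "k - m < m'" using that by auto
        then show ?thesis unfolding \<tau>_def h_def
          using U'(3) hol_forms_restrict[OF U'(1) W(1,3)] sub_hol_restrict[of _ "U' \<inter> Y" "?W \<inter> Y"] False by auto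
      qed
      have val: "(x \<otimes>\<^bsub>?P V\<^esub> y) q = pcls q (\<Sum>k<m + m'. pure q ?W (\<tau> k) (h k))" if q: "q \<in> ?W \<inter> V" for q
      proof -
        have "(\<Sum>k<m. pure q ?W (\<tau> k) (h k)) = (\<Sum>k<m. pure q U (\<sigma> k) (g k))"
          unfolding \<tau>_def h_def using q VY pure_restrict[OF W(1) _ _ W(2), of q] by (intro sum.cong) auto
        moreover have "(\<Sum>k<m'. pure q ?W (\<tau> (m + k)) (h (m + k))) = (\<Sum>k<m'. pure q U' (\<sigma>' k) (g' k))"
          unfolding \<tau>_def h_def using q VY pure_restrict[OF W(1) _ _ W(3), of q] by (intro sum.cong) auto
        ultimately show ?thesis
          unfolding sum_lessThan_add using U(4) U'(4) q by (simp add: pullback_sheaf_ops mult)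
      qed
      show "\<exists>U (m::nat) \<sigma> g. open U \<and> p \<in> U \<and>
        (\<forall>k<m. \<sigma> k \<in> carrier (hol_forms A U) \<and> g k \<in> carrier (sub_hol_sheaf A (U \<inter> Y))) \<and>
        (\<forall>q\<in>U \<inter> V. (x \<otimes>\<^bsub>?P V\<^esub> y) q = pcls q (\<Sum>k<m. pure q U (\<sigma> k) (g k)))"
        using W(1) U(2) U'(2) th val
        by (intro exI[of _ ?W] exI[of _ "m + m'"] exI[of _ \<tau>] exI[of _ h] conjI allI impI ballI) auto
    qed (simp add: pullback_sheaf_ops)
    show "\<one>\<^bsub>?P V\<^esub> \<otimes>\<^bsub>?P V\<^esub> x = x"
    proof
      fix p show "(\<one>\<^bsub>?P V\<^esub> \<otimes>\<^bsub>?P V\<^esub> x) p = x p"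
      proof (cases "p \<in> V")
        case True
        then show ?thesis using sc[OF x True VY] st[of p, THEN group.is_monoid]
          by (simp add: pullback_sheaf_ops monoid.l_one)
      next
        case False
        then show ?thesis using x by (simp add: pullback_sheaf_ops pullback_sheaf_carrier extensional_def)
      qed
    qed
    show "\<exists>y\<in>carrier (?P V). y \<otimes>\<^bsub>?P V\<^esub> x = \<one>\<^bsub>?P V\<^esub>"
    proof
      let ?y = "\<lambda>p\<in>V. inv\<^bsub>?S p\<^esub> x p"
      show "?y \<otimes>\<^bsub>?P V\<^esub> x = \<one>\<^bsub>?P V\<^esub>"
        using sc[OF x _ VY] st by (auto simp: pullback_sheaf_ops restrict_def fun_eq_iff group.l_inv)
      show "?y \<in> carrier (?P V)" unfolding pullback_sheaf_carrier
      proof (intro conjI ballI)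
        fix p assume p: "p \<in> V"
        obtain U and m :: nat and \<sigma> g where U: "open U" "p \<in> U"
          "\<forall>k<m. \<sigma> k \<in> carrier (hol_forms A U) \<and> g k \<in> carrier (sub_hol_sheaf A (U \<inter> Y))"
          "\<forall>q\<in>U \<inter> V. x q = pcls q (\<Sum>k<m. pure q U (\<sigma> k) (g k))"
          using x p unfolding pullback_sheaf_carrier by blast
        define \<tau> where "\<tau> k = (\<lambda>p\<in>U. \<lambda>c. - \<sigma> k p c)" for k
        have \<tau>: "\<tau> k \<in> carrier (hol_forms A U)" if "k < m" for k
          unfolding \<tau>_def using U(3) that hol_forms_uminus[OF U(1)] by blast
        have val: "?y q = pcls q (\<Sum>k<m. pure q U (\<tau> k) (g k))" if q: "q \<in> U \<inter> V" for q
        proof -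
          interpret q: group "?S q" by (rule st)
          have qY: "q \<in> U" "q \<in> Y" using q VY by auto
          obtain c where c: "c \<in> A" "q \<in> fst c" by (rule atlas_cover)
          let ?l = "\<Sum>k<m. pure q U (\<tau> k) (g k)" and ?r = "\<Sum>k<m. pure q U (\<sigma> k) (g k)"
          have lr: "?l + ?r = (\<Sum>k<m + m. pure q U (if k < m then \<tau> k else \<sigma> (k - m)) (if k < m then g k else g (k - m)))"
            unfolding sum_lessThan_add by simp
          \<comment> \<open>The concatenated list has vanishing coefficients, like the empty sum,
            and the coefficients determine the class.\<close>
          have "pcls q (?l + ?r) = pcls q (\<Sum>k\<in>({}::nat set). pure q U (\<tau> k) (g k))"
            unfolding lr
          proof (rule pullback_class_eqI[OF qY(2) c(2,1) U(1) qY(1) U(1) qY(1)])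
            fix p i assume p: "p \<in> U"
            show "(\<Sum>k<m + m. (if k < m then \<tau> k else \<sigma> (k - m)) p c $ i * (if k < m then g k else g (k - m)) p) =
                (\<Sum>k\<in>({}::nat set). \<tau> k p c $ i * g k p)"
              unfolding sum_lessThan_add using p by (simp add: \<tau>_def sum_negf)
          qed (use U(3) \<tau> in auto)
          then have "pcls q (?l + ?r) = pcls q 0" by simp
          then have "pcls q ?l \<otimes>\<^bsub>?S q\<^esub> x q = \<one>\<^bsub>?S q\<^esub>" using U(4) q by (simp add: mult one)
          moreover have "pcls q ?l \<in> carrier (?S q)"
            unfolding pullback_stalk_eq pcls_def by (intro T.cls_carrier pcs) (use U \<tau> qY in auto)
          ultimately have "inv\<^bsub>?S q\<^esub> x q = pcls q ?l" using sc[OF x _ VY, of q] q by (intro q.inv_equality) auto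
          then show ?thesis using q by simp
        qed
        show "\<exists>U (m::nat) \<sigma> g. open U \<and> p \<in> U \<and>
          (\<forall>k<m. \<sigma> k \<in> carrier (hol_forms A U) \<and> g k \<in> carrier (sub_hol_sheaf A (U \<inter> Y))) \<and>
          (\<forall>q\<in>U \<inter> V. ?y q = pcls q (\<Sum>k<m. pure q U (\<sigma> k) (g k)))"
          using U \<tau> val by (intro exI[of _ U] exI[of _ m] exI[of _ \<tau>] exI[of _ g] conjI allI impI ballI) blast+
      qed simp
    qed
  next
    fix x y z assume x: "x \<in> carrier (?P V)" and y: "y \<in> carrier (?P V)" and z: "z \<in> carrier (?P V)"
    show "x \<otimes>\<^bsub>?P V\<^esub> y \<otimes>\<^bsub>?P V\<^esub> z = x \<otimes>\<^bsub>?P V\<^esub> (y \<otimes>\<^bsub>?P V\<^esub> z)"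
      using sc[OF x _ VY] sc[OF y _ VY] sc[OF z _ VY] st[THEN group.is_monoid]
      by (auto simp: pullback_sheaf_ops restrict_def fun_eq_iff monoid.m_assoc)
  qed
  show ?thesis
  proof (rule group_presheaf.intro)
    fix U assume "openin (top_of_set Y) U"
    then show "group (?P U)" using grp openin_subset[of "top_of_set Y" U] by simp
    show "s \<in> extensional U" if "s \<in> carrier (?P U)" for s using that by (simp add: pullback_sheaf_carrier)
    fix V s t assume V: "V \<subseteq> U" and s: "s \<in> carrier (?P U)"
    show "restrict s V \<in> carrier (?P V)"
      unfolding pullback_sheaf_carrier
    proof (intro conjI ballI)
      fix p assume p: "p \<in> V"
      with V have "p \<in> U" by auto
      then obtain Z and m :: nat and \<sigma> g where Z: "open Z" "p \<in> Z"
          "\<forall>k<m. \<sigma> k \<in> carrier (hol_forms A Z) \<and> g k \<in> carrier (sub_hol_sheaf A (Z \<inter> Y))"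
          "\<forall>q\<in>Z \<inter> U. s q = pcls q (\<Sum>k<m. pure q Z (\<sigma> k) (g k))"
        using s unfolding pullback_sheaf_carrier by blast
      then show "\<exists>U (m::nat) \<sigma> g. open U \<and> p \<in> U \<and>
        (\<forall>k<m. \<sigma> k \<in> carrier (hol_forms A U) \<and> g k \<in> carrier (sub_hol_sheaf A (U \<inter> Y))) \<and>
        (\<forall>q\<in>U \<inter> V. restrict s V q = pcls q (\<Sum>k<m. pure q U (\<sigma> k) (g k)))"
        using V by (intro exI[of _ Z] exI[of _ m] exI[of _ \<sigma>] exI[of _ g]) (auto simp: subset_iff)
    qed simp
    show "restrict (s \<otimes>\<^bsub>?P U\<^esub> t) V = restrict s V \<otimes>\<^bsub>?P V\<^esub> restrict t V"
      using V by (auto simp: pullback_sheaf_ops restrict_def fun_eq_iff)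
  qed
qed

lemma to_pullback_germ:
  assumes "open U" "p \<in> U" "p \<in> Y" "p \<in> V" "s p = gM p U \<sigma>"
  shows "to_pullback A Y (hol_forms A) V s p = pcls p (pure p U \<sigma> (\<lambda>q\<in>U \<inter> Y. 1))"
proof -
  have "\<one>\<^bsub>stalk_ring (top_of_set Y) (sub_hol_sheaf A) p\<^esub> = gY p Y (\<lambda>q\<in>Y. 1)"
    by (simp add: stalk_ring_def sub_hol_ops)
  also have "\<dots> = gY p (U \<inter> Y) (\<lambda>q\<in>U \<inter> Y. 1)"
    by (rule germ_eqI[of _ "U \<inter> Y"]) (use assms open_Int_Y in auto)
  finally show ?thesis using assms by (simp add: to_pullback_def)
qed

lemma presheaf_hom_to_pullback:
  "presheaf_hom (top_of_set Y) (inv_image_sheaf (\<lambda>U. add_monoid (hol_forms A U)))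
     (pullback_sheaf A Y (hol_forms A)) (to_pullback A Y (hol_forms A))"
proof -
  let ?F = "\<lambda>U. add_monoid (hol_forms A U)"
  interpret F: group_presheaf euclidean ?F by (rule group_presheaf_hol_forms)
  interpret I: group_presheaf "top_of_set Y" "inv_image_sheaf ?F" by (rule group_presheaf_inv_image) unfold_locales
  interpret P: group_presheaf "top_of_set Y" "pullback_sheaf A Y (hol_forms A)" by (rule group_presheaf_pullback)
  have mult: "pcls p u \<otimes>\<^bsub>pullback_stalk A Y (hol_forms A) p\<^esub> pcls p v = pcls p (u + v)" for p u v
    unfolding pullback_stalk_eq pcls_def by (rule T.cls_mult)
  show ?thesis
  proof
    fix V s t assume "openin (top_of_set Y) V" and s: "s \<in> carrier (inv_image_sheaf ?F V)"
    then have VY: "V \<subseteq> Y" using openin_subset[of "top_of_set Y" V] by simp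
    show "to_pullback A Y (hol_forms A) V s \<in> carrier (pullback_sheaf A Y (hol_forms A) V)"
      unfolding pullback_sheaf_carrier
    proof (intro conjI ballI)
      fix p assume p: "p \<in> V"
      then obtain U \<sigma> where U: "open U" "p \<in> U" "\<sigma> \<in> carrier (hol_forms A U)" "\<forall>q\<in>U \<inter> V. s q = gM q U \<sigma>"
        using s unfolding inv_image_sheaf_simps by auto
      show "\<exists>U (m::nat) \<sigma> g. open U \<and> p \<in> U \<and>
        (\<forall>k<m. \<sigma> k \<in> carrier (hol_forms A U) \<and> g k \<in> carrier (sub_hol_sheaf A (U \<inter> Y))) \<and>
        (\<forall>q\<in>U \<inter> V. to_pullback A Y (hol_forms A) V s q = pcls q (\<Sum>k<m. pure q U (\<sigma> k) (g k)))"
        using U VY to_pullback_germ[OF U(1), of _ V s \<sigma>] sub_hol_const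
        by (intro exI[of _ U] exI[of _ "1::nat"] exI[of _ "\<lambda>_. \<sigma>"] exI[of _ "\<lambda>_. \<lambda>q\<in>U \<inter> Y. 1"]) auto
    qed (simp add: to_pullback_def)
    assume t: "t \<in> carrier (inv_image_sheaf ?F V)"
    have "to_pullback A Y (hol_forms A) V (s \<otimes>\<^bsub>inv_image_sheaf ?F V\<^esub> t) p =
       (to_pullback A Y (hol_forms A) V s \<otimes>\<^bsub>pullback_sheaf A Y (hol_forms A) V\<^esub> to_pullback A Y (hol_forms A) V t) p"
      if p: "p \<in> V" for p
    proof -
      have "u p \<in> carrier (stalk euclidean ?F p)" if "u \<in> carrier (inv_image_sheaf ?F V)" for u
      proof -
        have "\<exists>U \<sigma>. open U \<and> p \<in> U \<and> \<sigma> \<in> carrier (?F U) \<and> u p = F.gm p U \<sigma>"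
          using that p unfolding inv_image_sheaf_simps by blast
        then show ?thesis using F.stalk_carrierI by auto
      qed
      from this[OF s] this[OF t] obtain U \<sigma> \<theta> where U0: "openin euclidean U" "p \<in> U" "\<sigma> \<in> carrier (?F U)" "\<theta> \<in> carrier (?F U)"
         "s p = F.gm p U \<sigma>" "t p = F.gm p U \<theta>" by (rule F.stalk_common2)
      then have U: "open U" "\<sigma> \<in> carrier (hol_forms A U)" "\<theta> \<in> carrier (hol_forms A U)" "s p = gM p U \<sigma>" "t p = gM p U \<theta>" by auto
      have pY: "p \<in> Y" using p VY by auto
      have "(s \<otimes>\<^bsub>inv_image_sheaf ?F V\<^esub> t) p = gM p U (\<lambda>p\<in>U. \<lambda>c. \<sigma> p c + \<theta> p c)"
        using F.stalk_mult[OF U0(1-4)] U0 p by (simp add: inv_image_sheaf_simps hol_forms_ops)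
      note v = to_pullback_germ[of U p V "s \<otimes>\<^bsub>inv_image_sheaf ?F V\<^esub> t", OF U(1) U0(2) pY p this] to_pullback_germ[of U p V s, OF U(1) U0(2) pY p U(4)] to_pullback_germ[of U p V t, OF U(1) U0(2) pY p U(5)]
      obtain c where c: "c \<in> A" "p \<in> fst c" by (rule atlas_cover)
      \<comment> \<open>Additivity in the form, obtained by comparing the coefficients of one tensor
        with those of a sum of two.\<close>
      have "pcls p (\<Sum>k\<in>{0::nat}. pure p U (\<lambda>p\<in>U. \<lambda>c. \<sigma> p c + \<theta> p c) (\<lambda>q\<in>U \<inter> Y. 1)) =
         pcls p (\<Sum>k\<in>{0::nat, 1}. pure p U (if k = 0 then \<sigma> else \<theta>) (\<lambda>q\<in>U \<inter> Y. 1))"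
        by (rule pullback_class_eqI[OF pY c(2,1) U(1) U0(2) U(1) U0(2)])
           (use U hol_forms_add[OF U(1-3)] sub_hol_const in auto)
      then show ?thesis using p by (simp add: pullback_sheaf_ops v mult)
    qed
    then show "to_pullback A Y (hol_forms A) V (s \<otimes>\<^bsub>inv_image_sheaf ?F V\<^esub> t) =
       to_pullback A Y (hol_forms A) V s \<otimes>\<^bsub>pullback_sheaf A Y (hol_forms A) V\<^esub> to_pullback A Y (hol_forms A) V t"
      by (auto simp: to_pullback_def pullback_sheaf_ops(1) restrict_def fun_eq_iff)
  qed (auto simp: to_pullback_def restrict_def fun_eq_iff)
qed

end


section \<open>Semi-positive metrics restricted to a submanifold\<close>

text \<open>A trivialization is bijective on each fibre, so the description in \<open>frame\<close>
  picks out a unique element.\<close>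

lemma frame_props:
  assumes "line_bundle T R \<pi> B" "(U, \<tau>) \<in> B" "p \<in> U"
  shows "\<pi> (frame \<pi> \<tau> p) = p" "\<tau> (frame \<pi> \<tau> p) = 1"
proof -
  have "bij_betw \<tau> {e. \<pi> e = p} UNIV" using assms unfolding line_bundle_def by blast
  then have inj: "inj_on \<tau> {e. \<pi> e = p}" and "1 \<in> \<tau> ` {e. \<pi> e = p}" unfolding bij_betw_def by auto
  then obtain e where e: "\<pi> e = p" "\<tau> e = 1" by auto
  have "\<exists>!e. \<pi> e = p \<and> \<tau> e = 1"
  proof (rule ex1I[of _ e])
    show "e' = e" if "\<pi> e' = p \<and> \<tau> e' = 1" for e'
      by (rule inj_onD[OF inj]) (use that e in simp_all)
  qed (simp add: e)
  from theI'[OF this] show "\<pi> (frame \<pi> \<tau> p) = p" "\<tau> (frame \<pi> \<tau> p) = 1" unfolding frame_def by auto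
qed

lemma line_bundle_transition:
  assumes "line_bundle T R \<pi> B" "(U, \<tau>) \<in> B" "(U', \<tau>') \<in> B"
  shows "transition \<pi> \<tau> \<tau>' (U \<inter> U') \<in> Units (R (U \<inter> U'))"
    and "\<pi> e \<in> U \<inter> U' \<Longrightarrow> \<tau> e = transition \<pi> \<tau> \<tau>' (U \<inter> U') (\<pi> e) * \<tau>' e"
  using assms unfolding line_bundle_def by blast+

lemma has_derivative_wirtinger_add:
  assumes "f differentiable (at z)" "g differentiable (at z)"
  shows "d_dz i (\<lambda>w. f w + g w) z = d_dz i f z + d_dz i g z"
proof -
  have "((\<lambda>w. f w + g w) has_derivative (\<lambda>v. \<Sum>j\<in>UNIV. (d_dz j f z + d_dz j g z) * v $ j + (d_dzbar j f z + d_dzbar j g z) * cnj (v $ j))) (at z)"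
    using has_derivative_add[OF assms[THEN has_derivative_wirtinger]]
    by (simp add: sum.distrib[symmetric] algebra_simps)
  from wirtinger_unique(1)[OF this] show ?thesis .
qed

text \<open>Formally log |g|^2 is log g plus its conjugate, and \<open>d_dz\<close> sees the first
  summand only. Writing |g|^2 as a real inner product avoids the choice of a branch of log
  g.\<close>

lemma d_dz_ln_cmod_square:
  assumes g: "holomorphic_at_vec g z" "g z \<noteq> 0"
  shows "(\<lambda>w. complex_of_real (ln ((cmod (g w))\<^sup>2))) differentiable (at z)"
    and "d_dz i (\<lambda>w. complex_of_real (ln ((cmod (g w))\<^sup>2))) z = d_dz i g z / g z"
proof -
  let ?d = "\<lambda>v. \<Sum>j\<in>UNIV. d_dz j g z * v $ j"
  have "((\<lambda>w. g w \<bullet> g w) has_derivative (\<lambda>v. 2 * (g z \<bullet> ?d v))) (at z)"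
    using has_derivative_inner[OF holomorphic_at_vecD[OF g(1)] holomorphic_at_vecD[OF g(1)]]
    by (simp add: inner_commute)
  then have "((\<lambda>w. (cmod (g w))\<^sup>2) has_derivative (\<lambda>v. 2 * (g z \<bullet> ?d v))) (at z)"
    by (simp add: power2_norm_eq_inner)
  from has_derivative_ln[OF _ this] g(2)
  have "((\<lambda>w. ln ((cmod (g w))\<^sup>2)) has_derivative (\<lambda>v. 2 * (g z \<bullet> ?d v) * inverse ((cmod (g z))\<^sup>2))) (at z)"
    by simp
  then have 1: "((\<lambda>w. complex_of_real (ln ((cmod (g w))\<^sup>2))) has_derivative
      (\<lambda>v. complex_of_real (2 * (g z \<bullet> ?d v) * inverse ((cmod (g z))\<^sup>2)))) (at z)"
    by (rule has_derivative_of_real)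
  then show "(\<lambda>w. complex_of_real (ln ((cmod (g w))\<^sup>2))) differentiable (at z)" by (rule differentiableI)
  have "complex_of_real (2 * (g z \<bullet> d) * inverse ((cmod (g z))\<^sup>2)) = d / g z + cnj (d / g z)" for d
  proof -
    have "(g z \<bullet> d) * inverse ((cmod (g z))\<^sup>2) = Re (d / g z)"
      by (simp add: inner_complex_def Re_divide cmod_power2 divide_inverse algebra_simps)
    then have "complex_of_real (2 * (g z \<bullet> d) * inverse ((cmod (g z))\<^sup>2)) = complex_of_real (2 * Re (d / g z))"
      by (simp add: mult.assoc)
    then show ?thesis by (simp only: complex_add_cnj)
  qed
  then have "complex_of_real (2 * (g z \<bullet> ?d v) * inverse ((cmod (g z))\<^sup>2)) =
     (\<Sum>j\<in>UNIV. d_dz j g z / g z * v $ j + cnj (d_dz j g z / g z) * cnj (v $ j))" for v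
    by (simp add: sum_divide_distrib sum.distrib)
  with 1 have "((\<lambda>w. complex_of_real (ln ((cmod (g w))\<^sup>2))) has_derivative
      (\<lambda>v. \<Sum>j\<in>UNIV. d_dz j g z / g z * v $ j + cnj (d_dz j g z / g z) * cnj (v $ j))) (at z)" by simp
  from wirtinger_unique(1)[OF this] show "d_dz i (\<lambda>w. complex_of_real (ln ((cmod (g w))\<^sup>2))) z = d_dz i g z / g z" .
qed

text \<open>The situation to be contradicted: \<open>h\<close> is a semi-positive metric and
  \<open>S\<close> a family of unitary frames of the restricted bundle. \<open>S\<close> and the
  restrictions of \<open>L\<close> trivialize one bundle over \<open>Y\<close>, so the transition
  functions between them are units of O_Y.\<close>

locale semipositive_flat = complex_mfd_sub A Y
  for A :: "('a::{t2_space, second_countable_topology}, 'n::finite) chart set" and Y +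
  fixes \<pi> :: "'e \<Rightarrow> 'a" and L S :: "('a set \<times> ('e \<Rightarrow> complex)) set" and h :: "'e \<Rightarrow> real"
  assumes subm: "complex_submanifold A Y" and comp: "compact Y"
    and lb: "line_bundle euclidean (hol_sheaf A) \<pi> L"
    and flat: "line_bundle (top_of_set Y) (sub_hol_sheaf A) \<pi> (restrict_bundle Y L \<union> S)"
    and S_cover: "(\<Union>(U, \<tau>)\<in>S. U) = Y"
    and S_unitary: "\<And>U \<tau> U' \<tau>' p. (U, \<tau>) \<in> S \<Longrightarrow> (U', \<tau>') \<in> S \<Longrightarrow> p \<in> U \<inter> U' \<Longrightarrow>
       cmod (transition \<pi> \<tau> \<tau>' (U \<inter> U') p) = 1"
    and metric: "hermitian_metric A \<pi> L h"
    and psd: "\<And>U \<tau> c p \<xi>. (U, \<tau>) \<in> L \<Longrightarrow> c \<in> A \<Longrightarrow> p \<in> U \<Longrightarrow> p \<in> fst c \<Longrightarrow>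
       (\<Sum>j\<in>UNIV. \<Sum>k\<in>UNIV. chern_curvature c \<pi> \<tau> h p j k * \<xi> $ j * cnj (\<xi> $ k)) \<in> \<real>\<^sub>\<ge>\<^sub>0"
begin

abbreviation weight :: "('e \<Rightarrow> complex) \<Rightarrow> 'a \<Rightarrow> real" where "weight \<tau> p \<equiv> h (frame \<pi> \<tau> p)"

text \<open>Complex valued, since the Wirtinger operators act on complex functions.\<close>

definition lnw :: "('e \<Rightarrow> complex) \<Rightarrow> ('a, 'n) chart \<Rightarrow> complex ^ 'n \<Rightarrow> complex" where
  "lnw \<tau> c z = complex_of_real (ln (weight \<tau> (chart_inv c z)))"

lemma trivialization_open: "(U, \<tau>) \<in> L \<Longrightarrow> open U"
  using lb unfolding line_bundle_def by auto

lemma weight_pos: "(U, \<tau>) \<in> L \<Longrightarrow> p \<in> U \<Longrightarrow> weight \<tau> p > 0"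
  and metric_eq: "(U, \<tau>) \<in> L \<Longrightarrow> \<pi> e \<in> U \<Longrightarrow> h e = (cmod (\<tau> e))\<^sup>2 * weight \<tau> (\<pi> e)"
  using metric unfolding hermitian_metric_def by blast+

lemma lnw_differentiable:
  assumes "(U, \<tau>) \<in> L" "c \<in> A" "z \<in> snd c ` (fst c \<inter> U)"
  shows "lnw \<tau> c differentiable (at z)" "d_dz k (lnw \<tau> c) differentiable (at z)" "d_dzbar k (lnw \<tau> c) differentiable (at z)"
proof -
  have C: "C_infinity_on (\<lambda>z. weight \<tau> (chart_inv c z)) (snd c ` (fst c \<inter> U))"
    using metric assms unfolding hermitian_metric_def by blast
  have pos: "weight \<tau> (chart_inv c z) > 0" if "z \<in> snd c ` (fst c \<inter> U)" for z
    using that weight_pos[OF assms(1)] atlasD(4)[OF assms(2)] by auto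
  have "lnw \<tau> c = (\<lambda>z. complex_of_real (ln (weight \<tau> (chart_inv c z))))" by (auto simp: lnw_def)
  then show "lnw \<tau> c differentiable (at z)" "d_dz k (lnw \<tau> c) differentiable (at z)" "d_dzbar k (lnw \<tau> c) differentiable (at z)"
    using differentiable_d_dz_ln[OF C pos assms(3)] by simp_all
qed

lemma curvature_eq: "chern_curvature c \<pi> \<tau> h p j k = - d_dz j (d_dzbar k (lnw \<tau> c)) (snd c p)"
proof -
  have "lnw \<tau> c = (\<lambda>z. complex_of_real (ln (weight \<tau> (chart_inv c z))))" by (auto simp: lnw_def)
  then show ?thesis by (simp add: chern_curvature_def)
qed

text \<open>The logarithm of the squared norm of a unitary flat frame. It does not depend on the frame chosen
  by \<open>SOME\<close>, since the transition functions have modulus 1.\<close>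

definition \<psi> :: "'a \<Rightarrow> real" where
  "\<psi> x = ln (weight (snd (SOME s. s \<in> S \<and> x \<in> fst s)) x)"

lemma S_trivialization: assumes "x \<in> Y" obtains V \<sigma> where "(V, \<sigma>) \<in> S" "x \<in> V" "openin (top_of_set Y) V"
proof -
  obtain V \<sigma> where V: "(V, \<sigma>) \<in> S" "x \<in> V" using assms S_cover by auto
  then have "openin (top_of_set Y) V" using flat unfolding line_bundle_def by auto
  then show ?thesis using V that by blast
qed

lemma L_trivialization: obtains U \<tau> where "(U, \<tau>) \<in> L" "x \<in> U"
proof -
  have "x \<in> (\<Union>(U, \<tau>)\<in>L. U)" using lb unfolding line_bundle_def by simp
  then show ?thesis using that by auto
qed

text \<open>The frame chosen by \<open>SOME\<close> differs from that of \<open>\<sigma>\<close> by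
  a factor of modulus 1, so its \<open>\<tau>\<close>-coordinate has the modulus of the transition
  function. In the resulting formula the first summand is harmonic along complex curves in
  \<open>Y\<close>, so only the weight contributes to Laplacians of \<open>\<psi>\<close>.\<close>

lemma \<psi>_eq:
  assumes V: "(V, \<sigma>) \<in> S" "x \<in> V" and U: "(U, \<tau>) \<in> L" "x \<in> U" and x: "x \<in> Y"
  shows "transition \<pi> \<tau> \<sigma> (U \<inter> Y \<inter> V) x \<noteq> 0"
    and "\<psi> x = 2 * ln (cmod (transition \<pi> \<tau> \<sigma> (U \<inter> Y \<inter> V) x)) + ln (weight \<tau> x)"
proof -
  have UB: "(U \<inter> Y, \<tau>) \<in> restrict_bundle Y L \<union> S" using U by (force simp: restrict_bundle_def)
  have VB: "(V, \<sigma>) \<in> restrict_bundle Y L \<union> S" using V by simp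
  define g where "g = transition \<pi> \<tau> \<sigma> (U \<inter> Y \<inter> V)"
  have g: "g \<in> Units (sub_hol_sheaf A (U \<inter> Y \<inter> V))" "\<And>e. \<pi> e \<in> U \<inter> Y \<inter> V \<Longrightarrow> \<tau> e = g (\<pi> e) * \<sigma> e"
    using line_bundle_transition[OF flat UB VB] by (auto simp: g_def)
  obtain k where "(\<lambda>p\<in>U \<inter> Y \<inter> V. k p * g p) = (\<lambda>p\<in>U \<inter> Y \<inter> V. 1)"
    using g(1) unfolding Units_def sub_hol_ops by blast
  from fun_cong[OF this, of x] show gx: "transition \<pi> \<tau> \<sigma> (U \<inter> Y \<inter> V) x \<noteq> 0"
    using V U x by (auto simp: g_def)
  have wx: "weight \<tau> x > 0" using weight_pos[OF U] .
  define s where "s = (SOME s. s \<in> S \<and> x \<in> fst s)"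
  have s: "s \<in> S \<and> x \<in> fst s" unfolding s_def by (rule someI[of _ "(V, \<sigma>)"]) (use V in auto)
  have sS: "(fst s, snd s) \<in> S" "x \<in> fst s" using s by auto
  let ?e = "frame \<pi> (snd s) x"
  have sB: "(fst s, snd s) \<in> restrict_bundle Y L \<union> S" using sS by simp
  have pe: "\<pi> ?e = x" using frame_props[OF flat sB sS(2)] by simp
  have "cmod (\<sigma> ?e) = 1"
    using S_unitary[OF V(1) sS(1), of x] V sS by (simp add: transition_def)
  then have "cmod (\<tau> ?e) = cmod (g x)" using g(2)[of ?e] pe V U x by (simp add: norm_mult)
  then have "h ?e = (cmod (g x))\<^sup>2 * weight \<tau> x" using metric_eq[OF U(1), of ?e] pe U by simp
  then have "\<psi> x = ln ((cmod (g x))\<^sup>2 * weight \<tau> x)" unfolding \<psi>_def s_def by simp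
  also have "\<dots> = 2 * ln (cmod (g x)) + ln (weight \<tau> x)"
    using gx wx by (simp add: ln_mult g_def ln_realpow)
  finally show "\<psi> x = 2 * ln (cmod (transition \<pi> \<tau> \<sigma> (U \<inter> Y \<inter> V) x)) + ln (weight \<tau> x)" by (simp add: g_def)
qed

text \<open>The chart \<open>c'\<close> maps \<open>Y\<close> to the slice \<open>y\<^sub>i = 0\<close> (\<open>i \<in> J\<close>), and \<open>G\<close> extends, in the coordinates of \<open>c'\<close>, the
  transition function between \<open>\<tau>\<close> and a flat frame.\<close>

definition adapted :: "('a, 'n) chart \<Rightarrow> 'a set \<Rightarrow> ('e \<Rightarrow> complex) \<Rightarrow> ('a, 'n) chart \<Rightarrow> 'n set \<Rightarrow> (complex ^ 'n) set \<Rightarrow> (complex ^ 'n \<Rightarrow> complex) \<Rightarrow> bool" where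
  "adapted c U \<tau> c' J D G \<longleftrightarrow> holomorphic_chart A c' \<and> open D \<and> D \<subseteq> snd c' ` (fst c' \<inter> fst c \<inter> U) \<and>
     (\<forall>y\<in>D. holomorphic_at_vec G y) \<and>
     (\<forall>y\<in>D. (\<forall>i\<in>J. y $ i = 0) \<longrightarrow> chart_inv c' y \<in> Y \<and> G y \<noteq> 0 \<and>
        \<psi> (chart_inv c' y) = 2 * ln (cmod (G y)) + ln (weight \<tau> (chart_inv c' y))) \<and>
     (\<forall>q\<in>fst c' \<inter> Y. \<forall>i\<in>J. snd c' q $ i = 0)"

text \<open>The transition function to a flat frame is a section of O_Y, so near \<open>x\<close> it
  is the restriction of a holomorphic function \<open>k\<close> on the ambient manifold;
  \<open>G\<close> is \<open>k\<close> in the coordinates of the submanifold chart. Off the slice it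
  is an arbitrary extension, so its relation to \<open>\<psi>\<close> is claimed on the slice
  only.\<close>

lemma adapted_exists:
  assumes U: "(U, \<tau>) \<in> L" "x \<in> U" and c: "c \<in> A" "x \<in> fst c" and x: "x \<in> Y"
  obtains c' J D G where "adapted c U \<tau> c' J D G" "x \<in> fst c'" "snd c' x \<in> D"
proof -
  obtain c' J where c': "holomorphic_chart A c'" "x \<in> fst c'"
    and im: "snd c' ` (fst c' \<inter> Y) = {z \<in> snd c' ` fst c'. \<forall>i\<in>J. z $ i = 0}"
    using bspec[OF subm[unfolded complex_submanifold_def] x] by (elim exE conjE)
  obtain V \<sigma> where V: "(V, \<sigma>) \<in> S" "x \<in> V" "openin (top_of_set Y) V" using S_trivialization[OF x] .
  obtain V' where V': "open V'" "V = Y \<inter> V'" using V(3) by (auto simp: openin_open)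
  define g where "g = transition \<pi> \<tau> \<sigma> (U \<inter> Y \<inter> V)"
  have UB: "(U \<inter> Y, \<tau>) \<in> restrict_bundle Y L \<union> S" using U by (force simp: restrict_bundle_def)
  have VB: "(V, \<sigma>) \<in> restrict_bundle Y L \<union> S" using V by simp
  have "g \<in> carrier (sub_hol_sheaf A (U \<inter> Y \<inter> V))"
    using line_bundle_transition(1)[OF flat UB VB] unfolding g_def Units_def by blast
  moreover have "x \<in> U \<inter> Y \<inter> V" using U V x by auto
  ultimately obtain Z k where Z: "open Z" "x \<in> Z" "k \<in> carrier (hol_sheaf A Z)" "\<forall>q\<in>Z \<inter> (U \<inter> Y \<inter> V). g q = k q"
    unfolding sub_hol_carrier by blast
  define N where "N = fst c \<inter> U \<inter> V' \<inter> Z"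
  have N: "open N" "x \<in> N" using atlasD(1)[OF c(1)] trivialization_open[OF U(1)] V' V Z U c by (auto simp: N_def)
  define D where "D = snd c' ` (fst c' \<inter> N)"
  have inv: "chart_inv c' y \<in> fst c' \<inter> N" "snd c' (chart_inv c' y) = y" if "y \<in> D" for y
    using that holomorphic_chartD(4)[OF c'(1)] by (auto simp: D_def)
  have "adapted c U \<tau> c' J D (k \<circ> chart_inv c')"
    unfolding adapted_def
  proof (intro conjI ballI impI)
    show "open D" unfolding D_def by (rule holomorphic_chart_open_image[OF c'(1) N(1)])
    show "D \<subseteq> snd c' ` (fst c' \<inter> fst c \<inter> U)" unfolding D_def N_def by auto
    fix y assume y: "y \<in> D"
    obtain c0 where c0: "c0 \<in> A" "chart_inv c' y \<in> fst c0" by (rule atlas_cover)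
    have "holomorphic_at_vec (k \<circ> chart_inv c0) (snd c0 (chart_inv c' y))"
      using hol_sheafD[OF Z(1,3) c0] inv(1)[OF y] by (simp add: N_def)
    from chart_change(1)[OF c'(1) atlas_chart[OF c0(1)] holomorphic_chartD(7)[OF c'(1) c0(1)] _ c0(2) this] inv[OF y]
    show "holomorphic_at_vec (k \<circ> chart_inv c') y" by simp
    assume "\<forall>i\<in>J. y $ i = 0"
    then have "y \<in> snd c' ` (fst c' \<inter> Y)" using im y by (auto simp: D_def)
    then show qY: "chart_inv c' y \<in> Y" using holomorphic_chartD(4)[OF c'(1)] by auto
    have q: "chart_inv c' y \<in> V" "chart_inv c' y \<in> U" "chart_inv c' y \<in> Z"
      using inv(1)[OF y] qY V' by (auto simp: N_def)
    then have gk: "g (chart_inv c' y) = k (chart_inv c' y)" using Z(4) qY by blast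
    show "(k \<circ> chart_inv c') y \<noteq> 0" using \<psi>_eq(1)[OF V(1) q(1) U(1) q(2) qY] gk by (simp add: g_def)
    show "\<psi> (chart_inv c' y) = 2 * ln (cmod ((k \<circ> chart_inv c') y)) + ln (weight \<tau> (chart_inv c' y))"
      using \<psi>_eq(2)[OF V(1) q(1) U(1) q(2) qY] gk by (simp add: g_def)
  next
    fix q i assume "q \<in> fst c' \<inter> Y" "i \<in> J"
    then show "snd c' q $ i = 0" using im by blast
  qed (rule c'(1))
  moreover have "snd c' x \<in> D" using c' N by (auto simp: D_def)
  ultimately show ?thesis using that c' by blast
qed

end


section \<open>The function \<psi> on slices, its local constancy, and holomorphy of \<partial> log
  h along Y\<close>

lemma norm_smult_vec: "norm (a *s v) = norm a * norm v" for v :: "complex ^ 'n::finite"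
  by (simp add: norm_vec_def norm_mult L2_set_right_distrib)

context semipositive_flat
begin

lemma adapted_point:
  assumes ad: "adapted c U \<tau> c' J D G" and c: "c \<in> A" and y: "y \<in> D"
  shows "chart_inv c' y \<in> fst c'" "chart_inv c' y \<in> fst c" "chart_inv c' y \<in> U" "snd c' (chart_inv c' y) = y"
    "holomorphic_at_vec (\<lambda>z. snd c (chart_inv c' z) $ k) y"
    "snd c (chart_inv c' y) \<in> snd c ` (fst c \<inter> U)" "chart_inv c (snd c (chart_inv c' y)) = chart_inv c' y"
proof -
  have c': "holomorphic_chart A c'" and "y \<in> snd c' ` (fst c' \<inter> fst c \<inter> U)" using ad y unfolding adapted_def by auto
  then obtain q where q: "q \<in> fst c'" "q \<in> fst c" "q \<in> U" "y = snd c' q" by auto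
  then have "chart_inv c' y = q" using holomorphic_chartD(4)[OF c'] by simp
  with q show *: "chart_inv c' y \<in> fst c'" "chart_inv c' y \<in> fst c" "chart_inv c' y \<in> U" "snd c' (chart_inv c' y) = y" by auto
  show "holomorphic_at_vec (\<lambda>z. snd c (chart_inv c' z) $ k) y"
    using holomorphic_transition_at[OF holomorphic_chartD(7)[OF c' c] *(1,2)] *(4) by simp
  show "snd c (chart_inv c' y) \<in> snd c ` (fst c \<inter> U)" using * by auto
  show "chart_inv c (snd c (chart_inv c' y)) = chart_inv c' y" by (rule atlasD(4)[OF c *(2)])
qed

lemma adapted_line_open:
  assumes "adapted c U \<tau> c' J D G" shows "open {\<zeta>. y + \<zeta> *s v \<in> D}"
proof -
  have "linear (\<lambda>\<zeta>. \<zeta> *s v)" by (rule linearI) (auto simp: vec_eq_iff algebra_simps)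
  then have "continuous_on UNIV (\<lambda>\<zeta>. y + \<zeta> *s v)"
    by (intro continuous_on_add continuous_on_const linear_continuous_on) (simp add: linear_conv_bounded_linear)
  moreover have "open D" using assms unfolding adapted_def by simp
  ultimately show ?thesis using open_vimage[of D "\<lambda>\<zeta>. y + \<zeta> *s v"] by (simp add: vimage_def)
qed

text \<open>On a complex line in the slice, \<open>\<psi>\<close> is the harmonic term 2 log |G|
  plus the log weight along a holomorphic curve with velocity \<open>w\<close>. The Laplacian of the
  latter is 4 times the complex Hessian at \<open>w\<close>, and the curvature is minus that
  Hessian. Differentiability is recorded for Hopf's lemma, which takes a normal derivative.\<close>

lemma psi_along_slice:
  assumes ad: "adapted c U \<tau> c' J D G" and c: "c \<in> A" and U: "(U, \<tau>) \<in> L"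
    and y: "\<forall>i\<in>J. y $ i = 0" and v: "\<forall>i\<in>J. v $ i = 0" and \<zeta>: "y + \<zeta> *s v \<in> D"
    and w: "\<And>k. w $ k = (\<Sum>j\<in>UNIV. d_dz j (\<lambda>z. snd c (chart_inv c' z) $ k) (y + \<zeta> *s v) * v $ j)"
  shows "has_laplacian (\<lambda>\<zeta>. \<psi> (chart_inv c' (y + \<zeta> *s v)))
      (- 4 * Re (\<Sum>j\<in>UNIV. \<Sum>k\<in>UNIV. chern_curvature c \<pi> \<tau> h (chart_inv c' (y + \<zeta> *s v)) j k * w $ j * cnj (w $ k))) \<zeta>"
    and "(\<lambda>\<zeta>. \<psi> (chart_inv c' (y + \<zeta> *s v))) differentiable (at \<zeta>)"
proof -
  define T where "T = {\<zeta>. y + \<zeta> *s v \<in> D}"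
  define f where "f z = ln (weight \<tau> (chart_inv c z))" for z
  define \<gamma> where "\<gamma> \<zeta> = snd c (chart_inv c' (y + \<zeta> *s v))" for \<zeta>
  define g where "g \<zeta> = G (y + \<zeta> *s v)" for \<zeta>
  have F: "lnw \<tau> c = (\<lambda>z. complex_of_real (f z))" by (auto simp: lnw_def f_def)
  have T: "open T" "\<zeta> \<in> T" using adapted_line_open[OF ad] \<zeta> by (auto simp: T_def)
  have slice: "\<forall>i\<in>J. (y + \<xi> *s v) $ i = 0" for \<xi> using y v by simp
  have line: "((\<lambda>\<xi>. (y + \<xi> *s v) $ k) has_field_derivative v $ k) (at \<xi>)" for k \<xi>
    by (auto intro!: derivative_eq_intros)
  have der: "((\<lambda>\<xi>. \<gamma> \<xi> $ k) has_field_derivative (\<Sum>j\<in>UNIV. d_dz j (\<lambda>z. snd c (chart_inv c' z) $ k) (y + \<xi> *s v) * v $ j)) (at \<xi>)"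
    if "\<xi> \<in> T" for k \<xi>
    unfolding \<gamma>_def using has_field_derivative_along_curve[OF adapted_point(5)[OF ad c] line] that by (simp add: T_def)
  have hol: "(\<lambda>\<xi>. \<gamma> \<xi> $ k) holomorphic_on T" for k
    using der T by (auto simp: holomorphic_on_open)
  have wk: "w $ k = deriv (\<lambda>\<xi>. \<gamma> \<xi> $ k) \<zeta>" for k
    using DERIV_imp_deriv[OF der[OF T(2), of k]] w by simp
  have gder: "(g has_field_derivative (\<Sum>j\<in>UNIV. d_dz j G (y + \<xi> *s v) * v $ j)) (at \<xi>)" if "\<xi> \<in> T" for \<xi>
    unfolding g_def using has_field_derivative_along_curve[OF _ line, of G] that ad by (simp add: T_def adapted_def)
  have ghol: "g holomorphic_on T" using gder T by (auto simp: holomorphic_on_open)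
  have nz: "g \<xi> \<noteq> 0" and eq: "\<psi> (chart_inv c' (y + \<xi> *s v)) = 2 * ln (cmod (g \<xi>)) + f (\<gamma> \<xi>)" if "\<xi> \<in> T" for \<xi>
    using ad slice that adapted_point(7)[OF ad c] unfolding adapted_def T_def g_def f_def \<gamma>_def by auto
  have \<gamma>W: "\<gamma> \<xi> \<in> snd c ` (fst c \<inter> U)" if "\<xi> \<in> T" for \<xi>
    using adapted_point(6)[OF ad c] that by (simp add: \<gamma>_def T_def)
  have "has_laplacian (\<lambda>\<xi>. f (\<gamma> \<xi>))
    (4 * Re (\<Sum>j\<in>UNIV. \<Sum>k\<in>UNIV. d_dz j (d_dzbar k (lnw \<tau> c)) (\<gamma> \<zeta>) * w $ j * cnj (w $ k))) \<zeta>"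
    unfolding F
    by (rule has_laplacian_along_holomorphic_curve[OF T hol \<gamma>W _ _ wk])
       (use lnw_differentiable[OF U c] in \<open>auto simp flip: F\<close>)
  from has_laplacian_add[OF has_laplacian_cmult[OF has_laplacian_ln_cmod[OF ghol T nz], of 2] this]
  have "has_laplacian (\<lambda>\<xi>. 2 * ln (cmod (g \<xi>)) + f (\<gamma> \<xi>))
    (4 * Re (\<Sum>j\<in>UNIV. \<Sum>k\<in>UNIV. d_dz j (d_dzbar k (lnw \<tau> c)) (\<gamma> \<zeta>) * w $ j * cnj (w $ k))) \<zeta>" by simp
  from has_laplacian_cong[OF T eq[symmetric] this]
  show "has_laplacian (\<lambda>\<zeta>. \<psi> (chart_inv c' (y + \<zeta> *s v)))
      (- 4 * Re (\<Sum>j\<in>UNIV. \<Sum>k\<in>UNIV. chern_curvature c \<pi> \<tau> h (chart_inv c' (y + \<zeta> *s v)) j k * w $ j * cnj (w $ k))) \<zeta>"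
    unfolding curvature_eq by (simp add: \<gamma>_def sum_negf)
  have "(f has_derivative (\<lambda>v. 2 * Re (\<Sum>k\<in>UNIV. d_dzbar k (lnw \<tau> c) (\<gamma> \<zeta>) * cnj (v $ k)))) (at (\<gamma> \<zeta>))"
    unfolding F by (rule wirtinger_of_real(2)) (use lnw_differentiable(1)[OF U c \<gamma>W[OF T(2)]] in \<open>simp flip: F\<close>)
  moreover have "(\<gamma> has_derivative (\<lambda>d. d *s w)) (at \<zeta>)"
    using der[OF T(2)] w by (intro has_derivative_vecI) (simp add: has_field_derivative_def mult_commute_abs)
  ultimately have "(\<lambda>\<xi>. f (\<gamma> \<xi>)) differentiable (at \<zeta>)"
    using has_derivative_compose[of \<gamma> _ \<zeta> UNIV f] differentiableI by blast
  \<comment> \<open>This is 2 ln |g|, in a form whose derivative comes from the product rule for the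
    inner product.\<close>
  moreover have "(\<lambda>\<xi>. ln (g \<xi> \<bullet> g \<xi>)) differentiable (at \<zeta>)"
  proof -
    have "(g has_derivative (*) (\<Sum>j\<in>UNIV. d_dz j G (y + \<zeta> *s v) * v $ j)) (at \<zeta>)"
      using gder[OF T(2)] by (simp add: has_field_derivative_def)
    from has_derivative_ln[OF _ has_derivative_inner[OF this this]] nz[OF T(2)]
    show ?thesis by (auto intro!: differentiableI)
  qed
  ultimately have "(\<lambda>\<xi>. ln (g \<xi> \<bullet> g \<xi>) + f (\<gamma> \<xi>)) differentiable (at \<zeta>)" by (intro differentiable_add)
  then obtain d where d: "((\<lambda>\<xi>. ln (g \<xi> \<bullet> g \<xi>) + f (\<gamma> \<xi>)) has_derivative d) (at \<zeta>)" unfolding differentiable_def by blast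
  have "ln (g \<xi> \<bullet> g \<xi>) + f (\<gamma> \<xi>) = \<psi> (chart_inv c' (y + \<xi> *s v))" if "\<xi> \<in> T" for \<xi>
    using eq[OF that] nz[OF that] by (simp add: ln_realpow flip: power2_norm_eq_inner)
  from has_derivative_transform_within_open[OF d T this]
  show "(\<lambda>\<zeta>. \<psi> (chart_inv c' (y + \<zeta> *s v))) differentiable (at \<zeta>)" by (rule differentiableI)
qed

lemma psi_continuous_slice:
  assumes ad: "adapted c U \<tau> c' J D G" and c: "c \<in> A" and U: "(U, \<tau>) \<in> L"
  shows "continuous_on {y \<in> D. \<forall>i\<in>J. y $ i = 0} (\<lambda>y. \<psi> (chart_inv c' y))"
proof -
  let ?f = "\<lambda>z. ln (weight \<tau> (chart_inv c z))"
  have F: "lnw \<tau> c = (\<lambda>z. complex_of_real (?f z))" by (auto simp: lnw_def)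
  have fc: "isCont ?f z" if "z \<in> snd c ` (fst c \<inter> U)" for z
    using wirtinger_of_real(2)[OF lnw_differentiable(1)[OF U c that, unfolded F]] by (rule has_derivative_continuous)
  have "isCont (\<lambda>y. ?f (snd c (chart_inv c' y))) y" if "y \<in> D" for y
    by (rule isCont_o2[OF has_derivative_continuous[OF has_derivative_holomorphic_map[OF adapted_point(5)[OF ad c that]]]
      fc[OF adapted_point(6)[OF ad c that]]])
  then have 1: "continuous_on {y \<in> D. \<forall>i\<in>J. y $ i = 0} (\<lambda>y. ?f (snd c (chart_inv c' y)))"
    by (intro continuous_at_imp_continuous_on) auto
  have "continuous_on {y \<in> D. \<forall>i\<in>J. y $ i = 0} G"
    using ad holomorphic_at_vec_isCont unfolding adapted_def by (intro continuous_at_imp_continuous_on) auto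
  then have "continuous_on {y \<in> D. \<forall>i\<in>J. y $ i = 0} (\<lambda>y. 2 * ln (cmod (G y)) + ?f (snd c (chart_inv c' y)))"
    using ad unfolding adapted_def
    by (intro continuous_on_add[OF _ 1] continuous_on_mult continuous_on_const continuous_on_ln continuous_on_norm) auto
  then show ?thesis
    by (rule continuous_on_eq) (use ad adapted_point(7)[OF ad c] in \<open>auto simp: adapted_def\<close>)
qed



text \<open>Every point of a ball in the slice lies on a complex line through the centre. There the
  negative of \<open>\<psi>\<close> has nonnegative Laplacian, so if it is maximal at the centre,
  the strong maximum principle makes it constant. Connectedness and continuity are supplied for the
  passage to whole components.\<close>

lemma psi_local_minimum:
  assumes x: "x \<in> Y"
  obtains N where "open N" "x \<in> N" "connected (N \<inter> Y)" "continuous_on (N \<inter> Y) \<psi>"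
    "(\<forall>q\<in>N \<inter> Y. \<psi> x \<le> \<psi> q) \<longrightarrow> (\<forall>q\<in>N \<inter> Y. \<psi> q = \<psi> x)"
proof -
  obtain U \<tau> where U: "(U, \<tau>) \<in> L" "x \<in> U" by (rule L_trivialization)
  obtain c where c: "c \<in> A" "x \<in> fst c" by (rule atlas_cover)
  obtain c' J D G where ad: "adapted c U \<tau> c' J D G" and x': "x \<in> fst c'" "snd c' x \<in> D"
    using adapted_exists[OF U c x] .
  have c': "holomorphic_chart A c'" and D: "open D" "D \<subseteq> snd c' ` fst c'"
    and sl: "\<And>q i. q \<in> fst c' \<Longrightarrow> q \<in> Y \<Longrightarrow> i \<in> J \<Longrightarrow> snd c' q $ i = 0"
    and sl': "\<And>y. y \<in> D \<Longrightarrow> \<forall>i\<in>J. y $ i = 0 \<Longrightarrow> chart_inv c' y \<in> Y"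
    using ad unfolding adapted_def by auto
  define y0 where "y0 = snd c' x"
  obtain r where r: "r > 0" "ball y0 r \<subseteq> D" using D x' openE[of D y0] unfolding y0_def by blast
  define B where "B = {y \<in> ball y0 r. \<forall>i\<in>J. y $ i = 0}"
  have y0: "\<forall>i\<in>J. y0 $ i = 0" using sl x' x by (auto simp: y0_def)
  define N where "N = fst c' \<inter> snd c' -` ball y0 r"
  have N: "open N" "x \<in> N"
    unfolding N_def using continuous_open_preimage[OF holomorphic_chartD(2,1)[OF c'] open_ball] x' r by (auto simp: y0_def)
  have NY: "N \<inter> Y = chart_inv c' ` B"
  proof (intro equalityI subsetI)
    fix q assume q: "q \<in> N \<inter> Y"
    then have "snd c' q \<in> B" "q = chart_inv c' (snd c' q)"
      using sl holomorphic_chartD(4)[OF c'] by (auto simp: N_def B_def)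
    then show "q \<in> chart_inv c' ` B" by blast
  next
    fix q assume "q \<in> chart_inv c' ` B"
    then obtain y where y: "y \<in> ball y0 r" "\<forall>i\<in>J. y $ i = 0" "q = chart_inv c' y" by (auto simp: B_def)
    then have "y \<in> D" using r by auto
    then show "q \<in> N \<inter> Y" using y adapted_point(1,4)[OF ad c(1) \<open>y \<in> D\<close>] sl' by (auto simp: N_def)
  qed
  have "convex B" unfolding B_def
  proof (rule convexI)
    fix a b and s t :: real assume *: "a \<in> {y \<in> ball y0 r. \<forall>i\<in>J. y $ i = 0}" "b \<in> {y \<in> ball y0 r. \<forall>i\<in>J. y $ i = 0}" "0 \<le> s" "0 \<le> t" "s + t = 1"
    then have "s *\<^sub>R a + t *\<^sub>R b \<in> ball y0 r" by (intro convexD[OF convex_ball]) auto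
    with * show "s *\<^sub>R a + t *\<^sub>R b \<in> {y \<in> ball y0 r. \<forall>i\<in>J. y $ i = 0}" by simp
  qed
  moreover have "B \<subseteq> snd c' ` fst c'" using D(2) r(2) by (auto simp: B_def)
  ultimately have "connected (N \<inter> Y)"
    unfolding NY using continuous_on_subset[OF holomorphic_chartD(3)[OF c'], of B]
    by (intro connected_continuous_image convex_connected)
  moreover have "continuous_on (N \<inter> Y) \<psi>"
  proof -
    have "continuous_on (N \<inter> Y) (\<lambda>q. \<psi> (chart_inv c' (snd c' q)))"
    proof (rule continuous_on_compose2[OF psi_continuous_slice[OF ad c(1) U(1)]])
      show "continuous_on (N \<inter> Y) (snd c')" by (rule continuous_on_subset[OF holomorphic_chartD(2)[OF c']]) (auto simp: N_def)
      show "snd c' ` (N \<inter> Y) \<subseteq> {y \<in> D. \<forall>i\<in>J. y $ i = 0}" using sl r by (auto simp: N_def)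
    qed
    then show ?thesis by (rule continuous_on_eq) (use holomorphic_chartD(4)[OF c'] in \<open>auto simp: N_def\<close>)
  qed
  moreover have "\<forall>q\<in>N \<inter> Y. \<psi> q = \<psi> x" if min: "\<forall>q\<in>N \<inter> Y. \<psi> x \<le> \<psi> q"
  proof
    fix q assume "q \<in> N \<inter> Y"
    then obtain y where y: "y \<in> ball y0 r" "\<forall>i\<in>J. y $ i = 0" "q = chart_inv c' y" unfolding NY B_def by auto
    define v where "v = y - y0"
    have v: "\<forall>i\<in>J. v $ i = 0" using y y0 by (simp add: v_def)
    \<comment> \<open>The parameters for which the line stays in the ball: a disc around 0, or the
      whole plane if \<open>v = 0\<close>. The parameter 0 gives \<open>x\<close> and 1 gives
      \<open>q\<close>.\<close>
    define E where "E = {\<zeta>. y0 + \<zeta> *s v \<in> ball y0 r}"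
    have E: "E = {\<zeta>. norm \<zeta> * norm v < r}"
      unfolding E_def by (auto simp: dist_norm norm_smult_vec)
    have inD: "y0 + \<zeta> *s v \<in> D" if "\<zeta> \<in> E" for \<zeta> using that r by (auto simp: E_def)
    have "open E" unfolding E by (intro open_Collect_less continuous_intros)
    have "connected E" unfolding E
    proof (rule convex_connected, rule convexI)
      fix a b :: complex and s t :: real assume *: "a \<in> {\<zeta>. norm \<zeta> * norm v < r}" "b \<in> {\<zeta>. norm \<zeta> * norm v < r}" "0 \<le> s" "0 \<le> t" "s + t = 1"
      have "norm (s *\<^sub>R a + t *\<^sub>R b) * norm v \<le> (s * norm a + t * norm b) * norm v"
        using norm_triangle_ineq[of "s *\<^sub>R a" "t *\<^sub>R b"] * by (intro mult_right_mono) auto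
      also have "\<dots> = s * (norm a * norm v) + t * (norm b * norm v)" by (simp add: algebra_simps)
      also have "\<dots> < r" using * by (intro convex_bound_lt) auto
      finally show "s *\<^sub>R a + t *\<^sub>R b \<in> {\<zeta>. norm \<zeta> * norm v < r}" by simp
    qed
    let ?u = "\<lambda>\<zeta>. \<psi> (chart_inv c' (y0 + \<zeta> *s v))"
    have x0: "chart_inv c' y0 = x" using holomorphic_chartD(4)[OF c' x'(1)] by (simp add: y0_def)
    have "- ?u 1 = - ?u 0"
    proof (rule strong_maximum_principle[OF \<open>open E\<close> \<open>connected E\<close>, of "\<lambda>\<zeta>. - ?u \<zeta>"])
      fix \<zeta> assume \<zeta>: "\<zeta> \<in> E"
      show "(\<lambda>\<zeta>. - ?u \<zeta>) differentiable (at \<zeta>)"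
        by (intro differentiable_minus psi_along_slice(2)[OF ad c(1) U(1) y0 v inD[OF \<zeta>], of "\<chi> k. \<Sum>j\<in>UNIV. d_dz j (\<lambda>z. snd c (chart_inv c' z) $ k) (y0 + \<zeta> *s v) * v $ j"]) simp
      let ?p = "chart_inv c' (y0 + \<zeta> *s v)"
      define w :: "complex ^ 'n" where "w = (\<chi> k. \<Sum>j\<in>UNIV. d_dz j (\<lambda>z. snd c (chart_inv c' z) $ k) (y0 + \<zeta> *s v) * v $ j)"
      have "has_laplacian ?u (- 4 * Re (\<Sum>j\<in>UNIV. \<Sum>k\<in>UNIV. chern_curvature c \<pi> \<tau> h ?p j k * w $ j * cnj (w $ k))) \<zeta>"
        by (rule psi_along_slice(1)[OF ad c(1) U(1) y0 v inD[OF \<zeta>]]) (simp add: w_def)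
      from has_laplacian_cmult[OF this, of "-1"]
      have "has_laplacian (\<lambda>\<zeta>. - ?u \<zeta>) (4 * Re (\<Sum>j\<in>UNIV. \<Sum>k\<in>UNIV. chern_curvature c \<pi> \<tau> h ?p j k * w $ j * cnj (w $ k))) \<zeta>" by simp
      moreover have "Re (\<Sum>j\<in>UNIV. \<Sum>k\<in>UNIV. chern_curvature c \<pi> \<tau> h ?p j k * w $ j * cnj (w $ k)) \<ge> 0"
        using psd[OF U(1) c(1) adapted_point(3,2)[OF ad c(1) inD[OF \<zeta>]], of w] by (simp add: complex_nonneg_Reals_iff)
      ultimately show "\<exists>l\<ge>0. has_laplacian (\<lambda>\<zeta>. - ?u \<zeta>) l \<zeta>"
        by (intro exI[of _ "4 * Re (\<Sum>j\<in>UNIV. \<Sum>k\<in>UNIV. chern_curvature c \<pi> \<tau> h ?p j k * w $ j * cnj (w $ k))"]) simp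
      have "?p \<in> N \<inter> Y" unfolding NY B_def using \<zeta> y0 v by (auto simp: E_def)
      then show "- ?u \<zeta> \<le> - ?u 0" using min x0 by simp
    next
      show "0 \<in> E" using r by (simp add: E)
      show "1 \<in> E" using y by (simp add: E v_def dist_norm norm_minus_commute)
    qed
    then show "\<psi> q = \<psi> x" using x0 y by (simp add: v_def)
  qed
  ultimately show ?thesis using that N by blast
qed

text \<open>\<open>\<psi>\<close> attains a minimum on the connected component of \<open>x\<close>,
  which is closed in \<open>Y\<close> and hence compact. The points of minimum form a closed subset,
  and by \<open>psi_local_minimum\<close> an open one, so they fill the component.\<close>

lemma psi_locally_constant:
  assumes x: "x \<in> Y"
  obtains N where "open N" "x \<in> N" "\<forall>q\<in>N \<inter> Y. \<psi> q = \<psi> x"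
proof -
  have cont: "continuous_on Y \<psi>"
    unfolding continuous_on_eq_continuous_within
  proof
    fix q assume q: "q \<in> Y"
    obtain N where N: "open N" "q \<in> N" "connected (N \<inter> Y)" "continuous_on (N \<inter> Y) \<psi>"
      "(\<forall>p\<in>N \<inter> Y. \<psi> q \<le> \<psi> p) \<longrightarrow> (\<forall>p\<in>N \<inter> Y. \<psi> p = \<psi> q)"
      using psi_local_minimum[OF q] .
    have "continuous (at q within (N \<inter> Y)) \<psi>" using N(2,4) q by (simp add: continuous_on_eq_continuous_within)
    moreover have "at q within (N \<inter> Y) = at q within Y" by (rule at_within_nhd[of q N]) (use N(1,2) in auto)
    ultimately show "continuous (at q within Y) \<psi>" by (simp only: continuous_within)
  qed
  define C where "C = connected_component_set Y x"
  have xC: "x \<in> C" and CY: "C \<subseteq> Y" and conn: "connected C"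
    using x by (auto simp: C_def connected_component_subset dest: connected_component_in)
  have "closedin (top_of_set Y) C" unfolding C_def by (rule closedin_connected_component)
  then have "compact C" using closedin_compact[OF comp] by blast
  then obtain a where a: "a \<in> C" "\<And>q. q \<in> C \<Longrightarrow> \<psi> a \<le> \<psi> q"
    using continuous_attains_inf[of C \<psi>] xC continuous_on_subset[OF cont CY] by blast
  define Z where "Z = {q \<in> C. \<psi> q = \<psi> a}"
  \<comment> \<open>\<open>N \<inter> Y\<close> is connected, so it stays in the component; this
    yields neighbourhoods in \<open>Y\<close> and not merely in \<open>C\<close>.\<close>
  have nb: "\<exists>N. open N \<and> q \<in> N \<and> N \<inter> Y \<subseteq> Z" if q: "q \<in> Z" for q
  proof -
    have qY: "q \<in> Y" and qC: "q \<in> C" and qa: "\<psi> q = \<psi> a" using q CY by (auto simp: Z_def)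
    obtain N where N: "open N" "q \<in> N" "connected (N \<inter> Y)" "continuous_on (N \<inter> Y) \<psi>"
      "(\<forall>p\<in>N \<inter> Y. \<psi> q \<le> \<psi> p) \<longrightarrow> (\<forall>p\<in>N \<inter> Y. \<psi> p = \<psi> q)"
      using psi_local_minimum[OF qY] .
    have "N \<inter> Y \<subseteq> connected_component_set Y q"
      by (rule connected_component_maximal) (use N(2,3) qY in auto)
    also have "\<dots> = C" using qC unfolding C_def by (simp add: connected_component_eq)
    finally have sub: "N \<inter> Y \<subseteq> C" .
    have "\<forall>p\<in>N \<inter> Y. \<psi> q \<le> \<psi> p" unfolding qa using a(2) subsetD[OF sub] by blast
    from mp[OF N(5) this] have "\<forall>p\<in>N \<inter> Y. \<psi> p = \<psi> q" .
    then have "N \<inter> Y \<subseteq> Z" using sub qa by (auto simp: Z_def)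
    then show ?thesis using N(1,2) by blast
  qed
  have "closedin (top_of_set C) Z"
    unfolding Z_def by (rule continuous_closedin_preimage_constant[OF continuous_on_subset[OF cont CY]])
  moreover have "openin (top_of_set C) Z"
  proof (subst openin_subopen, intro ballI)
    fix q assume q: "q \<in> Z"
    then obtain N where N: "open N" "q \<in> N" "N \<inter> Y \<subseteq> Z" using nb by blast
    have "openin (top_of_set C) (C \<inter> N)" using N(1) by (rule openin_open_Int)
    moreover have "q \<in> C \<inter> N" "C \<inter> N \<subseteq> Z" using N q CY by (auto simp: Z_def)
    ultimately show "\<exists>T. openin (top_of_set C) T \<and> q \<in> T \<and> T \<subseteq> Z" by blast
  qed
  ultimately have "Z = {} \<or> Z = C" using conn by (simp add: connected_clopen)
  then have "x \<in> Z" using a xC by (auto simp: Z_def)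
  then obtain N where "open N" "x \<in> N" "N \<inter> Y \<subseteq> Z" using nb by blast
  moreover have "\<psi> q = \<psi> x" if "q \<in> Z" for q using that \<open>x \<in> Z\<close> by (simp add: Z_def)
  ultimately show ?thesis using that by blast
qed

text \<open>Both \<open>u\<close> and its negative have a local maximum at \<open>z\<close>.\<close>

lemma has_laplacian_zero_if_constant:
  assumes "has_laplacian u l z" "open T" "z \<in> T" "\<And>w. w \<in> T \<Longrightarrow> u w = u z"
  shows "l = 0"
proof -
  have "l \<le> 0" using has_laplacian_local_max[OF assms(1,2,3)] assms(4) by simp
  moreover have "-1 * l \<le> 0" using has_laplacian_local_max[OF has_laplacian_cmult[OF assms(1), of "-1"] assms(2,3)] assms(4) by simp
  ultimately show ?thesis by simp
qed

text \<open>Local constancy of \<open>\<psi>\<close> makes its Laplacian along \<open>v\<close>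
  vanish, so the curvature form is null at the image \<open>w\<close> of \<open>v\<close> in the
  chart \<open>c\<close>. Positivity in all directions then puts \<open>w\<close> into the kernel,
  so the conclusion holds for every index \<open>i\<close>, including directions normal to
  \<open>Y\<close>.\<close>

lemma curvature_kernel:
  assumes ad: "adapted c U \<tau> c' J D G" and c: "c \<in> A" and U: "(U, \<tau>) \<in> L"
    and y: "y \<in> D" "\<forall>i\<in>J. y $ i = 0" and v: "\<forall>i\<in>J. v $ i = 0"
  shows "(\<Sum>k\<in>UNIV. d_dz k (d_dzbar i (lnw \<tau> c)) (snd c (chart_inv c' y)) *
     (\<Sum>j\<in>UNIV. d_dz j (\<lambda>z. snd c (chart_inv c' z) $ k) y * v $ j)) = 0"
proof -
  define w :: "complex ^ 'n" where "w = (\<chi> k. \<Sum>j\<in>UNIV. d_dz j (\<lambda>z. snd c (chart_inv c' z) $ k) y * v $ j)"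
  let ?p = "chart_inv c' y"
  let ?Q = "\<lambda>\<xi> :: complex ^ 'n. \<Sum>j\<in>UNIV. \<Sum>k\<in>UNIV. chern_curvature c \<pi> \<tau> h ?p j k * \<xi> $ j * cnj (\<xi> $ k)"
  have c': "holomorphic_chart A c'" and pY: "?p \<in> Y" and D: "open D"
    and sl': "\<And>y. y \<in> D \<Longrightarrow> \<forall>i\<in>J. y $ i = 0 \<Longrightarrow> chart_inv c' y \<in> Y"
    using ad y unfolding adapted_def by auto
  obtain N where N: "open N" "?p \<in> N" "\<forall>q\<in>N \<inter> Y. \<psi> q = \<psi> ?p" using psi_locally_constant[OF pY] .
  define D' where "D' = snd c' ` (fst c' \<inter> N) \<inter> D"
  have D': "open D'" using holomorphic_chart_open_image[OF c' N(1)] D by (auto simp: D'_def)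
  have yD': "y \<in> D'" using adapted_point(1,4)[OF ad c y(1)] N y by (force simp: D'_def)
  have lin: "linear (\<lambda>\<zeta>. \<zeta> *s v)" by (rule linearI) (auto simp: vec_eq_iff algebra_simps)
  then have "continuous_on UNIV (\<lambda>\<zeta>. y + \<zeta> *s v)"
    by (intro continuous_on_add continuous_on_const linear_continuous_on) (simp add: linear_conv_bounded_linear)
  then have T: "open {\<zeta>. y + \<zeta> *s v \<in> D'}" "0 \<in> {\<zeta>. y + \<zeta> *s v \<in> D'}"
    using open_vimage[OF D', of "\<lambda>\<zeta>. y + \<zeta> *s v"] yD' by (simp_all add: vimage_def)
  have lap: "has_laplacian (\<lambda>\<zeta>. \<psi> (chart_inv c' (y + \<zeta> *s v))) (- 4 * Re (?Q w)) 0"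
    using psi_along_slice(1)[OF ad c U y(2) v, of 0 w] y(1) by (simp add: w_def)
  have "- 4 * Re (?Q w) = 0"
  proof (rule has_laplacian_zero_if_constant[OF lap T])
    fix \<zeta> assume "\<zeta> \<in> {\<zeta>. y + \<zeta> *s v \<in> D'}"
    then have z: "y + \<zeta> *s v \<in> D'" by simp
    then have "chart_inv c' (y + \<zeta> *s v) \<in> N" using holomorphic_chartD(4)[OF c'] by (auto simp: D'_def)
    moreover have "chart_inv c' (y + \<zeta> *s v) \<in> Y" using z y v by (intro sl') (auto simp: D'_def)
    ultimately show "\<psi> (chart_inv c' (y + \<zeta> *s v)) = \<psi> (chart_inv c' (y + 0 *s v))" using N by simp
  qed
  moreover have P: "?Q \<xi> \<in> \<real>\<^sub>\<ge>\<^sub>0" for \<xi> by (rule psd[OF U c adapted_point(3,2)[OF ad c y(1)]])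
  ultimately have "?Q w = 0" using P[of w] by (simp add: complex_nonneg_Reals_iff complex_eq_iff)
  from semidefinite_form_kernel[OF P this, of i] show ?thesis
    unfolding curvature_eq by (simp add: w_def sum_negf)
qed

text \<open>The log weight is real, so its two first derivatives are conjugate near
  \<open>z\<close>. In this form the conjugate of \<open>curvature_kernel\<close> says that a
  conjugate derivative of the coefficients vanishes, with no interchange of second
  derivatives.\<close>

lemma d_dzbar_d_dz_lnw:
  assumes U: "(U, \<tau>) \<in> L" and c: "c \<in> A" and z: "z \<in> snd c ` (fst c \<inter> U)"
  shows "d_dzbar k (d_dz i (lnw \<tau> c)) z = cnj (d_dz k (d_dzbar i (lnw \<tau> c)) z)"
proof -
  let ?W = "snd c ` (fst c \<inter> U)"
  have W: "open ?W" by (rule holomorphic_chart_open_image[OF atlas_chart[OF c] trivialization_open[OF U]])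
  have F: "lnw \<tau> c = (\<lambda>z. complex_of_real (ln (weight \<tau> (chart_inv c z))))" by (auto simp: lnw_def)
  have "d_dz i (lnw \<tau> c) z = cnj (d_dzbar i (lnw \<tau> c) z)" if "z \<in> ?W" for z
    using wirtinger_of_real(1)[OF lnw_differentiable(1)[OF U c that, unfolded F]] by (simp add: F)
  from wirtinger_cong(2)[OF W z this] show ?thesis using d_dzbar_cnj[OF lnw_differentiable(3)[OF U c z]] by simp
qed

text \<open>A section of O_Y must locally be the restriction of a holomorphic function on the
  ambient manifold, while this coefficient is merely smooth off \<open>Y\<close>. It is therefore
  evaluated on the slice and extended constantly in the coordinates that vanish on \<open>Y\<close>;
  \<open>curvature_kernel\<close> makes the extension holomorphic.\<close>

lemma d_lnw_sub_hol:
  assumes U: "(U, \<tau>) \<in> L" and c: "c \<in> A"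
  shows "(\<lambda>q\<in>U \<inter> fst c \<inter> Y. d_dz i (lnw \<tau> c) (snd c q)) \<in> carrier (sub_hol_sheaf A (U \<inter> fst c \<inter> Y))"
proof (rule sub_holI)
  fix x assume x: "x \<in> U \<inter> fst c \<inter> Y"
  then have xx: "x \<in> U" "x \<in> fst c" "x \<in> Y" by auto
  obtain c' J D G where ad: "adapted c U \<tau> c' J D G" and x': "x \<in> fst c'" "snd c' x \<in> D"
    using adapted_exists[OF U xx(1) c xx(2,3)] .
  have c': "holomorphic_chart A c'" and D: "open D"
    and sl: "\<And>q i. q \<in> fst c' \<Longrightarrow> q \<in> Y \<Longrightarrow> i \<in> J \<Longrightarrow> snd c' q $ i = 0"
    using ad unfolding adapted_def by auto
  \<comment> \<open>The projection onto the slice: complex linear, so composing with it keeps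
    holomorphy, and the identity at the coordinates of points of \<open>Y\<close>.\<close>
  define P :: "complex ^ 'n \<Rightarrow> complex ^ 'n" where "P y = (\<chi> i. if i \<in> J then 0 else y $ i)" for y
  have PJ: "\<forall>i\<in>J. P y $ i = 0" for y by (simp add: P_def)
  have P_id: "P y = y" if "\<forall>i\<in>J. y $ i = 0" for y using that by (auto simp: P_def vec_eq_iff)
  have P_hol: "holomorphic_at_vec (\<lambda>y. P y $ k) y"
    "d_dz j (\<lambda>y. P y $ k) y = (if k \<in> J then 0 else if j = k then 1 else 0)" for k y j
    unfolding P_def by (cases "k \<in> J"; simp add: holomorphic_at_vec_const holomorphic_at_vec_nth)+
  have P_cont: "continuous_on UNIV P"
  proof -
    have "continuous_on UNIV (\<lambda>y :: complex ^ 'n. if i \<in> J then 0 else y $ i)" for i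
      by (cases "i \<in> J") (auto intro!: continuous_intros)
    then show ?thesis unfolding P_def by (intro continuous_on_vec_lambda) blast
  qed
  define Z where "Z = fst c' \<inter> snd c' -` (D \<inter> P -` D)"
  have "open (D \<inter> P -` D)" using D open_vimage[OF D P_cont] by auto
  then have Z: "open Z" unfolding Z_def by (rule continuous_open_preimage[OF holomorphic_chartD(2,1)[OF c']])
  have xZ: "x \<in> Z" using x' P_id sl xx by (auto simp: Z_def)
  define k where "k q = d_dz i (lnw \<tau> c) (snd c (chart_inv c' (P (snd c' q))))" for q
  have "restrict k Z \<in> carrier (hol_sheaf A Z)"
  proof (rule hol_sheafI_charts[OF Z])
    fix q assume q: "q \<in> Z"
    let ?y = "snd c' q"
    have y: "P ?y \<in> D" using q by (auto simp: Z_def)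
    define M where "M w = snd c (chart_inv c' (P w))" for w
    have M: "holomorphic_at_vec (\<lambda>w. M w $ j) ?y" for j
      unfolding M_def using holomorphic_at_vec_compose[OF adapted_point(5)[OF ad c y] P_hol(1)] by simp
    have dM: "d_dz l (\<lambda>w. M w $ j) ?y = (\<Sum>m\<in>UNIV. d_dz m (\<lambda>z. snd c (chart_inv c' z) $ j) (P ?y) * d_dz l (\<lambda>w. P w $ m) ?y)" for l j
      unfolding M_def using d_dz_compose[OF holomorphic_at_vec_differentiable[OF adapted_point(5)[OF ad c y]] P_hol(1), of l j] by simp
    have MW: "M ?y \<in> snd c ` (fst c \<inter> U)" unfolding M_def by (rule adapted_point(6)[OF ad c y])
    have hol: "holomorphic_at_vec (\<lambda>w. d_dz i (lnw \<tau> c) (M w)) ?y"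
    proof (rule holomorphic_at_vec_along_kernel[OF lnw_differentiable(2)[OF U c MW] M])
      fix v :: "complex ^ 'n"
      \<comment> \<open>The derivative of \<open>M\<close> factors through \<open>P v\<close>, a
        slice direction as \<open>curvature_kernel\<close> requires.\<close>
      have "(\<Sum>l\<in>UNIV. d_dz l (\<lambda>w. M w $ j) ?y * v $ l) = (\<Sum>m\<in>UNIV. d_dz m (\<lambda>z. snd c (chart_inv c' z) $ j) (P ?y) * P v $ m)" for j
      proof -
        have Pv: "(\<Sum>l\<in>UNIV. d_dz l (\<lambda>w. P w $ m) ?y * v $ l) = P v $ m" for m
          unfolding P_hol(2) by (simp add: P_def if_distrib[of "\<lambda>t. t * _"] cong: if_cong)
        have "(\<Sum>l\<in>UNIV. d_dz l (\<lambda>w. M w $ j) ?y * v $ l) =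
          (\<Sum>l\<in>UNIV. \<Sum>m\<in>UNIV. d_dz m (\<lambda>z. snd c (chart_inv c' z) $ j) (P ?y) * (d_dz l (\<lambda>w. P w $ m) ?y * v $ l))"
          unfolding dM sum_distrib_right by (simp add: mult.assoc)
        also have "\<dots> = (\<Sum>m\<in>UNIV. d_dz m (\<lambda>z. snd c (chart_inv c' z) $ j) (P ?y) * (\<Sum>l\<in>UNIV. d_dz l (\<lambda>w. P w $ m) ?y * v $ l))"
          unfolding sum_distrib_left by (rule sum.swap)
        finally show ?thesis unfolding Pv .
      qed
      then have "(\<Sum>j\<in>UNIV. d_dzbar j (d_dz i (lnw \<tau> c)) (M ?y) * cnj (\<Sum>l\<in>UNIV. d_dz l (\<lambda>w. M w $ j) ?y * v $ l)) =
         cnj (\<Sum>j\<in>UNIV. d_dz j (d_dzbar i (lnw \<tau> c)) (M ?y) * (\<Sum>m\<in>UNIV. d_dz m (\<lambda>z. snd c (chart_inv c' z) $ j) (P ?y) * P v $ m))"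
        by (simp add: d_dzbar_d_dz_lnw[OF U c MW])
      also have "\<dots> = 0" using curvature_kernel[OF ad c U y PJ PJ, of i v] by (simp add: M_def)
      finally show "(\<Sum>j\<in>UNIV. d_dzbar j (d_dz i (lnw \<tau> c)) (M ?y) * cnj (\<Sum>l\<in>UNIV. d_dz l (\<lambda>w. M w $ j) ?y * v $ l)) = 0" .
    qed
    have S: "open (snd c' ` (fst c' \<inter> Z))" "?y \<in> snd c' ` (fst c' \<inter> Z)"
      using holomorphic_chart_open_image[OF c' Z] q by (auto simp: Z_def)
    have "d_dz i (lnw \<tau> c) (M w) = (k \<circ> chart_inv c') w" if "w \<in> snd c' ` (fst c' \<inter> Z)" for w
      using that holomorphic_chartD(4)[OF c'] by (auto simp: k_def M_def)
    from holomorphic_at_vec_cong[OF S this hol] have "holomorphic_at_vec (k \<circ> chart_inv c') ?y" .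
    then show "\<exists>c. holomorphic_chart A c \<and> q \<in> fst c \<and> holomorphic_at_vec (k \<circ> chart_inv c) (snd c q)"
      using c' q by (intro exI[of _ c']) (simp add: Z_def)
  qed
  moreover have "d_dz i (lnw \<tau> c) (snd c q) = restrict k Z q" if "q \<in> Z \<inter> (U \<inter> fst c \<inter> Y)" for q
    using that P_id[of "snd c' q"] sl holomorphic_chartD(4)[OF c', of q] by (auto simp: k_def Z_def)
  ultimately show "\<exists>V g. open V \<and> x \<in> V \<and> g \<in> carrier (hol_sheaf A V) \<and>
      (\<forall>q\<in>V \<inter> (U \<inter> fst c \<inter> Y). d_dz i (lnw \<tau> c) (snd c q) = g q)"
    using Z xZ by blast
qed

end


section \<open>The Ueda cocycle as a coboundary\<close>

lemma (in group_presheaf) trivial_cocycle: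
  "(\<lambda>_. topspace T, \<lambda>_ _. \<one>\<^bsub>F (topspace T)\<^esub>) \<in> cocycles1 T F"
proof -
  interpret group "F (topspace T)" using group by simp
  have "restrict \<one>\<^bsub>F (topspace T)\<^esub> (topspace T) = \<one>\<^bsub>F (topspace T)\<^esub>" by (rule restrict_one) auto
  then show ?thesis unfolding cocycles1_def pointed_cover_def by (simp add: Let_def)
qed

context semipositive_flat
begin

lemma weight_transition:
  assumes U: "(U, \<tau>) \<in> L" "(U', \<tau>') \<in> L" and p: "p \<in> U" "p \<in> U'"
  shows "weight \<tau>' p = (cmod (transition \<pi> \<tau> \<tau>' (U \<inter> U') p))\<^sup>2 * weight \<tau> p"
  using metric_eq[OF U(1), of "frame \<pi> \<tau>' p"] frame_props[OF lb U(2) p(2)] p by (simp add: transition_def)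

lemma transition_unit:
  assumes U: "(U, \<tau>) \<in> L" "(U', \<tau>') \<in> L"
  shows "transition \<pi> \<tau> \<tau>' (U \<inter> U') \<in> carrier (hol_sheaf A (U \<inter> U'))"
    "p \<in> U \<inter> U' \<Longrightarrow> transition \<pi> \<tau> \<tau>' (U \<inter> U') p \<noteq> 0"
  using line_bundle_transition(1)[OF lb U] hol_sheaf_Units[of "U \<inter> U'"]
    trivialization_open[OF U(1)] trivialization_open[OF U(2)] by (auto simp: open_Int)

text \<open>The logarithms of the two weights differ by log |g|^2, whose (1,0) derivative is dg / g.
  This produces the cocycle from the difference of two local forms.\<close>

lemma d_lnw_change_trivialization:
  assumes U: "(U, \<tau>) \<in> L" "(U', \<tau>') \<in> L" and p: "p \<in> U" "p \<in> U'" and c: "c \<in> A" "p \<in> fst c"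
  defines "g \<equiv> transition \<pi> \<tau> \<tau>' (U \<inter> U')"
  shows "d_dz i (lnw \<tau>' c) (snd c p) = d_dz i (lnw \<tau> c) (snd c p) + d_dz i (g \<circ> chart_inv c) (snd c p) / g p"
proof -
  have o: "open (U \<inter> U')" using trivialization_open U by blast
  let ?S = "snd c ` (fst c \<inter> (U \<inter> U'))"
  have S: "open ?S" "snd c p \<in> ?S" using holomorphic_chart_open_image[OF atlas_chart[OF c(1)] o] p c by auto
  have g: "holomorphic_at_vec (g \<circ> chart_inv c) (snd c p)" "(g \<circ> chart_inv c) (snd c p) = g p" "g p \<noteq> 0"
    unfolding g_def using hol_sheafD[OF o transition_unit(1)[OF U] c] transition_unit(2)[OF U] p atlasD(4)[OF c] by auto
  let ?l = "\<lambda>z. complex_of_real (ln ((cmod ((g \<circ> chart_inv c) z))\<^sup>2))"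
  have "lnw \<tau>' c z = lnw \<tau> c z + ?l z" if zS: "z \<in> ?S" for z
  proof -
    obtain q where q: "q \<in> fst c" "q \<in> U" "q \<in> U'" "z = snd c q" using zS by auto
    have z: "chart_inv c z = q" using q atlasD(4)[OF c(1)] by simp
    have "g q \<noteq> 0" unfolding g_def using transition_unit(2)[OF U] q by simp
    then have "ln (weight \<tau>' q) = ln (weight \<tau> q) + ln ((cmod (g q))\<^sup>2)"
      unfolding weight_transition[OF U q(2,3), folded g_def] using weight_pos[OF U(1) q(2)]
      by (subst ln_mult) auto
    then show ?thesis by (simp add: lnw_def z)
  qed
  then have "d_dz i (lnw \<tau>' c) (snd c p) = d_dz i (\<lambda>z. lnw \<tau> c z + ?l z) (snd c p)"
    by (rule wirtinger_cong(1)[OF S])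
  also have "\<dots> = d_dz i (lnw \<tau> c) (snd c p) + d_dz i ?l (snd c p)"
    using p c g(2,3)
    by (intro has_derivative_wirtinger_add lnw_differentiable(1)[OF U(1) c(1)] d_dz_ln_cmod_square(1)[OF g(1)]) auto
  also have "d_dz i ?l (snd c p) = d_dz i (g \<circ> chart_inv c) (snd c p) / g p"
    using d_dz_ln_cmod_square(2)[OF g(1), of i] g by simp
  finally show ?thesis .
qed

text \<open>For a fixed trivialization \<partial> log h is thus a form independent of the chart, so
  cochains written in different charts can be compared.\<close>

lemma d_lnw_change_chart:
  assumes U: "(U, \<tau>) \<in> L" "p \<in> U" and c: "c \<in> A" "p \<in> fst c" "c' \<in> A" "p \<in> fst c'"
  shows "d_dz i (lnw \<tau> c) (snd c p) =
    (\<Sum>k\<in>UNIV. d_dz k (lnw \<tau> c') (snd c' p) * d_dz i (\<lambda>z. snd c' (chart_inv c z) $ k) (snd c p))"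
proof -
  have F: "lnw \<tau> c = (\<lambda>q. complex_of_real (ln (weight \<tau> q))) \<circ> chart_inv c" for c by (auto simp: lnw_def)
  have "lnw \<tau> c' differentiable (at (snd c' p))"
    using lnw_differentiable(1)[OF U(1) c(3)] c U by blast
  then have d: "((\<lambda>q. complex_of_real (ln (weight \<tau> q))) \<circ> chart_inv c') differentiable (at (snd c' p))"
    unfolding F .
  from chart_change(2)[OF atlas_chart[OF c(1)] atlas_chart[OF c(3)] atlas_transition[OF c(1,3)] c(2,4),
      where f = "\<lambda>q. complex_of_real (ln (weight \<tau> q))" and i = i, OF d]
  show ?thesis unfolding F .
qed

text \<open>Following the transition functions through the defining maps gives the cocycle of the
  tensors of dlog g_pq with 1. The 0-cochain bounding it has the derivatives of the log weights as
  coefficients, which \<open>d_lnw_sub_hol\<close> makes sections of O_Y.\<close>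

lemma ueda_class_trivial: "ueda_class A Y \<pi> L = \<one>\<^bsub>H1 (top_of_set Y) (pullback_sheaf A Y (hol_forms A))\<^esub>"
proof -
  let ?P = "pullback_sheaf A Y (hol_forms A)"
  let ?S = "pullback_stalk A Y (hol_forms A)"
  interpret P: group_presheaf "top_of_set Y" ?P by (rule group_presheaf_pullback)
  \<comment> \<open>The same choice of trivializations as in \<open>line_bundle_class\<close>, so
    that the class unfolds to that of \<open>(U, g)\<close>.\<close>
  define t where "t p = (SOME t. t \<in> L \<and> p \<in> fst t)" for p
  define U where "U p = fst (t p)" for p
  define \<tau> where "\<tau> p = snd (t p)" for p
  have t: "t p \<in> L \<and> p \<in> fst (t p)" for p
  proof -
    obtain V \<sigma> where "(V, \<sigma>) \<in> L" "p \<in> V" by (rule L_trivialization)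
    then have "(V, \<sigma>) \<in> L \<and> p \<in> fst (V, \<sigma>)" by simp
    from someI[of "\<lambda>t. t \<in> L \<and> p \<in> fst t", OF this] show ?thesis unfolding t_def .
  qed
  have UL: "(U p, \<tau> p) \<in> L" and pU: "p \<in> U p" for p using t[of p] by (auto simp: U_def \<tau>_def)
  have oU: "open (U p)" for p by (rule trivialization_open[OF UL])
  define g where "g p q = transition \<pi> (\<tau> p) (\<tau> q) (U p \<inter> U q)" for p q
  have g: "g p q \<in> carrier (hol_sheaf A (U p \<inter> U q))" "x \<in> U p \<Longrightarrow> x \<in> U q \<Longrightarrow> g p q x \<noteq> 0" for p q x
    using transition_unit[OF UL UL] by (auto simp: g_def)
  have gu: "g p q \<in> carrier (hol_units A (U p \<inter> U q))" for p q
    using g oU by (simp add: units_of_def hol_sheaf_Units open_Int)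
  have coc: "(U, g) \<in> cocycles1 euclidean (hol_units A)"
  proof -
    have "restrict (g p q) W \<otimes>\<^bsub>hol_units A W\<^esub> restrict (g q r) W = restrict (g p r) W" if W: "W = U p \<inter> U q \<inter> U r" for p q r W
    proof -
      have "g p q x * g q r x = g p r x" if x: "x \<in> W" for x
      proof -
        have f: "\<pi> (frame \<pi> (\<tau> r) x) = x" using frame_props[OF lb UL] x W by auto
        from line_bundle_transition(2)[OF lb UL[of p] UL[of q], of "frame \<pi> (\<tau> r) x"] x W f
        show ?thesis by (simp add: g_def transition_def)
      qed
      then show ?thesis by (auto simp: units_of_def hol_sheaf_ops restrict_def fun_eq_iff)
    qed
    then show ?thesis using gu oU pU by (simp add: cocycles1_def pointed_cover_def)
  qed
  interpret H1: presheaf_hom euclidean "hol_units A" "direct_image_sheaf Y (inv_image_sheaf (hol_units A))" "adjunction_unit Y (hol_units A)"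
    by (rule presheaf_hom_adjunction_unit[OF group_presheaf_hol_units])
  interpret H2: presheaf_hom "top_of_set Y" "inv_image_sheaf (hol_units A)" "inv_image_sheaf (\<lambda>U. add_monoid (exact_forms A U))"
      "inv_image_map (\<lambda>U. add_monoid (exact_forms A U)) (dlog A)"
    by (rule presheaf_hom_inv_image[OF presheaf_hom_dlog])
  interpret H3: presheaf_hom "top_of_set Y" "inv_image_sheaf (\<lambda>U. add_monoid (exact_forms A U))" "inv_image_sheaf (\<lambda>U. add_monoid (hol_forms A U))"
      "inv_image_map (\<lambda>U. add_monoid (hol_forms A U)) (\<lambda>U \<omega>. \<omega>)"
    by (rule presheaf_hom_inv_image[OF presheaf_hom_exact_inclusion])
  interpret H4: presheaf_hom "top_of_set Y" "inv_image_sheaf (\<lambda>U. add_monoid (hol_forms A U))" ?P "to_pullback A Y (hol_forms A)"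
    by (rule presheaf_hom_to_pullback)
  define UY where "UY p = U p \<inter> Y" for p
  \<comment> \<open>The images of \<open>g\<close> stage by stage: germs along \<open>Y\<close>,
    logarithmic derivative, inclusion into all forms, passage to the tensor product.\<close>
  define c1 where "c1 p q = adjunction_unit Y (hol_units A) (U p \<inter> U q) (g p q)" for p q
  define c2 where "c2 p q = inv_image_map (\<lambda>U. add_monoid (exact_forms A U)) (dlog A) (UY p \<inter> UY q) (c1 p q)" for p q
  define c3 where "c3 p q = inv_image_map (\<lambda>U. add_monoid (hol_forms A U)) (\<lambda>U \<omega>. \<omega>) (UY p \<inter> UY q) (c2 p q)" for p q
  define c4 where "c4 p q = to_pullback A Y (hol_forms A) (UY p \<inter> UY q) (c3 p q)" for p q
  have k1: "(U, c1) \<in> cocycles1 euclidean (direct_image_sheaf Y (inv_image_sheaf (hol_units A)))"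
    using H1.cocycle_image[OF coc] by (simp add: c1_def[abs_def])
  note di = H1_direct_image_class[OF H2.F.group_presheaf_axioms k1]
  have k2: "(UY, c1) \<in> cocycles1 (top_of_set Y) (inv_image_sheaf (hol_units A))"
    using di(2) by (simp add: UY_def[abs_def])
  have k3: "(UY, c2) \<in> cocycles1 (top_of_set Y) (inv_image_sheaf (\<lambda>U. add_monoid (exact_forms A U)))"
    using H2.cocycle_image[OF k2] by (simp add: c2_def[abs_def])
  have k4: "(UY, c3) \<in> cocycles1 (top_of_set Y) (inv_image_sheaf (\<lambda>U. add_monoid (hol_forms A U)))"
    using H3.cocycle_image[OF k3] by (simp add: c3_def[abs_def])
  have k5: "(UY, c4) \<in> cocycles1 (top_of_set Y) ?P"
    using H4.cocycle_image[OF k4] by (simp add: c4_def[abs_def])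
  have "line_bundle_class euclidean (hol_sheaf A) \<pi> L = cohomologous1 euclidean (hol_units A) `` {(U, g)}"
    unfolding line_bundle_class_def Let_def U_def[abs_def] g_def[abs_def] \<tau>_def t_def ..
  then have "restricted_class A Y \<pi> L = cohomologous1 (top_of_set Y) (inv_image_sheaf (hol_units A)) `` {(UY, c1)}"
    unfolding restricted_class_def using H1.H1_map_class[OF coc] di(1)
    by (simp add: c1_def[abs_def] UY_def[abs_def])
  then have ueda: "ueda_class A Y \<pi> L = cohomologous1 (top_of_set Y) ?P `` {(UY, c4)}"
    unfolding ueda_class_def using H2.H1_map_class[OF k2] H3.H1_map_class[OF k3] H4.H1_map_class[OF k4]
    by (simp add: c2_def[abs_def] c3_def[abs_def] c4_def[abs_def])
  \<comment> \<open>Each stage acts on a germ through any one representing section, so the section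
    \<open>g p q\<close> can be followed through all of them.\<close>
  have c4: "c4 p q x = pcls x (pure x (U p \<inter> U q) (dlog A (U p \<inter> U q) (g p q)) (\<lambda>y\<in>U p \<inter> U q \<inter> Y. 1))"
    if x: "x \<in> UY p" "x \<in> UY q" for p q x
  proof -
    have o: "open (U p \<inter> U q)" "x \<in> U p \<inter> U q" "x \<in> Y" "x \<in> UY p \<inter> UY q" using oU x by (auto simp: UY_def)
    have 1: "c1 p q x = germ euclidean (\<lambda>U. carrier (hol_units A U)) x (U p \<inter> U q) (g p q)"
      using o by (simp add: c1_def adjunction_unit_def)
    have 2: "c2 p q x = germ euclidean (\<lambda>U. carrier (add_monoid (exact_forms A U))) x (U p \<inter> U q) (dlog A (U p \<inter> U q) (g p q))"
      unfolding c2_def by (rule inv_image_map_germ[where s = "c1 p q", OF presheaf_hom_dlog o(1,2) gu o(4) 1])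
    have "dlog A (U p \<inter> U q) (g p q) \<in> carrier (add_monoid (exact_forms A (U p \<inter> U q)))"
      using dlog_exact[OF o(1) g(1)] g(2) by simp
    from inv_image_map_germ[where s = "c2 p q", OF presheaf_hom_exact_inclusion o(1,2) this o(4) 2]
    have 3: "c3 p q x = gM x (U p \<inter> U q) (dlog A (U p \<inter> U q) (g p q))" by (simp add: c3_def)
    show ?thesis unfolding c4_def by (rule to_pullback_germ[where s = "c3 p q", OF o(1,2,3,4) 3])
  qed
  \<comment> \<open>The cochain is written in coordinates, so a chart is chosen at each
    point.\<close>
  define C where "C p = (SOME c. c \<in> A \<and> p \<in> fst c)" for p
  have C: "C p \<in> A" "p \<in> fst (C p)" for p
  proof -
    obtain c where "c \<in> A" "p \<in> fst c" by (rule atlas_cover)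
    then have "c \<in> A \<and> p \<in> fst c" by simp
    from someI[of "\<lambda>c. c \<in> A \<and> p \<in> fst c", OF this] have "C p \<in> A \<and> p \<in> fst (C p)" unfolding C_def .
    then show "C p \<in> A" "p \<in> fst (C p)" by auto
  qed
  define N where "N p = U p \<inter> fst (C p)" for p
  have N: "open (N p)" "p \<in> N p" "N p \<subseteq> U p" "N p \<subseteq> fst (C p)" for p
    using oU atlasD(1)[OF C(1)] pU C by (auto simp: N_def)
  define f where "f p i = (\<lambda>q\<in>N p \<inter> Y. d_dz i (lnw (\<tau> p) (C p)) (snd (C p) q))" for p i
  have f: "f p i \<in> carrier (sub_hol_sheaf A (N p \<inter> Y))" for p i
    unfolding f_def N_def by (rule d_lnw_sub_hol[OF UL C(1)])
  have dz: "dcoord (C p) (N p) i \<in> carrier (hol_forms A (N p))" for p i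
    by (rule dcoord_forms[OF N(1,4) C(1)])
  \<comment> \<open>\<partial> log h_p along \<open>Y\<close>: the dz_i are forms on the ambient
    manifold, the coefficients sections of O_Y.\<close>
  define b where "b p = (\<lambda>x\<in>N p \<inter> Y. pcls x (\<Sum>i\<in>UNIV. pure x (N p) (dcoord (C p) (N p) i) (f p i)))" for p
  have b: "b p \<in> carrier (?P (N p \<inter> Y))" for p
  proof -
    \<comment> \<open>\<open>pullback_sheaf\<close> sums over \<open>k < m\<close>, so the
      coordinates are numbered.\<close>
    obtain e where e: "bij_betw e {..<CARD('n)} (UNIV :: 'n set)"
      using ex_bij_betw_nat_finite[of "UNIV :: 'n set"] by (auto simp: atLeast0LessThan)
    have "(\<Sum>i\<in>UNIV. pure x (N p) (dcoord (C p) (N p) i) (f p i)) =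
       (\<Sum>k<CARD('n). pure x (N p) (dcoord (C p) (N p) (e k)) (f p (e k)))" for x
      by (rule sum.reindex_bij_betw[OF e, symmetric])
    then have "\<forall>q\<in>N p \<inter> (N p \<inter> Y). b p q = pcls q (\<Sum>k<CARD('n). pure q (N p) (dcoord (C p) (N p) (e k)) (f p (e k)))"
      by (simp add: b_def)
    then show ?thesis unfolding pullback_sheaf_carrier
      using N(1)[of p] dz[of p] f[of p]
      by (intro conjI ballI exI[of _ "N p"] exI[of _ "CARD('n)"] exI[of _ "\<lambda>k. dcoord (C p) (N p) (e k)"] exI[of _ "\<lambda>k. f p (e k)"])
         (auto simp: b_def)
  qed
  have one: "\<one>\<^bsub>?S p\<^esub> = pcls p 0" for p unfolding pullback_stalk_eq pcls_def by (rule T.cls_one)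
  have mult: "pcls p u \<otimes>\<^bsub>?S p\<^esub> pcls p v = pcls p (u + v)" for p u v
    unfolding pullback_stalk_eq pcls_def by (rule T.cls_mult)
  have key: "b q x = b p x \<otimes>\<^bsub>?S x\<^esub> c4 p q x" if x: "x \<in> N p" "x \<in> N q" "x \<in> Y" for p q x
  proof -
    let ?W = "N p \<inter> N q"
    have W: "open ?W" "x \<in> ?W" "?W \<subseteq> N p" "?W \<subseteq> N q" "?W \<subseteq> U p \<inter> U q" using N x by (auto simp: open_Int)
    let ?G = "dlog A (U p \<inter> U q) (g p q)"
    have oUU: "open (U p \<inter> U q)" using oU by auto
    have G: "?G \<in> carrier (hol_forms A (U p \<inter> U q))"
      using dlog_exact[OF oUU g(1)] g(2) by (simp add: exact_forms_carrier)
    \<comment> \<open>\<open>Some i\<close> indexes the terms of \<open>b p\<close> and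
      \<open>None\<close> the term of the cocycle, so that their sum is one finite sum of tensors
      over \<open>?W\<close>.\<close>
    define \<omega> where "\<omega> k = (case k of None \<Rightarrow> restrict ?G ?W | Some i \<Rightarrow> restrict (dcoord (C p) (N p) i) ?W)" for k
    define k' where "k' k = (case k of None \<Rightarrow> restrict (\<lambda>y\<in>U p \<inter> U q \<inter> Y. 1) (?W \<inter> Y) | Some i \<Rightarrow> restrict (f p i) (?W \<inter> Y))" for k
    have \<omega>: "\<omega> k \<in> carrier (hol_forms A ?W)" "k' k \<in> carrier (sub_hol_sheaf A (?W \<inter> Y))" for k
      unfolding \<omega>_def k'_def
      using hol_forms_restrict[OF oUU W(1,5) G] hol_forms_restrict[OF N(1) W(1,3) dz]
        sub_hol_restrict[OF f[of p], of "?W \<inter> Y"] sub_hol_restrict[OF sub_hol_const, of "?W \<inter> Y" "U p \<inter> U q \<inter> Y" 1] W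
      by (auto split: option.split)
    have \<omega>': "restrict (dcoord (C q) (N q) i) ?W \<in> carrier (hol_forms A ?W)"
      "restrict (f q i) (?W \<inter> Y) \<in> carrier (sub_hol_sheaf A (?W \<inter> Y))" for i
      using hol_forms_restrict[OF N(1) W(1,4) dz] sub_hol_restrict[OF f[of q], of "?W \<inter> Y"] by auto
    have e0: "pure x ?W (\<omega> None) (k' None) = pure x (U p \<inter> U q) ?G (\<lambda>y\<in>U p \<inter> U q \<inter> Y. 1)"
      unfolding \<omega>_def k'_def option.case by (rule pure_restrict[OF W(1,2) x(3) W(5)])
    have e1: "pure x ?W (\<omega> (Some i)) (k' (Some i)) = pure x (N p) (dcoord (C p) (N p) i) (f p i)" for i
      unfolding \<omega>_def k'_def option.case by (rule pure_restrict[OF W(1,2) x(3) W(3)])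
    have "b q x = pcls x (\<Sum>i\<in>UNIV. pure x ?W (restrict (dcoord (C q) (N q) i) ?W) (restrict (f q i) (?W \<inter> Y)))"
      using x pure_restrict[OF W(1,2) x(3) W(4)] by (simp add: b_def)
    \<comment> \<open>Re-indexed so that both sides are sums over the option type.\<close>
    also have "\<dots> = pcls x (\<Sum>k\<in>range Some. pure x ?W (restrict (dcoord (C q) (N q) (the k)) ?W) (restrict (f q (the k)) (?W \<inter> Y)))"
      by (subst sum.reindex) (auto simp: o_def)
    also have "\<dots> = pcls x (\<Sum>k\<in>UNIV. pure x ?W (\<omega> k) (k' k))"
    proof (rule pullback_class_eqI[OF x(3) _ C(1)[of p] W(1,2) W(1,2)])
      show "x \<in> fst (C p)" using x(1) N(4)[of p] by auto
      fix y i assume y: "y \<in> ?W" "y \<in> Y" "y \<in> fst (C p)"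
      then have yy: "y \<in> N p" "y \<in> N q" "y \<in> U p" "y \<in> U q" "y \<in> fst (C q)"
        using N(3,4)[of p] N(3,4)[of q] by auto
      \<comment> \<open>All coefficients are compared in the chart \<open>C p\<close>: first the
        chart is changed from \<open>C q\<close>, then the trivialization from
        \<open>\<tau> q\<close> to \<open>\<tau> p\<close>, which brings in dg / g.\<close>
      have "(\<Sum>k\<in>range Some. restrict (dcoord (C q) (N q) (the k)) ?W y (C p) $ i * restrict (f q (the k)) (?W \<inter> Y) y) =
        (\<Sum>j\<in>UNIV. d_dz j (lnw (\<tau> q) (C q)) (snd (C q) y) * d_dz i (\<lambda>z. snd (C q) (chart_inv (C p) z) $ j) (snd (C p) y))"
        using y yy dcoord_apply[OF N(1) C(1) yy(2) C(1) y(3)]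
        by (subst sum.reindex) (auto simp: o_def f_def mult.commute)
      also have "\<dots> = d_dz i (lnw (\<tau> q) (C p)) (snd (C p) y)"
        by (rule d_lnw_change_chart[OF UL yy(4) C(1) y(3) C(1) yy(5), symmetric])
      also have "\<dots> = d_dz i (lnw (\<tau> p) (C p)) (snd (C p) y) + d_dz i (g p q \<circ> chart_inv (C p)) (snd (C p) y) / g p q y"
        unfolding g_def by (rule d_lnw_change_trivialization[OF UL UL yy(3,4) C(1) y(3)])
      also have "\<dots> = (\<Sum>j\<in>UNIV. restrict (dcoord (C p) (N p) j) ?W y (C p) $ i * restrict (f p j) (?W \<inter> Y) y) +
          restrict ?G ?W y (C p) $ i * restrict (\<lambda>y\<in>U p \<inter> U q \<inter> Y. 1) (?W \<inter> Y) y"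
      proof -
        have "(\<Sum>j\<in>UNIV. restrict (dcoord (C p) (N p) j) ?W y (C p) $ i * restrict (f p j) (?W \<inter> Y) y) = f p i y"
          using y by (simp add: dcoord_same[OF N(1,4) C(1) yy(1)] if_distrib[of "\<lambda>t. t * _"] cong: if_cong)
        moreover have "restrict ?G ?W y (C p) $ i = d_dz i (g p q \<circ> chart_inv (C p)) (snd (C p) y) / g p q y"
          using y yy C(1) by (simp add: dlog_def ext_deriv_def)
        ultimately show ?thesis using y yy by (simp add: f_def)
      qed
      also have "\<dots> = (\<Sum>k\<in>UNIV. \<omega> k y (C p) $ i * k' k y)"
        unfolding UNIV_option_conv by (subst sum.insert) (auto simp: sum.reindex o_def \<omega>_def k'_def)
      finally show "(\<Sum>k\<in>range Some. restrict (dcoord (C q) (N q) (the k)) ?W y (C p) $ i * restrict (f q (the k)) (?W \<inter> Y) y) =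
          (\<Sum>k\<in>UNIV. \<omega> k y (C p) $ i * k' k y)" .
    qed (use \<omega> \<omega>' in auto)
    also have "(\<Sum>k\<in>UNIV. pure x ?W (\<omega> k) (k' k)) =
       pure x (U p \<inter> U q) ?G (\<lambda>y\<in>U p \<inter> U q \<inter> Y. 1) + (\<Sum>i\<in>UNIV. pure x (N p) (dcoord (C p) (N p) i) (f p i))"
      unfolding UNIV_option_conv by (subst sum.insert) (auto simp: sum.reindex o_def e0 e1)
    also have "pcls x \<dots> = b p x \<otimes>\<^bsub>?S x\<^esub> c4 p q x"
    proof -
      have "x \<in> UY p" "x \<in> UY q" using x N(3)[of p] N(3)[of q] by (auto simp: UY_def)
      then show ?thesis using x by (simp add: c4 b_def mult add.commute)
    qed
    finally show ?thesis .
  qed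
  have "((UY, c4), (\<lambda>_. Y, \<lambda>_ _. \<one>\<^bsub>?P Y\<^esub>)) \<in> cohomologous1 (top_of_set Y) ?P"
    unfolding P.cohomologous1_iff
  proof (intro conjI exI[of _ "\<lambda>p. N p \<inter> Y"] exI[of _ b] ballI)
    show "(UY, c4) \<in> cocycles1 (top_of_set Y) ?P" by (rule k5)
    show "(\<lambda>_. Y, \<lambda>_ _. \<one>\<^bsub>?P Y\<^esub>) \<in> cocycles1 (top_of_set Y) ?P" using P.trivial_cocycle by simp
    show "pointed_cover (top_of_set Y) (\<lambda>p. N p \<inter> Y)"
      unfolding pointed_cover_def using N open_Int_Y by auto
    fix p assume "p \<in> topspace (top_of_set Y)"
    show "N p \<inter> Y \<subseteq> UY p \<inter> Y" using N by (auto simp: UY_def)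
    show "b p \<in> carrier (?P (N p \<inter> Y))" by (rule b)
    fix q assume "q \<in> topspace (top_of_set Y)"
    \<comment> \<open>\<open>pcls x 0\<close> is the neutral element of the stalk, so the relation
      to the trivial cocycle reduces to \<open>key\<close>.\<close>
    have "pcls x 0 \<otimes>\<^bsub>?S x\<^esub> b q x = b p x \<otimes>\<^bsub>?S x\<^esub> c4 p q x" if "x \<in> N p" "x \<in> N q" "x \<in> Y" for x
    proof -
      have "pcls x 0 \<otimes>\<^bsub>?S x\<^esub> b q x = b q x" using that by (simp add: b_def mult)
      then show ?thesis using key[OF that] by simp
    qed
    then show "restrict \<one>\<^bsub>?P Y\<^esub> (N p \<inter> Y \<inter> (N q \<inter> Y)) \<otimes>\<^bsub>?P (N p \<inter> Y \<inter> (N q \<inter> Y))\<^esub> restrict (b q) (N p \<inter> Y \<inter> (N q \<inter> Y)) =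
       restrict (b p) (N p \<inter> Y \<inter> (N q \<inter> Y)) \<otimes>\<^bsub>?P (N p \<inter> Y \<inter> (N q \<inter> Y))\<^esub> restrict (c4 p q) (N p \<inter> Y \<inter> (N q \<inter> Y))"
      by (auto simp: pullback_sheaf_ops restrict_def fun_eq_iff one)
  qed
  then have rel: "((\<lambda>_. Y, \<lambda>_ _. \<one>\<^bsub>?P Y\<^esub>), (UY, c4)) \<in> cohomologous1 (top_of_set Y) ?P" by (rule P.cohomologous1_sym)
  \<comment> \<open>The class of the pair equals the class of either member, which identifies the
    two.\<close>
  have "cohomologous1 (top_of_set Y) ?P `` {(UY, c4), (\<lambda>_. Y, \<lambda>_ _. \<one>\<^bsub>?P Y\<^esub>)} =
      cohomologous1 (top_of_set Y) ?P `` {(\<lambda>_. Y, \<lambda>_ _. \<one>\<^bsub>?P Y\<^esub>)}"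
    using rel P.cohomologous1_refl[OF P.trivial_cocycle] by (intro P.cohomologous1_Image) auto
  moreover have "cohomologous1 (top_of_set Y) ?P `` {(UY, c4), (\<lambda>_. Y, \<lambda>_ _. \<one>\<^bsub>?P Y\<^esub>)} =
      cohomologous1 (top_of_set Y) ?P `` {(UY, c4)}"
    using P.cohomologous1_sym[OF rel] P.cohomologous1_refl[OF k5] by (intro P.cohomologous1_Image) auto
  ultimately show ?thesis unfolding ueda H1_def by simp
qed

end

theorem corollary2p5:
  fixes A :: "('a::{t2_space, second_countable_topology}, 'n::finite) chart set"
    and Y :: "'a set"
    and \<pi> :: "'e \<Rightarrow> 'a"
    and L :: "('a set \<times> ('e \<Rightarrow> complex)) set"
  assumes "complex_manifold A"
    and "complex_submanifold A Y"
    and "compact Y"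
    and "line_bundle euclidean (hol_sheaf A) \<pi> L"
    and "unitary_flat (top_of_set Y) (sub_hol_sheaf A) \<pi> (restrict_bundle Y L)"
    and "ueda_class A Y \<pi> L \<noteq> \<one>\<^bsub>H1 (top_of_set Y) (pullback_sheaf A Y (hol_forms A))\<^esub>"
  shows "\<not> semi_positive A \<pi> L"
proof
  assume "semi_positive A \<pi> L"
  then obtain h where h: "hermitian_metric A \<pi> L h"
    "\<forall>(U, \<tau>)\<in>L. \<forall>c\<in>A. \<forall>p\<in>U \<inter> fst c. \<forall>\<xi> :: complex ^ 'n.
       (\<Sum>j\<in>UNIV. \<Sum>k\<in>UNIV. chern_curvature c \<pi> \<tau> h p j k * \<xi> $ j * cnj (\<xi> $ k)) \<in> \<real>\<^sub>\<ge>\<^sub>0"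
    unfolding semi_positive_def by blast
  obtain S where S: "line_bundle (top_of_set Y) (sub_hol_sheaf A) \<pi> (restrict_bundle Y L \<union> S)"
    "(\<Union>(U, \<tau>)\<in>S. U) = topspace (top_of_set Y)"
    "\<forall>(U, \<tau>)\<in>S. \<forall>(U', \<tau>')\<in>S.
       locally_constant_on (top_of_set Y) (U \<inter> U') (transition \<pi> \<tau> \<tau>' (U \<inter> U')) \<and>
       (\<forall>p\<in>U \<inter> U'. cmod (transition \<pi> \<tau> \<tau>' (U \<inter> U') p) = 1)"
    using assms(5) unfolding unitary_flat_def by blast
  interpret semipositive_flat A Y \<pi> L S h
  proof unfold_locales
    show "(\<Union>(U, \<tau>)\<in>S. U) = Y" using S(2) by simp
    show "cmod (transition \<pi> \<tau> \<tau>' (U \<inter> U') p) = 1"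
      if "(U, \<tau>) \<in> S" "(U', \<tau>') \<in> S" "p \<in> U \<inter> U'" for U \<tau> U' \<tau>' p
      using S(3) that by fast
    show "(\<Sum>j\<in>UNIV. \<Sum>k\<in>UNIV. chern_curvature c \<pi> \<tau> h p j k * \<xi> $ j * cnj (\<xi> $ k)) \<in> \<real>\<^sub>\<ge>\<^sub>0"
      if "(U, \<tau>) \<in> L" "c \<in> A" "p \<in> U" "p \<in> fst c" for U \<tau> c p \<xi>
      using h(2) that by fast
  qed (use assms S(1) h(1) in auto)
  show False using ueda_class_trivial assms(6) by contradiction
qed

end
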